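(* Fix $a,b>0$ and let $\mathbf{D}$ be the restriction to $[0,a]\times[0,b]$ of a discrete Poisson–Kirchhoff system with parameters $(\nu_V,\nu_H,p_V,p_H,p_0,q)$, viewed as a finite collection of weighted segments. Let $\widehat{\mathbf{D}}$ be obtained by rotating $\mathbf{D}$ by $180$ degrees around $(a/2,b/2)$: each weighted segment $((x_-,y_-),(x_+,y_+),s)$ is replaced by $((a-x_+,b-y_+),(a-x_-,b-y_-),s)$. Then $\mathbf{D}$ and $\widehat{\mathbf{D}}$ have the same law.
   Context: Parameters: $\nu_V,\nu_H$ are non-zero finite measures on $\mathbb{Z}$ (identified with their mass functions $\nu_V(i),\nu_H(i)$); $p_0\in[0,1]$; $q:\mathbb{Z}\to[0,\infty)$; $p_V,p_H:\mathbb{Z}\to[0,1]$ with $\nu_V(i)=0\Rightarrow p_V(i)=q(i)=0$, $\nu_H(i)=0\Rightarrow p_H(i)=q(i)=0$, $p_V(i)+p_H(i)\le1$ for $i\ne0$ and $p_V(0)+p_H(0)+p_0\le 1$. Set $h(s)=\sum_{t\in\mathbb{Z}}\nu_V(s-t)\nu_H(t)$, $\lambda_V(s)=p_V(s)h(s)/\nu_V(s)$, $\lambda_H(s)=p_H(s)h(s)/\nu_H(s)$ ($0/0=0$), and the probability kernel $f(s,t)=\nu_V(s-t)\nu_H(t)/h(s)$ on $t\in\mathbb{Z}$. The discrete PKS on $[0,\infty)^2$ (all random choices independent): let $\mathcal{C}_X,\mathcal{C}_Y$ be Poisson point processes on $[0,\infty)\times\mathbb{Z}$ with intensities $\mathrm{d}x\,\nu_V(s)$,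 $\mathrm{d}y\,\nu_H(s)$ ($s$ counted w.r.t. counting measure), and $\mathcal{C}_0$ a Poisson point process on $[0,\infty)^2\times\mathbb{Z}$ with intensity $\mathrm{d}x\,\mathrm{d}y\,p_0\nu_V(-t)\nu_H(t)$, all independent. Each $(x,s)\in\mathcal{C}_X$ starts a vertical line of intensity $s$ at $(x,0)$ going up; each $(y,s)\in\mathcal{C}_Y$ starts a horizontal line of intensity $s$ at $(0,y)$ going right; each $(x,y,s)\in\mathcal{C}_0$ starts, at $(x,y)$, a horizontal line of intensity $s$ going right and a vertical line of intensity $-s$ going up. A vertical line of intensity $s$ splits at rate $\lambda_V(s)$ (draw $T\sim f(s,\cdot)$; it continues up with intensity $s-T$ and a horizontal line of intensity $T$ starts rightwards) and turns into a rightward horizontal line of the same intensity at rate $q(s)\sqrt{\nu_H(s)/\nu_V(s)}$. A horizontal line of intensity $s$ splits at rate $\lambda_H(s)$ (draw $T\sim f(s,\cdot)$; it continues right with intensity $T$ and a vertical line of intensity $s-T$ starts upwards) and turns into an upward vertical line of the same intensity at rate $q(s)\sqrt{\nu_V(s)/\nu_H(s)}$. When a horizontal line of intensity $s_W$ meets a vertical line of intensity $s_S$, with $u=s_S+s_W$: with probability $p_V(u)$ the horizontal stops and the vertical continues with intensity $u$; with probability $p_H(u)$ the vertical stops and the horizontal continues with intensity $u$; if $u=0$, with probability $p_0$ both lines disappear; otherwise (with the remaining probability $1-p_V(u)-p_H(u)-p_0\mathbf{1}_{u=0}$) draw $T\sim f(u,\cdot)$, the horizontal continues with intensity $T$ and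 the vertical with $u-T$. The restriction to $[0,a]\times[0,b]$ is the finite set of weighted segments $((x_-,y_-),(x_+,y_+),s)$ (vertical: $x_-=x_+$, $y_-<y_+$; horizontal: $y_-=y_+$, $x_-<x_+$), the pieces of lines in the box between consecutive event points/boundary points, each with its intensity. *)

theory Defs
  imports "HOL-Probability.Probability" "HOL-Library.Nat_Bijection"
begin

record pks_params =
  pk_nuV :: "int \<Rightarrow> real"
  pk_nuH :: "int \<Rightarrow> real"
  pk_pV  :: "int \<Rightarrow> real"
  pk_pH  :: "int \<Rightarrow> real"
  pk_p0  :: real
  pk_q   :: "int \<Rightarrow> real"
  pk_a   :: real
  pk_b   :: real

text \<open>Weighted segment ((x-,y-),(x+,y+),s).\<close>
type_synonym seg = "(real \<times> real) \<times> (real \<times> real) \<times> int"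

definition tot :: "(int \<Rightarrow> real) \<Rightarrow> real" where
  "tot w = infsum w UNIV"

definition hfun :: "pks_params \<Rightarrow> int \<Rightarrow> real" where
  "hfun P s = infsum (\<lambda>t. pk_nuV P (s - t) * pk_nuH P t) UNIV"

text \<open>Unnormalised kernel; normalised by tot it is f(s,.).\<close>
definition fker :: "pks_params \<Rightarrow> int \<Rightarrow> int \<Rightarrow> real" where
  "fker P s t = pk_nuV P (s - t) * pk_nuH P t"

definition lamV :: "pks_params \<Rightarrow> int \<Rightarrow> real" where
  "lamV P s = pk_pV P s * hfun P s / pk_nuV P s"
definition lamH :: "pks_params \<Rightarrow> int \<Rightarrow> real" where
  "lamH P s = pk_pH P s * hfun P s / pk_nuH P s"
definition turnV :: "pks_params \<Rightarrow> int \<Rightarrow> real" where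
  "turnV P s = pk_q P s * sqrt (pk_nuH P s / pk_nuV P s)"
definition turnH :: "pks_params \<Rightarrow> int \<Rightarrow> real" where
  "turnH P s = pk_q P s * sqrt (pk_nuV P s / pk_nuH P s)"
definition rV :: "pks_params \<Rightarrow> int \<Rightarrow> real" where
  "rV P s = lamV P s + turnV P s"
definition rH :: "pks_params \<Rightarrow> int \<Rightarrow> real" where
  "rH P s = lamH P s + turnH P s"

text \<open>Sample from the probability w/tot w on Z (enumerated by int_decode).
  Convention: returns 0 if the total mass is 0.\<close>
definition sample_Z :: "(int \<Rightarrow> real) \<Rightarrow> real \<Rightarrow> int" where
  "sample_Z w u =
    (if \<exists>n. u * tot w < (\<Sum>k\<le>n. w (int_decode k))
     then int_decode (LEAST n. u * tot w < (\<Sum>k\<le>n. w (int_decode k)))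
     else 0)"

definition poisson_sample :: "real \<Rightarrow> real \<Rightarrow> nat" where
  "poisson_sample l u =
    (if \<exists>n. u < (\<Sum>k\<le>n. exp (- l) * l ^ k / fact k)
     then (LEAST n. u < (\<Sum>k\<le>n. exp (- l) * l ^ k / fact k)) else 0)"

text \<open>Position of the next event of an exponential clock of rate r started at base;
  if r = 0 the clock never rings (returned position bound + 1 lies outside the box).\<close>
definition clock_after :: "real \<Rightarrow> real \<Rightarrow> real \<Rightarrow> real \<Rightarrow> real" where
  "clock_after base r u bound = (if r > 0 then base - ln (1 - u) / r else bound + 1)"

text \<open>Sweep from left to right. Active horizontal lines: (y, intensity, x where the
  current segment started, x of next spontaneous event).  Mode Vert x y s k: a vertical
  line at column x, current segment started at height y, intensity s, next spontaneous
  event at height k.\<close>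
datatype md = Sweep | Vert real real int real | Done

record pks_cfg =
  cfg_mode :: md
  cfg_hs   :: "(real \<times> int \<times> real \<times> real) list"
  cfg_cx   :: "(real \<times> int) list"
  cfg_c0   :: "(real \<times> real \<times> int) list"
  cfg_out  :: "seg set"
  cfg_idx  :: nat

definition emitH :: "real \<Rightarrow> real \<Rightarrow> real \<Rightarrow> int \<Rightarrow> seg set" where
  "emitH x0 x1 y s = (if x0 < x1 then {((x0, y), (x1, y), s)} else {})"
definition emitV :: "real \<Rightarrow> real \<Rightarrow> real \<Rightarrow> int \<Rightarrow> seg set" where
  "emitV x y0 y1 s = (if y0 < y1 then {((x, y0), (x, y1), s)} else {})"

text \<open>Independent uniform streams: stream j, k-th variable.\<close>
definition ustr :: "(nat \<Rightarrow> real) \<Rightarrow> nat \<Rightarrow> nat \<Rightarrow> real" where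
  "ustr \<omega> j k = \<omega> (prod_encode (j, k))"

definition pks_init :: "pks_params \<Rightarrow> (nat \<Rightarrow> real) \<Rightarrow> pks_cfg" where
  "pks_init P \<omega> =
    (let a = pk_a P; b = pk_b P;
         NX = poisson_sample (a * tot (pk_nuV P)) (ustr \<omega> 0 0);
         NY = poisson_sample (b * tot (pk_nuH P)) (ustr \<omega> 1 0);
         N0 = poisson_sample (a * b * pk_p0 P * hfun P 0) (ustr \<omega> 2 0)
     in \<lparr> cfg_mode = Sweep,
          cfg_hs = map (\<lambda>i. let y = b * ustr \<omega> 1 (3*i+1);
                                s = sample_Z (pk_nuH P) (ustr \<omega> 1 (3*i+2))
                            in (y, s, 0, clock_after 0 (rH P s) (ustr \<omega> 1 (3*i+3)) a)) [0..<NY],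
          cfg_cx = map (\<lambda>i. (a * ustr \<omega> 0 (2*i+1), sample_Z (pk_nuV P) (ustr \<omega> 0 (2*i+2)))) [0..<NX],
          cfg_c0 = map (\<lambda>i. (a * ustr \<omega> 2 (3*i+1), b * ustr \<omega> 2 (3*i+2),
                              sample_Z (fker P 0) (ustr \<omega> 2 (3*i+3)))) [0..<N0],
          cfg_out = {},
          cfg_idx = 0 \<rparr>)"

definition pks_step :: "pks_params \<Rightarrow> (nat \<Rightarrow> real) \<Rightarrow> pks_cfg \<Rightarrow> pks_cfg" where
  "pks_step P \<omega> c =
    (let a = pk_a P; b = pk_b P; hs = cfg_hs c; out = cfg_out c;
         d = (\<lambda>j. ustr \<omega> 3 (cfg_idx c + j));
         c' = c\<lparr>cfg_idx := cfg_idx c + 4\<rparr>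
     in case cfg_mode c of
       Done \<Rightarrow> c
     | Sweep \<Rightarrow>
         (let xs = map fst (cfg_cx c) @ map fst (cfg_c0 c) @ map (\<lambda>(y,s,x0,k). k) hs;
              t = (if xs = [] then a + 1 else Min (set xs))
          in if t > a then
               c'\<lparr>cfg_mode := Done, cfg_hs := [],
                  cfg_out := out \<union> (\<Union>(y,s,x0,k)\<in>set hs. emitH x0 a y s)\<rparr>
             else (case find (\<lambda>(x,s). x = t) (cfg_cx c) of
               Some (x, s) \<Rightarrow>
                 c'\<lparr>cfg_mode := Vert x 0 s (clock_after 0 (rV P s) (d 0) b),
                    cfg_cx := remove1 (x, s) (cfg_cx c)\<rparr>
             | None \<Rightarrow> (case find (\<lambda>(x,y,s). x = t) (cfg_c0 c) of
               Some (x, y, s) \<Rightarrow>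
                 c'\<lparr>cfg_mode := Vert x y (- s) (clock_after y (rV P (- s)) (d 0) b),
                    cfg_hs := hs @ [(y, s, x, clock_after x (rH P s) (d 1) a)],
                    cfg_c0 := remove1 (x, y, s) (cfg_c0 c)\<rparr>
             | None \<Rightarrow> (case find (\<lambda>(y,s,x0,k). k = t) hs of
               Some (y, s, x0, k) \<Rightarrow>
                 (if d 0 * rH P s < lamH P s then
                    (let T = sample_Z (fker P s) (d 1) in
                     c'\<lparr>cfg_mode := Vert k y (s - T) (clock_after y (rV P (s - T)) (d 2) b),
                        cfg_hs := remove1 (y, s, x0, k) hs @ [(y, T, k, clock_after k (rH P T) (d 3) a)],
                        cfg_out := out \<union> emitH x0 k y s\<rparr>)
                  else
                     c'\<lparr>cfg_mode := Vert k y s (clock_after y (rV P s) (d 2) b),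
                        cfg_hs := remove1 (y, s, x0, k) hs,
                        cfg_out := out \<union> emitH x0 k y s\<rparr>)
             | None \<Rightarrow> c'\<lparr>cfg_mode := Done\<rparr>))))
     | Vert x yv s k \<Rightarrow>
         (let above = filter (\<lambda>(y,_,_,_). yv < y) hs;
              yn = (if above = [] then b + 1 else Min (set (map fst above)))
          in if b < min k yn then
               c'\<lparr>cfg_mode := Sweep, cfg_out := out \<union> emitV x yv b s\<rparr>
             else if k \<le> yn then
               (if d 0 * rV P s < lamV P s then
                  (let T = sample_Z (fker P s) (d 1) in
                   c'\<lparr>cfg_mode := Vert x k (s - T) (clock_after k (rV P (s - T)) (d 2) b),
                      cfg_hs := hs @ [(k, T, x, clock_after x (rH P T) (d 3) a)],
                      cfg_out := out \<union> emitV x yv k s\<rparr>)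
                else
                   c'\<lparr>cfg_mode := Sweep,
                      cfg_hs := hs @ [(k, s, x, clock_after x (rH P s) (d 3) a)],
                      cfg_out := out \<union> emitV x yv k s\<rparr>)
             else (case find (\<lambda>(y,_,_,_). y = yn) hs of
               None \<Rightarrow> c'\<lparr>cfg_mode := Done\<rparr>
             | Some (yh, sW, x0, kh) \<Rightarrow>
                 (let u = s + sW;
                      hs0 = remove1 (yh, sW, x0, kh) hs;
                      out' = out \<union> emitV x yv yh s \<union> emitH x0 x yh sW
                  in if d 0 < pk_pV P u then
                       c'\<lparr>cfg_mode := Vert x yh u (clock_after yh (rV P u) (d 1) b),
                          cfg_hs := hs0, cfg_out := out'\<rparr>
                     else if d 0 < pk_pV P u + pk_pH P u then
                       c'\<lparr>cfg_mode := Sweep,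
                          cfg_hs := hs0 @ [(yh, u, x, clock_after x (rH P u) (d 1) a)],
                          cfg_out := out'\<rparr>
                     else if u = 0 \<and> d 0 < pk_pV P u + pk_pH P u + pk_p0 P then
                       c'\<lparr>cfg_mode := Sweep, cfg_hs := hs0, cfg_out := out'\<rparr>
                     else
                       (let T = sample_Z (fker P u) (d 1) in
                        c'\<lparr>cfg_mode := Vert x yh (u - T) (clock_after yh (rV P (u - T)) (d 2) b),
                           cfg_hs := hs0 @ [(yh, T, x, clock_after x (rH P T) (d 3) a)],
                           cfg_out := out'\<rparr>)))))"

definition pks_run :: "pks_params \<Rightarrow> (nat \<Rightarrow> real) \<Rightarrow> nat \<Rightarrow> pks_cfg" where
  "pks_run P \<omega> n = (pks_step P \<omega> ^^ n) (pks_init P \<omega>)"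

text \<open>The restriction D to the box, as a function of the i.i.d. uniform source
  (empty set on the null event that the simulation does not terminate).\<close>
definition pks_box :: "pks_params \<Rightarrow> (nat \<Rightarrow> real) \<Rightarrow> seg set" where
  "pks_box P \<omega> =
    (if \<exists>n. cfg_mode (pks_run P \<omega> n) = Done
     then cfg_out (pks_run P \<omega> (LEAST n. cfg_mode (pks_run P \<omega> n) = Done)) else {})"

definition pks_source :: "(nat \<Rightarrow> real) measure" where
  "pks_source = PiM UNIV (\<lambda>_. uniform_measure lborel {0..1})"

definition pks_seg_space :: "seg set measure" where
  "pks_seg_space = sigma (Collect finite)
     {{F. finite F \<and> card (F \<inter> B) = k} | B k. B \<in> sets (borel :: seg measure)}"

definition pks_law :: "pks_params \<Rightarrow> seg set measure" where
  "pks_law P = distr pks_source pks_seg_space (pks_box P)"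

definition rot180 :: "real \<Rightarrow> real \<Rightarrow> seg set \<Rightarrow> seg set" where
  "rot180 a b F = (\<lambda>((xm, ym), (xp, yp), s). ((a - xp, b - yp), (a - xm, b - ym), s)) ` F"

end

theory Submission
  imports Defs
begin

text \<open>
The simulation is a Markov chain that sweeps the box from left to right. A set of segments is recorded
only through its avoidance events for sets \<open>B\<close> whose complement has an indicator of product form
\<open>\<Sum>l. al l x0 y0 s * be l x1 y1 s\<close>; they form a \<open>\<pi>\<close>-system that generates the law. The label \<open>l\<close>
is attached to each line as a mark, so that avoidance factorises into a weight of the two ends of each
segment. After integrating out the uniform variables (the clocks are memoryless, so they may be
resampled at will), the \<open>n\<close>-step avoidance probability is an integral of products of vertex weights over
Poisson configurations of lines. The defining rates make each vertex weight invariant, up to the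
reference measures \<open>nuV\<close> and \<open>nuH\<close>, under exchange of its incoming and outgoing lines (for instance
\<open>nuV s * lamV s = pV s * hfun s\<close>), and the exponential survival factors are symmetric. Hence the adjoint
of one column of the sweep is the column operator of the rotated picture, and reading the \<open>n\<close> columns
backwards gives the avoidance probability of the rotated set.
\<close>

text \<open>What the simulation remembers is not symmetric: clock readings, starting abscissae, the
  order of the lists and the unread uniforms have no counterpart in the reversed picture until they
  are integrated out. Clocks: a line is recorded with a clock started at abscissa 0 and conditioned
  not to have rung, whatever its true start, so that the survival factors collect into
  \<open>EE x L\<close>. Starts: \<open>al\<close> is charged where a line leaves a vertex and
  \<open>be\<close> where it arrives at one, and the sum over the label turns the product into the
  factor \<open>phi\<close> of the whole segment; in between the chain sees only height, intensity
  and label. Even then a single step, a vertex combined with a free flight, is not self-adjoint; its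
  two parts are, up to \<open>adj\<close> and to transposition of the kernels. So a marked vertex is
  moved through the chain, with \<open>B i j\<close> for \<open>i\<close> vertices before and
  \<open>j\<close> after it. Finally, no estimate on the number of steps is made: runs are sorted by
  their exact number of steps, and a run that never ends yields the empty set, whose contribution is
  the same for all avoided sets.\<close>

notation pair_measure (infixr "><" 80)

abbreviation nint :: "'a measure => ('a => ennreal) => ennreal" where
 "nint M f == nn_integral M f"

section \<open>Lists over a measurable space\<close>

text \<open>Joint measurability on a product is turned into a rule for composed arguments, the form
  in which the \<open>measurable\<close> method can use hypotheses about curried functions. The
  variants up to \<open>meas8\<close> differ in arity alone.\<close>

lemma meas2:
 assumes "(%(a, b). F a b) \<in> Ma >< Mb \<rightarrow>\<^sub>M N"
  "ga \<in> M \<rightarrow>\<^sub>M Ma" "gb \<in> M \<rightarrow>\<^sub>M Mb"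
 shows "(%w. F (ga w) (gb w)) \<in> M \<rightarrow>\<^sub>M N"
 using measurable_compose[OF _ assms(1), of "%w. (ga w, gb w)" M] assms(2-) by simp

lemma meas3:
 assumes "(%(a, b, c). F a b c) \<in> Ma >< Mb >< Mc \<rightarrow>\<^sub>M N"
  "ga \<in> M \<rightarrow>\<^sub>M Ma" "gb \<in> M \<rightarrow>\<^sub>M Mb" "gc \<in> M \<rightarrow>\<^sub>M Mc"
 shows "(%w. F (ga w) (gb w) (gc w)) \<in> M \<rightarrow>\<^sub>M N"
 using measurable_compose[OF _ assms(1), of "%w. (ga w, gb w, gc w)" M] assms(2-) by simp

lemma meas4:
 assumes "(%(a, b, c, d). F a b c d) \<in> Ma >< Mb >< Mc >< Md \<rightarrow>\<^sub>M N"
  "ga \<in> M \<rightarrow>\<^sub>M Ma" "gb \<in> M \<rightarrow>\<^sub>M Mb" "gc \<in> M \<rightarrow>\<^sub>M Mc" "gd \<in> M \<rightarrow>\<^sub>M Md"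
 shows "(%w. F (ga w) (gb w) (gc w) (gd w)) \<in> M \<rightarrow>\<^sub>M N"
 using measurable_compose[OF _ assms(1), of "%w. (ga w, gb w, gc w, gd w)" M] assms(2-) by simp

lemma meas5:
 assumes "(%(a, b, c, d, e). F a b c d e) \<in> Ma >< Mb >< Mc >< Md >< Me \<rightarrow>\<^sub>M N"
  "ga \<in> M \<rightarrow>\<^sub>M Ma" "gb \<in> M \<rightarrow>\<^sub>M Mb" "gc \<in> M \<rightarrow>\<^sub>M Mc" "gd \<in> M \<rightarrow>\<^sub>M Md" "ge \<in> M \<rightarrow>\<^sub>M Me"
 shows "(%w. F (ga w) (gb w) (gc w) (gd w) (ge w)) \<in> M \<rightarrow>\<^sub>M N"
 using measurable_compose[OF _ assms(1), of "%w. (ga w, gb w, gc w, gd w, ge w)" M] assms(2-) by simp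

lemma meas6:
 assumes "(%(a, b, c, d, e, f). F a b c d e f) \<in> Ma >< Mb >< Mc >< Md >< Me >< Mf \<rightarrow>\<^sub>M N"
  "ga \<in> M \<rightarrow>\<^sub>M Ma" "gb \<in> M \<rightarrow>\<^sub>M Mb" "gc \<in> M \<rightarrow>\<^sub>M Mc" "gd \<in> M \<rightarrow>\<^sub>M Md" "ge \<in> M \<rightarrow>\<^sub>M Me" "gf \<in> M \<rightarrow>\<^sub>M Mf"
 shows "(%w. F (ga w) (gb w) (gc w) (gd w) (ge w) (gf w)) \<in> M \<rightarrow>\<^sub>M N"
 using measurable_compose[OF _ assms(1), of "%w. (ga w, gb w, gc w, gd w, ge w, gf w)" M] assms(2-) by simp

text \<open>The initial sigma-algebra for the length and the coordinates. Entries beyond the length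
  are whatever \<open>nth\<close> yields there; this does no harm, since the equations for
  \<open>nth\<close> of a cons, an append or a \<open>rem\<close> hold for all indices.\<close>

definition listM :: "'a measure => 'a list measure" where
 "listM E = vimage_algebra UNIV (%xs. (length xs, %i. xs ! i)) (count_space UNIV >< PiM UNIV (%_. E))"

definition rem :: "nat => 'a list => 'a list" where
 "rem i xs = take i xs @ drop (Suc i) xs"

text \<open>\<open>Q\<close> is asked against earlier entries and \<open>R\<close> against later
  ones: with a strict and a weak comparison of keys this selects the first minimiser in list order,
  which is the entry that \<open>find\<close> returns.\<close>

definition fsum :: "('a => 'a => bool) => ('a => 'a => bool) => ('a => 'a list => ennreal) => 'a list => ennreal" where
 "fsum Q R F xs = (\<Sum>i<length xs.
   if (\<forall>j<length xs. (j < i --> Q (xs ! i) (xs ! j)) & (i < j --> R (xs ! i) (xs ! j)))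
   then F (xs ! i) (rem i xs) else 0)"

abbreviation picks :: "('a => 'a list => ennreal) => 'a list => ennreal" where
 "picks \<equiv> fsum (%_ _. True) (%_ _. True)"

lemma rem_0 [simp]: "rem 0 (x # xs) = xs"
 and rem_Suc [simp]: "rem (Suc i) (x # xs) = x # rem i xs"
 and rem_Nil [simp]: "rem i [] = []"
 by (simp_all add: rem_def)

lemma mset_rem: "i < length xs ==> add_mset (xs ! i) (mset (rem i xs)) = mset xs"
 by (subst (3) id_take_nth_drop[of i xs]) (auto simp: rem_def)

lemma map_rem: "map f (rem i xs) = rem i (map f xs)"
 by (simp add: rem_def take_map drop_map)

lemma rem_replicate: "i < n ==> rem i (replicate n x) = replicate (n - 1) x"
 by (simp add: rem_def replicate_add[symmetric])

lemma fsum_Nil [simp]: "fsum Q R F [] = 0"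
 by (simp add: fsum_def)

lemma fsum_Cons: "fsum Q R F (x # xs) =
  (if \<forall>e\<in>set xs. R x e then F x xs else 0) +
  fsum Q R (%e es. if Q e x then F e (x # es) else 0) xs"
proof -
 have 1: "(\<forall>j<length (x # xs). (j < 0 --> Q ((x # xs) ! 0) ((x # xs) ! j)) & (0 < j --> R ((x # xs) ! 0) ((x # xs) ! j)))
   \<longleftrightarrow> (\<forall>e\<in>set xs. R x e)"
  by (auto simp: all_set_conv_all_nth less_Suc_eq_0_disj)
 have 2: "(\<forall>j<length (x # xs). (j < Suc i --> Q ((x # xs) ! Suc i) ((x # xs) ! j)) & (Suc i < j --> R ((x # xs) ! Suc i) ((x # xs) ! j)))
   \<longleftrightarrow> Q (xs ! i) x & (\<forall>j<length xs. (j < i --> Q (xs ! i) (xs ! j)) & (i < j --> R (xs ! i) (xs ! j)))" for i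
  by (auto simp: less_Suc_eq_0_disj)
 show ?thesis
  unfolding fsum_def list.size sum.lessThan_Suc_shift add_0_right add_Suc_right 1[unfolded list.size add_0_right add_Suc_right] 2[unfolded list.size add_0_right add_Suc_right]
  by (auto intro!: sum.cong)
qed

lemma fsum_cong: "(\<And>i. i < length xs ==> F (xs ! i) (rem i xs) = G (xs ! i) (rem i xs)) ==> fsum Q R F xs = fsum Q R G xs"
 unfolding fsum_def by (intro sum.cong) auto

lemma picks_eq: "picks F xs = (\<Sum>i<length xs. F (xs ! i) (rem i xs))"
 by (simp add: fsum_def)

lemma fsum_cmult: "fsum Q R (%e es. c * F e es) xs = c * fsum Q R F xs"
 unfolding fsum_def sum_distrib_left by (intro sum.cong) auto

locale list_space =
 fixes E :: "'a measure"
 assumes space_E [simp]: "space E = UNIV"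
begin

lemma space_listM [simp]: "space (listM E) = UNIV"
 by (simp add: listM_def)

lemma measurable_listM_iff:
 "f \<in> M \<rightarrow>\<^sub>M listM E \<longleftrightarrow>
   (%w. length (f w)) \<in> M \<rightarrow>\<^sub>M count_space UNIV & (\<forall>i. (%w. f w ! i) \<in> M \<rightarrow>\<^sub>M E)"
proof
 have g: "(%xs. (length xs, %i. xs ! i)) \<in> listM E \<rightarrow>\<^sub>M (count_space UNIV >< PiM UNIV (%_. E))"
  unfolding listM_def by (rule measurable_vimage_algebra1) (auto simp: space_pair_measure space_PiM space_E)
 assume f: "f \<in> M \<rightarrow>\<^sub>M listM E"
 have h: "(%w. (length (f w), %i. f w ! i)) \<in> M \<rightarrow>\<^sub>M (count_space UNIV >< PiM UNIV (%_. E))"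
  using measurable_compose[OF f g] by simp
 have "(%w. length (f w)) \<in> M \<rightarrow>\<^sub>M count_space UNIV"
  using measurable_compose[OF h measurable_fst] by simp
 moreover have "(%w. f w ! i) \<in> M \<rightarrow>\<^sub>M E" for i
  using measurable_compose[OF measurable_compose[OF h measurable_snd] measurable_component_singleton[of i UNIV]]
  by simp
 ultimately show "(%w. length (f w)) \<in> M \<rightarrow>\<^sub>M count_space UNIV & (\<forall>i. (%w. f w ! i) \<in> M \<rightarrow>\<^sub>M E)"
  by blast
next
 assume a: "(%w. length (f w)) \<in> M \<rightarrow>\<^sub>M count_space UNIV & (\<forall>i. (%w. f w ! i) \<in> M \<rightarrow>\<^sub>M E)"
 have "(%w. \<lambda>i\<in>UNIV. f w ! i) \<in> M \<rightarrow>\<^sub>M PiM UNIV (%_. E)"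
  by (rule measurable_restrict) (use a in auto)
 then show "f \<in> M \<rightarrow>\<^sub>M listM E"
  unfolding listM_def using a
  by (intro measurable_vimage_algebra2 measurable_Pair) (auto simp: restrict_UNIV)
qed

lemma measurable_length [measurable]: "length \<in> listM E \<rightarrow>\<^sub>M count_space UNIV"
 using measurable_listM_iff[of "%x. x" "listM E"] by simp

lemma measurable_nth [measurable]: "(%xs. xs ! i) \<in> listM E \<rightarrow>\<^sub>M E"
 using measurable_listM_iff[of "%x. x" "listM E"] by simp

lemma measurable_nth_var [measurable (raw)]:
 assumes [measurable]: "f \<in> M \<rightarrow>\<^sub>M listM E" "g \<in> M \<rightarrow>\<^sub>M count_space UNIV"
 shows "(%w. f w ! g w) \<in> M \<rightarrow>\<^sub>M E"
 by (rule measurable_compose_countable[of "%i w. f w ! i" M E g]) measurable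

lemma measurable_Nil [measurable]: "(%_. []) \<in> M \<rightarrow>\<^sub>M listM E"
 unfolding measurable_listM_iff using space_E by auto

lemma measurable_Cons [measurable (raw)]:
 assumes [measurable]: "f \<in> M \<rightarrow>\<^sub>M E" "g \<in> M \<rightarrow>\<^sub>M listM E"
 shows "(%w. f w # g w) \<in> M \<rightarrow>\<^sub>M listM E"
 unfolding measurable_listM_iff
proof (intro conjI allI)
 fix i show "(%w. (f w # g w) ! i) \<in> M \<rightarrow>\<^sub>M E"
  by (cases i) auto
qed simp

lemma measurable_append [measurable (raw)]:
 assumes [measurable]: "f \<in> M \<rightarrow>\<^sub>M listM E" "g \<in> M \<rightarrow>\<^sub>M listM E"
 shows "(%w. f w @ g w) \<in> M \<rightarrow>\<^sub>M listM E"
 unfolding measurable_listM_iff nth_append by simp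

lemma rem_nth: "rem i xs ! j = (if length xs \<le> i then xs ! j else if j < i then xs ! j else xs ! Suc j)"
proof (induction xs arbitrary: i j)
 case (Cons x xs)
 then show ?case by (cases i; cases j) auto
qed simp

lemma measurable_rem [measurable (raw)]:
 assumes [measurable]: "f \<in> M \<rightarrow>\<^sub>M listM E"
 shows "(%w. rem i (f w)) \<in> M \<rightarrow>\<^sub>M listM E"
proof -
 have l: "length (rem i xs) = (if i < length xs then length xs - 1 else length xs)" for xs :: "'a list"
  by (auto simp: rem_def)
 show ?thesis unfolding measurable_listM_iff rem_nth l by simp
qed

lemma measurable_fsum [measurable (raw)]:
 assumes [measurable]: "f \<in> M \<rightarrow>\<^sub>M listM E"
  and [measurable]: "(%(w, e, es). F w e es) \<in> borel_measurable (M >< E >< listM E)"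
  and [measurable]: "Measurable.pred (M >< E >< E) (%(w, e, e'). Q w e e')"
  and [measurable]: "Measurable.pred (M >< E >< E) (%(w, e, e'). R w e e')"
 shows "(%w. fsum (Q w) (R w) (F w) (f w)) \<in> borel_measurable M"
proof -
 have [measurable]: "(%w. F w (f w ! i) (rem i (f w))) \<in> borel_measurable M" for i
  by (rule measurable_compose[OF _ assms(2), of "%w. (w, f w ! i, rem i (f w))", simplified]) measurable
 have [measurable]: "Measurable.pred M (%w. Q w (f w ! i) (f w ! j))" "Measurable.pred M (%w. R w (f w ! i) (f w ! j))" for i j
  subgoal by (rule measurable_compose[OF _ assms(3), of "%w. (w, f w ! i, f w ! j)", simplified]) measurable
  subgoal by (rule measurable_compose[OF _ assms(4), of "%w. (w, f w ! i, f w ! j)", simplified]) measurable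
  done
 have "(%w. (%n w. (\<Sum>i<n. if (\<forall>j<n. (j < i --> Q w (f w ! i) (f w ! j)) & (i < j --> R w (f w ! i) (f w ! j)))
   then F w (f w ! i) (rem i (f w)) else 0)) (length (f w)) w) \<in> borel_measurable M"
  by (rule measurable_compose_countable) measurable
 then show ?thesis unfolding fsum_def by simp
qed

text \<open>The number of steps of the fold depends on the point. For \<open>n\<close> steps read
  from position \<open>k\<close> the fold is a fixed composition \<open>G n k\<close>, and the
  length takes countably many values.\<close>

lemma measurable_foldr [measurable (raw)]:
 assumes xs [measurable]: "f \<in> M \<rightarrow>\<^sub>M listM E"
  and h [measurable]: "(%(w, e, a). h w e a) \<in> M >< E >< N \<rightarrow>\<^sub>M N"
  and [measurable]: "g \<in> M \<rightarrow>\<^sub>M N"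
 shows "(%w. foldr (h w) (f w) (g w)) \<in> M \<rightarrow>\<^sub>M N"
proof -
 define G where "G = rec_nat (%k w. g w) (%n r k w. h w (f w ! k) (r (Suc k) w))"
 have G0: "G 0 k w = g w" and GS: "G (Suc n) k w = h w (f w ! k) (G n (Suc k) w)" for n k w
  by (simp_all add: G_def)
 have meas: "G n k \<in> M \<rightarrow>\<^sub>M N" for n k
 proof (induction n arbitrary: k)
  case 0 then show ?case by (simp add: G0[abs_def])
 next
  case (Suc n)
  note [measurable] = Suc
  show ?case unfolding GS[abs_def]
   by (rule measurable_compose[OF _ h, of "%w. (w, f w ! k, G n (Suc k) w)", simplified]) measurable
 qed
 have eq: "foldr (h w) (drop k (f w)) (g w) = G (length (f w) - k) k w" for k w
 proof (induction "length (f w) - k" arbitrary: k)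
  case 0 then show ?case by (simp add: G0)
 next
  case (Suc n)
  then have "k < length (f w)" by auto
  then have "drop k (f w) = f w ! k # drop (Suc k) (f w)" by (rule Cons_nth_drop_Suc[symmetric])
  moreover have "length (f w) - k = Suc (length (f w) - Suc k)" using \<open>k < length (f w)\<close> by auto
  moreover have "n = length (f w) - Suc k" using Suc(2) by auto
  ultimately show ?case using Suc(1)[of "Suc k"] by (simp add: GS)
 qed
 have "(%w. G (length (f w)) 0 w) \<in> M \<rightarrow>\<^sub>M N"
  by (rule measurable_compose_countable[OF meas]) measurable
 then show ?thesis using eq[of _ 0] by simp
qed

lemma pred_Ball_list [measurable (raw)]:
 assumes [measurable]: "f \<in> M \<rightarrow>\<^sub>M listM E"
  and [measurable]: "Measurable.pred (M >< E) (%(w, e). A w e)"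
 shows "Measurable.pred M (%w. \<forall>e\<in>set (f w). A w e)"
proof -
 have eq: "(\<forall>e\<in>set xs. A w e) = foldr (%e a. A w e & a) xs True" for w xs
  by (induction xs) auto
 show ?thesis unfolding eq by measurable
qed

lemma measurable_prod_list [measurable (raw)]:
 fixes h :: "_ => _ => ennreal"
 assumes [measurable]: "f \<in> M \<rightarrow>\<^sub>M listM E"
  and [measurable]: "(%(w, e). h w e) \<in> borel_measurable (M >< E)"
 shows "(%w. prod_list (map (h w) (f w))) \<in> borel_measurable M"
proof -
 have eq: "prod_list (map (h w) xs) = foldr (%e a. h w e * a) xs 1" for w xs
  by (induction xs) auto
 show ?thesis unfolding eq by measurable
qed

lemma measurable_sum_list [measurable (raw)]:
 fixes h :: "_ => _ => real"
 assumes [measurable]: "f \<in> M \<rightarrow>\<^sub>M listM E"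
  and [measurable]: "(%(w, e). h w e) \<in> borel_measurable (M >< E)"
 shows "(%w. sum_list (map (h w) (f w))) \<in> borel_measurable M"
proof -
 have eq: "sum_list (map (h w) xs) = foldr (%e a. h w e + a) xs 0" for w xs
  by (induction xs) auto
 show ?thesis unfolding eq by measurable
qed

end

section \<open>Iterated integrals over lists\<close>

text \<open>Each label of \<open>L\<close> chooses the measure of its own entry, so that lists whose
  entries have different laws fit into the same scheme as i.i.d. ones.\<close>

primrec lint :: "('l => 'a measure) => 'l list => ('a list => ennreal) => ennreal" where
 "lint K [] F = F []"
| "lint K (l # L) F = (nint (K l) (%e. lint K L (%es. F (e # es))))"

text \<open>The unnormalised Poisson process: for finite \<open>\<mu>\<close>, division by
  \<open>exp\<close> of the total mass gives its law. Leaving out the normalisation keeps the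
  duality below free of constants.\<close>

definition mint :: "'a measure => ('a list => ennreal) => ennreal" where
 "mint \<mu> F = (\<Sum>n. ennreal (1 / fact n) * lint (%_. \<mu>) (replicate n ()) F)"

lemma lint_cong_AE:
 assumes "\<And>es. list_all2 \<rho> L es ==> F es = G es" "\<And>l. l \<in> set L ==> AE e in K l. \<rho> l e"
 shows "lint K L F = lint K L G"
 using assms
proof (induction L arbitrary: F G)
 case (Cons l L)
 have "AE e in K l. lint K L (%es. F (e # es)) = lint K L (%es. G (e # es))"
  using Cons.prems(2)[of l, simplified]
 proof eventually_elim
  case (elim e)
  show ?case by (rule Cons.IH) (use elim Cons.prems in auto)
 qed
 then show ?case by (auto intro: nn_integral_cong_AE)
qed simp

lemma lint_zero [simp]: "lint K L (%_. 0) = 0"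
 by (induction L) auto

locale list_kernel = list_space E for E :: "'a measure" +
 fixes K :: "'l => 'a measure"
 assumes sets_K [measurable_cong, simp]: "sets (K l) = sets E"
  and sfin: "sigma_finite_measure (K l)"
begin

lemma space_K [simp]: "space (K l) = UNIV"
 using sets_eq_imp_space_eq[OF sets_K[of l]] space_E by simp

text \<open>The accumulator \<open>acc\<close> holds the entries already chosen, so that the
  induction over the labels always speaks about the same list space.\<close>

lemma lint_measurable_acc:
 assumes [measurable]: "(%(w, es). F w es) \<in> borel_measurable (M >< listM E)"
 shows "(%(w, acc). lint K L (%es. F w (acc @ es))) \<in> borel_measurable (M >< listM E)"
proof (induction L)
 case Nil then show ?case by simp
next
 case (Cons l L)
 interpret sigma_finite_measure "K l" by (rule sfin)
 have "(%((w, acc), e). lint K L (%es. F w ((acc @ [e]) @ es))) \<in> borel_measurable ((M >< listM E) >< K l)"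
 proof -
  have "(%x. (fst (fst x), snd (fst x) @ [snd x])) \<in> (M >< listM E) >< K l \<rightarrow>\<^sub>M M >< listM E"
   by measurable
  from measurable_compose[OF this Cons] show ?thesis by (simp add: split_beta')
 qed
 with borel_measurable_nn_integral[of "%x e. lint K L (%es. F (fst x) ((snd x @ [e]) @ es))" "M >< listM E"]
 show ?case by (simp add: split_beta')
qed

lemma lint_measurable [measurable (raw)]:
 assumes [measurable]: "(%(w, es). F w es) \<in> borel_measurable (M >< listM E)"
 shows "(%w. lint K L (F w)) \<in> borel_measurable M"
 using measurable_compose[OF _ lint_measurable_acc[OF assms, of L], of "%w. (w, [])" M] by simp

lemma lint_nn_integral:
 assumes \<mu>: "sigma_finite_measure \<mu>"
  and [measurable]: "(%(p, es). F p es) \<in> borel_measurable (\<mu> >< listM E)"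
 shows "lint K L (%es. nint \<mu> (%p. F p es)) = (nint \<mu> (%p. lint K L (F p)))"
 using assms(2)
proof (induction L arbitrary: F)
 case (Cons l L)
 note [measurable] = Cons.prems
 interpret \<mu>: sigma_finite_measure \<mu> by fact
 interpret Kl: sigma_finite_measure "K l" by (rule sfin)
 interpret P: pair_sigma_finite \<mu> "K l" ..
 have "lint K (l # L) (%es. nint \<mu> (%p. F p es)) = (nint (K l) (%e. (nint \<mu> (%p. lint K L (%es. F p (e # es))))))"
  by (simp, intro nn_integral_cong Cons.IH) measurable
 also have "... = (nint \<mu> (%p. (nint (K l) (%e. lint K L (%es. F p (e # es))))))"
  by (rule P.Fubini') measurable
 finally show ?case by simp
qed simp

lemma lint_cmult:
 assumes [measurable]: "F \<in> borel_measurable (listM E)"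
 shows "lint K L (%es. c * F es) = c * lint K L F"
 using assms
proof (induction L arbitrary: F)
 case (Cons l L)
 note [measurable] = Cons.prems
 have "lint K L (%es. c * F (e # es)) = c * lint K L (%es. F (e # es))" for e
  by (rule Cons.IH) measurable
 then show ?case by (simp, intro nn_integral_cmult) measurable
qed simp

lemma lint_add:
 assumes [measurable]: "F \<in> borel_measurable (listM E)" "G \<in> borel_measurable (listM E)"
 shows "lint K L (%es. F es + G es) = lint K L F + lint K L G"
 using assms
proof (induction L arbitrary: F G)
 case (Cons l L)
 note [measurable] = Cons.prems
 have "lint K L (%es. F (e # es) + G (e # es)) = lint K L (%es. F (e # es)) + lint K L (%es. G (e # es))" for e
  by (rule Cons.IH) measurable
 then show ?case by (simp, intro nn_integral_add) measurable
qed simp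

lemma lint_snoc: "lint K (L @ [l]) F = lint K L (%es. nint (K l) (%e. F (es @ [e])))"
 by (induction L arbitrary: F) auto

text \<open>When ties are null, the strict test \<open>Q\<close> and the weak test \<open>R\<close>
  both agree almost surely with \<open>B\<close>, and the asymmetry between earlier and later
  entries disappears. This is asked only for those selected entries on which \<open>F\<close> does
  not vanish.\<close>

lemma lint_fsum:
 assumes [measurable]: "(%(e, es). F e es) \<in> borel_measurable (E >< listM E)"
  and [measurable]: "Measurable.pred (E >< E) (%(e, e'). Q e e')" "Measurable.pred (E >< E) (%(e, e'). R e e')"
   "Measurable.pred (E >< E) (%(e, e'). B e e')"
  and AE: "\<And>e es l. F e es ~= 0 ==> AE e' in K l. Q e e' = B e e' & R e e' = B e e'"
 shows "lint K L (fsum Q R F) =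
  (\<Sum>i<length L. nint (K (L ! i)) (%e. lint K (rem i L) (%es. if \<forall>e'\<in>set es. B e e' then F e es else 0)))"
 using assms(1,5)
proof (induction L arbitrary: F)
 case (Cons l L)
 note [measurable] = Cons.prems(1)
 interpret Kl: sigma_finite_measure "K l" by (rule sfin)
 have 1: "lint K L (%es. if \<forall>e'\<in>set es. R e e' then F e es else 0) =
   lint K L (%es. if \<forall>e'\<in>set es. B e e' then F e es else 0)" for e
 proof (cases "\<exists>es. F e es ~= 0")
  case True
  then obtain es0 where "F e es0 ~= 0" by blast
  note ae = Cons.prems(2)[OF this]
  show ?thesis
   by (rule lint_cong_AE[where \<rho>="%l e'. R e e' = B e e'"])
    (use ae in \<open>auto simp: list_all2_conv_all_nth all_set_conv_all_nth\<close>)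
 next
  case False
  then show ?thesis by (intro arg_cong[of _ _ "lint K L"]) auto
 qed
 have IH: "lint K L (fsum Q R (%e es. if Q e e0 then F e (e0 # es) else 0)) =
   (\<Sum>i<length L. nint (K (L ! i)) (%e. lint K (rem i L) (%es. if \<forall>e'\<in>set es. B e e' then (if Q e e0 then F e (e0 # es) else 0) else 0)))" for e0
  by (rule Cons.IH) (measurable, use Cons.prems(2) in \<open>auto split: if_splits\<close>)
 \<comment> \<open>If the selected entry lies in the tail, the head \<open>e0\<close> is one of its
   competitors; after the exchange of the two integrals its test \<open>Q\<close> becomes part of
   the test \<open>B\<close> over the whole remainder.\<close>
 have 2: "(nint (K l) (%e0. (nint (K (L ! i)) (%e. lint K (rem i L) (%es. if \<forall>e'\<in>set es. B e e' then (if Q e e0 then F e (e0 # es) else 0) else 0)))))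
   = (nint (K (L ! i)) (%e. (nint (K l) (%e0. lint K (rem i L) (%es. if \<forall>e'\<in>set (e0 # es). B e e' then F e (e0 # es) else 0)))))" for i
 proof -
  interpret Ki: sigma_finite_measure "K (L ! i)" by (rule sfin)
  interpret P: pair_sigma_finite "K l" "K (L ! i)" ..
  have "(nint (K l) (%e0. (nint (K (L ! i)) (%e. lint K (rem i L) (%es. if \<forall>e'\<in>set es. B e e' then (if Q e e0 then F e (e0 # es) else 0) else 0)))))
   = (nint (K (L ! i)) (%e. (nint (K l) (%e0. lint K (rem i L) (%es. if \<forall>e'\<in>set es. B e e' then (if Q e e0 then F e (e0 # es) else 0) else 0)))))"
   by (rule P.Fubini'[symmetric]) measurable
  also have "... = (nint (K (L ! i)) (%e. (nint (K l) (%e0. lint K (rem i L) (%es. if \<forall>e'\<in>set (e0 # es). B e e' then F e (e0 # es) else 0)))))"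
  proof (rule nn_integral_cong)
   fix e
   show "(nint (K l) (%e0. lint K (rem i L) (%es. if \<forall>e'\<in>set es. B e e' then (if Q e e0 then F e (e0 # es) else 0) else 0)))
    = (nint (K l) (%e0. lint K (rem i L) (%es. if \<forall>e'\<in>set (e0 # es). B e e' then F e (e0 # es) else 0)))"
   proof (cases "\<exists>es. F e es ~= 0")
    case True
    then obtain es0 where "F e es0 ~= 0" by blast
    note ae = Cons.prems(2)[OF this, of l]
    show ?thesis
     by (rule nn_integral_cong_AE, use ae in eventually_elim)
       (auto intro!: arg_cong[of _ _ "lint K (rem i L)"])
   next
    case False
    then show ?thesis by (intro nn_integral_cong arg_cong[of _ _ "lint K (rem i L)"]) auto
   qed
  qed
  finally show ?thesis .
 qed
 have "lint K (l # L) (fsum Q R F) =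
  (nint (K l) (%e0. lint K L (%es. (if \<forall>e'\<in>set es. R e0 e' then F e0 es else 0) +
    fsum Q R (%e es. if Q e e0 then F e (e0 # es) else 0) es)))"
  by (simp add: fsum_Cons)
 also have "... = (nint (K l) (%e0. lint K L (%es. if \<forall>e'\<in>set es. R e0 e' then F e0 es else 0) +
    lint K L (fsum Q R (%e es. if Q e e0 then F e (e0 # es) else 0))))"
  by (intro nn_integral_cong lint_add) measurable
 also have "... = (nint (K l) (%e0. lint K L (%es. if \<forall>e'\<in>set es. B e0 e' then F e0 es else 0))) +
   (\<Sum>i<length L. nint (K l) (%e0. (nint (K (L ! i)) (%e. lint K (rem i L) (%es. if \<forall>e'\<in>set es. B e e' then (if Q e e0 then F e (e0 # es) else 0) else 0)))))"
 proof -
  have m: "(%e0. nint (K (L ! i)) (%e. lint K (rem i L) (%es. if \<forall>e'\<in>set es. B e e' then (if Q e e0 then F e (e0 # es) else 0) else 0))) \<in> borel_measurable (K l)" for i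
  proof -
   interpret Ki: sigma_finite_measure "K (L ! i)" by (rule sfin)
   show ?thesis by measurable
  qed
  show ?thesis unfolding 1 IH
   by (subst nn_integral_add) (use m in \<open>simp_all add: nn_integral_sum\<close>, measurable)
 qed
 also have "... = (\<Sum>i<length (l # L). nint (K ((l # L) ! i)) (%e. lint K (rem i (l # L)) (%es. if \<forall>e'\<in>set es. B e e' then F e es else 0)))"
  unfolding list.size add_0_right add_Suc_right sum.lessThan_Suc_shift 2 by simp
 finally show ?case .
qed simp

end

section \<open>Chains of vertices along a sweep\<close>

locale mint_space = list_space E for E :: "'a measure" +
 fixes \<mu> :: "'a measure"
 assumes sets_mu [measurable_cong, simp]: "sets \<mu> = sets E"
  and sfin_mu: "sigma_finite_measure \<mu>"
begin

sublocale kern: list_kernel E "%_::unit. \<mu>"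
 by (intro list_kernel.intro list_kernel_axioms.intro list_space_axioms sets_mu sfin_mu)

sublocale sigma_finite_measure \<mu> by (rule sfin_mu)

lemma space_mu [simp]: "space \<mu> = UNIV"
 using kern.space_K by simp

lemma mint_measurable [measurable (raw)]:
 assumes [measurable]: "(%(w, es). F w es) \<in> borel_measurable (M >< listM E)"
 shows "(%w. mint \<mu> (F w)) \<in> borel_measurable M"
 unfolding mint_def by measurable

lemma mint_nn_integral:
 assumes \<nu>: "sigma_finite_measure \<nu>"
  and [measurable]: "(%(p, es). F p es) \<in> borel_measurable (\<nu> >< listM E)"
 shows "mint \<mu> (%es. nint \<nu> (%p. F p es)) = (nint \<nu> (%p. mint \<mu> (F p)))"
 unfolding mint_def
 by (subst nn_integral_suminf, measurable, subst nn_integral_cmult, measurable,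
   subst kern.lint_nn_integral[OF \<nu>], measurable)

lemma mint_cmult:
 assumes [measurable]: "F \<in> borel_measurable (listM E)"
 shows "mint \<mu> (%es. c * F es) = c * mint \<mu> F"
 unfolding mint_def by (subst kern.lint_cmult, measurable) (simp add: mult.left_commute[of _ c])

lemma mint_add:
 assumes [measurable]: "F \<in> borel_measurable (listM E)" "G \<in> borel_measurable (listM E)"
 shows "mint \<mu> (%es. F es + G es) = mint \<mu> F + mint \<mu> G"
 unfolding mint_def by (subst kern.lint_add, measurable) (simp add: distrib_left suminf_add)

lemma mint_cong_AE:
 assumes "\<And>es. list_all \<rho> es ==> F es = G es" "AE e in \<mu>. \<rho> e"
 shows "mint \<mu> F = mint \<mu> G"
 unfolding mint_def
 by (intro suminf_cong arg_cong2[of _ _ _ _ "(*)"] refl lint_cong_AE[where \<rho>="%_. \<rho>"])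
   (use assms in \<open>auto simp: list_all2_conv_all_nth list_all_length\<close>)

text \<open>The Mecke formula: each of the \<open>n\<close> points of an \<open>n\<close>-point
  configuration may be the selected one, and \<open>n / n!\<close> is \<open>1 / (n - 1)!\<close>,
  so the remaining points form an unnormalised Poisson configuration again.\<close>

lemma mint_fsum:
 assumes [measurable]: "(%(e, es). F e es) \<in> borel_measurable (E >< listM E)"
  and [measurable]: "Measurable.pred (E >< E) (%(e, e'). Q e e')" "Measurable.pred (E >< E) (%(e, e'). R e e')"
   "Measurable.pred (E >< E) (%(e, e'). B e e')"
  and AE: "\<And>e es. F e es ~= 0 ==> AE e' in \<mu>. Q e e' = B e e' & R e e' = B e e'"
 shows "mint \<mu> (fsum Q R F) = (nint \<mu> (%e. mint \<mu> (%es. if \<forall>e'\<in>set es. B e e' then F e es else 0)))"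
proof -
 define X where "X n = (nint \<mu> (%e. lint (%_. \<mu>) (replicate n ()) (%es. if \<forall>e'\<in>set es. B e e' then F e es else 0)))" for n
 have 1: "lint (%_. \<mu>) (replicate n ()) (fsum Q R F) = of_nat n * X (n - 1)" for n
  by (subst kern.lint_fsum[where B=B], measurable, rule AE, assumption) (simp add: rem_replicate X_def)
 have 2: "ennreal (1 / fact (Suc n)) * (of_nat (Suc n) * X n) = ennreal (1 / fact n) * X n" for n
 proof -
  have "ennreal (1 / fact (Suc n)) * of_nat (Suc n) = ennreal (1 / fact (Suc n) * real (Suc n))"
   by (subst ennreal_mult) (auto simp: ennreal_of_nat_eq_real_of_nat)
  also have "1 / fact (Suc n) * real (Suc n) = (1 / fact n :: real)"
   by (simp add: field_simps del: of_nat_Suc)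
  finally show ?thesis by (simp add: mult.assoc[symmetric] del: of_nat_Suc)
 qed
 have "mint \<mu> (fsum Q R F) = (\<Sum>n. ennreal (1 / fact (Suc n)) * (of_nat (Suc n) * X n))"
  unfolding mint_def 1 by (subst suminf_offset[of _ 1]) simp_all
 also have "... = (\<Sum>n. ennreal (1 / fact n) * X n)"
  unfolding 2 ..
 also have "... = (nint \<mu> (%e. mint \<mu> (%es. if \<forall>e'\<in>set es. B e e' then F e es else 0)))"
  unfolding mint_def X_def by (subst nn_integral_suminf, measurable, subst nn_integral_cmult, measurable)
 finally show ?thesis .
qed

lemma mint_picks:
 assumes [measurable]: "(%(e, es). F e es) \<in> borel_measurable (E >< listM E)"
 shows "mint \<mu> (picks F) = (nint \<mu> (%e. mint \<mu> (F e)))"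
 using mint_fsum[of F "%_ _. True" "%_ _. True" "%_ _. True"] by simp

end

text \<open>The simulation appends new lines at the end of the list, the operators of the chain put
  them in front; only functions of the multiset of lines let the two be compared.\<close>

definition sym_fun :: "('a list => 'b) => bool" where
 "sym_fun F \<longleftrightarrow> (\<forall>xs ys. mset xs = mset ys --> F xs = F ys)"

lemma sym_funD: "sym_fun F ==> mset xs = mset ys ==> F xs = F ys"
 unfolding sym_fun_def by blast

lemma sym_fun_const [simp]: "sym_fun (%_. c)" by (simp add: sym_fun_def)

text \<open>Each \<open>F z\<close> factors through the multiset of its argument, so the sum over
  positions becomes a sum over the elements of a multiset.\<close>

lemma sym_fun_picks:
 assumes "\<And>z. sym_fun (F z)"
 shows "sym_fun (picks F)"
proof -
 define F' where "F' z M = F z (SOME ys. mset ys = M)" for z M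
 have F': "F z ys = F' z (mset ys)" for z ys
  unfolding F'_def by (rule sym_funD[OF assms]) (metis (mono_tags, lifting) someI_ex)
 have sum: "picks (%z ys. G z (mset ys)) xs = (\<Sum>z\<in>#mset xs. G z (mset xs - {#z#}))" for G xs
 proof (induction xs arbitrary: G)
  case (Cons x xs)
  have "(\<Sum>z\<in>#mset xs. G z (add_mset x (mset xs - {#z#}))) = (\<Sum>z\<in>#mset xs. G z (add_mset x (mset xs) - {#z#}))"
   by (intro arg_cong[of _ _ sum_mset] image_mset_cong) (use diff_union_single_conv[of _ "mset xs" "{#x#}"] in auto)
  then show ?case using Cons[of "%z M. G z (add_mset x M)"] by (simp add: fsum_Cons)
 qed simp
 have F_eq: "F = (%z ys. F' z (mset ys))" by (intro ext F')
 have "picks F xs = (\<Sum>z\<in>#mset xs. F' z (mset xs - {#z#}))" for xs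
  by (subst F_eq) (rule sum)
 then show ?thesis unfolding sym_fun_def by simp
qed

lemma sym_picks:
 assumes "sym_fun U" shows "picks (%z r. G z r * U (z # r)) xs = picks (%z r. G z r * U xs) xs"
proof (rule fsum_cong)
 fix i assume "i < length xs"
 then have "U (xs ! i # rem i xs) = U xs" by (intro sym_funD[OF assms]) (simp add: mset_rem)
 then show "G (xs ! i) (rem i xs) * U (xs ! i # rem i xs) = G (xs ! i) (rem i xs) * U xs" by simp
qed

text \<open>One weight per kind of vertex: \<open>wL\<close>, \<open>wR\<close>, \<open>wB\<close>,
  \<open>wT\<close> for a line on the left, right, bottom, top side; \<open>wC\<close>,
  \<open>wA\<close> for creation and annihilation of a pair; \<open>wHT\<close>, \<open>wVT\<close>
  for turns; \<open>wHS\<close>, \<open>wVS\<close> for splits; \<open>wHJ\<close>,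
  \<open>wVJ\<close> for meetings that leave one line; \<open>wX\<close> for meetings that leave
  two. They are to be read as densities with respect to the reference measures of the outgoing
  lines.\<close>

record 'm wts =
 wL :: "real => 'm => ennreal"
 wR :: "real => 'm => ennreal"
 wB :: "real => 'm => ennreal"
 wT :: "real => 'm => ennreal"
 wC :: "real => real => 'm => 'm => ennreal"
 wA :: "real => real => 'm => 'm => ennreal"
 wHT :: "real => real => 'm => 'm => ennreal"
 wVT :: "real => real => 'm => 'm => ennreal"
 wHS :: "real => real => 'm => 'm => 'm => ennreal"
 wHJ :: "real => real => 'm => 'm => 'm => ennreal"
 wVS :: "real => real => 'm => 'm => 'm => ennreal"
 wVJ :: "real => real => 'm => 'm => 'm => ennreal"
 wX :: "real => real => 'm => 'm => 'm => 'm => ennreal"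

text \<open>Reversal pairs the kinds of vertex: a side with the opposite side, creation with
  annihilation, the turn of one direction with that of the other, a split with a meeting that leaves
  one line, and a crossing with itself.\<close>

definition adj :: "'m wts => 'm wts" where
 "adj w = \<lparr> wL = wR w, wR = wL w, wB = wT w, wT = wB w, wC = wA w, wA = wC w,
   wHT = (%x y m m'. wVT w x y m' m), wVT = (%x y m m'. wHT w x y m' m),
   wHS = (%x y m h v. wHJ w x y h v m), wHJ = (%x y h v m. wHS w x y m h v),
   wVS = (%x y m h v. wVJ w x y h v m), wVJ = (%x y h v m. wVS w x y m h v),
   wX = (%x y h v h' v'. wX w x y h' v' h v) \<rparr>"

lemma adj_simps [simp]:
 "wL (adj w) = wR w" "wR (adj w) = wL w" "wB (adj w) = wT w" "wT (adj w) = wB w"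
 "wC (adj w) = wA w" "wA (adj w) = wC w"
 "wHT (adj w) x y m m' = wVT w x y m' m" "wVT (adj w) x y m m' = wHT w x y m' m"
 "wHS (adj w) x y m h v = wHJ w x y h v m" "wHJ (adj w) x y h v m = wHS w x y m h v"
 "wVS (adj w) x y m h v = wVJ w x y h v m" "wVJ (adj w) x y h v m = wVS w x y m h v"
 "wX (adj w) x y h v h' v' = wX w x y h' v' h v"
 by (simp_all add: adj_def)

text \<open>The chain is studied abstractly: \<open>CH\<close> and \<open>CV\<close> are the
  reference measures for the marks of horizontal and vertical lines, \<open>LA\<close> and
  \<open>LB\<close> those for abscissae and heights. No reflection symmetry is assumed at this
  stage.\<close>

locale line_chain =
 fixes MM CH CV :: "'m measure" and LA LB :: "real measure"
 assumes space_MM [simp]: "space MM = UNIV"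
  and sets_CH [measurable_cong, simp]: "sets CH = sets MM"
  and sets_CV [measurable_cong, simp]: "sets CV = sets MM"
  and sets_LA [measurable_cong, simp]: "sets LA = sets borel"
  and sets_LB [measurable_cong, simp]: "sets LB = sets borel"
  and sfin_CH: "sigma_finite_measure CH" and sfin_CV: "sigma_finite_measure CV"
  and sfin_LA: "sigma_finite_measure LA" and sfin_LB: "sigma_finite_measure LB"
begin

abbreviation lineE :: "(real \<times> 'm) measure" where "lineE \<equiv> borel >< MM"
abbreviation lineM :: "(real \<times> 'm) measure" where "lineM \<equiv> LB >< CH"

sublocale CH: sigma_finite_measure CH by (rule sfin_CH)
sublocale CV: sigma_finite_measure CV by (rule sfin_CV)
sublocale LA: sigma_finite_measure LA by (rule sfin_LA)
sublocale LB: sigma_finite_measure LB by (rule sfin_LB)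
sublocale LBCH: pair_sigma_finite LB CH ..
sublocale CHCV: pair_sigma_finite CH CV ..
sublocale CVCH: pair_sigma_finite CV CH ..
sublocale CHCH: pair_sigma_finite CH CH ..
sublocale CVCV: pair_sigma_finite CV CV ..

sublocale mint_space lineE lineM
proof (intro mint_space.intro list_space.intro mint_space_axioms.intro)
 show "space lineE = UNIV" by (simp add: space_pair_measure)
 show "sets lineM = sets lineE" by (rule sets_pair_measure_cong) auto
 show "sigma_finite_measure lineM" by (rule LBCH.sigma_finite_measure_axioms)
qed

lemma nn_integral_lineM:
 assumes [measurable]: "f \<in> borel_measurable lineE"
 shows "(nint lineM (%z. f z)) = (nint LB (%y. nint CH (%m. f (y, m))))"
 by (rule CH.nn_integral_fst[symmetric]) measurable

text \<open>The vertex operators: \<open>vS\<close> opens a column, \<open>vT\<close> leaves through the end of a column, \<open>v1\<close> is a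
 spontaneous event of a vertical line and \<open>v2\<close> its collision with the horizontal line \<open>z\<close>.\<close>

definition vS :: "'m wts => real => real => (real => 'm => (real \<times> 'm) list => ennreal) => (real \<times> 'm) list => ennreal" where
 "vS w y0 x g \<eta> = (nint CV (%m. wB w x m * g y0 m \<eta>))
   + (nint LB (%y. nint CH (%h. nint CV (%v. wC w x y h v * g y v ((y, h) # \<eta>)))))
   + picks (%z r. (nint CH (%h. nint CV (%v. wHS w x (fst z) (snd z) h v * g (fst z) v ((fst z, h) # r))))
     + (nint CV (%v. wHT w x (fst z) (snd z) v * g (fst z) v r))) \<eta>"

definition vT :: "'m wts => real => ((real \<times> 'm) list => ennreal) => 'm => (real \<times> 'm) list => ennreal" where
 "vT w x gS m \<eta> = wT w x m * gS \<eta>"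

definition v1 :: "'m wts => real => ((real \<times> 'm) list => ennreal) => (real => 'm => (real \<times> 'm) list => ennreal)
  => real => 'm => (real \<times> 'm) list => ennreal" where
 "v1 w x gS g y m \<eta> = (nint CH (%h. nint CV (%v. wVS w x y m h v * g y v ((y, h) # \<eta>))))
   + (nint CH (%h. wVT w x y m h * gS ((y, h) # \<eta>)))"

definition v2 :: "'m wts => real => ((real \<times> 'm) list => ennreal) => (real => 'm => (real \<times> 'm) list => ennreal)
  => (real \<times> 'm) => 'm => (real \<times> 'm) list => ennreal" where
 "v2 w x gS g z m r = (nint CV (%v. wVJ w x (fst z) (snd z) m v * g (fst z) v r))
   + (nint CH (%h. wHJ w x (fst z) (snd z) m h * gS ((fst z, h) # r)))
   + wA w x (fst z) (snd z) m * gS r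
   + (nint CH (%h. nint CV (%v. wX w x (fst z) (snd z) m h v * g (fst z) v ((fst z, h) # r))))"

text \<open>Joins a function \<open>u\<close> of the past to the outcome \<open>h\<close> of a
  vertex. The four terms belong to the start of a column, the exit at \<open>y1\<close>, a
  spontaneous event and a collision; in the last one the line that is hit is still part of the list
  seen by \<open>uV\<close>.\<close>

definition pairing :: "real => ((real \<times> 'm) list => ennreal) => (real => 'm => (real \<times> 'm) list => ennreal) =>
  ((real \<times> 'm) list => ennreal) => ('m => (real \<times> 'm) list => ennreal) =>
  (real => 'm => (real \<times> 'm) list => ennreal) => ((real \<times> 'm) => 'm => (real \<times> 'm) list => ennreal) => ennreal" where
 "pairing y1 uS uV hS hT h1 h2 = mint lineM (%\<eta>. hS \<eta> * uS \<eta>)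
  + mint lineM (%\<eta>. nint CV (%m. hT m \<eta> * uV y1 m \<eta>))
  + mint lineM (%\<eta>. nint CV (%m. (nint LB (%y. h1 y m \<eta> * uV y m \<eta>))))
  + mint lineM (%\<eta>. nint CV (%m. picks (%z r. h2 z m r * uV (fst z) m (z # r)) \<eta>))"

definition wts_meas :: "'m wts => bool" where
 "wts_meas w \<longleftrightarrow>
  (%(x, m). wL w x m) \<in> borel_measurable (borel >< MM) &
  (%(x, m). wR w x m) \<in> borel_measurable (borel >< MM) &
  (%(x, m). wB w x m) \<in> borel_measurable (borel >< MM) &
  (%(x, m). wT w x m) \<in> borel_measurable (borel >< MM) &
  (%(x, y, h, v). wC w x y h v) \<in> borel_measurable (borel >< borel >< MM >< MM) &
  (%(x, y, h, v). wA w x y h v) \<in> borel_measurable (borel >< borel >< MM >< MM) &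
  (%(x, y, h, v). wHT w x y h v) \<in> borel_measurable (borel >< borel >< MM >< MM) &
  (%(x, y, h, v). wVT w x y h v) \<in> borel_measurable (borel >< borel >< MM >< MM) &
  (%(x, y, m, h, v). wHS w x y m h v) \<in> borel_measurable (borel >< borel >< MM >< MM >< MM) &
  (%(x, y, m, h, v). wHJ w x y m h v) \<in> borel_measurable (borel >< borel >< MM >< MM >< MM) &
  (%(x, y, m, h, v). wVS w x y m h v) \<in> borel_measurable (borel >< borel >< MM >< MM >< MM) &
  (%(x, y, m, h, v). wVJ w x y m h v) \<in> borel_measurable (borel >< borel >< MM >< MM >< MM) &
  (%(x, y, m, n, h, v). wX w x y m n h v) \<in> borel_measurable (borel >< borel >< MM >< MM >< MM >< MM)"

lemma wts_measD:
 assumes "wts_meas w"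
 shows "(%(x, m). wL w x m) \<in> borel_measurable (borel >< MM)"
  "(%(x, m). wR w x m) \<in> borel_measurable (borel >< MM)"
  "(%(x, m). wB w x m) \<in> borel_measurable (borel >< MM)"
  "(%(x, m). wT w x m) \<in> borel_measurable (borel >< MM)"
  "(%(x, y, h, v). wC w x y h v) \<in> borel_measurable (borel >< borel >< MM >< MM)"
  "(%(x, y, h, v). wA w x y h v) \<in> borel_measurable (borel >< borel >< MM >< MM)"
  "(%(x, y, h, v). wHT w x y h v) \<in> borel_measurable (borel >< borel >< MM >< MM)"
  "(%(x, y, h, v). wVT w x y h v) \<in> borel_measurable (borel >< borel >< MM >< MM)"
  "(%(x, y, m, h, v). wHS w x y m h v) \<in> borel_measurable (borel >< borel >< MM >< MM >< MM)"
  "(%(x, y, m, h, v). wHJ w x y m h v) \<in> borel_measurable (borel >< borel >< MM >< MM >< MM)"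
  "(%(x, y, m, h, v). wVS w x y m h v) \<in> borel_measurable (borel >< borel >< MM >< MM >< MM)"
  "(%(x, y, m, h, v). wVJ w x y m h v) \<in> borel_measurable (borel >< borel >< MM >< MM >< MM)"
  "(%(x, y, m, n, h, v). wX w x y m n h v) \<in> borel_measurable (borel >< borel >< MM >< MM >< MM >< MM)"
 using assms by (auto simp: wts_meas_def)

lemmas wts_raw =
 meas2[OF wts_measD(1)] meas2[OF wts_measD(2)] meas2[OF wts_measD(3)] meas2[OF wts_measD(4)]
 meas4[OF wts_measD(5)] meas4[OF wts_measD(6)] meas4[OF wts_measD(7)] meas4[OF wts_measD(8)]
 meas5[OF wts_measD(9)] meas5[OF wts_measD(10)] meas5[OF wts_measD(11)] meas5[OF wts_measD(12)]
 meas6[OF wts_measD(13)]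

lemma wts_meas_adj:
 assumes "wts_meas w" shows "wts_meas (adj w)"
proof -
 note [measurable (raw)] = wts_raw[OF assms]
 show ?thesis unfolding wts_meas_def adj_simps by (intro conjI) measurable
qed

definition measS where "measS g \<longleftrightarrow> (%(x::real, \<eta>). g x \<eta> :: ennreal) \<in> borel_measurable (borel >< listM lineE)"
definition measV where "measV g \<longleftrightarrow> (%(x::real, y::real, m, \<eta>). g x y m \<eta> :: ennreal) \<in> borel_measurable (borel >< borel >< MM >< listM lineE)"
definition measV1 where "measV1 g \<longleftrightarrow> (%(y::real, m, \<eta>). g y m \<eta> :: ennreal) \<in> borel_measurable (borel >< MM >< listM lineE)"

lemmas measS_raw = meas2[OF measS_def[THEN iffD1]]
lemmas measV_raw = meas4[OF measV_def[THEN iffD1]]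
lemmas measV1_raw = meas3[OF measV1_def[THEN iffD1]]

lemma vS_measurable:
 assumes "wts_meas w" "measV g" shows "measS (%x. vS w y0 x (g x))"
proof -
 note [measurable (raw)] = wts_raw[OF assms(1)] measV_raw[OF assms(2)]
 show ?thesis unfolding measS_def vS_def by measurable
qed

lemma vT_measurable:
 assumes "wts_meas w" "measS gS"
 shows "(%(x, m, \<eta>). vT w x (gS x) m \<eta>) \<in> borel_measurable (borel >< MM >< listM lineE)"
proof -
 note [measurable (raw)] = wts_raw[OF assms(1)] measS_raw[OF assms(2)]
 show ?thesis unfolding vT_def by measurable
qed

lemma v1_measurable:
 assumes "wts_meas w" "measS gS" "measV g"
 shows "measV (%x. v1 w x (gS x) (g x))"
proof -
 note [measurable (raw)] = wts_raw[OF assms(1)] measS_raw[OF assms(2)] measV_raw[OF assms(3)]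
 show ?thesis unfolding v1_def measV_def by measurable
qed

lemma v2_measurable:
 assumes "wts_meas w" "measS gS" "measV g"
 shows "(%(x, z, m, r). v2 w x (gS x) (g x) z m r) \<in> borel_measurable (borel >< lineE >< MM >< listM lineE)"
proof -
 note [measurable (raw)] = wts_raw[OF assms(1)] measS_raw[OF assms(2)] measV_raw[OF assms(3)]
 show ?thesis unfolding v2_def by measurable
qed

end

section \<open>Duality of the vertex operators\<close>

lemma nn_swap2:
 assumes "sigma_finite_measure A" "sigma_finite_measure B"
  and [measurable]: "(%(a, b). f a b) \<in> borel_measurable (A >< B)"
 shows "(nint A (%a. nint B (%b. f a b))) = (nint B (%b. nint A (%a. f a b)))"
proof -
 interpret A: sigma_finite_measure A by fact
 interpret B: sigma_finite_measure B by fact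
 interpret P: pair_sigma_finite B A ..
 show ?thesis by (rule P.Fubini') measurable
qed

lemma nn_swap3:
 assumes "sigma_finite_measure A" "sigma_finite_measure B" "sigma_finite_measure C"
  and f: "(%(a, b, c). f a b c) \<in> borel_measurable (A >< B >< C)"
 shows "(nint A (%a. nint B (%b. nint C (%c. f a b c)))) = (nint C (%c. nint A (%a. nint B (%b. f a b c))))"
proof -
 interpret A: sigma_finite_measure A by fact
 interpret B: sigma_finite_measure B by fact
 interpret C: sigma_finite_measure C by fact
 note [measurable (raw)] = meas3[OF f]
 have "(nint A (%a. nint B (%b. nint C (%c. f a b c)))) = (nint A (%a. nint C (%c. nint B (%b. f a b c))))"
  by (intro nn_integral_cong nn_swap2 assms) measurable
 also have "... = (nint C (%c. nint A (%a. nint B (%b. f a b c))))"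
  by (intro nn_swap2 assms) measurable
 finally show ?thesis .
qed

context line_chain
begin

text \<open>The normal form of the pairing, with one term per kind of vertex: the height outermost,
  then the lines not involved, then incoming and outgoing marks. Here the exchange of past and
  future is visible term by term.\<close>

definition canon where "canon w x y0 y1 uS uV gS gV =
  mint lineM (%r. nint CV (%m. wB w x m * gV y0 m r * uS r))
 + mint lineM (%r. nint CV (%m. wT w x m * gS r * uV y1 m r))
 + (nint LB (%y. mint lineM (%r. nint CH (%h. nint CV (%v. wC w x y h v * gV y v ((y, h) # r) * uS r)))))
 + (nint LB (%y. mint lineM (%r. nint CH (%h. nint CV (%v. wA w x y h v * gS r * uV y v ((y, h) # r))))))
 + (nint LB (%y. mint lineM (%r. nint CH (%m. nint CH (%h. nint CV (%v. wHS w x y m h v * gV y v ((y, h) # r) * uS ((y, m) # r)))))))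
 + (nint LB (%y. mint lineM (%r. nint CH (%h. nint CV (%v. nint CH (%m. wHJ w x y h v m * gS ((y, m) # r) * uV y v ((y, h) # r)))))))
 + (nint LB (%y. mint lineM (%r. nint CH (%m. nint CV (%v. wHT w x y m v * gV y v r * uS ((y, m) # r))))))
 + (nint LB (%y. mint lineM (%r. nint CV (%v. nint CH (%m. wVT w x y v m * gS ((y, m) # r) * uV y v r)))))
 + (nint LB (%y. mint lineM (%r. nint CV (%m. nint CH (%h. nint CV (%v. wVS w x y m h v * gV y v ((y, h) # r) * uV y m r))))))
 + (nint LB (%y. mint lineM (%r. nint CH (%h. nint CV (%v. nint CV (%m. wVJ w x y h v m * gV y m r * uV y v ((y, h) # r)))))))
 + (nint LB (%y. mint lineM (%r. nint CH (%h. nint CV (%v. nint CH (%h'. nint CV (%v'. wX w x y h v h' v' * gV y v' ((y, h') # r) * uV y v ((y, h) # r))))))))"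

context
 fixes w :: "'m wts" and x y0 y1 :: real and uS gS :: "(real \<times> 'm) list => ennreal" and uV gV :: "real => 'm => (real \<times> 'm) list => ennreal"
 assumes w: "wts_meas w"
  and uS [measurable]: "uS \<in> borel_measurable (listM lineE)"
  and gS [measurable]: "gS \<in> borel_measurable (listM lineE)"
  and uV: "(%(y, m, \<eta>). uV y m \<eta>) \<in> borel_measurable (borel >< MM >< listM lineE)"
  and gV: "(%(y, m, \<eta>). gV y m \<eta>) \<in> borel_measurable (borel >< MM >< listM lineE)"
begin

text \<open>Each term is carried to that of its partner under \<open>adj\<close>; what remains is
  Tonelli, to bring the marks into the order that the partner prescribes.\<close>

lemma canon_adj: "canon w x y0 y1 uS uV gS gV = canon (adj w) x y1 y0 gS gV uS uV"
proof -
 note [measurable (raw)] = wts_raw[OF w] meas3[OF uV] meas3[OF gV]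
 note sf = sfin_CV sfin_CH
 have 6: "(nint CH (%h. nint CV (%v. nint CH (%m. wHJ w x y h v m * gS ((y, m) # r) * uV y v ((y, h) # r)))))
  = (nint CH (%m. nint CH (%h. nint CV (%v. wHJ w x y h v m * uV y v ((y, h) # r) * gS ((y, m) # r)))))" for y r
  by (rule trans, rule nn_swap3[of CH CV CH], rule sf, rule sf, rule sf, measurable) (simp add: mult_ac)
 have 5: "(nint CH (%m. nint CH (%h. nint CV (%v. wHS w x y m h v * gV y v ((y, h) # r) * uS ((y, m) # r)))))
  = (nint CH (%h. nint CV (%v. nint CH (%m. wHS w x y m h v * uS ((y, m) # r) * gV y v ((y, h) # r)))))" for y r
  by (rule sym, rule trans, rule nn_swap3, rule sf, rule sf, rule sf, measurable) (simp add: mult_ac)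
 have 7: "(nint CH (%m. nint CV (%v. wHT w x y m v * gV y v r * uS ((y, m) # r))))
  = (nint CV (%v. nint CH (%m. wHT w x y m v * uS ((y, m) # r) * gV y v r)))" for y r
  by (rule trans, rule nn_swap2[of CH CV], rule sf, rule sf, measurable) (simp add: mult_ac)
 have 8: "(nint CV (%v. nint CH (%m. wVT w x y v m * gS ((y, m) # r) * uV y v r)))
  = (nint CH (%m. nint CV (%v. wVT w x y v m * uV y v r * gS ((y, m) # r))))" for y r
  by (rule trans, rule nn_swap2[of CV CH], rule sf, rule sf, measurable) (simp add: mult_ac)
 have 9: "(nint CV (%m. nint CH (%h. nint CV (%v. wVS w x y m h v * gV y v ((y, h) # r) * uV y m r))))
  = (nint CH (%h. nint CV (%v. nint CV (%m. wVS w x y m h v * uV y m r * gV y v ((y, h) # r)))))" for y r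
  by (rule sym, rule trans, rule nn_swap3, rule sf, rule sf, rule sf, measurable) (simp add: mult_ac)
 have 10: "(nint CH (%h. nint CV (%v. nint CV (%m. wVJ w x y h v m * gV y m r * uV y v ((y, h) # r)))))
  = (nint CV (%m. nint CH (%h. nint CV (%v. wVJ w x y h v m * uV y v ((y, h) # r) * gV y m r))))" for y r
  by (rule trans, rule nn_swap3[of CH CV CV], rule sf, rule sf, rule sf, measurable) (simp add: mult_ac)
 have 11: "(nint CH (%h. nint CV (%v. nint CH (%h'. nint CV (%v'. wX w x y h v h' v' * gV y v' ((y, h') # r) * uV y v ((y, h) # r))))))
  = (nint CH (%h'. nint CV (%v'. nint CH (%h. nint CV (%v. wX w x y h v h' v' * uV y v ((y, h) # r) * gV y v' ((y, h') # r))))))" for y r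
 proof -
  have "(nint CH (%h. nint CV (%v. nint CH (%h'. nint CV (%v'. wX w x y h v h' v' * gV y v' ((y, h') # r) * uV y v ((y, h) # r))))))
   = (nint CH (%h'. nint CH (%h. nint CV (%v. nint CV (%v'. wX w x y h v h' v' * gV y v' ((y, h') # r) * uV y v ((y, h) # r))))))"
   by (rule nn_swap3, rule sf, rule sf, rule sf, measurable)
  also have "... = (nint CH (%h'. nint CV (%v'. nint CH (%h. nint CV (%v. wX w x y h v h' v' * gV y v' ((y, h') # r) * uV y v ((y, h) # r))))))"
   by (intro nn_integral_cong nn_swap3 sf) measurable
  finally show ?thesis by (simp add: mult_ac)
 qed
 show ?thesis unfolding canon_def adj_simps 5 6 7 8 9 10 11
  by (simp add: mult_ac add_ac)
qed

text \<open>The Mecke formula turns the choice of the horizontal line that has an event into an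
  integral over a line \<open>(y, m)\<close> outside the configuration. Symmetry of
  \<open>uS\<close> allows that line to be put back in front.\<close>

lemma pairing_A:
 assumes "sym_fun uS"
 shows "mint lineM (%\<eta>. vS w y0 x gV \<eta> * uS \<eta>) =
  mint lineM (%r. nint CV (%m. wB w x m * gV y0 m r * uS r))
 + (nint LB (%y. mint lineM (%r. nint CH (%h. nint CV (%v. wC w x y h v * gV y v ((y, h) # r) * uS r)))))
 + (nint LB (%y. mint lineM (%r. nint CH (%m. nint CH (%h. nint CV (%v. wHS w x y m h v * gV y v ((y, h) # r) * uS ((y, m) # r)))))))
 + (nint LB (%y. mint lineM (%r. nint CH (%m. nint CV (%v. wHT w x y m v * gV y v r * uS ((y, m) # r))))))"
proof -
 note [measurable (raw)] = wts_raw[OF w] meas3[OF uV] meas3[OF gV]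
 define H where "H z r = (nint CH (%h. nint CV (%v. wHS w x (fst z) (snd z) h v * gV (fst z) v ((fst z, h) # r))))
     + (nint CV (%v. wHT w x (fst z) (snd z) v * gV (fst z) v r))" for z r
 have "(%(z, r). H z r) \<in> borel_measurable (lineE >< listM lineE)"
  unfolding H_def by measurable
 note [measurable (raw)] = meas2[OF this]
 have "mint lineM (%\<eta>. vS w y0 x gV \<eta> * uS \<eta>) =
   mint lineM (%\<eta>. (nint CV (%m. wB w x m * gV y0 m \<eta>)) * uS \<eta>
    + (nint LB (%y. nint CH (%h. nint CV (%v. wC w x y h v * gV y v ((y, h) # \<eta>))))) * uS \<eta>
    + picks (%z r. H z r * uS (z # r)) \<eta>)"
  unfolding vS_def H_def[symmetric] sym_picks[OF assms, of H]
  by (simp add: distrib_left fsum_cmult mult.commute)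
 also have "... = mint lineM (%\<eta>. (nint CV (%m. wB w x m * gV y0 m \<eta>)) * uS \<eta>)
   + mint lineM (%\<eta>. (nint LB (%y. nint CH (%h. nint CV (%v. wC w x y h v * gV y v ((y, h) # \<eta>))))) * uS \<eta>)
   + mint lineM (picks (%z r. H z r * uS (z # r)))"
  by (subst mint_add, measurable, subst mint_add, measurable)
 also have "mint lineM (%\<eta>. (nint CV (%m. wB w x m * gV y0 m \<eta>)) * uS \<eta>) = mint lineM (%r. nint CV (%m. wB w x m * gV y0 m r * uS r))"
  by (subst nn_integral_multc, measurable)
 also have "mint lineM (%\<eta>. (nint LB (%y. nint CH (%h. nint CV (%v. wC w x y h v * gV y v ((y, h) # \<eta>))))) * uS \<eta>)
  = (nint LB (%y. mint lineM (%r. nint CH (%h. nint CV (%v. wC w x y h v * gV y v ((y, h) # r) * uS r)))))"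
  by (subst mint_nn_integral[symmetric], rule sfin_LB, measurable)
    (simp add: nn_integral_multc)
 also have "mint lineM (picks (%z r. H z r * uS (z # r))) = (nint LB (%y. nint CH (%m. mint lineM (%r. H (y, m) r * uS ((y, m) # r)))))"
  by (subst mint_picks, measurable, subst nn_integral_lineM, measurable)
 also have "... = (nint LB (%y. mint lineM (%r. nint CH (%m. H (y, m) r * uS ((y, m) # r)))))"
  by (intro nn_integral_cong mint_nn_integral[symmetric] sfin_CH) measurable
 also have "... = (nint LB (%y. mint lineM (%r. (nint CH (%m. nint CH (%h. nint CV (%v. wHS w x y m h v * gV y v ((y, h) # r) * uS ((y, m) # r)))))
    + (nint CH (%m. nint CV (%v. wHT w x y m v * gV y v r * uS ((y, m) # r)))))))"
  unfolding H_def by (simp add: distrib_right nn_integral_add nn_integral_multc)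
 also have "... = (nint LB (%y. mint lineM (%r. nint CH (%m. nint CH (%h. nint CV (%v. wHS w x y m h v * gV y v ((y, h) # r) * uS ((y, m) # r)))))))
   + (nint LB (%y. mint lineM (%r. nint CH (%m. nint CV (%v. wHT w x y m v * gV y v r * uS ((y, m) # r))))))"
  by (subst mint_add, measurable, subst nn_integral_add, measurable)
 finally show ?thesis by (simp add: add.assoc)
qed

lemma pairing_C: "mint lineM (%\<eta>. nint CV (%m. (nint LB (%y. v1 w x gS gV y m \<eta> * uV y m \<eta>)))) =
  (nint LB (%y. mint lineM (%r. nint CV (%m. nint CH (%h. nint CV (%v. wVS w x y m h v * gV y v ((y, h) # r) * uV y m r))))))
 + (nint LB (%y. mint lineM (%r. nint CV (%v. nint CH (%m. wVT w x y v m * gS ((y, m) # r) * uV y v r)))))"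
proof -
 note [measurable (raw)] = wts_raw[OF w] meas3[OF uV] meas3[OF gV]
 have "(%(y, m, \<eta>). v1 w x gS gV y m \<eta>) \<in> borel_measurable (borel >< MM >< listM lineE)"
  unfolding v1_def by measurable
 note [measurable (raw)] = meas3[OF this]
 have "mint lineM (%\<eta>. nint CV (%m. (nint LB (%y. v1 w x gS gV y m \<eta> * uV y m \<eta>))))
   = mint lineM (%\<eta>. nint LB (%y. (nint CV (%m. v1 w x gS gV y m \<eta> * uV y m \<eta>))))"
  by (subst nn_swap2, rule sfin_CV, rule sfin_LB, measurable)
 also have "... = (nint LB (%y. mint lineM (%\<eta>. nint CV (%m. v1 w x gS gV y m \<eta> * uV y m \<eta>))))"
  by (rule mint_nn_integral[OF sfin_LB]) measurable
 also have "... = (nint LB (%y. mint lineM (%r. (nint CV (%m. nint CH (%h. nint CV (%v. wVS w x y m h v * gV y v ((y, h) # r) * uV y m r))))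
    + (nint CV (%v. nint CH (%m. wVT w x y v m * gS ((y, m) # r) * uV y v r))))))"
  unfolding v1_def by (simp add: distrib_right nn_integral_add nn_integral_multc)
 also have "... = (nint LB (%y. mint lineM (%r. nint CV (%m. nint CH (%h. nint CV (%v. wVS w x y m h v * gV y v ((y, h) # r) * uV y m r))))))
  + (nint LB (%y. mint lineM (%r. nint CV (%v. nint CH (%m. wVT w x y v m * gS ((y, m) # r) * uV y v r)))))"
  by (subst mint_add, measurable, subst nn_integral_add, measurable)
 finally show ?thesis .
qed

text \<open>The Mecke formula for the line that is hit: it already stands in front of the list seen
  by \<open>uV\<close> and becomes an incoming line of the normal form.\<close>

lemma pairing_D: "mint lineM (%\<eta>. nint CV (%m. picks (%z r. v2 w x gS gV z m r * uV (fst z) m (z # r)) \<eta>)) =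
  (nint LB (%y. mint lineM (%r. nint CH (%h. nint CV (%v. wA w x y h v * gS r * uV y v ((y, h) # r))))))
 + (nint LB (%y. mint lineM (%r. nint CH (%h. nint CV (%v. nint CH (%m. wHJ w x y h v m * gS ((y, m) # r) * uV y v ((y, h) # r)))))))
 + (nint LB (%y. mint lineM (%r. nint CH (%h. nint CV (%v. nint CV (%m. wVJ w x y h v m * gV y m r * uV y v ((y, h) # r)))))))
 + (nint LB (%y. mint lineM (%r. nint CH (%h. nint CV (%v. nint CH (%h'. nint CV (%v'. wX w x y h v h' v' * gV y v' ((y, h') # r) * uV y v ((y, h) # r))))))))"
proof -
 note [measurable (raw)] = wts_raw[OF w] meas3[OF uV] meas3[OF gV]
 have "(%(z, m, r). v2 w x gS gV z m r) \<in> borel_measurable (lineE >< MM >< listM lineE)"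
  unfolding v2_def by measurable
 note [measurable (raw)] = meas3[OF this]
 have "mint lineM (%\<eta>. nint CV (%m. picks (%z r. v2 w x gS gV z m r * uV (fst z) m (z # r)) \<eta>))
  = (nint CV (%m. mint lineM (picks (%z r. v2 w x gS gV z m r * uV (fst z) m (z # r)))))"
  by (rule mint_nn_integral[OF sfin_CV]) measurable
 also have "... = (nint CV (%m. (nint lineM (%z. mint lineM (%r. v2 w x gS gV z m r * uV (fst z) m (z # r))))))"
  by (intro nn_integral_cong mint_picks) measurable
 also have "... = (nint lineM (%z. (nint CV (%m. mint lineM (%r. v2 w x gS gV z m r * uV (fst z) m (z # r))))))"
  by (rule nn_swap2[OF sfin_CV sfin_mu]) measurable
 also have "... = (nint LB (%y. nint CH (%h. nint CV (%v. mint lineM (%r. v2 w x gS gV (y, h) v r * uV y v ((y, h) # r))))))"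
  by (subst nn_integral_lineM, measurable)
 also have "... = (nint LB (%y. mint lineM (%r. nint CH (%h. nint CV (%v. v2 w x gS gV (y, h) v r * uV y v ((y, h) # r))))))"
  by (subst mint_nn_integral, rule sfin_CH, measurable, subst mint_nn_integral, rule sfin_CV, measurable)
 also have "... = (nint LB (%y. mint lineM (%r. (nint CH (%h. nint CV (%v. nint CV (%m. wVJ w x y h v m * gV y m r * uV y v ((y, h) # r)))))
   + (nint CH (%h. nint CV (%v. nint CH (%m. wHJ w x y h v m * gS ((y, m) # r) * uV y v ((y, h) # r)))))
   + (nint CH (%h. nint CV (%v. wA w x y h v * gS r * uV y v ((y, h) # r))))
   + (nint CH (%h. nint CV (%v. nint CH (%h'. nint CV (%v'. wX w x y h v h' v' * gV y v' ((y, h') # r) * uV y v ((y, h) # r)))))))))"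
  unfolding v2_def by (simp add: distrib_right nn_integral_add nn_integral_multc)
 also have "... = (nint LB (%y. mint lineM (%r. nint CH (%h. nint CV (%v. nint CV (%m. wVJ w x y h v m * gV y m r * uV y v ((y, h) # r)))))
   + mint lineM (%r. nint CH (%h. nint CV (%v. nint CH (%m. wHJ w x y h v m * gS ((y, m) # r) * uV y v ((y, h) # r)))))
   + mint lineM (%r. nint CH (%h. nint CV (%v. wA w x y h v * gS r * uV y v ((y, h) # r))))
   + mint lineM (%r. nint CH (%h. nint CV (%v. nint CH (%h'. nint CV (%v'. wX w x y h v h' v' * gV y v' ((y, h') # r) * uV y v ((y, h) # r))))))))"
  by (subst mint_add, measurable, subst mint_add, measurable, subst mint_add, measurable)
 also have "... = (nint LB (%y. mint lineM (%r. nint CH (%h. nint CV (%v. nint CV (%m. wVJ w x y h v m * gV y m r * uV y v ((y, h) # r)))))))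
   + (nint LB (%y. mint lineM (%r. nint CH (%h. nint CV (%v. nint CH (%m. wHJ w x y h v m * gS ((y, m) # r) * uV y v ((y, h) # r)))))))
   + (nint LB (%y. mint lineM (%r. nint CH (%h. nint CV (%v. wA w x y h v * gS r * uV y v ((y, h) # r))))))
   + (nint LB (%y. mint lineM (%r. nint CH (%h. nint CV (%v. nint CH (%h'. nint CV (%v'. wX w x y h v h' v' * gV y v' ((y, h') # r) * uV y v ((y, h) # r))))))))"
  by (subst nn_integral_add, measurable, subst nn_integral_add, measurable, subst nn_integral_add, measurable)
 finally show ?thesis by (simp add: add_ac)
qed

lemma pairing_canon:
 assumes "sym_fun uS"
 shows "pairing y1 uS uV (vS w y0 x gV) (vT w x gS) (v1 w x gS gV) (v2 w x gS gV) = canon w x y0 y1 uS uV gS gV"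
 unfolding pairing_def pairing_A[OF assms] pairing_C pairing_D canon_def vT_def
 by (simp add: add_ac)

end

text \<open>Detailed balance: the vertex operator is self-dual up to exchanging incoming and outgoing lines.\<close>
lemma vertex_duality:
 assumes "wts_meas w" "uS \<in> borel_measurable (listM lineE)" "gS \<in> borel_measurable (listM lineE)"
  "(%(y, m, \<eta>). uV y m \<eta>) \<in> borel_measurable (borel >< MM >< listM lineE)"
  "(%(y, m, \<eta>). gV y m \<eta>) \<in> borel_measurable (borel >< MM >< listM lineE)"
  "sym_fun uS" "sym_fun gS"
 shows "pairing y1 uS uV (vS w y0 x gV) (vT w x gS) (v1 w x gS gV) (v2 w x gS gV) =
  pairing y0 gS gV (vS (adj w) y1 x uV) (vT (adj w) x uS) (v1 (adj w) x uS uV) (v2 (adj w) x uS uV)"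
 by (subst (1 2) pairing_canon) (use assms wts_meas_adj canon_adj in auto)

end

section \<open>The chain of vertices and its reversal\<close>

lemma sym_funI: "(\<And>xs ys. mset xs = mset ys ==> F xs = F ys) ==> sym_fun F"
 unfolding sym_fun_def by blast

context line_chain
begin

text \<open>Free flight of the sweep line to the next column. Its companion \<open>pV\<close> is the
  flight of a vertical line, which ends at \<open>y1\<close>, at an event of its own or at one of
  the horizontal lines.\<close>

definition pS :: "((real \<times> 'm) list => real => real => ennreal) => (real => (real \<times> 'm) list => ennreal) => real => (real \<times> 'm) list => ennreal" where
 "pS kS h x \<eta> = (nint LA (%x'. kS \<eta> x x' * h x' \<eta>))"

definition pV :: "('m => (real \<times> 'm) list => real => real => ennreal) => real => ('m => (real \<times> 'm) list => ennreal) =>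
  (real => 'm => (real \<times> 'm) list => ennreal) => (real \<times> 'm => 'm => (real \<times> 'm) list => ennreal) =>
  real => 'm => (real \<times> 'm) list => ennreal" where
 "pV kV y1 hT h1 h2 y m \<eta> = kV m \<eta> y y1 * hT m \<eta> + (nint LB (%y'. kV m \<eta> y y' * h1 y' m \<eta>))
   + picks (%z r. kV m \<eta> y (fst z) * h2 z m r) \<eta>"

abbreviation lprod :: "(real => 'm => ennreal) => (real \<times> 'm) list => ennreal" where
 "lprod f \<eta> \<equiv> prod_list (map (%z. f (fst z) (snd z)) \<eta>)"

text \<open>\<open>n\<close> vertices are left before the sweep line flies on to \<open>x1\<close>.
  Inside a column with no vertex left there is no way to finish, hence the zero.\<close>

fun ch :: "'m wts => ((real \<times> 'm) list => real => real => ennreal) => ('m => (real \<times> 'm) list => real => real => ennreal) =>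
  real => real => real => nat =>
  (real => (real \<times> 'm) list => ennreal) \<times> (real => real => 'm => (real \<times> 'm) list => ennreal)" where
 "ch w kS kV x1 y0 y1 0 = (%x \<eta>. kS \<eta> x x1 * lprod (wR w) \<eta>, %x y m \<eta>. 0)"
| "ch w kS kV x1 y0 y1 (Suc n) = (case ch w kS kV x1 y0 y1 n of (gS, gV) =>
   (pS kS (%x. vS w y0 x (gV x)),
   %x. pV kV y1 (vT w x (gS x)) (v1 w x (gS x) (gV x)) (v2 w x (gS x) (gV x))))"

abbreviation "chS w kS kV x1 y0 y1 n \<equiv> fst (ch w kS kV x1 y0 y1 n)"
abbreviation "chV w kS kV x1 y0 y1 n \<equiv> snd (ch w kS kV x1 y0 y1 n)"

definition kern_meas :: "((real \<times> 'm) list => real => real => ennreal) => ('m => (real \<times> 'm) list => real => real => ennreal) => bool" where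
 "kern_meas kS kV \<longleftrightarrow> (%(\<eta>, x, x'). kS \<eta> x x') \<in> borel_measurable (listM lineE >< borel >< borel) &
  (%(m, \<eta>, x, x'). kV m \<eta> x x') \<in> borel_measurable (MM >< listM lineE >< borel >< borel) &
  (\<forall>x x'. sym_fun (%\<eta>. kS \<eta> x x')) & (\<forall>m x x'. sym_fun (%\<eta>. kV m \<eta> x x'))"

lemma kern_measD:
 assumes "kern_meas kS kV"
 shows "(%(\<eta>, x, x'). kS \<eta> x x') \<in> borel_measurable (listM lineE >< borel >< borel)"
  "(%(m, \<eta>, x, x'). kV m \<eta> x x') \<in> borel_measurable (MM >< listM lineE >< borel >< borel)"
  "sym_fun (%\<eta>. kS \<eta> u u')" "sym_fun (%\<eta>. kV m \<eta> u u')"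
 using assms unfolding kern_meas_def by blast+

lemmas kern_raw = meas3[OF kern_measD(1)] meas4[OF kern_measD(2)]

lemma kern_meas_flip:
 assumes "kern_meas kS kV"
 shows "kern_meas (%\<eta> x x'. kS \<eta> x' x) (%m \<eta> x x'. kV m \<eta> x' x)"
proof -
 note [measurable (raw)] = kern_raw[OF assms]
 show ?thesis unfolding kern_meas_def by (intro conjI allI kern_measD(3,4)[OF assms]) measurable
qed

lemma pS_measurable:
 assumes "kern_meas kS kV" "measS h" shows "measS (pS kS h)"
proof -
 note [measurable (raw)] = kern_raw[OF assms(1)] measS_raw[OF assms(2)]
 show ?thesis unfolding measS_def pS_def by measurable
qed

lemma pV_measurable:
 assumes "kern_meas kS kV"
  and hT: "(%(x, m, \<eta>). hT x m \<eta>) \<in> borel_measurable (borel >< MM >< listM lineE)" and h1: "measV h1"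
  and h2: "(%(x, z, m, r). h2 x z m r) \<in> borel_measurable (borel >< lineE >< MM >< listM lineE)"
 shows "measV (%x. pV kV y1 (hT x) (h1 x) (h2 x))"
proof -
 note [measurable (raw)] = kern_raw[OF assms(1)] meas3[OF hT] measV_raw[OF h1] meas4[OF h2]
 show ?thesis unfolding measV_def pV_def by measurable
qed

lemma ch_measurable:
 assumes "wts_meas w" "kern_meas kS kV"
 shows "measS (chS w kS kV x1 y0 y1 n)" "measV (chV w kS kV x1 y0 y1 n)"
proof (induction n)
 case 0
 note [measurable (raw)] = wts_raw[OF assms(1)] kern_raw[OF assms(2)]
 show "measS (chS w kS kV x1 y0 y1 0)" unfolding measS_def ch.simps fst_conv by measurable
 show "measV (chV w kS kV x1 y0 y1 0)" unfolding measV_def ch.simps snd_conv by measurable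
next
 case (Suc n)
 show "measS (chS w kS kV x1 y0 y1 (Suc n))" "measV (chV w kS kV x1 y0 y1 (Suc n))"
  unfolding ch.simps split_beta' fst_conv snd_conv
  by (intro pS_measurable[OF assms(2)] vS_measurable pV_measurable[OF assms(2)] vT_measurable v1_measurable v2_measurable assms(1) Suc)+
qed

lemma vS_sym:
 assumes "\<And>y m. sym_fun (gV y m)"
 shows "sym_fun (vS w y0 x gV)"
proof (rule sym_funI)
 fix xs ys :: "(real \<times> 'm) list" assume e: "mset xs = mset ys"
 define F where "F z r = (nint CH (%h. nint CV (%v. wHS w x (fst z) (snd z) h v * gV (fst z) v ((fst z, h) # r))))
     + (nint CV (%v. wHT w x (fst z) (snd z) v * gV (fst z) v r))" for z r
 have g: "mset xs = mset ys ==> gV y m xs = gV y m ys" "mset xs = mset ys ==> gV y m (p # xs) = gV y m (p # ys)" for y m p xs ys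
  by (rule sym_funD[OF assms], simp)+
 have "sym_fun (F z)" for z
 proof (rule sym_funI)
  fix r r' :: "(real \<times> 'm) list" assume e: "mset r = mset r'"
  show "F z r = F z r'" unfolding F_def by (simp only: g(1)[OF e] g(2)[OF e])
 qed
 then have "picks F xs = picks F ys" by (rule sym_funD[OF sym_fun_picks e])
 then show "vS w y0 x gV xs = vS w y0 x gV ys"
  unfolding vS_def F_def[symmetric] by (simp only: g(1)[OF e] g(2)[OF e])
qed

lemma vT_sym: "sym_fun gS ==> sym_fun (vT w x gS m)"
 by (rule sym_funI) (simp add: vT_def, metis sym_funD)

lemma v1_sym:
 assumes "\<And>y m. sym_fun (gV y m)" "sym_fun gS"
 shows "sym_fun (v1 w x gS gV y m)"
proof (rule sym_funI)
 fix xs ys :: "(real \<times> 'm) list" assume e: "mset xs = mset ys"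
 have g: "gV y m (p # xs) = gV y m (p # ys)" "gS (p # xs) = gS (p # ys)" for y m p
  by (rule sym_funD[OF assms(1)] sym_funD[OF assms(2)], simp add: e)+
 show "v1 w x gS gV y m xs = v1 w x gS gV y m ys" unfolding v1_def by (simp only: g)
qed

lemma v2_sym:
 assumes "\<And>y m. sym_fun (gV y m)" "sym_fun gS"
 shows "sym_fun (v2 w x gS gV z m)"
proof (rule sym_funI)
 fix xs ys :: "(real \<times> 'm) list" assume e: "mset xs = mset ys"
 have g: "gV y m (p # xs) = gV y m (p # ys)" "gS (p # xs) = gS (p # ys)" "gV y m xs = gV y m ys" "gS xs = gS ys" for y m p
  by (rule sym_funD[OF assms(1)] sym_funD[OF assms(2)], simp add: e)+
 show "v2 w x gS gV z m xs = v2 w x gS gV z m ys" unfolding v2_def by (simp only: g)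
qed

lemma pV_sym:
 assumes "kern_meas kS kV" "\<And>m. sym_fun (hT m)" "\<And>y m. sym_fun (h1 y m)" "\<And>z m. sym_fun (h2 z m)"
 shows "sym_fun (pV kV y1 hT h1 h2 y m)"
proof (rule sym_funI)
 fix xs ys :: "(real \<times> 'm) list" assume e: "mset xs = mset ys"
 have k: "kV m xs u u' = kV m ys u u'" for u u' by (rule sym_funD[OF kern_measD(4)[OF assms(1)] e])
 have h: "hT m xs = hT m ys" "h1 y' m xs = h1 y' m ys" for y'
  by (rule sym_funD[OF assms(2)] sym_funD[OF assms(3)], simp add: e)+
 have "sym_fun (%r. kV m ys y (fst z) * h2 z m r)" for z
  by (rule sym_funI, rule arg_cong[of _ _ "%t. _ * t"], rule sym_funD[OF assms(4)])
 from sym_funD[OF sym_fun_picks[of "%z r. kV m ys y (fst z) * h2 z m r", OF this] e]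
 show "pV kV y1 hT h1 h2 y m xs = pV kV y1 hT h1 h2 y m ys"
  unfolding pV_def by (simp only: k h)
qed

lemma lprod_sym: "sym_fun (lprod f)"
proof (rule sym_funI)
 fix xs ys :: "(real \<times> 'm) list" assume "mset xs = mset ys"
 then have "mset (map (%z. f (fst z) (snd z)) xs) = mset (map (%z. f (fst z) (snd z)) ys)" by simp
 then show "lprod f xs = lprod f ys" by (metis prod_mset_prod_list)
qed

lemma ch_sym:
 assumes "kern_meas kS kV"
 shows "sym_fun (chS w kS kV x1 y0 y1 n x)" "sym_fun (chV w kS kV x1 y0 y1 n x y m)"
proof -
 have "(\<forall>x. sym_fun (chS w kS kV x1 y0 y1 n x)) & (\<forall>x y m. sym_fun (chV w kS kV x1 y0 y1 n x y m))"
proof (induction n)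
 case 0
 have "sym_fun (chS w kS kV x1 y0 y1 0 x)" for x unfolding ch.simps fst_conv
  by (rule sym_funI) (use sym_funD[OF kern_measD(3)[OF assms]] sym_funD[OF lprod_sym[of "wR w"]] in \<open>metis (no_types, lifting)\<close>)
 then show ?case by simp
next
 case (Suc n)
 then have IH: "sym_fun (chS w kS kV x1 y0 y1 n x)" "sym_fun (chV w kS kV x1 y0 y1 n x y m)" for x y m
  by blast+
 have "sym_fun (chS w kS kV x1 y0 y1 (Suc n) x)" for x
 proof (rule sym_funI)
  fix xs ys :: "(real \<times> 'm) list" assume e: "mset xs = mset ys"
  have "kS xs x x' = kS ys x x'" for x' by (rule sym_funD[OF kern_measD(3)[OF assms] e])
  moreover have "vS w y0 x' (chV w kS kV x1 y0 y1 n x') xs = vS w y0 x' (chV w kS kV x1 y0 y1 n x') ys" for x'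
   by (rule sym_funD[OF vS_sym e]) (rule IH)
  ultimately show "chS w kS kV x1 y0 y1 (Suc n) x xs = chS w kS kV x1 y0 y1 (Suc n) x ys"
   by (simp add: split_beta' pS_def)
 qed
 moreover have "sym_fun (chV w kS kV x1 y0 y1 (Suc n) x y m)" for x y m
  unfolding ch.simps split_beta' snd_conv
  by (intro pV_sym[OF assms] vT_sym v1_sym v2_sym IH)
 ultimately show ?case by blast
qed
 then show "sym_fun (chS w kS kV x1 y0 y1 n x)" "sym_fun (chV w kS kV x1 y0 y1 n x y m)" by blast+
qed

text \<open>A vertical line may start at \<open>y0\<close>, at a point distributed by
  \<open>LB\<close> or at one of \<open>n\<close> fixed heights, and may stop likewise with
  \<open>y1\<close>. The identity is Tonelli for the form with kernel \<open>K\<close> in the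
  corresponding 3 by 3 blocks.\<close>

lemma bilinear_swap:
 fixes a b :: "nat => ennreal" and v h :: "real => ennreal"
 assumes [measurable]: "v \<in> borel_measurable borel" "h \<in> borel_measurable borel"
  and K: "(%(y, y'). K y y') \<in> borel_measurable (borel >< borel)"
 shows "a0 * (K y0 y1 * b0 + (nint LB (%y'. K y0 y' * h y')) + (\<Sum>j<n. K y0 (p j) * b j))
   + (nint LB (%y. v y * (K y y1 * b0 + (nint LB (%y'. K y y' * h y')) + (\<Sum>j<n. K y (p j) * b j))))
   + (\<Sum>i<n. a i * (K (p i) y1 * b0 + (nint LB (%y'. K (p i) y' * h y')) + (\<Sum>j<n. K (p i) (p j) * b j)))
  = b0 * (K y0 y1 * a0 + (nint LB (%y. K y y1 * v y)) + (\<Sum>i<n. K (p i) y1 * a i))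
   + (nint LB (%y'. h y' * (K y0 y' * a0 + (nint LB (%y. K y y' * v y)) + (\<Sum>i<n. K (p i) y' * a i))))
   + (\<Sum>j<n. b j * (K y0 (p j) * a0 + (nint LB (%y. K y (p j) * v y)) + (\<Sum>i<n. K (p i) (p j) * a i)))"
proof -
 note [measurable (raw)] = meas2[OF K]
 have d: "(nint LB (%y. v y * (K y y1 * b0 + (nint LB (%y'. K y y' * h y')) + (\<Sum>j<n. K y (p j) * b j))))
  = (nint LB (%y. v y * K y y1)) * b0 + (nint LB (%y. nint LB (%y'. v y * K y y' * h y'))) + (\<Sum>j<n. (nint LB (%y. v y * K y (p j))) * b j)"
  by (simp add: distrib_left nn_integral_add sum_distrib_left nn_integral_sum nn_integral_multc[symmetric] nn_integral_cmult[symmetric] mult.assoc)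
 have e: "(nint LB (%y'. h y' * (K y0 y' * a0 + (nint LB (%y. K y y' * v y)) + (\<Sum>i<n. K (p i) y' * a i))))
  = (nint LB (%y'. h y' * K y0 y')) * a0 + (nint LB (%y'. nint LB (%y. h y' * K y y' * v y))) + (\<Sum>i<n. (nint LB (%y'. h y' * K (p i) y')) * a i)"
  by (simp add: distrib_left nn_integral_add sum_distrib_left nn_integral_sum nn_integral_multc[symmetric] nn_integral_cmult[symmetric] mult.assoc)
 have f: "(nint LB (%y. nint LB (%y'. v y * K y y' * h y'))) = (nint LB (%y'. nint LB (%y. h y' * K y y' * v y)))"
  by (rule trans, rule nn_swap2[OF sfin_LB sfin_LB], measurable) (simp add: mult_ac)
 have g: "(\<Sum>i<n. \<Sum>j<n. a i * (b j * K (p i) (p j))) = (\<Sum>j<n. \<Sum>i<n. a i * (b j * K (p i) (p j)))"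
  by (rule sum.swap)
 have hh: "(nint LB (%y'. h y' * K u y')) = (nint LB (%y'. K u y' * h y'))" "(nint LB (%y. v y * K y u)) = (nint LB (%y. K y u * v y))" for u
  by (simp_all add: mult.commute)
 show ?thesis unfolding d e f hh
  by (simp add: distrib_left sum.distrib g sum_distrib_left mult_ac add_ac)
qed

lemma pV_duality:
 assumes k: "kern_meas kS kV"
  and hT: "\<And>m. hT m \<in> borel_measurable (listM lineE)" and h1: "measV1 h1"
  and uT: "\<And>m. uT m \<in> borel_measurable (listM lineE)" and u1: "measV1 u1"
 shows "uT m \<eta> * pV kV y1 hT h1 h2 y0 m \<eta> + (nint LB (%y. u1 y m \<eta> * pV kV y1 hT h1 h2 y m \<eta>))
   + picks (%z r. u2 z m r * pV kV y1 hT h1 h2 (fst z) m \<eta>) \<eta>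
  = hT m \<eta> * pV (%m \<eta> y y'. kV m \<eta> y' y) y0 uT u1 u2 y1 m \<eta>
   + (nint LB (%y. h1 y m \<eta> * pV (%m \<eta> y y'. kV m \<eta> y' y) y0 uT u1 u2 y m \<eta>))
   + picks (%z r. h2 z m r * pV (%m \<eta> y y'. kV m \<eta> y' y) y0 uT u1 u2 (fst z) m \<eta>) \<eta>"
proof -
 note [measurable (raw)] = kern_raw[OF k] measV1_raw[OF h1] measV1_raw[OF u1]
 show ?thesis unfolding pV_def picks_eq
  by (rule bilinear_swap) measurable
qed

text \<open>By symmetry the line that is hit can be put back at its place in the list, so that
  \<open>uV\<close> sees the same \<open>\<eta>\<close> in all terms. The three terms with a
  vertical line can then be treated together, pointwise in \<open>\<eta>\<close> and
  \<open>m\<close>, as \<open>pV_duality\<close> requires.\<close>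

lemma pairing_eq:
 assumes uV: "measV1 uV" "\<And>y m. sym_fun (uV y m)"
  and hS [measurable]: "hS \<in> borel_measurable (listM lineE)" and uS [measurable]: "uS \<in> borel_measurable (listM lineE)"
  and hT: "(%(m, \<eta>). hT m \<eta>) \<in> borel_measurable (MM >< listM lineE)" and h1: "measV1 h1"
  and h2: "(%(z, m, r). h2 z m r) \<in> borel_measurable (lineE >< MM >< listM lineE)"
 shows "pairing y1 uS uV hS hT h1 h2 = mint lineM (%\<eta>. hS \<eta> * uS \<eta>) +
   mint lineM (%\<eta>. nint CV (%m. hT m \<eta> * uV y1 m \<eta> + (nint LB (%y. h1 y m \<eta> * uV y m \<eta>))
    + picks (%z r. h2 z m r * uV (fst z) m \<eta>) \<eta>))"
proof -
 note [measurable (raw)] = measV1_raw[OF uV(1)] meas2[OF hT] measV1_raw[OF h1] meas3[OF h2]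
 have "mint lineM (%\<eta>. nint CV (%m. hT m \<eta> * uV y1 m \<eta> + (nint LB (%y. h1 y m \<eta> * uV y m \<eta>))
    + picks (%z r. h2 z m r * uV (fst z) m \<eta>) \<eta>))
  = mint lineM (%\<eta>. (nint CV (%m. hT m \<eta> * uV y1 m \<eta>)) + (nint CV (%m. (nint LB (%y. h1 y m \<eta> * uV y m \<eta>))))
    + (nint CV (%m. picks (%z r. h2 z m r * uV (fst z) m \<eta>) \<eta>)))"
  by (subst nn_integral_add, measurable, subst nn_integral_add, measurable)
 also have "... = mint lineM (%\<eta>. (nint CV (%m. hT m \<eta> * uV y1 m \<eta>)) + (nint CV (%m. (nint LB (%y. h1 y m \<eta> * uV y m \<eta>))))
    + (nint CV (%m. picks (%z r. h2 z m r * uV (fst z) m (z # r)) \<eta>)))"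
 proof -
  have "picks (%z r. h2 z m r * uV (fst z) m \<eta>) \<eta> = picks (%z r. h2 z m r * uV (fst z) m (z # r)) \<eta>" for m \<eta>
  proof (rule fsum_cong)
   fix i assume "i < length \<eta>"
   then have "uV (fst (\<eta> ! i)) m \<eta> = uV (fst (\<eta> ! i)) m (\<eta> ! i # rem i \<eta>)"
    by (intro sym_funD[OF uV(2)]) (simp add: mset_rem)
   then show "h2 (\<eta> ! i) m (rem i \<eta>) * uV (fst (\<eta> ! i)) m \<eta> = h2 (\<eta> ! i) m (rem i \<eta>) * uV (fst (\<eta> ! i)) m (\<eta> ! i # rem i \<eta>)"
    by (simp only:)
  qed
  then show ?thesis by simp
 qed
 also have "... = mint lineM (%\<eta>. nint CV (%m. hT m \<eta> * uV y1 m \<eta>))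
  + mint lineM (%\<eta>. nint CV (%m. (nint LB (%y. h1 y m \<eta> * uV y m \<eta>))))
  + mint lineM (%\<eta>. nint CV (%m. picks (%z r. h2 z m r * uV (fst z) m (z # r)) \<eta>))"
  by (subst mint_add, measurable, subst mint_add, measurable)
 finally show ?thesis unfolding pairing_def by (simp add: add.assoc)
qed

text \<open>A flight can be moved from one argument of the pairing to the other at the price of
  transposing its kernel: by \<open>bilinear_swap\<close> inside a column and by Tonelli between
  columns.\<close>

lemma pairing_prop:
 assumes k: "kern_meas kS kV"
  and hS: "measS hS" and hT: "(%(x, m, \<eta>). hT x m \<eta>) \<in> borel_measurable (borel >< MM >< listM lineE)" and h1: "measV h1"
  and h2: "(%(x, z, m, r). h2 x z m r) \<in> borel_measurable (borel >< lineE >< MM >< listM lineE)"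
  and hsym: "\<And>x m. sym_fun (hT x m)" "\<And>x y m. sym_fun (h1 x y m)" "\<And>x z m. sym_fun (h2 x z m)"
  and uS: "measS uS" and uT: "(%(x, m, \<eta>). uT x m \<eta>) \<in> borel_measurable (borel >< MM >< listM lineE)" and u1: "measV u1"
  and u2: "(%(x, z, m, r). u2 x z m r) \<in> borel_measurable (borel >< lineE >< MM >< listM lineE)"
  and usym: "\<And>x m. sym_fun (uT x m)" "\<And>x y m. sym_fun (u1 x y m)" "\<And>x z m. sym_fun (u2 x z m)"
 shows "(nint LA (%x. pairing y0 (pS kS hS x) (pV kV y1 (hT x) (h1 x) (h2 x)) (uS x) (uT x) (u1 x) (u2 x)))
   = (nint LA (%x. pairing y1 (pS (%\<eta> x x'. kS \<eta> x' x) uS x) (pV (%m \<eta> y y'. kV m \<eta> y' y) y0 (uT x) (u1 x) (u2 x)) (hS x) (hT x) (h1 x) (h2 x)))"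
proof -
 let ?kS = "%\<eta> x x'. kS \<eta> x' x" and ?kV = "%m \<eta> y y'. kV m \<eta> y' y"
 note k' = kern_meas_flip[OF k]
 note [measurable (raw)] = kern_raw[OF k] measS_raw[OF hS] meas3[OF hT] measV_raw[OF h1] meas4[OF h2]
   measS_raw[OF uS] meas3[OF uT] measV_raw[OF u1] meas4[OF u2]
 note [measurable (raw)] = measS_raw[OF pS_measurable[OF k hS]] measV_raw[OF pV_measurable[OF k hT h1 h2]]
   measS_raw[OF pS_measurable[OF k' uS]] measV_raw[OF pV_measurable[OF k' uT u1 u2]]
 \<comment> \<open>The part of the pairing inside columns. \<open>pV_duality\<close> shows it to be
   the same quantity when read from the other side.\<close>
 define DV where "DV x = mint lineM (%\<eta>. nint CV (%m. uT x m \<eta> * pV kV y1 (hT x) (h1 x) (h2 x) y0 m \<eta>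
   + (nint LB (%y. u1 x y m \<eta> * pV kV y1 (hT x) (h1 x) (h2 x) y m \<eta>))
   + picks (%z r. u2 x z m r * pV kV y1 (hT x) (h1 x) (h2 x) (fst z) m \<eta>) \<eta>))" for x
 have DV_meas [measurable]: "DV \<in> borel_measurable borel" unfolding DV_def by measurable
 have DV2: "DV x = mint lineM (%\<eta>. nint CV (%m. hT x m \<eta> * pV ?kV y0 (uT x) (u1 x) (u2 x) y1 m \<eta>
   + (nint LB (%y. h1 x y m \<eta> * pV ?kV y0 (uT x) (u1 x) (u2 x) y m \<eta>))
   + picks (%z r. h2 x z m r * pV ?kV y0 (uT x) (u1 x) (u2 x) (fst z) m \<eta>) \<eta>))" for x
  unfolding DV_def
  by (subst pV_duality[OF k]; (unfold measV1_def)?; measurable)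
 have 1: "pairing y0 (pS kS hS x) (pV kV y1 (hT x) (h1 x) (h2 x)) (uS x) (uT x) (u1 x) (u2 x)
   = mint lineM (%\<eta>. uS x \<eta> * pS kS hS x \<eta>) + DV x" for x
  unfolding DV_def
  by (rule pairing_eq; (intro pV_sym[OF k] hsym)?; (unfold measV1_def)?; measurable)
 have 2: "pairing y1 (pS ?kS uS x) (pV ?kV y0 (uT x) (u1 x) (u2 x)) (hS x) (hT x) (h1 x) (h2 x)
   = mint lineM (%\<eta>. hS x \<eta> * pS ?kS uS x \<eta>) + DV x" for x
  unfolding DV2
  by (rule pairing_eq; (intro pV_sym[OF k'] usym)?; (unfold measV1_def)?; measurable)
 have "(nint LA (%x. mint lineM (%\<eta>. uS x \<eta> * pS kS hS x \<eta>))) = mint lineM (%\<eta>. nint LA (%x. nint LA (%x'. uS x \<eta> * (kS \<eta> x x' * hS x' \<eta>))))"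
  by (subst mint_nn_integral[OF sfin_LA, symmetric], measurable) (simp add: pS_def nn_integral_cmult)
 also have "... = mint lineM (%\<eta>. nint LA (%x'. nint LA (%x. uS x \<eta> * (kS \<eta> x x' * hS x' \<eta>))))"
  by (intro arg_cong[of _ _ "mint lineM"] ext nn_swap2 sfin_LA) measurable
 also have "... = mint lineM (%\<eta>. nint LA (%x'. nint LA (%x. hS x' \<eta> * (kS \<eta> x x' * uS x \<eta>))))"
  by (simp add: mult_ac)
 also have "... = (nint LA (%x. mint lineM (%\<eta>. hS x \<eta> * pS ?kS uS x \<eta>)))"
  by (subst mint_nn_integral[OF sfin_LA, symmetric], measurable) (simp add: pS_def nn_integral_cmult)
 finally have 3: "(nint LA (%x. mint lineM (%\<eta>. uS x \<eta> * pS kS hS x \<eta>))) = (nint LA (%x. mint lineM (%\<eta>. hS x \<eta> * pS ?kS uS x \<eta>)))" .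
 show ?thesis unfolding 1 2
  by (subst nn_integral_add, measurable, subst nn_integral_add, measurable) (simp add: 3)
qed

text \<open>The vertices are carried from the future to the past one at a time: \<open>B i j\<close>
  has \<open>i\<close> vertices before and \<open>j\<close> after a marked one.
  \<open>vertex_duality\<close> reads the marked vertex backwards and \<open>pairing_prop\<close>
  moves the flight next to it to the other side, which gives
  \<open>B i (Suc j) = B (Suc i) j\<close>.\<close>

theorem chain_duality:
 assumes w: "wts_meas w" and k: "kern_meas kS kV"
 shows "mint lineM (%\<eta>. lprod (wL w) \<eta> * chS w kS kV x1 y0 y1 n x0 \<eta>) =
  mint lineM (%\<eta>. lprod (wR w) \<eta> * chS (adj w) (%\<eta> x x'. kS \<eta> x' x) (%m \<eta> y y'. kV m \<eta> y' y) x0 y1 y0 n x1 \<eta>)"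
\<comment> \<open>Without a vertex there is nothing to mark; both sides are the free flight from
  \<open>x0\<close> to \<open>x1\<close>.\<close>
proof (cases n)
 case 0
 then show ?thesis by (simp add: mult_ac)
next
 case (Suc n)
 let ?kS = "%\<eta> x x'. kS \<eta> x' x" and ?kV = "%m \<eta> y y'. kV m \<eta> y' y"
 note k' = kern_meas_flip[OF k] and w' = wts_meas_adj[OF w]
 define gS where "gS = chS w kS kV x1 y0 y1"
 define gV where "gV = chV w kS kV x1 y0 y1"
 define uS where "uS = chS (adj w) ?kS ?kV x0 y1 y0"
 define uV where "uV = chV (adj w) ?kS ?kV x0 y1 y0"
 have mS: "measS (gS i)" "measS (uS i)" and mV: "measV (gV i)" "measV (uV i)" for i
  unfolding gS_def gV_def uS_def uV_def by (intro ch_measurable w w' k k')+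
 have sS: "sym_fun (gS i x)" "sym_fun (uS i x)" and sV: "sym_fun (gV i x y m)" "sym_fun (uV i x y m)" for i x y m
  unfolding gS_def gV_def uS_def uV_def by (intro ch_sym k k')+
 note [measurable (raw)] = wts_raw[OF w] kern_raw[OF k] measS_raw[OF mS(1)] measS_raw[OF mS(2)] measV_raw[OF mV(1)] measV_raw[OF mV(2)]
 have gS0: "gS 0 = (%x \<eta>. kS \<eta> x x1 * lprod (wR w) \<eta>)" "gV 0 = (%x y m \<eta>. 0)"
  "uS 0 = (%x \<eta>. kS \<eta> x0 x * lprod (wL w) \<eta>)" "uV 0 = (%x y m \<eta>. 0)"
  by (simp_all add: gS_def gV_def uS_def uV_def)
 have gSS: "gS (Suc i) = pS kS (%x. vS w y0 x (gV i x))"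
  "gV (Suc i) = (%x. pV kV y1 (vT w x (gS i x)) (v1 w x (gS i x) (gV i x)) (v2 w x (gS i x) (gV i x)))"
  "uS (Suc i) = pS ?kS (%x. vS (adj w) y1 x (uV i x))"
  "uV (Suc i) = (%x. pV ?kV y0 (vT (adj w) x (uS i x)) (v1 (adj w) x (uS i x) (uV i x)) (v2 (adj w) x (uS i x) (uV i x)))" for i
  by (simp_all add: gS_def gV_def uS_def uV_def split_beta')
 define B where "B i j = (nint LA (%x. pairing y1 (uS i x) (uV i x) (vS w y0 x (gV j x)) (vT w x (gS j x))
   (v1 w x (gS j x) (gV j x)) (v2 w x (gS j x) (gV j x))))" for i j
 have dual: "B i j = (nint LA (%x. pairing y0 (gS j x) (gV j x) (vS (adj w) y1 x (uV i x)) (vT (adj w) x (uS i x))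
   (v1 (adj w) x (uS i x) (uV i x)) (v2 (adj w) x (uS i x) (uV i x))))" for i j
  unfolding B_def by (intro nn_integral_cong vertex_duality w sS) measurable
 have step: "B i (Suc j) = B (Suc i) j" for i j
  unfolding dual[of i "Suc j"] unfolding B_def gSS
  by (intro pairing_prop k vS_measurable vT_measurable v1_measurable v2_measurable w w' mS mV vT_sym v1_sym v2_sym sS sV)
 have B0n: "B i j = B (i + j) 0" for i j
  by (induction j arbitrary: i) (simp_all add: step)
 have vSm: "measS (%x. vS w y0 x (gV i x))" "measS (%x. vS (adj w) y1 x (uV i x))" for i
  by (intro vS_measurable w w' mV)+
 note [measurable (raw)] = measS_raw[OF vSm(1)] measS_raw[OF vSm(2)]
 have "mint lineM (%\<eta>. lprod (wL w) \<eta> * gS (Suc n) x0 \<eta>)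
   = mint lineM (%\<eta>. nint LA (%x. vS w y0 x (gV n x) \<eta> * uS 0 x \<eta>))"
  unfolding gSS gS0 pS_def by (subst nn_integral_cmult[symmetric], measurable) (simp add: mult_ac)
 \<comment> \<open>\<open>uV 0\<close> is zero, so of the four terms of the pairing only the start
   of a column survives.\<close>
 also have "... = B 0 n"
  unfolding B_def pairing_def gS0 by (subst mint_nn_integral[OF sfin_LA], measurable) (simp add: mint_def picks_eq)
 also have "... = B n 0" using B0n[of 0 n] by simp
 also have "... = mint lineM (%\<eta>. nint LA (%x. vS (adj w) y1 x (uV n x) \<eta> * gS 0 x \<eta>))"
  unfolding dual pairing_def gS0 by (subst mint_nn_integral[OF sfin_LA], measurable) (simp add: mint_def picks_eq)
 also have "... = mint lineM (%\<eta>. lprod (wR w) \<eta> * uS (Suc n) x1 \<eta>)"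
  unfolding gSS gS0 pS_def by (subst nn_integral_cmult[symmetric], measurable) (simp add: mult_ac)
 finally show ?thesis unfolding Suc gS_def uS_def .
qed

end

section \<open>Reflection of the box\<close>

lemma picks_map: "picks F (map f xs) = picks (%z r. F (f z) (map f r)) xs"
 by (simp add: picks_eq map_rem)

lemma (in list_space) measurable_map_list [measurable (raw)]:
 assumes f [measurable]: "f \<in> M \<rightarrow>\<^sub>M listM E" and [measurable]: "g \<in> E \<rightarrow>\<^sub>M E"
 shows "(%w. map g (f w)) \<in> M \<rightarrow>\<^sub>M listM E"
proof -
 have eq: "map g xs = foldr (%e a. g e # a) xs []" for xs by (induction xs) auto
 show ?thesis unfolding eq by measurable
qed

locale line_chain_rot = line_chain +
 fixes a b :: real
 assumes refl_LA: "f \<in> borel_measurable borel ==> (nint LA (%x. f (a - x))) = (nint LA (%x. f x))"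
  and refl_LB: "f \<in> borel_measurable borel ==> (nint LB (%y. f (b - y))) = (nint LB (%y. f y))"
begin

text \<open>At a given position of the sweep line a horizontal line is known by its height and mark
  alone, so the list is reflected in the heights; abscissae are reflected in the arguments of the
  functions.\<close>

definition flip :: "real \<times> 'a => real \<times> 'a" where "flip z = (b - fst z, snd z)"

lemma flip_simps [simp]: "fst (flip z) = b - fst z" "snd (flip z) = snd z" "flip (y, m) = (b - y, m)"
 by (simp_all add: flip_def)

lemma measurable_flip [measurable]: "flip \<in> lineE \<rightarrow>\<^sub>M lineE"
 unfolding flip_def[abs_def] by measurable

definition rot :: "'a wts => 'a wts" where
 "rot w = \<lparr> wL = (%y. wL w (b - y)), wR = (%y. wR w (b - y)), wB = (%x. wB w (a - x)), wT = (%x. wT w (a - x)),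
   wC = (%x y. wC w (a - x) (b - y)), wA = (%x y. wA w (a - x) (b - y)),
   wHT = (%x y. wHT w (a - x) (b - y)), wVT = (%x y. wVT w (a - x) (b - y)),
   wHS = (%x y. wHS w (a - x) (b - y)), wHJ = (%x y. wHJ w (a - x) (b - y)),
   wVS = (%x y. wVS w (a - x) (b - y)), wVJ = (%x y. wVJ w (a - x) (b - y)),
   wX = (%x y. wX w (a - x) (b - y)) \<rparr>"

lemma rot_simps [simp]:
 "wL (rot w) y = wL w (b - y)" "wR (rot w) y = wR w (b - y)" "wB (rot w) x = wB w (a - x)" "wT (rot w) x = wT w (a - x)"
 "wC (rot w) x y = wC w (a - x) (b - y)" "wA (rot w) x y = wA w (a - x) (b - y)"
 "wHT (rot w) x y = wHT w (a - x) (b - y)" "wVT (rot w) x y = wVT w (a - x) (b - y)"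
 "wHS (rot w) x y = wHS w (a - x) (b - y)" "wHJ (rot w) x y = wHJ w (a - x) (b - y)"
 "wVS (rot w) x y = wVS w (a - x) (b - y)" "wVJ (rot w) x y = wVJ w (a - x) (b - y)"
 "wX (rot w) x y = wX w (a - x) (b - y)"
 by (simp_all add: rot_def)

lemma mint_flip:
 assumes [measurable]: "F \<in> borel_measurable (listM lineE)"
 shows "mint lineM (%\<eta>. F (map flip \<eta>)) = mint lineM F"
proof -
 have z: "(nint lineM (%z. G (flip z))) = (nint lineM (%z. G z))" if [measurable]: "G \<in> borel_measurable lineE" for G
 proof -
  have "(nint lineM (%z. G (flip z))) = (nint LB (%y. (%y. nint CH (%m. G (y, m))) (b - y)))"
   by (subst nn_integral_lineM, measurable)
  also have "... = (nint lineM (%z. G z))"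
   by (subst refl_LB, measurable, subst nn_integral_lineM, measurable)
  finally show ?thesis .
 qed
 have "lint (%_. lineM) (replicate n ()) (%\<eta>. F (map flip \<eta>)) = lint (%_. lineM) (replicate n ()) F" for n
  using assms
 proof (induction n arbitrary: F)
  case (Suc n)
  note [measurable] = Suc.prems
  have "lint (%_. lineM) (replicate n ()) (%\<eta>. F (z # map flip \<eta>)) = lint (%_. lineM) (replicate n ()) (%\<eta>. F (z # \<eta>))" for z
   by (rule Suc.IH) measurable
  then show ?case using z[of "%z. lint (%_. lineM) (replicate n ()) (%\<eta>. F (z # \<eta>))"] by simp
 qed simp
 then show ?thesis by (simp add: mint_def)
qed

lemma vS_rot:
 assumes w: "wts_meas w" and g: "measV1 g"
 shows "vS (rot w) y0 x (%y m \<eta>. g (b - y) m (map flip \<eta>)) \<eta> = vS w (b - y0) (a - x) g (map flip \<eta>)"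
proof -
 note [measurable (raw)] = wts_raw[OF w] measV1_raw[OF g]
 have "(nint LB (%y. (%y. nint CH (%h. nint CV (%v. wC w (a - x) y h v * g y v ((y, h) # map flip \<eta>)))) (b - y)))
  = (nint LB (%y. nint CH (%h. nint CV (%v. wC w (a - x) y h v * g y v ((y, h) # map flip \<eta>)))))"
  by (rule refl_LB) measurable
 then show ?thesis unfolding vS_def by (simp add: picks_map)
qed

lemma pV_rot:
 assumes k: "kern_meas kS kV" and h1: "measV1 h1"
 shows "pV (%m \<eta> y y'. kV m (map flip \<eta>) (b - y) (b - y')) y1 (%m \<eta>. hT m (map flip \<eta>)) (%y m \<eta>. h1 (b - y) m (map flip \<eta>))
   (%z m r. h2 (flip z) m (map flip r)) y m \<eta> = pV kV (b - y1) hT h1 h2 (b - y) m (map flip \<eta>)"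
proof -
 note [measurable (raw)] = kern_raw[OF k] measV1_raw[OF h1]
 have "(nint LB (%y'. (%y'. kV m (map flip \<eta>) (b - y) y' * h1 y' m (map flip \<eta>)) (b - y')))
  = (nint LB (%y'. kV m (map flip \<eta>) (b - y) y' * h1 y' m (map flip \<eta>)))"
  by (rule refl_LB) measurable
 then show ?thesis unfolding pV_def by (simp add: picks_map)
qed

text \<open>Integrals over \<open>LA\<close> and \<open>LB\<close> do not change when the variable
  is reflected, so each step of the recursion commutes with the reflection, and the reflected
  weights run the same chain between reflected end points.\<close>

lemma ch_rot:
 assumes w: "wts_meas w" and k: "kern_meas kS kV"
 defines "kS' \<equiv> %\<eta> x x'. kS (map flip \<eta>) (a - x) (a - x')"
  and "kV' \<equiv> %m \<eta> y y'. kV m (map flip \<eta>) (b - y) (b - y')"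
 shows "ch (rot w) kS' kV' x1 y0 y1 n =
   (%x \<eta>. chS w kS kV (a - x1) (b - y0) (b - y1) n (a - x) (map flip \<eta>),
   %x y m \<eta>. chV w kS kV (a - x1) (b - y0) (b - y1) n (a - x) (b - y) m (map flip \<eta>))"
proof (induction n)
 case 0
 show ?case by (simp add: kS'_def comp_def)
next
 case (Suc n)
 define gS where "gS = chS w kS kV (a - x1) (b - y0) (b - y1) n"
 define gV where "gV = chV w kS kV (a - x1) (b - y0) (b - y1) n"
 have mS: "measS gS" and mV: "measV gV" unfolding gS_def gV_def by (intro ch_measurable w k)+
 note [measurable (raw)] = wts_raw[OF w] kern_raw[OF k] measS_raw[OF mS] measV_raw[OF mV] measS_raw[OF vS_measurable[OF w mV]]
  measV_raw[OF v1_measurable[OF w mS mV]]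
 have mV1: "measV1 (gV x)" for x unfolding measV1_def by measurable
 have m1: "measV1 (v1 w x (gS x) (gV x))" for x unfolding measV1_def by measurable
 have S: "pS kS' (%x. vS (rot w) y0 x (%y m \<eta>. gV (a - x) (b - y) m (map flip \<eta>))) x \<eta>
   = pS kS (%x. vS w (b - y0) x (gV x)) (a - x) (map flip \<eta>)" for x \<eta>
 proof -
  have "(nint LA (%x'. (%x'. kS (map flip \<eta>) (a - x) x' * vS w (b - y0) x' (gV x') (map flip \<eta>)) (a - x')))
   = (nint LA (%x'. kS (map flip \<eta>) (a - x) x' * vS w (b - y0) x' (gV x') (map flip \<eta>)))"
   by (rule refl_LA) measurable
  then show ?thesis unfolding pS_def kS'_def vS_rot[OF w mV1] by simp
 qed
 have e: "vT (rot w) x (%\<eta>. gS (a - x) (map flip \<eta>)) = (%m \<eta>. vT w (a - x) (gS (a - x)) m (map flip \<eta>))"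
  "v1 (rot w) x (%\<eta>. gS (a - x) (map flip \<eta>)) (%y m \<eta>. gV (a - x) (b - y) m (map flip \<eta>))
   = (%y m \<eta>. v1 w (a - x) (gS (a - x)) (gV (a - x)) (b - y) m (map flip \<eta>))"
  "v2 (rot w) x (%\<eta>. gS (a - x) (map flip \<eta>)) (%y m \<eta>. gV (a - x) (b - y) m (map flip \<eta>))
   = (%z m r. v2 w (a - x) (gS (a - x)) (gV (a - x)) (flip z) m (map flip r))" for x
  by (simp_all add: vT_def v1_def v2_def fun_eq_iff)
 have V: "pV kV' y1 (%m \<eta>. vT w (a - x) (gS (a - x)) m (map flip \<eta>))
   (%y m \<eta>. v1 w (a - x) (gS (a - x)) (gV (a - x)) (b - y) m (map flip \<eta>))
   (%z m r. v2 w (a - x) (gS (a - x)) (gV (a - x)) (flip z) m (map flip r)) y m \<eta>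
  = pV kV (b - y1) (vT w (a - x) (gS (a - x))) (v1 w (a - x) (gS (a - x)) (gV (a - x)))
    (v2 w (a - x) (gS (a - x)) (gV (a - x))) (b - y) m (map flip \<eta>)" for x y m \<eta>
  unfolding kV'_def by (rule pV_rot[OF k m1])
 show ?case
  unfolding ch.simps Suc split_beta' fst_conv snd_conv gS_def[symmetric] gV_def[symmetric] e
  by (intro prod_eqI ext) (simp_all only: fst_conv snd_conv S V)
qed

text \<open>Sweeping the rotated picture from left to right is sweeping the original one backwards.\<close>
theorem chain_rotation:
 assumes w: "wts_meas w" and k: "kern_meas kS kV"
  and kS: "\<And>\<eta> x x'. kS (map flip \<eta>) (a - x') (a - x) = kS \<eta> x x'"
  and kV: "\<And>m \<eta> y y'. kV m (map flip \<eta>) (b - y') (b - y) = kV m \<eta> y y'"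
 shows "mint lineM (%\<eta>. lprod (wL w) \<eta> * chS w kS kV a 0 b n 0 \<eta>) =
  mint lineM (%\<eta>. lprod (wL (rot (adj w))) \<eta> * chS (rot (adj w)) kS kV a 0 b n 0 \<eta>)"
proof -
 let ?kS = "%\<eta> x x'. kS \<eta> x' x" and ?kV = "%m \<eta> y y'. kV m \<eta> y' y"
 note k' = kern_meas_flip[OF k] and w' = wts_meas_adj[OF w]
 note [measurable (raw)] = wts_raw[OF w] kern_raw[OF k] measS_raw[OF ch_measurable(1)[OF w' k', of 0 b 0 n]]
 have "mint lineM (%\<eta>. lprod (wL w) \<eta> * chS w kS kV a 0 b n 0 \<eta>)
  = mint lineM (%\<eta>. lprod (wR w) \<eta> * chS (adj w) ?kS ?kV 0 b 0 n a \<eta>)"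
  by (rule chain_duality[OF w k])
 also have "... = mint lineM (%\<eta>. (%\<eta>. lprod (wR w) \<eta> * chS (adj w) ?kS ?kV 0 b 0 n a \<eta>) (map flip \<eta>))"
  by (rule mint_flip[symmetric]) measurable
 also have "... = mint lineM (%\<eta>. lprod (wL (rot (adj w))) \<eta> * chS (rot (adj w)) kS kV a 0 b n 0 \<eta>)"
  using ch_rot[OF w' k', of a 0 b n] by (simp add: kS kV comp_def)
 finally show ?thesis .
qed

end

section \<open>The sweep in terms of event lists\<close>

lemma fsum_0: "(\<And>e r. e \<in> set xs ==> F e r = 0) ==> fsum Q R F xs = 0"
 by (auto simp: fsum_def intro!: sum.neutral)

text \<open>\<open>p\<close> marks the entries that compete. The first one with the minimal key
  \<open>t\<close> beats earlier competitors strictly and later ones weakly, and no other entry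
  does. Since no earlier entry has that key, deleting its position is
  \<open>remove1\<close>.\<close>

lemma fsum_find:
 fixes f :: "'a => real"
 assumes "find (%e. f e = t) xs = Some e0" "\<And>e. f e = t ==> p e" "\<And>e. e \<in> set xs ==> p e ==> t \<le> f e"
  "\<And>e r. \<not> p e ==> F e r = 0"
  "\<And>e e'. Q e e' \<longleftrightarrow> (p e' --> f e < f e')" "\<And>e e'. R e e' \<longleftrightarrow> (p e' --> f e \<le> f e')"
 shows "fsum Q R F xs = F e0 (remove1 e0 xs)"
 using assms(1,3,4)
proof (induction xs arbitrary: F)
 case (Cons x xs)
 show ?case
 proof (cases "f x = t")
  case True
  then have e0: "e0 = x" and px: "p x" using Cons.prems(1) assms(2) by auto
  have "fsum Q R (%e es. if Q e x then F e (x # es) else 0) xs = 0"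
  proof (rule fsum_0)
   fix e r assume "e \<in> set xs"
   show "(if Q e x then F e (x # r) else 0) = 0"
    using Cons.prems(2)[of e] Cons.prems(3)[of e "x # r"] \<open>e \<in> set xs\<close> px True by (cases "p e") (auto simp: assms(5))
  qed
  moreover have "\<forall>e\<in>set xs. R x e" using Cons.prems(2) True by (auto simp: assms(6))
  ultimately show ?thesis by (simp add: fsum_Cons e0)
 next
  case False
  then have fd: "find (%e. f e = t) xs = Some e0" using Cons.prems(1) by auto
  then have e0: "e0 \<in> set xs" "f e0 = t" by (auto simp: find_Some_iff)
  then have p0: "p e0" using assms(2) by auto
  have 1: "(if \<forall>e\<in>set xs. R x e then F x xs else 0) = 0"
  proof (cases "p x")
   case True
   then have "t < f x" using Cons.prems(2)[of x] False by auto
   then have "\<not> R x e0" using p0 e0 by (auto simp: assms(6))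
   then show ?thesis using e0 by auto
  qed (use Cons.prems(3) in auto)
  have "p x ==> f e0 < f x" using Cons.prems(2)[of x] False e0 by auto
  then have Q0: "Q e0 x" by (auto simp: assms(5))
  have "fsum Q R (%e es. if Q e x then F e (x # es) else 0) xs = (if Q e0 x then F e0 (x # remove1 e0 xs) else 0)"
   by (rule Cons.IH[OF fd]) (use Cons.prems in auto)
  then show ?thesis using 1 Q0 False e0 by (auto simp: fsum_Cons)
 qed
qed simp

lemma meas8:
 assumes "(%(a, b, c, d, e, f, g, h). F a b c d e f g h) \<in> Ma >< Mb >< Mc >< Md >< Me >< Mf >< Mg >< Mh \<rightarrow>\<^sub>M N"
  "ga \<in> M \<rightarrow>\<^sub>M Ma" "gb \<in> M \<rightarrow>\<^sub>M Mb" "gc \<in> M \<rightarrow>\<^sub>M Mc" "gd \<in> M \<rightarrow>\<^sub>M Md" "ge \<in> M \<rightarrow>\<^sub>M Me" "gf \<in> M \<rightarrow>\<^sub>M Mf" "gg \<in> M \<rightarrow>\<^sub>M Mg" "gh \<in> M \<rightarrow>\<^sub>M Mh"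
 shows "(%w. F (ga w) (gb w) (gc w) (gd w) (ge w) (gf w) (gg w) (gh w)) \<in> M \<rightarrow>\<^sub>M N"
 using measurable_compose[OF _ assms(1), of "%w. (ga w, gb w, gc w, gd w, ge w, gf w, gg w, gh w)" M] assms(2-) by simp

abbreviation intM :: "int measure" where "intM \<equiv> count_space UNIV"
abbreviation hsE :: "(real \<times> int \<times> real \<times> real) measure" where "hsE \<equiv> borel >< intM >< borel >< borel"
abbreviation cxE :: "(real \<times> int) measure" where "cxE \<equiv> borel >< intM"
abbreviation c0E :: "(real \<times> real \<times> int) measure" where "c0E \<equiv> borel >< borel >< intM"
abbreviation unifM :: "real measure" where "unifM \<equiv> uniform_measure lborel {0..1}"
abbreviation seqM :: "(nat => real) measure" where "seqM \<equiv> PiM UNIV (%_. unifM)"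

interpretation hsL: list_space hsE by (rule list_space.intro) (simp add: space_pair_measure)
interpretation cxL: list_space cxE by (rule list_space.intro) (simp add: space_pair_measure)
interpretation c0L: list_space c0E by (rule list_space.intro) (simp add: space_pair_measure)

text \<open>Wrapping the application \<open>\<delta> k\<close> in a constant gives the
  \<open>measurable\<close> method a head symbol to match. A step of the simulation reads at most
  four uniforms and advances the index by four; \<open>sh4\<close> is that advance.\<close>

definition sq :: "(nat => real) => nat => real" where "sq \<delta> k = \<delta> k"
definition sh4 :: "(nat => real) => nat => real" where "sh4 \<delta> = (%k. \<delta> (k + 4))"
abbreviation clk :: "real \<times> int \<times> real \<times> real => real" where "clk e \<equiv> snd (snd (snd e))"

lemma measurable_sample_Z [measurable]: "sample_Z w \<in> borel \<rightarrow>\<^sub>M intM"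
 unfolding sample_Z_def[abs_def] by measurable

lemma measurable_sample_fker [measurable (raw)]:
 assumes [measurable]: "s \<in> M \<rightarrow>\<^sub>M intM" "u \<in> borel_measurable M"
 shows "(%w. sample_Z (fker P (s w)) (u w)) \<in> M \<rightarrow>\<^sub>M intM"
 by (rule measurable_compose_countable[of "%i w. sample_Z (fker P i) (u w)" M intM s]) measurable

lemma measurable_clock_after [measurable (raw)]:
 assumes [measurable]: "x \<in> borel_measurable M" "r \<in> borel_measurable M" "u \<in> borel_measurable M" "c \<in> borel_measurable M"
 shows "(%w. clock_after (x w) (r w) (u w) (c w)) \<in> borel_measurable M"
 unfolding clock_after_def by measurable

lemma sets_unifM [simp, measurable_cong]: "sets unifM = sets borel"
 by simp

lemma measurable_seq_component':
 assumes "d \<in> M \<rightarrow>\<^sub>M seqM" shows "(%w. d w i) \<in> M \<rightarrow>\<^sub>M unifM"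
 using measurable_compose[OF assms measurable_component_singleton[of i UNIV "%_. unifM"]] by simp

lemma measurable_seq_component [measurable (raw)]:
 assumes "d \<in> M \<rightarrow>\<^sub>M seqM" shows "(%w. sq (d w) i) \<in> borel_measurable M"
 using measurable_seq_component'[OF assms, of i] by (simp add: sq_def measurable_cong_sets[OF refl sets_unifM])

lemma measurable_sh4 [measurable (raw)]:
 assumes "d \<in> M \<rightarrow>\<^sub>M seqM" shows "(%w. sh4 (d w)) \<in> M \<rightarrow>\<^sub>M seqM"
 unfolding sh4_def by (rule measurable_PiM_single') (auto intro: measurable_seq_component'[OF assms])

text \<open>\<open>phi\<close> is the factor contributed by one finished segment, later the
  indicator that it lies outside the avoided set.\<close>

locale pks_alg =
 fixes P :: pks_params and phi :: "real => real => real => real => int => ennreal"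
 assumes phi_meas: "(%(x0, y0, x1, y1, s). phi x0 y0 x1 y1 s) \<in> borel_measurable (borel >< borel >< borel >< borel >< intM)"
begin

abbreviation "a \<equiv> pk_a P"
abbreviation "b \<equiv> pk_b P"

text \<open>The value 1 for degenerate pieces matches \<open>emitH\<close>, which emits nothing for
  them.\<close>

definition phH :: "real => real => real => int => ennreal" where
 "phH x0 x1 y s = (if x0 < x1 then phi x0 y x1 y s else 1)"
definition phV :: "real => real => real => int => ennreal" where
 "phV x y0 y1 s = (if y0 < y1 then phi x y0 x y1 s else 1)"

lemma phH_meas: "(%(x0, x1, y, s). phH x0 x1 y s) \<in> borel_measurable (borel >< borel >< borel >< intM)"
 and phV_meas: "(%(x, y0, y1, s). phV x y0 y1 s) \<in> borel_measurable (borel >< borel >< borel >< intM)"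
proof -
 note [measurable (raw)] = meas5[OF phi_meas]
 show "(%(x0, x1, y, s). phH x0 x1 y s) \<in> borel_measurable (borel >< borel >< borel >< intM)"
  "(%(x, y0, y1, s). phV x y0 y1 s) \<in> borel_measurable (borel >< borel >< borel >< intM)"
  unfolding phH_def phV_def by measurable
qed

lemmas ph_raw [measurable (raw)] = meas4[OF phH_meas] meas4[OF phV_meas]

type_synonym hs = "(real \<times> int \<times> real \<times> real) list"
type_synonym cxs = "(real \<times> int) list"
type_synonym c0s = "(real \<times> real \<times> int) list"
type_synonym RVt = "real => real => int => real => hs => cxs => c0s => (nat => real) => ennreal"
type_synonym RSt = "hs => cxs => c0s => (nat => real) => ennreal"

definition sX :: "RVt => (real \<times> int) => RSt" where
 "sX rv e hs cx c0 \<delta> = rv (fst e) 0 (snd e) (clock_after 0 (rV P (snd e)) (sq \<delta> 0) b) hs cx c0 (sh4 \<delta>)"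

definition s0 :: "RVt => (real \<times> real \<times> int) => RSt" where
 "s0 rv e hs cx c0 \<delta> = (case e of (x, y, s) => rv x y (- s) (clock_after y (rV P (- s)) (sq \<delta> 0) b)
   (hs @ [(y, s, x, clock_after x (rH P s) (sq \<delta> 1) a)]) cx c0 (sh4 \<delta>))"

definition sH :: "RVt => (real \<times> int \<times> real \<times> real) => RSt" where
 "sH rv e hs cx c0 \<delta> = (case e of (y, s, x0, k) => phH x0 k y s *
   (if sq \<delta> 0 * rH P s < lamH P s then
    let T = sample_Z (fker P s) (sq \<delta> 1) in
    rv k y (s - T) (clock_after y (rV P (s - T)) (sq \<delta> 2) b) (hs @ [(y, T, k, clock_after k (rH P T) (sq \<delta> 3) a)]) cx c0 (sh4 \<delta>)
   else rv k y s (clock_after y (rV P s) (sq \<delta> 2) b) hs cx c0 (sh4 \<delta>)))"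

text \<open>The three sums follow the search order of the simulation: births on the lower side,
  creations in the interior, clocks. A comparison with a kind searched later is weak and one with a
  kind searched earlier is strict, so that at most one term is non-zero.\<close>

definition rs_step :: "RVt => RSt" where
 "rs_step rv hs cx c0 \<delta> =
   fsum (%e e'. fst e < fst e') (%e e'. fst e \<le> fst e') (%e cx'.
    if fst e \<le> a & (\<forall>e'\<in>set c0. fst e \<le> fst e') & (\<forall>e'\<in>set hs. fst e \<le> clk e') then sX rv e hs cx' c0 \<delta> else 0) cx
  + fsum (%e e'. fst e < fst e') (%e e'. fst e \<le> fst e') (%e c0'.
    if fst e \<le> a & (\<forall>e'\<in>set cx. fst e < fst e') & (\<forall>e'\<in>set hs. fst e \<le> clk e') then s0 rv e hs cx c0' \<delta> else 0) c0
  + fsum (%e e'. clk e < clk e') (%e e'. clk e \<le> clk e') (%e hs'.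
    if clk e \<le> a & (\<forall>e'\<in>set cx. clk e < fst e') & (\<forall>e'\<in>set c0. clk e < fst e') then sH rv e hs' cx c0 \<delta> else 0) hs"

definition rv_free :: "RSt => RVt => RVt" where
 "rv_free rs rv x yv s k hs cx c0 \<delta> = phV x yv k s *
   (if sq \<delta> 0 * rV P s < lamV P s then
    let T = sample_Z (fker P s) (sq \<delta> 1) in
    rv x k (s - T) (clock_after k (rV P (s - T)) (sq \<delta> 2) b) (hs @ [(k, T, x, clock_after x (rH P T) (sq \<delta> 3) a)]) cx c0 (sh4 \<delta>)
   else rs (hs @ [(k, s, x, clock_after x (rH P s) (sq \<delta> 3) a)]) cx c0 (sh4 \<delta>))"

definition rv_coll :: "RSt => RVt => real => real => int => (real \<times> int \<times> real \<times> real) => RSt" where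
 "rv_coll rs rv x yv s e hs cx c0 \<delta> = (case e of (yh, sW, x0, kh) => let u = s + sW in phV x yv yh s * phH x0 x yh sW *
   (if sq \<delta> 0 < pk_pV P u then rv x yh u (clock_after yh (rV P u) (sq \<delta> 1) b) hs cx c0 (sh4 \<delta>)
   else if sq \<delta> 0 < pk_pV P u + pk_pH P u then rs (hs @ [(yh, u, x, clock_after x (rH P u) (sq \<delta> 1) a)]) cx c0 (sh4 \<delta>)
   else if u = 0 & sq \<delta> 0 < pk_pV P u + pk_pH P u + pk_p0 P then rs hs cx c0 (sh4 \<delta>)
   else let T = sample_Z (fker P u) (sq \<delta> 1) in
    rv x yh (u - T) (clock_after yh (rV P (u - T)) (sq \<delta> 2) b) (hs @ [(yh, T, x, clock_after x (rH P T) (sq \<delta> 3) a)]) cx c0 (sh4 \<delta>)))"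

text \<open>The height of the next line is not computed as a minimum; comparisons with all lines
  above \<open>yv\<close> express the same cases and are measurable at once.\<close>

definition rv_step :: "RSt => RVt => RVt" where
 "rv_step rs rv x yv s k hs cx c0 \<delta> =
   (if b < k & (\<forall>e\<in>set hs. yv < fst e --> b < fst e) then phV x yv b s * rs hs cx c0 (sh4 \<delta>)
   else if \<forall>e\<in>set hs. yv < fst e --> k \<le> fst e then rv_free rs rv x yv s k hs cx c0 \<delta>
   else fsum (%e e'. yv < fst e' --> fst e < fst e') (%e e'. yv < fst e' --> fst e \<le> fst e')
    (%e hs'. if yv < fst e then rv_coll rs rv x yv s e hs' cx c0 \<delta> else 0) hs)"

definition rs_fin :: RSt where
 "rs_fin hs cx c0 \<delta> = (if (\<forall>e\<in>set hs. a < clk e) & (\<forall>e\<in>set cx. a < fst e) & (\<forall>e\<in>set c0. a < fst e)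
   then prod_list (map (%e. phH (fst (snd (snd e))) a (fst e) (fst (snd e))) hs) else 0)"

text \<open>\<open>n\<close> counts the steps before the last one, and the last step, which enters
  \<open>Done\<close>, is built into \<open>rs_fin\<close>. Hence the shift by one against
  \<open>fR\<close>.\<close>

fun RR :: "nat => RSt \<times> RVt" where
 "RR 0 = (rs_fin, %x yv s k hs cx c0 \<delta>. 0)"
| "RR (Suc n) = (rs_step (snd (RR n)), rv_step (fst (RR n)) (snd (RR n)))"

definition measRS where "measRS rs \<longleftrightarrow> (%(hs, cx, c0, \<delta>). rs hs cx c0 \<delta> :: ennreal) \<in> borel_measurable (listM hsE >< listM cxE >< listM c0E >< seqM)"
definition measRV where "measRV rv \<longleftrightarrow> (%(x, y, s, k, hs, cx, c0, \<delta>). rv x y s k hs cx c0 \<delta> :: ennreal) \<in>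
  borel_measurable (borel >< borel >< intM >< borel >< listM hsE >< listM cxE >< listM c0E >< seqM)"

lemmas measRS_raw = meas4[OF measRS_def[THEN iffD1]]
lemmas measRV_raw = meas8[OF measRV_def[THEN iffD1]]

lemma rs_step_meas:
 assumes "measRV rv" shows "measRS (rs_step rv)"
proof -
 note [measurable (raw)] = measRV_raw[OF assms]
 have 1: "(%(e, hs, cx, c0, \<delta>). sX rv e hs cx c0 \<delta>) \<in> borel_measurable (cxE >< listM hsE >< listM cxE >< listM c0E >< seqM)"
  unfolding sX_def by measurable
 have 2: "(%(e, hs, cx, c0, \<delta>). s0 rv e hs cx c0 \<delta>) \<in> borel_measurable (c0E >< listM hsE >< listM cxE >< listM c0E >< seqM)"
  unfolding s0_def by measurable
 have 3: "(%(e, hs, cx, c0, \<delta>). sH rv e hs cx c0 \<delta>) \<in> borel_measurable (hsE >< listM hsE >< listM cxE >< listM c0E >< seqM)"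
  unfolding sH_def Let_def by measurable
 note [measurable (raw)] = meas5[OF 1] meas5[OF 2] meas5[OF 3]
 show ?thesis unfolding measRS_def rs_step_def by measurable
qed

lemma rv_free_meas:
 assumes "measRS rs" "measRV rv" shows "measRV (rv_free rs rv)"
proof -
 note [measurable (raw)] = measRS_raw[OF assms(1)] measRV_raw[OF assms(2)]
 show ?thesis unfolding measRV_def rv_free_def Let_def by measurable
qed

lemma rv_coll_meas:
 assumes "measRS rs" "measRV rv"
 shows "(%(x, y, s, e, hs, cx, c0, \<delta>). rv_coll rs rv x y s e hs cx c0 \<delta>) \<in>
  borel_measurable (borel >< borel >< intM >< hsE >< listM hsE >< listM cxE >< listM c0E >< seqM)"
proof -
 note [measurable (raw)] = measRS_raw[OF assms(1)] measRV_raw[OF assms(2)]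
 show ?thesis unfolding rv_coll_def Let_def by measurable
qed

lemma rv_step_meas:
 assumes "measRS rs" "measRV rv" shows "measRV (rv_step rs rv)"
proof -
 note [measurable (raw)] = measRS_raw[OF assms(1)] measRV_raw[OF rv_free_meas[OF assms]] meas8[OF rv_coll_meas[OF assms]]
 show ?thesis unfolding measRV_def rv_step_def by measurable
qed

lemma RR_meas: "measRS (fst (RR n))" "measRV (snd (RR n))"
proof (induction n)
 case 0
 show "measRS (fst (RR 0))" unfolding RR.simps fst_conv measRS_def rs_fin_def by measurable
 show "measRV (snd (RR 0))" unfolding RR.simps snd_conv measRV_def by measurable
next
 case (Suc n)
 show "measRS (fst (RR (Suc n)))" "measRV (snd (RR (Suc n)))"
  unfolding RR.simps fst_conv snd_conv by (intro rs_step_meas rv_step_meas Suc)+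
qed

end

definition av :: "seg set => seg set => ennreal" where
 "av B F = (if F \<inter> B = {} then 1 else 0)"

lemma av_empty [simp]: "av B {} = 1" by (simp add: av_def)
lemma av_Un: "av B (F \<union> G) = av B F * av B G" by (auto simp: av_def)

lemma av_UN: "av B (\<Union>e\<in>set xs. f e) = prod_list (map (%e. av B (f e)) xs)"
 by (induction xs) (auto simp: av_Un)

definition dl :: "(nat => real) => nat => nat => real" where
 "dl \<omega> i = (%k. ustr \<omega> 3 (i + k))"

lemma sh4_dl: "sh4 (dl \<omega> i) = dl \<omega> (i + 4)"
 by (auto simp: sh4_def dl_def add_ac)

lemma sq_dl: "sq (dl \<omega> i) j = ustr \<omega> 3 (i + j)"
 by (auto simp: sq_def dl_def)

text \<open>Only runs that enter \<open>Done\<close> after exactly \<open>n\<close> steps count, so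
  the contributions of different \<open>n\<close> never overlap and can be summed.\<close>

primrec fR :: "pks_params => seg set => nat => (nat => real) => pks_cfg => ennreal" where
 "fR P B 0 \<omega> c = (if cfg_mode c = Done then av B (cfg_out c) else 0)"
| "fR P B (Suc n) \<omega> c = (if cfg_mode c = Done then 0 else fR P B n \<omega> (pks_step P \<omega> c))"

locale pks_alg_ind = pks_alg +
 fixes B :: "seg set"
 assumes phi_ind: "phi x0 y0 x1 y1 s = indicator (- B) ((x0, y0), (x1, y1), s)"
begin

lemma av_emitH: "av B (emitH x0 x1 y s) = phH x0 x1 y s"
 by (auto simp: av_def emitH_def phH_def phi_ind)

lemma av_emitV: "av B (emitV x y0 y1 s) = phV x y0 y1 s"
 by (auto simp: av_def emitV_def phV_def phi_ind)

definition times :: "pks_cfg => real list" where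
 "times c = map fst (cfg_cx c) @ map fst (cfg_c0 c) @ map clk (cfg_hs c)"
definition tmin :: "pks_cfg => real" where
 "tmin c = (if times c = [] then a + 1 else Min (set (times c)))"

lemma tmin_gt: "a < tmin c \<longleftrightarrow> (\<forall>e\<in>set (cfg_hs c). a < clk e) & (\<forall>e\<in>set (cfg_cx c). a < fst e) & (\<forall>e\<in>set (cfg_c0 c). a < fst e)"
proof (cases "times c = []")
 case True
 then show ?thesis by (auto simp: tmin_def times_def)
next
 case False
 then have "a < tmin c \<longleftrightarrow> (\<forall>t\<in>set (times c). a < t)" by (simp add: tmin_def)
 then show ?thesis by (auto simp: times_def)
qed

lemma tmin_le:
 "e \<in> set (cfg_cx c) ==> tmin c \<le> fst e" "e0 \<in> set (cfg_c0 c) ==> tmin c \<le> fst e0" "eh \<in> set (cfg_hs c) ==> tmin c \<le> clk eh"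
 by (auto simp: tmin_def times_def)

lemma tmin_in: "\<not> a < tmin c ==> tmin c \<in> set (times c)"
 unfolding tmin_def by (cases "times c = []") (auto simp del: set_append)

lemma pks_step_sweep:
 assumes "cfg_mode c = Sweep"
 shows "pks_step P \<omega> c =
  (let t = tmin c; d = (%j. sq (dl \<omega> (cfg_idx c)) j); c' = c\<lparr>cfg_idx := cfg_idx c + 4\<rparr> in
  if a < t then c'\<lparr>cfg_mode := Done, cfg_hs := [],
    cfg_out := cfg_out c \<union> (\<Union>e\<in>set (cfg_hs c). emitH (fst (snd (snd e))) a (fst e) (fst (snd e)))\<rparr>
  else case find (%e. fst e = t) (cfg_cx c) of
   Some e => c'\<lparr>cfg_mode := Vert (fst e) 0 (snd e) (clock_after 0 (rV P (snd e)) (d 0) b), cfg_cx := remove1 e (cfg_cx c)\<rparr>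
  | None => (case find (%e. fst e = t) (cfg_c0 c) of
   Some e => c'\<lparr>cfg_mode := Vert (fst e) (fst (snd e)) (- snd (snd e)) (clock_after (fst (snd e)) (rV P (- snd (snd e))) (d 0) b),
     cfg_hs := cfg_hs c @ [(fst (snd e), snd (snd e), fst e, clock_after (fst e) (rH P (snd (snd e))) (d 1) a)],
     cfg_c0 := remove1 e (cfg_c0 c)\<rparr>
  | None => (case find (%e. clk e = t) (cfg_hs c) of
   Some (y, s, x0, k) =>
    (if d 0 * rH P s < lamH P s then
     (let T = sample_Z (fker P s) (d 1) in
      c'\<lparr>cfg_mode := Vert k y (s - T) (clock_after y (rV P (s - T)) (d 2) b),
       cfg_hs := remove1 (y, s, x0, k) (cfg_hs c) @ [(y, T, k, clock_after k (rH P T) (d 3) a)],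
       cfg_out := cfg_out c \<union> emitH x0 k y s\<rparr>)
    else
      c'\<lparr>cfg_mode := Vert k y s (clock_after y (rV P s) (d 2) b),
       cfg_hs := remove1 (y, s, x0, k) (cfg_hs c),
       cfg_out := cfg_out c \<union> emitH x0 k y s\<rparr>)
  | None => c'\<lparr>cfg_mode := Done\<rparr>)))"
 unfolding pks_step_def Let_def assms md.case tmin_def times_def sq_dl split_beta' prod.collapse
 by (rule refl)

lemma rs_step_X:
 assumes "\<not> a < tmin c" "find (%e. fst e = tmin c) (cfg_cx c) = Some e"
 shows "rs_step rv (cfg_hs c) (cfg_cx c) (cfg_c0 c) \<delta> = sX rv e (cfg_hs c) (remove1 e (cfg_cx c)) (cfg_c0 c) \<delta>"
proof -
 have e: "e \<in> set (cfg_cx c)" "fst e = tmin c" using assms(2) by (auto simp: find_Some_iff)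
 show ?thesis unfolding rs_step_def
  by (subst fsum_find[OF assms(2), where p="%_. True"], simp, use tmin_le in simp, simp, simp, simp,
    subst fsum_0, use e tmin_le in fastforce, subst fsum_0, use e tmin_le in fastforce)
    (use e tmin_le assms(1) in auto)
qed

lemma rs_step_0:
 assumes "\<not> a < tmin c" "find (%e. fst e = tmin c) (cfg_cx c) = None" "find (%e. fst e = tmin c) (cfg_c0 c) = Some e"
 shows "rs_step rv (cfg_hs c) (cfg_cx c) (cfg_c0 c) \<delta> = s0 rv e (cfg_hs c) (cfg_cx c) (remove1 e (cfg_c0 c)) \<delta>"
proof -
 have e: "e \<in> set (cfg_c0 c)" "fst e = tmin c" using assms(3) by (auto simp: find_Some_iff)
 have x: "tmin c < fst e'" if "e' \<in> set (cfg_cx c)" for e'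
  using assms(2)[unfolded find_None_iff] tmin_le(1)[OF that] that by (metis less_eq_real_def)
 show ?thesis unfolding rs_step_def
  by (subst fsum_0, use e x in fastforce,
    subst fsum_find[OF assms(3), where p="%_. True"], simp, use tmin_le in simp, simp, simp, simp,
    subst fsum_0, use e tmin_le in fastforce)
    (use e x tmin_le assms(1) in auto)
qed

lemma rs_step_H:
 assumes "\<not> a < tmin c" "find (%e. fst e = tmin c) (cfg_cx c) = None" "find (%e. fst e = tmin c) (cfg_c0 c) = None"
  "find (%e. clk e = tmin c) (cfg_hs c) = Some e"
 shows "rs_step rv (cfg_hs c) (cfg_cx c) (cfg_c0 c) \<delta> = sH rv e (remove1 e (cfg_hs c)) (cfg_cx c) (cfg_c0 c) \<delta>"
proof -
 have e: "e \<in> set (cfg_hs c)" "clk e = tmin c" using assms(4) by (auto simp: find_Some_iff)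
 have x: "tmin c < fst e'" if "e' \<in> set (cfg_cx c)" for e'
  using assms(2)[unfolded find_None_iff] tmin_le(1)[OF that] that by (metis less_eq_real_def)
 have x0: "tmin c < fst e'" if "e' \<in> set (cfg_c0 c)" for e'
  using assms(3)[unfolded find_None_iff] tmin_le(2)[OF that] that by (metis less_eq_real_def)
 show ?thesis unfolding rs_step_def
  by (subst fsum_0, use e x in fastforce, subst fsum_0, use e x0 in fastforce,
    subst fsum_find[OF assms(4), where p="%_. True"], simp, use tmin_le in simp, simp, simp, simp)
    (use e x x0 tmin_le assms(1) in auto)
qed

lemma tmin_find:
 assumes "\<not> a < tmin c" "find (%e. fst e = tmin c) (cfg_cx c) = None" "find (%e. fst e = tmin c) (cfg_c0 c) = None"
 obtains e where "find (%e. clk e = tmin c) (cfg_hs c) = Some e"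
proof -
 have "find (%e. clk e = tmin c) (cfg_hs c) ~= None"
  using tmin_in[OF assms(1)] assms(2,3) unfolding times_def find_None_iff set_append set_map by (elim UnE imageE; metis)
 then show ?thesis using that by auto
qed

definition ynext :: "real => (real \<times> int \<times> real \<times> real) list => real" where
 "ynext yv hs = (let above = filter (%e. yv < fst e) hs in if above = [] then b + 1 else Min (set (map fst above)))"

lemma ynext_cases:
 "(\<forall>e\<in>set hs. \<not> yv < fst e) & ynext yv hs = b + 1 \<or>
  (\<exists>e\<in>set hs. yv < fst e & fst e = ynext yv hs) & (\<forall>e\<in>set hs. yv < fst e --> ynext yv hs \<le> fst e)"
proof (cases "filter (%e. yv < fst e) hs = []")
 case True
 then show ?thesis by (auto simp: ynext_def filter_empty_conv)
next
 case False
 then have "ynext yv hs = Min (fst ` set (filter (%e. yv < fst e) hs))" by (simp add: ynext_def Let_def)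
 moreover have "Min (fst ` set (filter (%e. yv < fst e) hs)) \<in> fst ` set (filter (%e. yv < fst e) hs)"
  using False by (intro Min_in) (simp_all del: set_filter)
 moreover have "Min (fst ` set (filter (%e. yv < fst e) hs)) \<le> fst e" if "e \<in> set hs" "yv < fst e" for e
  using that by (intro Min_le) auto
 ultimately show ?thesis by fastforce
qed

lemma pks_step_vert:
 assumes "cfg_mode c = Vert x yv s k"
 shows "pks_step P \<omega> c =
  (let yn = ynext yv (cfg_hs c); d = (%j. sq (dl \<omega> (cfg_idx c)) j); c' = c\<lparr>cfg_idx := cfg_idx c + 4\<rparr>; hs = cfg_hs c; out = cfg_out c in
  if b < min k yn then c'\<lparr>cfg_mode := Sweep, cfg_out := out \<union> emitV x yv b s\<rparr>
  else if k \<le> yn then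
        (if d 0 * rV P s < lamV P s then
         (let T = sample_Z (fker P s) (d 1) in
          c'\<lparr>cfg_mode := Vert x k (s - T) (clock_after k (rV P (s - T)) (d 2) b),
           cfg_hs := hs @ [(k, T, x, clock_after x (rH P T) (d 3) a)],
           cfg_out := out \<union> emitV x yv k s\<rparr>)
        else
          c'\<lparr>cfg_mode := Sweep,
           cfg_hs := hs @ [(k, s, x, clock_after x (rH P s) (d 3) a)],
           cfg_out := out \<union> emitV x yv k s\<rparr>)
  else (case find (%e. fst e = yn) hs of
        None => c'\<lparr>cfg_mode := Done\<rparr>
       | Some (yh, sW, x0, kh) =>
         (let u = s + sW;
           hs0 = remove1 (yh, sW, x0, kh) hs;
           out' = out \<union> emitV x yv yh s \<union> emitH x0 x yh sW
         in if d 0 < pk_pV P u then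
            c'\<lparr>cfg_mode := Vert x yh u (clock_after yh (rV P u) (d 1) b),
             cfg_hs := hs0, cfg_out := out'\<rparr>
           else if d 0 < pk_pV P u + pk_pH P u then
            c'\<lparr>cfg_mode := Sweep,
             cfg_hs := hs0 @ [(yh, u, x, clock_after x (rH P u) (d 1) a)],
             cfg_out := out'\<rparr>
           else if u = 0 & d 0 < pk_pV P u + pk_pH P u + pk_p0 P then
            c'\<lparr>cfg_mode := Sweep, cfg_hs := hs0, cfg_out := out'\<rparr>
           else
            (let T = sample_Z (fker P u) (d 1) in
            c'\<lparr>cfg_mode := Vert x yh (u - T) (clock_after yh (rV P (u - T)) (d 2) b),
              cfg_hs := hs0 @ [(yh, T, x, clock_after x (rH P T) (d 3) a)],
              cfg_out := out'\<rparr>))))"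
proof -
 have f: "(%(y, _, _, _). yv < y) = (%e::real \<times> int \<times> real \<times> real. yv < fst e)"
  "(%(y, _, _, _). y = t) = (%e::real \<times> int \<times> real \<times> real. fst e = t)" for t
  by auto
 show ?thesis
  unfolding pks_step_def Let_def assms md.case ynext_def sq_dl f by simp
qed

lemma ynext_find:
 assumes "\<not> b < min k (ynext yv hs)" "\<not> k \<le> ynext yv hs"
 obtains e where "find (%e. fst e = ynext yv hs) hs = Some e"
proof -
 have "find (%e. fst e = ynext yv hs) hs ~= None"
 proof -
  from assms have "ynext yv hs ~= b + 1" by auto
  then show ?thesis using ynext_cases[of hs yv] unfolding find_None_iff by blast
 qed
 then show ?thesis using that by auto
qed

lemma rv_step_cases:
 "b < min k (ynext yv hs) ==> rv_step rs rv x yv s k hs cx c0 \<delta> = phV x yv b s * rs hs cx c0 (sh4 \<delta>)"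
 "\<not> b < min k (ynext yv hs) ==> k \<le> ynext yv hs ==> rv_step rs rv x yv s k hs cx c0 \<delta> = rv_free rs rv x yv s k hs cx c0 \<delta>"
 "\<not> b < min k (ynext yv hs) ==> \<not> k \<le> ynext yv hs ==> find (%e. fst e = ynext yv hs) hs = Some e ==>
   rv_step rs rv x yv s k hs cx c0 \<delta> = rv_coll rs rv x yv s e (remove1 e hs) cx c0 \<delta>"
proof -
 have 1: "b < min k (ynext yv hs) \<longleftrightarrow> b < k & (\<forall>e\<in>set hs. yv < fst e --> b < fst e)"
  using ynext_cases[of hs yv] by force
 have 2: "\<not> b < min k (ynext yv hs) ==> k \<le> ynext yv hs \<longleftrightarrow> (\<forall>e\<in>set hs. yv < fst e --> k \<le> fst e)"
  using ynext_cases[of hs yv] by force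
 show "b < min k (ynext yv hs) ==> rv_step rs rv x yv s k hs cx c0 \<delta> = phV x yv b s * rs hs cx c0 (sh4 \<delta>)"
  unfolding rv_step_def 1 by simp
 show "\<not> b < min k (ynext yv hs) ==> k \<le> ynext yv hs ==> rv_step rs rv x yv s k hs cx c0 \<delta> = rv_free rs rv x yv s k hs cx c0 \<delta>"
  unfolding rv_step_def 1[symmetric] using 2 by simp
 assume *: "\<not> b < min k (ynext yv hs)" "\<not> k \<le> ynext yv hs" and fd: "find (%e. fst e = ynext yv hs) hs = Some e"
 have yn: "yv < ynext yv hs" "\<forall>e\<in>set hs. yv < fst e --> ynext yv hs \<le> fst e"
  using ynext_cases[of hs yv] * by auto
 have e: "fst e = ynext yv hs" using fd by (auto simp: find_Some_iff)
 have F: "fsum (%e e'. yv < fst e' --> fst e < fst e') (%e e'. yv < fst e' --> fst e \<le> fst e')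
    (%e hs'. if yv < fst e then rv_coll rs rv x yv s e hs' cx c0 \<delta> else 0) hs
   = (if yv < fst e then rv_coll rs rv x yv s e (remove1 e hs) cx c0 \<delta> else 0)"
  by (rule fsum_find[OF fd, where p="%e. yv < fst e"]) (use yn in auto)
 show "rv_step rs rv x yv s k hs cx c0 \<delta> = rv_coll rs rv x yv s e (remove1 e hs) cx c0 \<delta>"
  unfolding rv_step_def 1[symmetric]
  by (subst if_not_P, rule *(1), subst if_not_P, use 2 * in blast) (use F yn e in simp)
qed

text \<open>Every branch of the simulation is matched with one summand of \<open>rs_step\<close> or
  one case of \<open>rv_step\<close>. What the step emits is joined to \<open>cfg_out\<close>, and
  since \<open>av\<close> of a union is a product, it contributes the factor \<open>phH\<close> or
  \<open>phV\<close> of that branch.\<close>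

lemma fR_RR:
 "cfg_mode c = Sweep ==> fR P B (Suc n) \<omega> c = av B (cfg_out c) * fst (RR n) (cfg_hs c) (cfg_cx c) (cfg_c0 c) (dl \<omega> (cfg_idx c))"
 "cfg_mode c = Vert x yv s k ==> fR P B (Suc n) \<omega> c = av B (cfg_out c) * snd (RR n) x yv s k (cfg_hs c) (cfg_cx c) (cfg_c0 c) (dl \<omega> (cfg_idx c))"
proof -
 have "(cfg_mode c = Sweep --> fR P B (Suc n) \<omega> c = av B (cfg_out c) * fst (RR n) (cfg_hs c) (cfg_cx c) (cfg_c0 c) (dl \<omega> (cfg_idx c)))
  & (\<forall>x yv s k. cfg_mode c = Vert x yv s k --> fR P B (Suc n) \<omega> c = av B (cfg_out c) * snd (RR n) x yv s k (cfg_hs c) (cfg_cx c) (cfg_c0 c) (dl \<omega> (cfg_idx c)))"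
 proof (induction n arbitrary: c)
  case 0
  have sw: "fR P B (Suc 0) \<omega> c = av B (cfg_out c) * fst (RR 0) (cfg_hs c) (cfg_cx c) (cfg_c0 c) (dl \<omega> (cfg_idx c))"
   if m: "cfg_mode c = Sweep"
  proof (cases "a < tmin c")
   case True
   then show ?thesis using tmin_gt[of c]
    by (simp add: m pks_step_sweep[OF m] Let_def av_Un av_UN av_emitH rs_fin_def)
  next
   case False
   then have "rs_fin (cfg_hs c) (cfg_cx c) (cfg_c0 c) (dl \<omega> (cfg_idx c)) = 0"
    using tmin_gt[of c] by (auto simp: rs_fin_def)
   \<comment> \<open>The fallback branch that sets \<open>Done\<close> is unreachable: if some event
     is not beyond \<open>a\<close>, one of the three searches succeeds.\<close>
   moreover have "cfg_mode (pks_step P \<omega> c) ~= Done"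
   proof (cases "find (%e. fst e = tmin c) (cfg_cx c)")
    case cN: None
    show ?thesis
    proof (cases "find (%e. fst e = tmin c) (cfg_c0 c)")
     case None
     obtain e where "find (%e. clk e = tmin c) (cfg_hs c) = Some e" using tmin_find[OF False cN None] by blast
     moreover obtain y s x0 k where "e = (y, s, x0, k)" by (cases e) auto
     ultimately show ?thesis using False cN None by (simp add: pks_step_sweep[OF m] Let_def)
    qed (use False cN in \<open>simp add: pks_step_sweep[OF m] Let_def\<close>)
   qed (use False in \<open>simp add: pks_step_sweep[OF m] Let_def\<close>)
   ultimately show ?thesis by (simp add: m)
  qed
  have ve: "fR P B (Suc 0) \<omega> c = av B (cfg_out c) * snd (RR 0) x yv s k (cfg_hs c) (cfg_cx c) (cfg_c0 c) (dl \<omega> (cfg_idx c))"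
   if m: "cfg_mode c = Vert x yv s k" for x yv s k
  proof -
   have "cfg_mode (pks_step P \<omega> c) ~= Done"
   proof (cases "b < min k (ynext yv (cfg_hs c)) \<or> k \<le> ynext yv (cfg_hs c)")
    case False
    obtain e where "find (%e. fst e = ynext yv (cfg_hs c)) (cfg_hs c) = Some e" using ynext_find[of k yv "cfg_hs c"] False by blast
    moreover obtain yh sW x0 kh where "e = (yh, sW, x0, kh)" by (cases e) auto
    ultimately show ?thesis using False by (simp add: pks_step_vert[OF m] Let_def)
   qed (auto simp: pks_step_vert[OF m] Let_def)
   then show ?thesis by (simp add: m)
  qed
  show ?case using sw ve by blast
 next
  case (Suc n)
  have IHs: "cfg_mode c = Sweep ==> fR P B (Suc n) \<omega> c = av B (cfg_out c) * fst (RR n) (cfg_hs c) (cfg_cx c) (cfg_c0 c) (dl \<omega> (cfg_idx c))"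
   and IHv: "cfg_mode c = Vert x yv s k ==> fR P B (Suc n) \<omega> c = av B (cfg_out c) * snd (RR n) x yv s k (cfg_hs c) (cfg_cx c) (cfg_c0 c) (dl \<omega> (cfg_idx c))"
   for c x yv s k using Suc by blast+
  have un: "fR P B (Suc (Suc n)) \<omega> c = fR P B (Suc n) \<omega> (pks_step P \<omega> c)" if "cfg_mode c ~= Done"
   using that by simp
  have sw: "fR P B (Suc (Suc n)) \<omega> c = av B (cfg_out c) * fst (RR (Suc n)) (cfg_hs c) (cfg_cx c) (cfg_c0 c) (dl \<omega> (cfg_idx c))"
   if m: "cfg_mode c = Sweep"
  proof (cases "a < tmin c")
   case True
   then have "rs_step rv (cfg_hs c) (cfg_cx c) (cfg_c0 c) \<delta> = 0" for rv \<delta>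
    unfolding tmin_gt rs_step_def
    by (subst fsum_0, fastforce, subst fsum_0, fastforce, subst fsum_0, fastforce) simp
   moreover have "cfg_mode (pks_step P \<omega> c) = Done" using True by (simp add: pks_step_sweep[OF m] Let_def)
   ultimately show ?thesis by (simp add: m)
  next
   case nt: False
   show ?thesis
   proof (cases "find (%e. fst e = tmin c) (cfg_cx c)")
    case (Some e)
    show ?thesis
     using nt Some by (subst un, simp add: m, subst IHv, simp add: pks_step_sweep[OF m] Let_def)
      (simp add: pks_step_sweep[OF m] Let_def rs_step_X[OF nt Some] sX_def sh4_dl sq_dl)
   next
    case cN: None
    show ?thesis
    proof (cases "find (%e. fst e = tmin c) (cfg_c0 c)")
     case (Some e)
     show ?thesis
      using nt cN Some by (subst un, simp add: m, subst IHv, simp add: pks_step_sweep[OF m] Let_def)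
       (simp add: pks_step_sweep[OF m] Let_def rs_step_0[OF nt cN Some] s0_def sh4_dl sq_dl split_beta')
    next
     case c0N: None
     obtain e where e: "find (%e. clk e = tmin c) (cfg_hs c) = Some e" using tmin_find[OF nt cN c0N] by blast
     obtain y s x0 k where ee: "e = (y, s, x0, k)" by (cases e) auto
     show ?thesis
     proof (cases "sq (dl \<omega> (cfg_idx c)) 0 * rH P s < lamH P s")
      case True
      then show ?thesis
       using nt cN c0N e by (subst un, simp add: m, subst IHv, simp add: pks_step_sweep[OF m] Let_def ee)
        (simp add: pks_step_sweep[OF m] Let_def rs_step_H[OF nt cN c0N e] sH_def sh4_dl ee av_Un av_emitH mult.assoc)
     next
      case False
      then show ?thesis
       using nt cN c0N e by (subst un, simp add: m, subst IHv, simp add: pks_step_sweep[OF m] Let_def ee)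
        (simp add: pks_step_sweep[OF m] Let_def rs_step_H[OF nt cN c0N e] sH_def sh4_dl ee av_Un av_emitH mult.assoc)
     qed
    qed
   qed
  qed
  have ve: "fR P B (Suc (Suc n)) \<omega> c = av B (cfg_out c) * snd (RR (Suc n)) x yv s k (cfg_hs c) (cfg_cx c) (cfg_c0 c) (dl \<omega> (cfg_idx c))"
   if m: "cfg_mode c = Vert x yv s k" for x yv s k
  proof (cases "b < min k (ynext yv (cfg_hs c))")
   case b: True
   have rv: "snd (RR (Suc n)) x yv s k (cfg_hs c) (cfg_cx c) (cfg_c0 c) (dl \<omega> (cfg_idx c))
    = phV x yv b s * fst (RR n) (cfg_hs c) (cfg_cx c) (cfg_c0 c) (sh4 (dl \<omega> (cfg_idx c)))"
    unfolding RR.simps snd_conv by (rule rv_step_cases(1)[OF b])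
   show ?thesis unfolding rv using b
    by (subst un, simp add: m, subst IHs, simp add: pks_step_vert[OF m] Let_def)
      (simp add: pks_step_vert[OF m] Let_def sh4_dl av_Un av_emitV mult.assoc)
  next
   case nb: False
   show ?thesis
   proof (cases "k \<le> ynext yv (cfg_hs c)")
    case kb: True
    have rv: "snd (RR (Suc n)) x yv s k (cfg_hs c) (cfg_cx c) (cfg_c0 c) (dl \<omega> (cfg_idx c))
     = rv_free (fst (RR n)) (snd (RR n)) x yv s k (cfg_hs c) (cfg_cx c) (cfg_c0 c) (dl \<omega> (cfg_idx c))"
     unfolding RR.simps snd_conv by (rule rv_step_cases(2)[OF nb kb])
    show ?thesis
    proof (cases "sq (dl \<omega> (cfg_idx c)) 0 * rV P s < lamV P s")
     case True
     then show ?thesis unfolding rv using nb kb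
      by (subst un, simp add: m, subst IHv, simp add: pks_step_vert[OF m] Let_def)
        (simp add: pks_step_vert[OF m] Let_def sh4_dl av_Un av_emitV mult.assoc rv_free_def)
    next
     case False
     then show ?thesis unfolding rv using nb kb
      by (subst un, simp add: m, subst IHs, simp add: pks_step_vert[OF m] Let_def)
        (simp add: pks_step_vert[OF m] Let_def sh4_dl av_Un av_emitV mult.assoc rv_free_def)
    qed
   next
    case nk: False
    obtain e where e: "find (%e. fst e = ynext yv (cfg_hs c)) (cfg_hs c) = Some e" using ynext_find[OF nb nk] by blast
    obtain yh sW x0 kh where ee: "e = (yh, sW, x0, kh)" by (cases e) auto
    have rv: "snd (RR (Suc n)) x yv s k (cfg_hs c) (cfg_cx c) (cfg_c0 c) (dl \<omega> (cfg_idx c))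
     = rv_coll (fst (RR n)) (snd (RR n)) x yv s e (remove1 e (cfg_hs c)) (cfg_cx c) (cfg_c0 c) (dl \<omega> (cfg_idx c))"
     unfolding RR.simps snd_conv by (rule rv_step_cases(3)[OF nb nk e])
    let ?d = "sq (dl \<omega> (cfg_idx c)) 0" and ?u = "s + sW"
    consider (1) "?d < pk_pV P ?u" | (2) "\<not> ?d < pk_pV P ?u" "?d < pk_pV P ?u + pk_pH P ?u"
     | (3) "\<not> ?d < pk_pV P ?u" "\<not> ?d < pk_pV P ?u + pk_pH P ?u" "?u = 0 & ?d < pk_pV P ?u + pk_pH P ?u + pk_p0 P"
     | (4) "\<not> ?d < pk_pV P ?u" "\<not> ?d < pk_pV P ?u + pk_pH P ?u" "?u ~= 0"
     | (5) "\<not> ?d < pk_pV P ?u" "\<not> ?d < pk_pV P ?u + pk_pH P ?u" "?u = 0" "\<not> ?d < pk_pV P ?u + pk_pH P ?u + pk_p0 P"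
     by blast
    then show ?thesis
    proof cases
     case 1
     then show ?thesis unfolding rv using nb nk e
      by (subst un, simp add: m, subst IHv, simp add: pks_step_vert[OF m] Let_def ee)
        (simp add: pks_step_vert[OF m] Let_def sh4_dl av_Un av_emitV av_emitH mult.assoc rv_coll_def ee)
    next
     case 2
     then show ?thesis unfolding rv using nb nk e
      by (subst un, simp add: m, subst IHs, simp add: pks_step_vert[OF m] Let_def ee)
        (simp add: pks_step_vert[OF m] Let_def sh4_dl av_Un av_emitV av_emitH mult.assoc rv_coll_def ee)
    next
     case 3
     have u: "s + sW = 0" using 3 by blast
     show ?thesis unfolding rv using nb nk e 3(1,2) 3(3)[THEN conjunct2]
      by (subst un, simp add: m, subst IHs, simp add: pks_step_vert[OF m] Let_def ee u)
        (simp add: pks_step_vert[OF m] Let_def sh4_dl av_Un av_emitV av_emitH mult.assoc rv_coll_def ee u)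
    next
     case 4
     then show ?thesis unfolding rv using nb nk e
      by (subst un, simp add: m, subst IHv, simp add: pks_step_vert[OF m] Let_def ee)
        (simp add: pks_step_vert[OF m] Let_def sh4_dl av_Un av_emitV av_emitH mult.assoc rv_coll_def ee)
    next
     case 5
     show ?thesis unfolding rv using nb nk e 5(1,2,4)
      by (subst un, simp add: m, subst IHv, simp add: pks_step_vert[OF m] Let_def ee 5(3))
        (simp add: pks_step_vert[OF m] Let_def sh4_dl av_Un av_emitV av_emitH mult.assoc rv_coll_def ee 5(3))
    qed
   qed
  qed
  show ?case using sw ve by blast
 qed
 then show "cfg_mode c = Sweep ==> fR P B (Suc n) \<omega> c = av B (cfg_out c) * fst (RR n) (cfg_hs c) (cfg_cx c) (cfg_c0 c) (dl \<omega> (cfg_idx c))"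
  "cfg_mode c = Vert x yv s k ==> fR P B (Suc n) \<omega> c = av B (cfg_out c) * snd (RR n) x yv s k (cfg_hs c) (cfg_cx c) (cfg_c0 c) (dl \<omega> (cfg_idx c))"
  by blast+
qed

end

section \<open>Averages over the uniform source\<close>

declare emeasure_uniform_measure [simp del]

lemma ennreal_divide_1 [simp]: "(x::ennreal) / 1 = x"
 by (simp add: divide_ennreal_def)

lemma nn_unif: "f \<in> borel_measurable borel ==> (nint unifM (%u. f u)) = (nint lborel (%u. f u * indicator {0..1} u))"
 by (subst nn_integral_uniform_measure) auto

lemma prob_unifM: "prob_space unifM"
 by (rule prob_space_uniform_measure) auto

lemma AE_unifM: "AE u in unifM. 0 \<le> u & u < 1"
proof -
 have "AE u in lborel. u ~= (1::real)" by (rule AE_lborel_singleton)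
 then show ?thesis by (subst AE_uniform_measure) auto
qed

lemma emeasure_unifM: "0 \<le> c ==> c \<le> d ==> d \<le> 1 ==> emeasure unifM {c..<d} = ennreal (d - c)"
proof -
 assume a: "0 \<le> c" "c \<le> d" "d \<le> 1"
 then have "{0..1} \<inter> {c..<d} = {c..<d}" by auto
 then show ?thesis using a by (subst emeasure_uniform_measure) auto
qed

text \<open>Inversion of the distribution function: the least index whose partial sum exceeds
  \<open>u * W\<close> equals \<open>n\<close> on an interval of length \<open>w n / W\<close>. At
  \<open>u = 1\<close> no partial sum exceeds \<open>W\<close>, but this point is null.\<close>

lemma inverse_cdf:
 fixes w :: "nat => real" and F :: "nat => ennreal"
 assumes w: "\<And>n. 0 \<le> w n" and s: "w sums W" and W: "0 < W"
  and N: "\<And>u. (\<exists>n. u * W < (\<Sum>k\<le>n. w k)) ==> G u = F (LEAST n. u * W < (\<Sum>k\<le>n. w k))"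
 shows "(nint unifM (%u. G u)) = (\<Sum>n. ennreal (w n / W) * F n)"
proof -
 define S where "S n = (\<Sum>k<n. w k)" for n
 have S_le: "S n \<le> W" for n unfolding S_def using sum_le_suminf[of w "{..<n}"] s w by (simp add: sums_iff)
 have S_mono: "m \<le> n ==> S m \<le> S n" for m n unfolding S_def using w by (intro sum_mono2) auto
 have S0: "0 \<le> S n" for n unfolding S_def using w by (intro sum_nonneg) auto
 have SS: "(\<Sum>k\<le>n. w k) = S (Suc n)" for n by (simp add: S_def lessThan_Suc_atMost)
 have "AE u in unifM. G u = (\<Sum>n. F n * indicator {S n / W..<S (Suc n) / W} u)"
  using AE_unifM
 proof eventually_elim
  case (elim u)
  have "u * W < W" using elim W by auto
  moreover have "S \<longlonglongrightarrow> W" using s by (simp add: sums_def S_def[abs_def])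
  ultimately have "eventually (%n. u * W < S n) sequentially" by (rule order_tendstoD(1)[rotated])
  then obtain n0 where "\<forall>n\<ge>n0. u * W < S n" unfolding eventually_sequentially by blast
  then have "u * W < S (Suc n0)" by simp
  then have ex: "\<exists>n. u * W < (\<Sum>k\<le>n. w k)" unfolding SS by blast
  define n where "n = (LEAST n. u * W < (\<Sum>k\<le>n. w k))"
  have n: "u * W < S (Suc n)" using LeastI_ex[OF ex] unfolding n_def SS .
  have n2: "S n \<le> u * W"
  proof (cases n)
   case 0 then show ?thesis using elim W by (simp add: S_def)
  next
   case (Suc m)
   then have "\<not> u * W < S (Suc m)" using not_less_Least[of m "%n. u * W < (\<Sum>k\<le>n. w k)"] unfolding n_def SS by simp
   then show ?thesis by (simp add: Suc)
  qed
  have "indicator {S m / W..<S (Suc m) / W} u = (if m = n then 1 else 0 :: ennreal)" for m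
  proof -
   have "S m / W \<le> u & u < S (Suc m) / W \<longleftrightarrow> S m \<le> u * W & u * W < S (Suc m)"
    using W by (simp add: field_simps)
   also have "... \<longleftrightarrow> m = n"
   proof
    assume m: "S m \<le> u * W & u * W < S (Suc m)"
    show "m = n"
    proof (rule ccontr)
     assume "m ~= n"
     then consider "Suc m \<le> n" | "Suc n \<le> m" by linarith
     then show False using S_mono m n n2 by cases fastforce+
    qed
   qed (use n n2 in auto)
   finally show ?thesis by (auto simp: indicator_def)
  qed
  then have "(\<Sum>m. F m * indicator {S m / W..<S (Suc m) / W} u) = (\<Sum>m. if m = n then F m else 0)"
   by (intro suminf_cong) auto
  also have "... = F n" by (subst suminf_finite[of "{n}"]) auto
  finally show ?case using N[OF ex] by (simp add: n_def)
 qed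
 then have "(nint unifM (%u. G u)) = (nint unifM (%u. (\<Sum>n. F n * indicator {S n / W..<S (Suc n) / W} u)))"
  by (rule nn_integral_cong_AE)
 also have "... = (\<Sum>n. F n * emeasure unifM {S n / W..<S (Suc n) / W})"
  by (subst nn_integral_suminf) (auto intro!: suminf_cong nn_integral_cmult_indicator)
 also have "... = (\<Sum>n. ennreal (w n / W) * F n)"
 proof (intro suminf_cong)
  fix n
  have "emeasure unifM {S n / W..<S (Suc n) / W} = ennreal (S (Suc n) / W - S n / W)"
   using S0[of n] S_le[of "Suc n"] S_mono[of n "Suc n"] W by (intro emeasure_unifM) (auto simp: field_simps)
  also have "S (Suc n) / W - S n / W = w n / W" by (simp add: S_def add_divide_distrib)
  finally show "F n * emeasure unifM {S n / W..<S (Suc n) / W} = ennreal (w n / W) * F n" by (simp add: mult.commute)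
 qed
 finally show ?thesis .
qed

lemma nn_integral_sample_Z:
 fixes w :: "int => real"
 assumes w: "\<And>n. 0 \<le> w n" and s: "w summable_on UNIV" and W: "0 < tot w"
 shows "(nint unifM (%u. F (sample_Z w u))) = (nint (count_space UNIV) (%t. ennreal (w t / tot w) * F t))"
proof -
 have bij: "bij_betw int_decode UNIV UNIV" by (rule bij_int_decode)
 have "((%n. w (int_decode n)) has_sum tot w) UNIV"
  using has_sum_infsum[OF s] has_sum_reindex_bij_betw[OF bij, of w "tot w"] by (simp add: tot_def)
 then have sums: "(%n. w (int_decode n)) sums tot w" by (rule has_sum_imp_sums)
 have "(nint unifM (%u. F (sample_Z w u))) = (\<Sum>n. ennreal (w (int_decode n) / tot w) * F (int_decode n))"
  by (rule inverse_cdf[OF _ sums W]) (auto simp: w sample_Z_def)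
 also have "... = (nint (count_space UNIV) (%n. ennreal (w (int_decode n) / tot w) * F (int_decode n)))"
  by (simp add: nn_integral_count_space_nat)
 also have "... = (nint (count_space UNIV) (%t. ennreal (w t / tot w) * F t))"
  by (rule nn_integral_bij_count_space[OF bij])
 finally show ?thesis .
qed

lemma nn_integral_poisson:
 assumes l: "0 \<le> l"
 shows "(nint unifM (%u. F (poisson_sample l u))) = (\<Sum>n. ennreal (exp (- l) * l ^ n / fact n) * F n)"
proof -
 have "(%n. exp (- l) * (l ^ n / fact n)) sums (exp (- l) * exp l)"
  using exp_converges[of l] by (intro sums_mult) (simp add: divide_inverse mult.commute scaleR_conv_of_real)
 then have s: "(%n. exp (- l) * l ^ n / fact n) sums 1" by (simp add: exp_minus_inverse mult.commute)
 show ?thesis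
  by (subst inverse_cdf[OF _ s, of _ F]) (auto simp: l poisson_sample_def)
qed

lemma unif_split:
 assumes "0 \<le> p" "p \<le> 1"
 shows "(nint unifM (%d. (if d < p then A else B))) = ennreal p * A + ennreal (1 - p) * B"
proof -
 have "(nint unifM (%d. (if d < p then A else B))) = (nint unifM (%d. A * indicator {0..<p} d + B * indicator {p..<1} d))"
  by (intro nn_integral_cong_AE, rule eventually_mono[OF AE_unifM]) (use assms in \<open>auto simp: indicator_def\<close>)
 also have "... = A * emeasure unifM {0..<p} + B * emeasure unifM {p..<1}"
  by (subst nn_integral_add) (auto simp: nn_integral_cmult_indicator)
 finally show ?thesis using assms by (simp add: emeasure_unifM mult.commute)
qed

lemma unif_split4:
 assumes "0 \<le> p1" "0 \<le> p2" "0 \<le> p3" "p1 + p2 + p3 \<le> 1"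
 shows "(nint unifM (%d. (if d < p1 then A else if d < p1 + p2 then B else if d < p1 + p2 + p3 then C else D)))
   = ennreal p1 * A + ennreal p2 * B + ennreal p3 * C + ennreal (1 - p1 - p2 - p3) * D"
proof -
 have "(nint unifM (%d. (if d < p1 then A else if d < p1 + p2 then B else if d < p1 + p2 + p3 then C else D)))
  = (nint unifM (%d. A * indicator {0..<p1} d + B * indicator {p1..<p1 + p2} d + C * indicator {p1 + p2..<p1 + p2 + p3} d
    + D * indicator {p1 + p2 + p3..<1} d))"
  by (intro nn_integral_cong_AE, rule eventually_mono[OF AE_unifM]) (use assms in \<open>auto simp: indicator_def\<close>)
 also have "... = A * emeasure unifM {0..<p1} + B * emeasure unifM {p1..<p1 + p2} + C * emeasure unifM {p1 + p2..<p1 + p2 + p3}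
    + D * emeasure unifM {p1 + p2 + p3..<1}"
  by (simp add: nn_integral_add nn_integral_cmult_indicator)
 finally show ?thesis using assms by (simp add: emeasure_unifM mult.commute diff_diff_eq add.assoc)
qed

lemma emeasure_unifM_UNIV [simp]: "emeasure unifM UNIV = 1"
 using prob_space.emeasure_space_1[OF prob_unifM] by simp

lemma unif_const: "(nint unifM (%d. c)) = c"
 by simp

text \<open>\<open>- ln (1 - u) / r\<close> is the quantile function of the exponential law of rate
  \<open>r\<close>; the density is that law shifted by \<open>x\<close>.\<close>

lemma clock_law:
 assumes r: "0 < r" and [measurable]: "F \<in> borel_measurable borel"
 shows "(nint unifM (%u. F (clock_after x r u c))) = (nint lborel (%t. ennreal (r * exp (- r * (t - x))) * indicator {x<..} t * F t))"
proof -
 interpret prob_space unifM by (rule prob_unifM)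
 define X where "X u = - ln (1 - u) / r" for u :: real
 have [measurable]: "X \<in> borel_measurable borel" unfolding X_def by measurable
 have "distributed unifM lborel X (exponential_density r)"
 proof (rule exponential_distributedI)
  show "X \<in> borel_measurable unifM" by measurable
  show "0 < r" by fact
  fix t :: real assume t: "0 \<le> t"
  have e: "exp (- t * r) \<le> 1" "0 < exp (- t * r)" using t r by (auto simp: mult_nonneg_nonneg)
  have "AE u in unifM. u \<in> {x \<in> space unifM. X x \<le> t} \<longleftrightarrow> u \<in> {0..<1 - exp (- t * r)}"
  proof -
   have "AE u in lborel. u ~= 1 - exp (- t * r)" by (rule AE_lborel_singleton)
   then have "AE u in unifM. u ~= 1 - exp (- t * r)" by (subst AE_uniform_measure) auto
   then show ?thesis using AE_unifM
   proof eventually_elim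
    case (elim u)
    have "X u \<le> t \<longleftrightarrow> - ln (1 - u) \<le> t * r" unfolding X_def by (rule pos_divide_le_eq[OF r])
    also have "... \<longleftrightarrow> - (t * r) \<le> ln (1 - u)" by linarith
    also have "... \<longleftrightarrow> exp (- (t * r)) \<le> 1 - u" using elim by (subst ln_ge_iff) auto
    also have "... \<longleftrightarrow> u < 1 - exp (- t * r)" using elim by auto
    finally show ?case using elim by auto
   qed
  qed
  then have "emeasure unifM {x \<in> space unifM. X x \<le> t} = emeasure unifM {0..<1 - exp (- t * r)}"
   by (intro emeasure_eq_AE) measurable
  also have "... = ennreal (1 - exp (- t * r))" using e by (subst emeasure_unifM) auto
  also have "... = 1 - ennreal (exp (- t * r))" using e by (simp add: ennreal_minus flip: ennreal_1)
  finally show "emeasure unifM {x \<in> space unifM. X x \<le> t} = 1 - ennreal (exp (- t * r))" .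
 qed
 then have "(nint unifM (%u. F (x + X u))) = (nint lborel (%t. ennreal (exponential_density r t) * F (x + t)))"
  by (intro distributed_nn_integral[symmetric]) measurable
 also have "... = (nint lborel (%t. ennreal (exponential_density r (- x + 1 * t)) * F (x + (- x + 1 * t))))"
  by (subst nn_integral_real_affine[of _ 1 "- x"]) auto
 also have "... = (nint lborel (%t. ennreal (r * exp (- r * (t - x))) * indicator {x<..} t * F t))"
 proof (rule nn_integral_cong_AE)
  have "AE t in lborel. t ~= x" by (rule AE_lborel_singleton)
  then show "AE t in lborel. ennreal (exponential_density r (- x + 1 * t)) * F (x + (- x + 1 * t))
    = ennreal (r * exp (- r * (t - x))) * indicator {x<..} t * F t"
   by eventually_elim (auto simp: exponential_density_def indicator_def algebra_simps)
 qed
 finally show ?thesis using r by (simp add: clock_after_def X_def)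
qed

lemma clock_zero: "(nint unifM (%u. F (clock_after x 0 u c))) = F (c + 1)"
 by (simp add: clock_after_def unif_const)

text \<open>Memorylessness without division: a clock started at \<open>x\<close> is a clock started
  at 0, restricted to ring after \<open>x\<close> and reweighted by the inverse
  \<open>exp (r * x)\<close> of the survival probability. For \<open>r = 0\<close> both sit at
  \<open>c + 1\<close>, beyond \<open>x\<close>.\<close>

lemma clock_memoryless:
 assumes r: "0 \<le> r" and x: "0 \<le> x" "x \<le> c" and [measurable]: "F \<in> borel_measurable borel"
 shows "(nint unifM (%u. F (clock_after x r u c))) =
  ennreal (exp (r * x)) * (nint unifM (%u. (if x < clock_after 0 r u c then F (clock_after 0 r u c) else 0)))"
proof (cases "r = 0")
 case True
 show ?thesis using x unfolding True
  by (simp add: clock_zero[of F] clock_zero[of "%t. if x < t then F t else 0"])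
next
 case False
 then have r: "0 < r" using assms by auto
 have "(nint unifM (%u. (if x < clock_after 0 r u c then F (clock_after 0 r u c) else 0)))
  = (nint lborel (%t. ennreal (r * exp (- r * t)) * indicator {0<..} t * (if x < t then F t else 0)))"
  by (subst clock_law[OF r, of "%t. if x < t then F t else 0"]) auto
 also have "ennreal (exp (r * x)) * ... = (nint lborel (%t. ennreal (exp (r * x)) * (ennreal (r * exp (- r * t)) * indicator {0<..} t * (if x < t then F t else 0))))"
  by (rule nn_integral_cmult[symmetric]) measurable
 also have "... = (nint lborel (%t. ennreal (r * exp (- r * (t - x))) * indicator {x<..} t * F t))"
 proof (rule nn_integral_cong)
  fix t
  have "exp (r * x) * (r * exp (- r * t)) = r * exp (- r * (t - x))"
   by (simp add: algebra_simps flip: exp_add)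
  then have "ennreal (exp (r * x)) * ennreal (r * exp (- r * t)) = ennreal (r * exp (- r * (t - x)))"
   using r by (subst ennreal_mult[symmetric]) auto
  then show "ennreal (exp (r * x)) * (ennreal (r * exp (- r * t)) * indicator {0<..} t * (if x < t then F t else 0))
   = ennreal (r * exp (- r * (t - x))) * indicator {x<..} t * F t"
   using x by (auto simp: indicator_def mult.assoc[symmetric])
 qed
 finally show ?thesis using clock_law[OF r, of F x c] by simp
qed

lemma clock_le:
 assumes r: "0 \<le> r" and c: "0 \<le> c" and [measurable]: "F \<in> borel_measurable borel"
 shows "(nint unifM (%u. (if clock_after x r u c \<le> c then F (clock_after x r u c) else 0))) =
   (nint lborel (%t. ennreal (r * exp (- r * (t - x))) * (if x < t & t \<le> c then F t else 0)))"
proof (cases "r = 0")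
 case True
 show ?thesis unfolding True by (simp add: clock_zero[of "%t. if t \<le> c then F t else 0"])
next
 case False
 then have r: "0 < r" using assms by auto
 show ?thesis
  by (subst clock_law[OF r, of "%t. if t \<le> c then F t else 0"]) (auto intro!: nn_integral_cong simp: indicator_def)
qed

lemma clock_gt:
 assumes r: "0 \<le> r" and x: "x \<le> t" "t \<le> c"
 shows "(nint unifM (%u. (if t < clock_after x r u c then A else 0))) = ennreal (exp (- r * (t - x))) * A"
proof (cases "r = 0")
 case True
 show ?thesis using x unfolding True by (simp add: clock_zero[of "%s. if t < s then A else 0"])
next
 case False
 then have r: "0 < r" using assms by auto
 have d: "1 - exp (- r * (t - x)) \<ge> 0" "exp (- r * (t - x)) > 0" using r x by auto
 have "(nint unifM (%u. (if t < clock_after x r u c then A else 0))) = (nint unifM (%u. A * indicator {1 - exp (- r * (t - x))..<1} u))"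
 proof (rule nn_integral_cong_AE)
  have "AE u in lborel. u ~= 1 - exp (- r * (t - x))" by (rule AE_lborel_singleton)
  then have "AE u in unifM. u ~= 1 - exp (- r * (t - x))" by (subst AE_uniform_measure) auto
  then show "AE u in unifM. (if t < clock_after x r u c then A else 0) = A * indicator {1 - exp (- r * (t - x))..<1} u"
   using AE_unifM
  proof eventually_elim
   case (elim u)
   have "t < clock_after x r u c \<longleftrightarrow> ln (1 - u) < - r * (t - x)" using r by (simp add: clock_after_def field_simps)
   also have "... \<longleftrightarrow> 1 - u < exp (- r * (t - x))" using elim by (metis diff_gt_0_iff_gt exp_less_cancel_iff exp_ln)
   finally show ?case using elim by (auto simp: indicator_def)
  qed
 qed
 also have "... = A * ennreal (1 - (1 - exp (- r * (t - x))))"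
  using d by (subst nn_integral_cmult_indicator) (auto simp: emeasure_unifM)
 finally show ?thesis by (simp add: mult.commute)
qed

lemma clock_AE_neq:
 assumes "0 \<le> r" "t \<le> c"
 shows "AE u in unifM. clock_after x r u c ~= t"
proof (cases "r = 0")
 case True
 then show ?thesis using assms by (auto simp: clock_after_def)
next
 case False
 then have r: "0 < r" using assms by auto
 have "AE u in lborel. u ~= 1 - exp (- r * (t - x))" by (rule AE_lborel_singleton)
 then have "AE u in unifM. u ~= 1 - exp (- r * (t - x))" by (subst AE_uniform_measure) auto
 then show ?thesis using AE_unifM
 proof eventually_elim
  case (elim u)
  show ?case
  proof
   assume "clock_after x r u c = t"
   then have "ln (1 - u) = - r * (t - x)" using r by (simp add: clock_after_def field_simps)
   then have "1 - u = exp (- r * (t - x))" using elim by (metis diff_gt_0_iff_gt exp_ln)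
   then show False using elim by auto
  qed
 qed
qed

interpretation useq: sequence_space unifM
 by (intro sequence_space.intro product_prob_space.intro product_prob_space_axioms.intro product_sigma_finite.intro
   prob_unifM prob_space_imp_sigma_finite)

lemma prob_seqM: "prob_space seqM"
 by (rule prob_space_PiM) (rule prob_unifM)

lemma seq_split1:
 assumes [measurable]: "F \<in> borel_measurable seqM"
 shows "(nint seqM (%\<delta>. F \<delta>)) = (nint unifM (%u. nint seqM (%\<delta>. F (case_nat u \<delta>))))"
proof -
 have "(nint seqM (%\<delta>. F \<delta>)) = (nint (distr (unifM >< seqM) seqM (%(s, \<omega>). case_nat s \<omega>)) (%\<delta>. F \<delta>))"
  unfolding useq.PiM_iter ..
 also have "... = (nint (unifM >< seqM) (%p. F (case_nat (fst p) (snd p))))"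
  by (subst nn_integral_distr) (auto simp: split_beta')
 also have "... = (nint unifM (%u. nint seqM (%\<delta>. F (case_nat u \<delta>))))"
  by (subst sigma_finite_measure.nn_integral_fst[OF prob_space_imp_sigma_finite[OF prob_seqM], symmetric]) auto
 finally show ?thesis .
qed

text \<open>The four uniforms read by a step are independent of each other and of the shifted stream
  that feeds the later steps.\<close>

lemma seq_split4:
 assumes F: "(%(d0, d1, d2, d3, \<delta>). F d0 d1 d2 d3 \<delta>) \<in> borel_measurable (borel >< borel >< borel >< borel >< seqM)"
 shows "(nint seqM (%\<delta>. F (sq \<delta> 0) (sq \<delta> 1) (sq \<delta> 2) (sq \<delta> 3) (sh4 \<delta>))) =
  (nint unifM (%d0. nint unifM (%d1. nint unifM (%d2. nint unifM (%d3. nint seqM (%\<delta>. F d0 d1 d2 d3 \<delta>))))))"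
proof -
 note [measurable (raw)] = meas5[OF F]
 have cn [measurable]: "case_nat u \<in> seqM \<rightarrow>\<^sub>M seqM" for u :: real
  by (rule measurable_case_nat') auto
 have e: "sh4 (case_nat d0 (case_nat d1 (case_nat d2 (case_nat d3 \<delta>)))) = \<delta>" for d0 d1 d2 d3 \<delta>
  by (auto simp: sh4_def fun_eq_iff numeral_eq_Suc)
 show ?thesis
  by (subst seq_split1, measurable, subst seq_split1, measurable, subst seq_split1, measurable, subst seq_split1, measurable)
    (simp add: sq_def e numeral_2_eq_2 numeral_3_eq_3)
qed

text \<open>The image of a sigma-finite measure may fail to be sigma-finite; a measurable left
  inverse \<open>g\<close> transports an exhausting sequence. This serves the label measures
  \<open>KL\<close>, whose total mass may be infinite.\<close>

lemma sigma_finite_distr_inv: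
 assumes "sigma_finite_measure M" "f \<in> M \<rightarrow>\<^sub>M N" "g \<in> N \<rightarrow>\<^sub>M M" "\<And>x. x \<in> space M ==> g (f x) = x"
 shows "sigma_finite_measure (distr M N f)"
proof -
 interpret M: sigma_finite_measure M by fact
 obtain A :: "nat => 'a set" where A: "range A \<subseteq> sets M" "(\<Union>i. A i) = space M" "\<And>i. emeasure M (A i) ~= \<infinity>"
  using M.sigma_finite by blast
 show ?thesis
 proof (rule sigma_finite_measure.intro, intro exI[of _ "range (%i. g -` A i \<inter> space N)"] conjI ballI)
  show "countable (range (%i. g -` A i \<inter> space N))" by simp
  show "range (%i. g -` A i \<inter> space N) \<subseteq> sets (distr M N f)" using assms(3) A by (auto simp: measurable_sets)
  show "\<Union> (range (%i. g -` A i \<inter> space N)) = space (distr M N f)"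
   using measurable_space[OF assms(3)] unfolding A(2)[symmetric] by auto
  fix B assume "B \<in> range (%i. g -` A i \<inter> space N)"
  then obtain i where B: "B = g -` A i \<inter> space N" by auto
  have Ai: "A i \<in> sets M" using A(1) by auto
  have "f -` B \<inter> space M = A i"
   using assms(4) sets.sets_into_space[OF Ai] measurable_space[OF assms(2)] by (auto simp: B subset_iff)
  then show "emeasure (distr M N f) B ~= \<infinity>"
   using A B assms(2,3) by (subst emeasure_distr) (auto simp: measurable_sets)
 qed
qed

lemma sigma_finite_countable:
 fixes M :: "'a::countable measure"
 assumes "sets M = UNIV" "\<And>x. emeasure M {x} ~= \<infinity>"
 shows "sigma_finite_measure M"
proof (rule sigma_finite_measure.intro, intro exI[of _ "range (%x. {x})"] conjI ballI)
 have "space M = UNIV" using assms(1) by (metis UNIV_I sets.sets_into_space top.extremum_uniqueI)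
 then show "\<Union> (range (%x. {x})) = space M" by auto
qed (use assms in auto)

lemma (in list_kernel) lint_sum:
 assumes "\<And>i. i \<in> I ==> F i \<in> borel_measurable (listM E)" "finite I"
 shows "lint K L (%es. \<Sum>i\<in>I. F i es) = (\<Sum>i\<in>I. lint K L (F i))"
 using assms(2,1) by (induction I rule: finite_induct) (simp_all add: lint_add)

lemma (in list_kernel) lint_fsum_out:
 assumes [measurable]: "\<And>e r. F e r \<in> borel_measurable (listM E)"
 shows "lint K L (%es. fsum Q R (%e r. F e r es) xs) = fsum Q R (%e r. lint K L (F e r)) xs"
proof -
 have eq: "lint K L (%es. if P then G es else 0) = (if P then lint K L G else 0)" for P G by simp
 show ?thesis unfolding fsum_def by (subst lint_sum; (simp only: eq | measurable | simp; fail))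
qed

lemma (in mint_space) mint_sum:
 assumes "\<And>i. i \<in> I ==> F i \<in> borel_measurable (listM E)" "finite I"
 shows "mint \<mu> (%es. \<Sum>i\<in>I. F i es) = (\<Sum>i\<in>I. mint \<mu> (F i))"
 using assms(2,1) by (induction I rule: finite_induct) (simp_all add: mint_add, simp add: mint_def)

lemma (in mint_space) mint_fsum_out:
 assumes [measurable]: "\<And>e r. F e r \<in> borel_measurable (listM E)"
 shows "mint \<mu> (%es. fsum Q R (%e r. F e r es) xs) = fsum Q R (%e r. mint \<mu> (F e r)) xs"
proof -
 have eq: "mint \<mu> (%es. if P then G es else 0) = (if P then mint \<mu> G else 0)" for P G by (simp add: mint_def)
 show ?thesis unfolding fsum_def by (subst mint_sum; (simp only: eq | measurable | simp; fail))
qed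

lemma nn_integral_fsum:
 assumes [measurable]: "\<And>e r. F e r \<in> borel_measurable M"
 shows "(nint M (%w. fsum Q R (%e r. F e r w) xs)) = fsum Q R (%e r. nint M (%w. F e r w)) xs"
proof -
 have eq: "(nint M (%w. (if P then G w else 0))) = (if P then (nint M (%w. G w)) else 0)" for P G by simp
 show ?thesis unfolding fsum_def by (subst nn_integral_sum; (simp only: eq | measurable | simp; fail))
qed

lemma (in list_kernel) lint_nth_rem:
 assumes "i < length L" and [measurable]: "F \<in> borel_measurable (listM E)" "Measurable.pred E p"
 shows "lint K L (%es. if p (es ! i) then F (rem i es) else 0) = (nint (K (L ! i)) (%e. (if p e then 1 else 0))) * lint K (rem i L) F"
 using assms(1,2)
proof (induction L arbitrary: i F)
 case (Cons l L)
 note [measurable] = Cons.prems(2)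
 show ?case
 proof (cases i)
  case 0
  have "lint K L (%es. if p e then F es else 0) = (if p e then 1 else 0) * lint K L F" for e by simp
  then show ?thesis unfolding 0 by (simp add: nn_integral_multc cong: if_cong)
 next
  case (Suc j)
  have "lint K L (%es. if p (es ! j) then F (e # rem j es) else 0) = (nint (K (L ! j)) (%e. (if p e then 1 else 0))) * lint K (rem j L) (%es. F (e # es))" for e
   using Cons.IH[of j "%es. F (e # es)"] Cons.prems(1) Suc by simp
  then show ?thesis unfolding Suc by (simp add: nn_integral_cmult cong: if_cong)
 qed
qed simp

lemma AE_fst:
 assumes "sigma_finite_measure N" "AE x in M. P x"
 shows "AE z in M >< N. P (fst z)"
proof -
 interpret N: sigma_finite_measure N by fact
 obtain A where A: "A \<in> null_sets M" "{x \<in> space M. \<not> P x} \<subseteq> A"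
  using assms(2) by (auto elim!: AE_E simp: null_sets_def)
 have "emeasure (M >< N) (A \<times> space N) = 0"
  using A by (subst N.emeasure_pair_measure_Times) auto
 then show ?thesis
  using A by (intro AE_I[of _ _ "A \<times> space N"]) (auto simp: space_pair_measure)
qed

section \<open>Reference measures, clock laws and label measures\<close>

abbreviation natM :: "nat measure" where "natM \<equiv> count_space UNIV"
abbreviation markM :: "(int \<times> nat) measure" where "markM \<equiv> count_space UNIV"

lemma measurable_mark_Pair [measurable (raw)]:
 assumes "f \<in> M \<rightarrow>\<^sub>M intM" "g \<in> M \<rightarrow>\<^sub>M natM"
 shows "(%w. (f w, g w)) \<in> M \<rightarrow>\<^sub>M markM"
 using measurable_Pair[OF assms] by (simp add: pair_measure_countable)

lemma measurable_mark_fst: "f \<in> M \<rightarrow>\<^sub>M markM ==> (%w. fst (f w)) \<in> M \<rightarrow>\<^sub>M intM"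
 and measurable_mark_snd: "f \<in> M \<rightarrow>\<^sub>M markM ==> (%w. snd (f w)) \<in> M \<rightarrow>\<^sub>M natM"
 by (auto intro: measurable_compose)

text \<open>\<open>phi_dec\<close> is the product form of the avoidance factor: \<open>al\<close>
  sees the end where a line starts, \<open>be\<close> the end where it stops, and the label
  \<open>l\<close> ties the two together. Finiteness of \<open>al\<close> and \<open>be\<close>
  keeps the label measures sigma-finite.\<close>

locale pks_dist = pks_alg P phi for P phi +
 fixes al be :: "nat => real => real => int => ennreal"
 assumes al_meas: "(%(l, x, y, s). al l x y s) \<in> borel_measurable (natM >< borel >< borel >< intM)"
  and be_meas: "(%(l, x, y, s). be l x y s) \<in> borel_measurable (natM >< borel >< borel >< intM)"
  and al_fin: "al l x y s ~= \<top>" and be_fin: "be l x y s ~= \<top>"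
  and phi_dec: "phi x0 y0 x1 y1 s = (nint natM (%l. al l x0 y0 s * be l x1 y1 s))"
  and nV0: "0 \<le> pk_nuV P i" and nH0: "0 \<le> pk_nuH P i"
  and nVs: "pk_nuV P summable_on UNIV" and nHs: "pk_nuH P summable_on UNIV"
  and p0: "0 \<le> pk_p0 P" and q0: "0 \<le> pk_q P i"
  and pV0: "0 \<le> pk_pV P i" and pH0: "0 \<le> pk_pH P i"
  and nVz: "pk_nuV P i = 0 ==> pk_pV P i = 0 & pk_q P i = 0"
  and nHz: "pk_nuH P i = 0 ==> pk_pH P i = 0 & pk_q P i = 0"
  and psum: "i ~= 0 ==> pk_pV P i + pk_pH P i \<le> 1"
  and psum0: "pk_pV P 0 + pk_pH P 0 + pk_p0 P \<le> 1"
  and a_pos: "0 < pk_a P" and b_pos: "0 < pk_b P"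
begin

abbreviation "nV \<equiv> pk_nuV P"
abbreviation "nH \<equiv> pk_nuH P"

lemmas al_raw [measurable (raw)] = meas4[OF al_meas]
lemmas be_raw [measurable (raw)] = meas4[OF be_meas]

definition LA :: "real measure" where "LA = density lborel (indicator {0<..<a})"
definition LB :: "real measure" where "LB = density lborel (indicator {0<..<b})"
text \<open>A mark is an intensity together with a label. The intensity carries the mass of
  \<open>nuH\<close>, labels are merely counted.\<close>

definition mkH :: "(int \<times> nat) measure" where "mkH = density markM (%m. ennreal (nH (fst m)))"
definition mkV :: "(int \<times> nat) measure" where "mkV = density markM (%m. ennreal (nV (fst m)))"
definition nuVM :: "int measure" where "nuVM = density intM (%s. ennreal (nV s))"
definition nu0M :: "int measure" where "nu0M = density intM (%s. ennreal (pk_p0 P * nV (- s) * nH s))"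

lemma sets_meas [simp, measurable_cong]:
 "sets LA = sets borel" "sets LB = sets borel" "sets mkH = sets markM" "sets mkV = sets markM"
 "sets nuVM = sets intM" "sets nu0M = sets intM"
 by (simp_all add: LA_def LB_def mkH_def mkV_def nuVM_def nu0M_def)

lemma sfin: "sigma_finite_measure LA" "sigma_finite_measure LB" "sigma_finite_measure mkH" "sigma_finite_measure mkV"
 "sigma_finite_measure nuVM" "sigma_finite_measure nu0M"
proof -
 have "emeasure LA (space LA) ~= \<infinity>" "emeasure LB (space LB) ~= \<infinity>"
  using a_pos b_pos by (simp_all add: LA_def LB_def emeasure_density)
 then show "sigma_finite_measure LA" "sigma_finite_measure LB"
  by (auto intro!: finite_measure.axioms(1) finite_measureI)
 show "sigma_finite_measure mkH" "sigma_finite_measure mkV" "sigma_finite_measure nuVM" "sigma_finite_measure nu0M"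
  by (rule sigma_finite_countable; simp add: mkH_def mkV_def nuVM_def nu0M_def emeasure_density ennreal_mult_eq_top_iff)+
qed

lemma nn_LA: "f \<in> borel_measurable borel ==> (nint LA (%x. f x)) = (nint lborel (%x. indicator {0<..<a} x * f x))"
 and nn_LB: "f \<in> borel_measurable borel ==> (nint LB (%x. f x)) = (nint lborel (%x. indicator {0<..<b} x * f x))"
 unfolding LA_def LB_def by (simp_all add: nn_integral_density)

lemma AE_LA: "AE x in LA. 0 < x & x < a" and AE_LB: "AE y in LB. 0 < y & y < b"
 unfolding LA_def LB_def by (auto simp: AE_density indicator_def)

lemma AE_LA_neq: "AE x in LA. x ~= t" and AE_LB_neq: "AE x in LB. x ~= t"
 unfolding LA_def LB_def using AE_lborel_singleton[of t] by (auto simp: AE_density)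

lemma AE_LB_notin: "finite A ==> AE y in LB. y \<notin> A"
 unfolding LB_def by (subst AE_density) (auto intro!: AE_I[of _ _ A] simp: finite_imp_null_set_lborel null_setsD1 finite_imp_closed borel_closed)

lemma refl_LA: "f \<in> borel_measurable borel ==> (nint LA (%x. f (a - x))) = (nint LA (%x. f x))"
 and refl_LB: "f \<in> borel_measurable borel ==> (nint LB (%x. f (b - x))) = (nint LB (%x. f x))"
proof -
 have *: "(nint lborel (%x. indicator {0<..<c} x * f (c - x))) = (nint lborel (%x. indicator {0<..<c} x * f x))"
  if [measurable]: "f \<in> borel_measurable borel" for f :: "real => ennreal" and c :: real
 proof -
  have "(nint lborel (%x. indicator {0<..<c} x * f x)) = (nint lborel (%x. indicator {0<..<c} (c + - 1 * x) * f (c + - 1 * x)))"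
   by (subst nn_integral_real_affine[of _ "- 1" c]) auto
  also have "... = (nint lborel (%x. indicator {0<..<c} x * f (c - x)))"
   by (intro nn_integral_cong) (auto simp: indicator_def)
  finally show ?thesis ..
 qed
 show "f \<in> borel_measurable borel ==> (nint LA (%x. f (a - x))) = (nint LA (%x. f x))"
  "f \<in> borel_measurable borel ==> (nint LB (%x. f (b - x))) = (nint LB (%x. f x))"
  by (simp_all add: nn_LA nn_LB *)
qed

sublocale lc: line_chain_rot markM mkH mkV LA LB a b
 by (intro line_chain_rot.intro line_chain.intro line_chain_rot_axioms.intro sfin refl_LA refl_LB) simp_all

sublocale vX: sigma_finite_measure nuVM by (rule sfin)
sublocale v0: sigma_finite_measure nu0M by (rule sfin)

abbreviation muX :: "(real \<times> int) measure" where "muX \<equiv> LA >< nuVM"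
abbreviation mu0 :: "(real \<times> real \<times> int) measure" where "mu0 \<equiv> LA >< LB >< nu0M"

sublocale psX: pair_sigma_finite LA nuVM ..
sublocale psB0: pair_sigma_finite LB nu0M ..
sublocale LB0: sigma_finite_measure "LB >< nu0M" by (rule psB0.sigma_finite_measure_axioms)
sublocale ps0: pair_sigma_finite LA "LB >< nu0M" ..

sublocale mX: mint_space cxE muX
 by (intro mint_space.intro mint_space_axioms.intro cxL.list_space_axioms psX.sigma_finite_measure_axioms sets_pair_measure_cong sets_meas)

sublocale m0: mint_space c0E mu0
 by (intro mint_space.intro mint_space_axioms.intro c0L.list_space_axioms ps0.sigma_finite_measure_axioms sets_pair_measure_cong sets_meas)

text \<open>The record of a line with height, intensity and starting abscissa given by
  \<open>l\<close>. Its clock starts at 0 rather than at the starting abscissa; that it has not rung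
  before the current position is imposed later by \<open>Full\<close>.\<close>

definition KH :: "real \<times> int \<times> real => (real \<times> int \<times> real \<times> real) measure" where
 "KH l = distr unifM hsE (%u. (fst l, fst (snd l), snd (snd l), clock_after 0 (rH P (fst (snd l))) u a))"

text \<open>The label is weighted by the \<open>al\<close> of the starting point of the line. The
  matching \<open>be\<close> is paid where the line ends, and the sum over \<open>j\<close> then
  restores \<open>phi\<close>.\<close>

definition KL :: "real \<times> int \<times> real => (real \<times> int \<times> nat) measure" where
 "KL l = distr (density natM (%j. al j (snd (snd l)) (fst l) (fst (snd l)))) (borel >< markM) (%j. (fst l, fst (snd l), j))"

sublocale kH: list_kernel hsE KH
proof (intro list_kernel.intro list_kernel_axioms.intro hsL.list_space_axioms)
 fix l
 show "sets (KH l) = sets hsE" by (simp add: KH_def)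
 have "prob_space (KH l)" unfolding KH_def by (intro prob_space.prob_space_distr prob_unifM) measurable
 then show "sigma_finite_measure (KH l)" by (rule prob_space_imp_sigma_finite)
qed

sublocale kL: list_kernel "borel >< markM" KL
proof (intro list_kernel.intro list_kernel_axioms.intro lc.list_space_axioms)
 fix l
 show "sets (KL l) = sets (borel >< markM)" by (simp add: KL_def)
 show "sigma_finite_measure (KL l)" unfolding KL_def
 proof (rule sigma_finite_distr_inv[where g="%z. snd (snd z)"])
  show "sigma_finite_measure (density natM (%j. al j (snd (snd l)) (fst l) (fst (snd l))))"
   by (rule sigma_finite_countable) (simp_all add: emeasure_density al_fin ennreal_mult_eq_top_iff)
  have "(%z. snd (snd z)) \<in> borel >< markM \<rightarrow>\<^sub>M natM"
   by (rule measurable_compose[OF measurable_snd]) simp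
  then show "(%z. snd (snd z)) \<in> borel >< markM \<rightarrow>\<^sub>M density natM (%j. al j (snd (snd l)) (fst l) (fst (snd l)))"
   by (simp add: measurable_cong_sets)
 qed auto
qed

lemma nn_KH: "f \<in> borel_measurable hsE ==>
  (nint (KH (y, s, x0)) (%e. f e)) = (nint unifM (%u. f (y, s, x0, clock_after 0 (rH P s) u a)))"
 unfolding KH_def by (subst nn_integral_distr) auto

lemma nn_KL: "f \<in> borel_measurable (borel >< markM) ==>
  (nint (KL (y, s, x0)) (%e. f e)) = (nint natM (%j. al j x0 y s * f (y, s, j)))"
 unfolding KL_def by (subst nn_integral_distr) (auto simp: nn_integral_density)

lemma nn_muX: "f \<in> borel_measurable cxE ==> (nint muX (%e. f e)) = (nint LA (%x. nint nuVM (%s. f (x, s))))"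
 by (rule sigma_finite_measure.nn_integral_fst[OF sfin(5), symmetric]) measurable

lemma nn_mu0:
 assumes [measurable]: "f \<in> borel_measurable c0E"
 shows "(nint mu0 (%e. f e)) = (nint LA (%x. nint LB (%y. nint nu0M (%s. f (x, y, s)))))"
proof -
 have "(nint mu0 (%e. f e)) = (nint LA (%x. nint (LB >< nu0M) (%e. f (x, e))))"
  by (rule sigma_finite_measure.nn_integral_fst[OF psB0.sigma_finite_measure_axioms, symmetric]) measurable
 also have "... = (nint LA (%x. nint LB (%y. nint nu0M (%s. f (x, y, s)))))"
  by (intro nn_integral_cong sigma_finite_measure.nn_integral_fst[OF sfin(6), symmetric]) measurable
 finally show ?thesis .
qed

lemma rH0: "0 \<le> rH P s" and rV0: "0 \<le> rV P s"
 and lamH0: "0 \<le> lamH P s" and lamV0: "0 \<le> lamV P s" and turnH0: "0 \<le> turnH P s" and turnV0: "0 \<le> turnV P s"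
proof -
 have h: "0 \<le> hfun P s" unfolding hfun_def by (intro infsum_nonneg) (simp add: nV0 nH0)
 show "0 \<le> lamH P s" "0 \<le> lamV P s" "0 \<le> turnH P s" "0 \<le> turnV P s"
  using h nV0 nH0 pV0 pH0 q0 by (simp_all add: lamH_def lamV_def turnH_def turnV_def)
 then show "0 \<le> rH P s" "0 \<le> rV P s" by (simp_all add: rH_def rV_def)
qed

definition relL :: "real \<times> int \<times> real => real \<times> int \<times> real \<times> real => bool" where
 "relL l e \<longleftrightarrow> fst e = fst l & fst (snd e) = fst (snd l) & fst (snd (snd e)) = snd (snd l)"

lemma KH_AE_neq: "t \<le> a ==> AE e in KH l. clk e ~= t"
proof -
 assume t: "t \<le> a"
 have 1: "(%u. (fst l, fst (snd l), snd (snd l), clock_after 0 (rH P (fst (snd l))) u a)) \<in> unifM \<rightarrow>\<^sub>M hsE"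
  by measurable
 have "Measurable.pred hsE (%e. clk e ~= t)" by measurable
 then have 2: "{e \<in> space hsE. clk e ~= t} \<in> sets hsE" by (rule predE)
 show ?thesis unfolding KH_def AE_distr_iff[OF 1 2]
  using clock_AE_neq[where x=0, OF rH0[of "fst (snd l)"] t] by simp
qed

definition Tri where "Tri L F = mint muX (%cx. mint mu0 (%c0. lint KH L (%hs. F hs cx c0)))"

definition measF where "measF F \<longleftrightarrow> (%(hs, cx, c0). F hs cx c0 :: ennreal) \<in> borel_measurable (listM hsE >< listM cxE >< listM c0E)"
lemmas measF_raw = meas3[OF measF_def[THEN iffD1]]

lemma Tri_meas [measurable (raw)]:
 assumes F: "(%(w, hs, cx, c0). F w hs cx c0) \<in> borel_measurable (M >< listM hsE >< listM cxE >< listM c0E)"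
 shows "(%w. Tri L (F w)) \<in> borel_measurable M"
proof -
 note [measurable (raw)] = meas4[OF F]
 show ?thesis unfolding Tri_def by measurable
qed

text \<open>Coincidences with a prescribed abscissa are null. The bound \<open>t \<le> a\<close>
  stays clear of \<open>a + 1\<close>, the position of a clock that never rings, which is an
  atom.\<close>

lemma Tri_cong_AE:
 assumes "t \<le> a" "\<And>hs cx c0. list_all2 relL L hs ==> \<forall>e\<in>set hs. clk e ~= t ==> \<forall>e\<in>set cx. fst e ~= t & fst e < a ==>
   \<forall>e\<in>set c0. fst e ~= t & fst e < a ==> F hs cx c0 = G hs cx c0"
 shows "Tri L F = Tri L G"
 unfolding Tri_def
proof (rule mX.mint_cong_AE[where \<rho>="%e. fst e ~= t & fst e < a"])
 have LA: "AE x in LA. x ~= t & x < a" using AE_LA AE_LA_neq[of t] by eventually_elim auto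
 show "AE e in muX. fst e ~= t & fst e < a"
  by (rule AE_fst[OF sfin(5) LA])
 fix cx assume cx: "list_all (%e. fst e ~= t & fst e < a) (cx :: (real \<times> int) list)"
 show "mint mu0 (%c0. lint KH L (%hs. F hs cx c0)) = mint mu0 (%c0. lint KH L (%hs. G hs cx c0))"
 proof (rule m0.mint_cong_AE[where \<rho>="%e. fst e ~= t & fst e < a"])
  show "AE e in mu0. fst e ~= t & fst e < a"
   by (rule AE_fst[OF psB0.sigma_finite_measure_axioms LA])
  fix c0 assume c0: "list_all (%e. fst e ~= t & fst e < a) (c0 :: (real \<times> real \<times> int) list)"
  show "lint KH L (%hs. F hs cx c0) = lint KH L (%hs. G hs cx c0)"
  proof (rule lint_cong_AE[where \<rho>="%l e. relL l e & clk e ~= t"])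
   fix l show "AE e in KH l. relL l e & clk e ~= t"
    unfolding KH_def using clock_AE_neq[where x=0, OF rH0[of "fst (snd l)"] assms(1)]
    by (subst AE_distr_iff) (measurable, auto simp: relL_def)
  next
   fix hs assume "list_all2 (%l e. relL l e & clk e ~= t) L hs"
   then show "F hs cx c0 = G hs cx c0"
    using cx c0 by (intro assms(2)) (auto simp: list_all_iff list_all2_conv_all_nth all_set_conv_all_nth)
  qed
 qed
qed

lemma Tri_cong: "(\<And>hs cx c0. list_all2 relL L hs ==> F hs cx c0 = G hs cx c0) ==> Tri L F = Tri L G"
 by (rule Tri_cong_AE[of 0]) (use a_pos in auto)

lemma Tri_nn_integral:
 assumes "sigma_finite_measure \<nu>" and F: "(%(p, hs, cx, c0). F p hs cx c0) \<in> borel_measurable (\<nu> >< listM hsE >< listM cxE >< listM c0E)"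
 shows "Tri L (%hs cx c0. nint \<nu> (%p. F p hs cx c0)) = (nint \<nu> (%p. Tri L (F p)))"
proof -
 interpret \<nu>: sigma_finite_measure \<nu> by fact
 note [measurable (raw)] = meas4[OF F]
 show ?thesis unfolding Tri_def
  by (subst kH.lint_nn_integral[OF assms(1)], measurable, subst m0.mint_nn_integral[OF assms(1)], measurable,
    rule mX.mint_nn_integral[OF assms(1)], measurable)
qed

lemma Tri_add:
 assumes "measF F" "measF G"
 shows "Tri L (%hs cx c0. F hs cx c0 + G hs cx c0) = Tri L F + Tri L G"
proof -
 note [measurable (raw)] = measF_raw[OF assms(1)] measF_raw[OF assms(2)]
 show ?thesis unfolding Tri_def
  by (subst kH.lint_add, measurable, subst m0.mint_add, measurable, subst mX.mint_add, measurable)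
qed

lemma Tri_cmult:
 assumes "measF F"
 shows "Tri L (%hs cx c0. c * F hs cx c0) = c * Tri L F"
proof -
 note [measurable (raw)] = measF_raw[OF assms(1)]
 show ?thesis unfolding Tri_def
  by (subst kH.lint_cmult, measurable, subst m0.mint_cmult, measurable, subst mX.mint_cmult, measurable)
qed

lemma Tri_zero [simp]: "Tri L (%_ _ _. 0) = 0"
 by (simp add: Tri_def mint_def)

text \<open>The Mecke formula for the earliest point: the other points form an unnormalised Poisson
  configuration again, restricted to lie to its right.\<close>

lemma Tri_X:
 assumes H: "(%(e, hs, cx, c0). H e hs cx c0) \<in> borel_measurable (cxE >< listM hsE >< listM cxE >< listM c0E)"
 shows "Tri L (%hs cx c0. fsum (%e e'. fst e < fst e') (%e e'. fst e \<le> fst e') (%e cx'. H e hs cx' c0) cx)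
  = (nint muX (%e. Tri L (%hs cx c0. if \<forall>e'\<in>set cx. fst e < fst e' then H e hs cx c0 else 0)))"
proof -
 note [measurable (raw)] = meas4[OF H]
 have AE: "AE e' in muX. fst e' ~= t" for t
  by (rule AE_fst[OF sfin(5) AE_LA_neq])
 have "Tri L (%hs cx c0. fsum (%e e'. fst e < fst e') (%e e'. fst e \<le> fst e') (%e cx'. H e hs cx' c0) cx)
  = mint muX (fsum (%e e'. fst e < fst e') (%e e'. fst e \<le> fst e') (%e cx'. mint mu0 (%c0. lint KH L (%hs. H e hs cx' c0))))"
  unfolding Tri_def by (subst kH.lint_fsum_out, measurable, subst m0.mint_fsum_out, measurable)
 also have "... = (nint muX (%e. mint muX (%cx. if \<forall>e'\<in>set cx. fst e < fst e' then mint mu0 (%c0. lint KH L (%hs. H e hs cx c0)) else 0)))"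
 proof (rule mX.mint_fsum)
  fix e :: "real \<times> int"
  show "AE e' in muX. (fst e < fst e') = (fst e < fst e') & (fst e \<le> fst e') = (fst e < fst e')"
   using AE[of "fst e"] by eventually_elim auto
 qed measurable
 also have "... = (nint muX (%e. Tri L (%hs cx c0. if \<forall>e'\<in>set cx. fst e < fst e' then H e hs cx c0 else 0)))"
 proof -
  have 1: "lint KH L (%hs. if P then G hs else 0) = (if P then lint KH L G else 0)" for P G by simp
  have 2: "mint mu0 (%c0. if P then G c0 else 0) = (if P then mint mu0 G else 0)" for P G by (simp add: mint_def)
  show ?thesis unfolding Tri_def 1 2 ..
 qed
 finally show ?thesis .
qed

lemma Tri_0:
 assumes H: "(%(e, hs, cx, c0). H e hs cx c0) \<in> borel_measurable (c0E >< listM hsE >< listM cxE >< listM c0E)"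
 shows "Tri L (%hs cx c0. fsum (%e e'. fst e < fst e') (%e e'. fst e \<le> fst e') (%e c0'. H e hs cx c0') c0)
  = (nint mu0 (%e. Tri L (%hs cx c0. if \<forall>e'\<in>set c0. fst e < fst e' then H e hs cx c0 else 0)))"
proof -
 note [measurable (raw)] = meas4[OF H]
 have AE: "AE e' in mu0. fst e' ~= t" for t
  by (rule AE_fst[OF psB0.sigma_finite_measure_axioms AE_LA_neq])
 have "Tri L (%hs cx c0. fsum (%e e'. fst e < fst e') (%e e'. fst e \<le> fst e') (%e c0'. H e hs cx c0') c0)
  = mint muX (%cx. mint mu0 (fsum (%e e'. fst e < fst e') (%e e'. fst e \<le> fst e') (%e c0. lint KH L (%hs. H e hs cx c0))))"
  unfolding Tri_def by (subst kH.lint_fsum_out, measurable)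
 also have "... = mint muX (%cx. nint mu0 (%e. mint mu0 (%c0. if \<forall>e'\<in>set c0. fst e < fst e' then lint KH L (%hs. H e hs cx c0) else 0)))"
 proof (intro arg_cong[of _ _ "mint muX"] ext, rule m0.mint_fsum)
  fix e :: "real \<times> real \<times> int"
  show "AE e' in mu0. (fst e < fst e') = (fst e < fst e') & (fst e \<le> fst e') = (fst e < fst e')"
   using AE[of "fst e"] by eventually_elim auto
 qed measurable
 also have "... = (nint mu0 (%e. mint muX (%cx. mint mu0 (%c0. if \<forall>e'\<in>set c0. fst e < fst e' then lint KH L (%hs. H e hs cx c0) else 0))))"
  by (rule mX.mint_nn_integral[OF m0.sfin_mu]) measurable
 also have "... = (nint mu0 (%e. Tri L (%hs cx c0. if \<forall>e'\<in>set c0. fst e < fst e' then H e hs cx c0 else 0)))"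
 proof -
  have 1: "lint KH L (%hs. if P then G hs else 0) = (if P then lint KH L G else 0)" for P G by simp
  show ?thesis unfolding Tri_def 1 ..
 qed
 finally show ?thesis .
qed

text \<open>The clocks are finitely many and have individual laws, so the earliest one is summed
  over the lines. \<open>H0\<close> confines it to readings up to \<open>a\<close>, where these laws
  have no atoms.\<close>

lemma Tri_H:
 assumes H: "(%(e, hs, cx, c0). H e hs cx c0) \<in> borel_measurable (hsE >< listM hsE >< listM cxE >< listM c0E)"
  and H0: "\<And>e hs cx c0. a < clk e ==> H e hs cx c0 = 0"
 shows "Tri L (%hs cx c0. fsum (%e e'. clk e < clk e') (%e e'. clk e \<le> clk e') (%e hs'. H e hs' cx c0) hs)
  = (\<Sum>i<length L. nint (KH (L ! i)) (%e. Tri (rem i L) (%hs cx c0. if \<forall>e'\<in>set hs. clk e < clk e' then H e hs cx c0 else 0)))"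
proof -
 note [measurable (raw)] = meas4[OF H]
 have "lint KH L (fsum (%e e'. clk e < clk e') (%e e'. clk e \<le> clk e') (%e hs'. H e hs' cx c0))
  = (\<Sum>i<length L. nint (KH (L ! i)) (%e. lint KH (rem i L) (%hs. if \<forall>e'\<in>set hs. clk e < clk e' then H e hs cx c0 else 0)))" for cx c0
 proof (rule kH.lint_fsum)
  fix e hs and l :: "real \<times> int \<times> real" assume "H e hs cx c0 ~= 0"
  then have "clk e \<le> a" using H0[of e] by (metis not_le)
  then have "AE e' in KH l. clk e' ~= clk e"
   by (rule KH_AE_neq)
  then show "AE e' in KH l. (clk e < clk e') = (clk e < clk e') & (clk e \<le> clk e') = (clk e < clk e')"
   by eventually_elim auto
 qed measurable
 then have "Tri L (%hs cx c0. fsum (%e e'. clk e < clk e') (%e e'. clk e \<le> clk e') (%e hs'. H e hs' cx c0) hs)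
  = mint muX (%cx. mint mu0 (%c0. \<Sum>i<length L. nint (KH (L ! i)) (%e. lint KH (rem i L) (%hs. if \<forall>e'\<in>set hs. clk e < clk e' then H e hs cx c0 else 0))))"
  unfolding Tri_def by simp
 also have "... = (\<Sum>i<length L. mint muX (%cx. mint mu0 (%c0. nint (KH (L ! i)) (%e. lint KH (rem i L) (%hs. if \<forall>e'\<in>set hs. clk e < clk e' then H e hs cx c0 else 0)))))"
 proof -
  have m: "(%(cx, c0). nint (KH (L ! i)) (%e. lint KH (rem i L) (%hs. if \<forall>e'\<in>set hs. clk e < clk e' then H e hs cx c0 else 0)))
   \<in> borel_measurable (listM cxE >< listM c0E)" for i
  proof -
   interpret Ki: sigma_finite_measure "KH (L ! i)" by (rule kH.sfin)
   show ?thesis by measurable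
  qed
  note [measurable (raw)] = meas2[OF m]
  have 1: "mint mu0 (%c0. \<Sum>i<length L. nint (KH (L ! i)) (%e. lint KH (rem i L) (%hs. if \<forall>e'\<in>set hs. clk e < clk e' then H e hs cx c0 else 0)))
   = (\<Sum>i<length L. mint mu0 (%c0. nint (KH (L ! i)) (%e. lint KH (rem i L) (%hs. if \<forall>e'\<in>set hs. clk e < clk e' then H e hs cx c0 else 0))))" for cx
   by (rule m0.mint_sum, rule meas2[OF m], simp_all)
  have m': "(%cx. mint mu0 (%c0. nint (KH (L ! i)) (%e. lint KH (rem i L) (%hs. if \<forall>e'\<in>set hs. clk e < clk e' then H e hs cx c0 else 0))))
   \<in> borel_measurable (listM cxE)" for i
   by (rule m0.mint_measurable, rule m)
  show ?thesis unfolding 1 by (rule mX.mint_sum, rule m', simp)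
 qed
 also have "... = (\<Sum>i<length L. nint (KH (L ! i)) (%e. Tri (rem i L) (%hs cx c0. if \<forall>e'\<in>set hs. clk e < clk e' then H e hs cx c0 else 0)))"
 proof (intro sum.cong refl)
  fix i
  interpret Ki: sigma_finite_measure "KH (L ! i)" by (rule kH.sfin)
  show "mint muX (%cx. mint mu0 (%c0. nint (KH (L ! i)) (%e. lint KH (rem i L) (%hs. if \<forall>e'\<in>set hs. clk e < clk e' then H e hs cx c0 else 0))))
   = (nint (KH (L ! i)) (%e. Tri (rem i L) (%hs cx c0. if \<forall>e'\<in>set hs. clk e < clk e' then H e hs cx c0 else 0)))"
   unfolding Tri_def
   by (subst m0.mint_nn_integral[OF kH.sfin], measurable, rule mX.mint_nn_integral[OF kH.sfin], measurable)
 qed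
 finally show ?thesis .
qed

end

section \<open>Averaged states and averaged events\<close>

interpretation unifP: prob_space unifM by (rule prob_unifM)
interpretation seqP: prob_space seqM by (rule prob_seqM)

context pks_dist
begin

definition all_gt :: "real => (real \<times> int \<times> real \<times> real) list => (real \<times> int) list => (real \<times> real \<times> int) list => bool" where
 "all_gt x hs cx c0 \<longleftrightarrow> (\<forall>e\<in>set hs. x < clk e) & (\<forall>e\<in>set cx. x < fst e) & (\<forall>e\<in>set c0. x < fst e)"

lemma all_gt_meas [measurable (raw)]:
 assumes [measurable]: "x \<in> borel_measurable M" "hs \<in> M \<rightarrow>\<^sub>M listM hsE" "cx \<in> M \<rightarrow>\<^sub>M listM cxE" "c0 \<in> M \<rightarrow>\<^sub>M listM c0E"
 shows "Measurable.pred M (%w. all_gt (x w) (hs w) (cx w) (c0 w))"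
 unfolding all_gt_def by measurable

text \<open>The unnormalised expectation over all that is hidden when the sweep line stands at
  \<open>x\<close>: points and clocks to the right of it.\<close>

definition Full where "Full x L F = Tri L (%hs cx c0. if all_gt x hs cx c0 then F hs cx c0 else 0)"
definition "VS n hs cx c0 = (nint seqM (%\<delta>. fst (RR n) hs cx c0 \<delta>))"
definition "VV n x y s k hs cx c0 = (nint seqM (%\<delta>. snd (RR n) x y s k hs cx c0 \<delta>))"
text \<open>A fresh vertical line, whose clock is still to be drawn. \<open>app\<close> does the
  same for a fresh horizontal line, and \<open>HV\<close> is a split of intensity \<open>u\<close>
  into both.\<close>

definition "vst n x y s hs cx c0 = (nint unifM (%u. VV n x y s (clock_after y (rV P s) u b) hs cx c0))"
definition "app x y s F hs cx c0 = (nint unifM (%u. F (hs @ [(y, s, x, clock_after x (rH P s) u a)]) cx c0))"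
definition "HV n u x y hs cx c0 = (nint intM (%T. ennreal (fker P u T / hfun P u) * app x y T (vst n x y (u - T)) hs cx c0))"

lemma VS_meas: "(%(hs, cx, c0). VS n hs cx c0) \<in> borel_measurable (listM hsE >< listM cxE >< listM c0E)"
proof -
 note [measurable (raw)] = measRS_raw[OF RR_meas(1)]
 show ?thesis unfolding VS_def by measurable
qed
lemmas VS_raw [measurable (raw)] = meas3[OF VS_meas]

lemma VV_raw [measurable (raw)]:
 assumes [measurable]: "x \<in> borel_measurable M" "y \<in> borel_measurable M" "s \<in> M \<rightarrow>\<^sub>M intM" "k \<in> borel_measurable M"
  "hs \<in> M \<rightarrow>\<^sub>M listM hsE" "cx \<in> M \<rightarrow>\<^sub>M listM cxE" "c0 \<in> M \<rightarrow>\<^sub>M listM c0E"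
 shows "(%w. VV n (x w) (y w) (s w) (k w) (hs w) (cx w) (c0 w)) \<in> borel_measurable M"
proof -
 note [measurable (raw)] = measRV_raw[OF RR_meas(2)]
 show ?thesis unfolding VV_def by measurable
qed

lemma vst_raw [measurable (raw)]:
 assumes [measurable]: "x \<in> borel_measurable M" "y \<in> borel_measurable M" "s \<in> M \<rightarrow>\<^sub>M intM"
  "hs \<in> M \<rightarrow>\<^sub>M listM hsE" "cx \<in> M \<rightarrow>\<^sub>M listM cxE" "c0 \<in> M \<rightarrow>\<^sub>M listM c0E"
 shows "(%w. vst n (x w) (y w) (s w) (hs w) (cx w) (c0 w)) \<in> borel_measurable M"
 unfolding vst_def by measurable

lemma app_VS_raw [measurable (raw)]:
 assumes [measurable]: "x \<in> borel_measurable M" "y \<in> borel_measurable M" "s \<in> M \<rightarrow>\<^sub>M intM"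
  "hs \<in> M \<rightarrow>\<^sub>M listM hsE" "cx \<in> M \<rightarrow>\<^sub>M listM cxE" "c0 \<in> M \<rightarrow>\<^sub>M listM c0E"
 shows "(%w. app (x w) (y w) (s w) (VS n) (hs w) (cx w) (c0 w)) \<in> borel_measurable M"
 unfolding app_def by measurable

lemma app_vst_raw [measurable (raw)]:
 assumes [measurable]: "x \<in> borel_measurable M" "y \<in> borel_measurable M" "s \<in> M \<rightarrow>\<^sub>M intM"
  "hs \<in> M \<rightarrow>\<^sub>M listM hsE" "cx \<in> M \<rightarrow>\<^sub>M listM cxE" "c0 \<in> M \<rightarrow>\<^sub>M listM c0E"
  "x' \<in> borel_measurable M" "y' \<in> borel_measurable M" "s' \<in> M \<rightarrow>\<^sub>M intM"
 shows "(%w. app (x w) (y w) (s w) (vst n (x' w) (y' w) (s' w)) (hs w) (cx w) (c0 w)) \<in> borel_measurable M"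
 unfolding app_def by measurable

lemma HV_raw [measurable (raw)]:
 assumes [measurable]: "x \<in> borel_measurable M" "y \<in> borel_measurable M" "u \<in> M \<rightarrow>\<^sub>M intM"
  "hs \<in> M \<rightarrow>\<^sub>M listM hsE" "cx \<in> M \<rightarrow>\<^sub>M listM cxE" "c0 \<in> M \<rightarrow>\<^sub>M listM c0E"
 shows "(%w. HV n (u w) (x w) (y w) (hs w) (cx w) (c0 w)) \<in> borel_measurable M"
proof -
 interpret sigma_finite_measure intM by (rule sigma_finite_measure_count_space)
 show ?thesis unfolding HV_def by measurable
qed

lemma Full_cong: "(\<And>hs cx c0. list_all2 relL L hs ==> all_gt x hs cx c0 ==> F hs cx c0 = G hs cx c0) ==> Full x L F = Full x L G"
 unfolding Full_def by (rule Tri_cong) auto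

lemma measF_gt: "measF F ==> measF (%hs cx c0. if all_gt x hs cx c0 then F hs cx c0 else 0)"
proof -
 assume "measF F"
 note [measurable (raw)] = measF_raw[OF this]
 show ?thesis unfolding measF_def by measurable
qed

lemma Full_add:
 assumes "measF F" "measF G" shows "Full x L (%hs cx c0. F hs cx c0 + G hs cx c0) = Full x L F + Full x L G"
 unfolding Full_def by (subst Tri_add[symmetric], (rule measF_gt assms)+, rule Tri_cong) auto

lemma Full_cmult:
 assumes "measF F" shows "Full x L (%hs cx c0. c * F hs cx c0) = c * Full x L F"
 unfolding Full_def by (subst Tri_cmult[symmetric], (rule measF_gt assms)+, rule Tri_cong) auto

lemma Full_nn_integral:
 assumes "sigma_finite_measure \<nu>" and F: "(%(p, hs, cx, c0). F p hs cx c0) \<in> borel_measurable (\<nu> >< listM hsE >< listM cxE >< listM c0E)"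
 shows "Full x L (%hs cx c0. nint \<nu> (%p. F p hs cx c0)) = (nint \<nu> (%p. Full x L (F p)))"
proof -
 note [measurable (raw)] = meas4[OF F]
 show ?thesis unfolding Full_def
  by (subst Tri_nn_integral[OF assms(1), symmetric], measurable, rule Tri_cong) auto
qed

lemma Full_meas [measurable (raw)]:
 assumes F: "(%(w, hs, cx, c0). F w hs cx c0) \<in> borel_measurable (M >< listM hsE >< listM cxE >< listM c0E)"
  and [measurable]: "x \<in> borel_measurable M"
 shows "(%w. Full (x w) L (F w)) \<in> borel_measurable M"
proof -
 note [measurable (raw)] = meas4[OF F]
 show ?thesis unfolding Full_def by measurable
qed

text \<open>The clock of a newly started line is, by memorylessness, that of a line started at abscissa 0
 conditioned not to have rung yet.\<close>
lemma Full_app: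
 assumes "0 \<le> x" "x \<le> a" "measF F"
 shows "Full x L (app x y s F) = ennreal (exp (rH P s * x)) * Full x (L @ [(y, s, x)]) F"
proof -
 note [measurable (raw)] = measF_raw[OF assms(3)]
 have 1: "(nint (KH (y, s, x)) (%e. (if all_gt x (hs @ [e]) cx c0 then F (hs @ [e]) cx c0 else 0))) * ennreal (exp (rH P s * x))
   = (if all_gt x hs cx c0 then app x y s F hs cx c0 else 0)" for hs cx c0
 proof -
  have "(nint (KH (y, s, x)) (%e. (if all_gt x (hs @ [e]) cx c0 then F (hs @ [e]) cx c0 else 0)))
   = (nint unifM (%u. (if all_gt x (hs @ [(y, s, x, clock_after 0 (rH P s) u a)]) cx c0 then F (hs @ [(y, s, x, clock_after 0 (rH P s) u a)]) cx c0 else 0)))"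
   by (rule nn_KH) measurable
  also have "... = (if all_gt x hs cx c0 then (nint unifM (%u. (if x < clock_after 0 (rH P s) u a then F (hs @ [(y, s, x, clock_after 0 (rH P s) u a)]) cx c0 else 0))) else 0)"
  proof -
   have "all_gt x (hs @ [e]) cx c0 \<longleftrightarrow> x < clk e & all_gt x hs cx c0" for e by (auto simp: all_gt_def)
   then show ?thesis by (cases "all_gt x hs cx c0") simp_all
  qed
  finally show ?thesis
   using clock_memoryless[OF rH0[of s] assms(1,2), of "%k. F (hs @ [(y, s, x, k)]) cx c0"]
   by (simp add: app_def mult.commute)
 qed
 have "Full x (L @ [(y, s, x)]) F = Tri L (%hs cx c0. nint (KH (y, s, x)) (%e. (if all_gt x (hs @ [e]) cx c0 then F (hs @ [e]) cx c0 else 0)))"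
  unfolding Full_def Tri_def kH.lint_snoc ..
 moreover have "ennreal (exp (rH P s * x)) * ... = Tri L (%hs cx c0. ennreal (exp (rH P s * x)) * (nint (KH (y, s, x)) (%e. (if all_gt x (hs @ [e]) cx c0 then F (hs @ [e]) cx c0 else 0))))"
 proof (rule Tri_cmult[symmetric])
  interpret sigma_finite_measure "KH (y, s, x)" by (rule kH.sfin)
  show "measF (%hs cx c0. nint (KH (y, s, x)) (%e. (if all_gt x (hs @ [e]) cx c0 then F (hs @ [e]) cx c0 else 0)))"
   unfolding measF_def by measurable
 qed
 ultimately show ?thesis unfolding Full_def[of x L] using 1 by (simp add: mult.commute)
qed

text \<open>A line that is hit leaves the list and its clock is never read again; integrating that
  clock leaves the probability \<open>exp (- rH P s * x)\<close> that it was silent up to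
  \<open>x\<close>.\<close>

lemma Full_rem:
 assumes "0 \<le> x" "x \<le> a" "i < length L" "measF F" "L ! i = (y, s, x0)"
 shows "Full x L (%hs cx c0. F (rem i hs) cx c0) = ennreal (exp (- rH P s * x)) * Full x (rem i L) F"
proof -
 note [measurable (raw)] = measF_raw[OF assms(4)]
 have g: "all_gt x hs cx c0 \<longleftrightarrow> x < clk (hs ! i) & all_gt x (rem i hs) cx c0" if "list_all2 relL L hs" for hs cx c0
 proof -
  have "i < length hs" using assms(3) that by (simp add: list_all2_lengthD)
  from mset_rem[OF this] have "set hs = insert (hs ! i) (set (rem i hs))"
   by (metis set_mset_add_mset_insert set_mset_mset)
  then show ?thesis by (auto simp: all_gt_def)
 qed
 have c: "(nint (KH (L ! i)) (%e. (if x < clk e then 1 else 0))) = ennreal (exp (- rH P s * x))"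
  unfolding assms(5) by (subst nn_KH, measurable) (use clock_gt[OF rH0[of s] assms(1,2), of 1] in simp)
 have "Full x L (%hs cx c0. F (rem i hs) cx c0) =
   Tri L (%hs cx c0. if x < clk (hs ! i) then (if all_gt x (rem i hs) cx c0 then F (rem i hs) cx c0 else 0) else 0)"
  unfolding Full_def by (rule Tri_cong) (simp add: g)
 also have "... = mint muX (%cx. mint mu0 (%c0. ennreal (exp (- rH P s * x)) * lint KH (rem i L) (%hs. if all_gt x hs cx c0 then F hs cx c0 else 0)))"
  unfolding Tri_def
 proof (intro arg_cong[of _ _ "mint muX"] arg_cong[of _ _ "mint mu0"] ext)
  fix cx c0
  have "lint KH L (%hs. if x < clk (hs ! i) then (%hs. if all_gt x hs cx c0 then F hs cx c0 else 0) (rem i hs) else 0)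
   = (nint (KH (L ! i)) (%e. (if x < clk e then 1 else 0))) * lint KH (rem i L) (%hs. if all_gt x hs cx c0 then F hs cx c0 else 0)"
   by (rule kH.lint_nth_rem[OF assms(3)]) measurable
  then show "lint KH L (%hs. if x < clk (hs ! i) then if all_gt x (rem i hs) cx c0 then F (rem i hs) cx c0 else 0 else 0)
   = ennreal (exp (- rH P s * x)) * lint KH (rem i L) (%hs. if all_gt x hs cx c0 then F hs cx c0 else 0)"
   unfolding c .
 qed
 also have "... = ennreal (exp (- rH P s * x)) * Full x (rem i L) F"
  unfolding Full_def Tri_def by (subst m0.mint_cmult, measurable, subst mX.mint_cmult, measurable)
 finally show ?thesis .
qed

lemma fker_nonneg: "0 \<le> fker P u t" by (simp add: fker_def nV0 nH0)

lemma fker_summable: "fker P u summable_on UNIV"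
proof (rule summable_on_comparison_test)
 show "(%t. tot nV * nH t) summable_on UNIV" by (rule summable_on_cmult_right[OF nHs])
 have "nV i \<le> tot nV" for i
  using infsum_mono_neutral[OF summable_on_finite[of "{i}" nV] nVs] nV0 by (simp add: tot_def)
 then show "fker P u t \<le> tot nV * nH t" for t by (simp add: fker_def mult_right_mono nH0)
qed (rule fker_nonneg)

lemma tot_fker: "tot (fker P u) = hfun P u"
 by (simp add: tot_def hfun_def fker_def[abs_def])

lemma hfun_nonneg: "0 \<le> hfun P u" unfolding tot_fker[symmetric] tot_def by (rule infsum_nonneg) (rule fker_nonneg)

lemma fker_le_hfun: "fker P u t \<le> hfun P u"
 using infsum_mono_neutral[OF summable_on_finite[of "{t}" "fker P u"] fker_summable[of u]] fker_nonneg
 by (simp add: tot_fker[symmetric] tot_def)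

text \<open>The incoming pair is itself one of the summands of \<open>hfun\<close>, so at a
  collision the splitting kernel can be normalised.\<close>

lemma hfun_pos: "0 < nH h ==> 0 < nV v ==> 0 < hfun P (h + v)"
 using fker_le_hfun[of "h + v" h] by (auto simp: fker_def intro: less_le_trans[OF mult_pos_pos])

lemma split_event:
 assumes "0 < hfun P u"
 shows "(nint unifM (%d1. nint unifM (%d2. nint unifM (%d3. VV n x y (u - sample_Z (fker P u) d1) (clock_after y (rV P (u - sample_Z (fker P u) d1)) d2 b)
   (hs @ [(y, sample_Z (fker P u) d1, x, clock_after x (rH P (sample_Z (fker P u) d1)) d3 a)]) cx c0))))
  = HV n u x y hs cx c0"
proof -
 have "(nint unifM (%d2. nint unifM (%d3. VV n x y (u - T) (clock_after y (rV P (u - T)) d2 b) (hs @ [(y, T, x, clock_after x (rH P T) d3 a)]) cx c0)))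
   = app x y T (vst n x y (u - T)) hs cx c0" for T
  unfolding app_def vst_def
  by (rule nn_swap2) (auto intro: prob_space_imp_sigma_finite prob_unifM, measurable)
 then show ?thesis unfolding HV_def
  by (subst nn_integral_sample_Z[OF fker_nonneg fker_summable, unfolded tot_fker, OF assms, symmetric]) simp
qed

lemma ennreal_mult_le: "0 \<le> x ==> 0 \<le> y ==> ennreal x * ennreal y = ennreal (x * y)"
 by (simp add: ennreal_mult)

text \<open>The simulation realises the competing rates \<open>lam\<close> and \<open>turn\<close>
  by one clock of rate \<open>r\<close> and a coin. The factor \<open>r\<close>, which comes from
  the exponential density of the clock, separates the coin into the two rates.\<close>

lemma rate_split:
 assumes "0 < r" "0 \<le> lam" "0 \<le> turn" "r = lam + turn"
 shows "ennreal r * (nint unifM (%d. (if d * r < lam then A else B))) = ennreal lam * A + ennreal turn * B"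
proof -
 have "d * r < lam \<longleftrightarrow> d < lam / r" for d using assms(1) by (simp add: field_simps)
 then have "(nint unifM (%d. (if d * r < lam then A else B))) = ennreal (lam / r) * A + ennreal (1 - lam / r) * B"
  using assms by (simp add: unif_split)
 moreover have "ennreal r * ennreal (lam / r) = ennreal lam" "ennreal r * ennreal (1 - lam / r) = ennreal turn"
  using assms by (subst ennreal_mult_le; simp add: field_simps)+
 ultimately show ?thesis by (simp only: distrib_left mult.assoc[symmetric])
qed

text \<open>Averaged outcomes of the three kinds of event that end a segment inside the box: an
  event of a horizontal line, an event of a vertical line (\<open>fev\<close>) and a collision
  (\<open>cev\<close>).\<close>

definition "hev n e hs cx c0 = (nint seqM (%\<delta>. sH (snd (RR n)) e hs cx c0 \<delta>))"
definition "fev n x y s k hs cx c0 = (nint seqM (%\<delta>. rv_free (fst (RR n)) (snd (RR n)) x y s k hs cx c0 \<delta>))"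
definition "cev n x y s e hs cx c0 = (nint seqM (%\<delta>. rv_coll (fst (RR n)) (snd (RR n)) x y s e hs cx c0 \<delta>))"

lemma sX_int: "(nint seqM (%\<delta>. sX (snd (RR n)) e hs cx c0 \<delta>)) = vst n (fst e) 0 (snd e) hs cx c0"
proof -
 note [measurable (raw)] = measRV_raw[OF RR_meas(2)]
 show ?thesis unfolding sX_def
  by (subst seq_split4[of "%d0 d1 d2 d3 \<delta>. snd (RR n) (fst e) 0 (snd e) (clock_after 0 (rV P (snd e)) d0 b) hs cx c0 \<delta>"], measurable)
   (simp add: vst_def VV_def)
qed

lemma s0_int: "(nint seqM (%\<delta>. s0 (snd (RR n)) (x, y, s) hs cx c0 \<delta>)) = app x y s (vst n x y (- s)) hs cx c0"
proof -
 note [measurable (raw)] = measRV_raw[OF RR_meas(2)]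
 have "(nint seqM (%\<delta>. s0 (snd (RR n)) (x, y, s) hs cx c0 \<delta>)) =
  (nint unifM (%d0. nint unifM (%d1. VV n x y (- s) (clock_after y (rV P (- s)) d0 b) (hs @ [(y, s, x, clock_after x (rH P s) d1 a)]) cx c0)))"
  unfolding s0_def prod.case
  by (subst seq_split4[of "%d0 d1 d2 d3 \<delta>. snd (RR n) x y (- s) (clock_after y (rV P (- s)) d0 b) (hs @ [(y, s, x, clock_after x (rH P s) d1 a)]) cx c0 \<delta>"], measurable)
   (simp add: VV_def)
 also have "... = app x y s (vst n x y (- s)) hs cx c0"
  unfolding app_def vst_def
  by (rule nn_swap2) (auto intro: prob_space_imp_sigma_finite prob_unifM, measurable)
 finally show ?thesis .
qed

lemma hev_eq:
 assumes "0 < rH P s"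
 shows "ennreal (rH P s) * hev n (y, s, x0, k) hs cx c0 =
  phH x0 k y s * (ennreal (lamH P s) * HV n s k y hs cx c0 + ennreal (turnH P s) * vst n k y s hs cx c0)"
proof -
 note [measurable (raw)] = measRV_raw[OF RR_meas(2)] measRS_raw[OF RR_meas(1)]
 define F where "F d0 d1 d2 d3 \<delta> = phH x0 k y s * (if d0 * rH P s < lamH P s then
    snd (RR n) k y (s - sample_Z (fker P s) d1) (clock_after y (rV P (s - sample_Z (fker P s) d1)) d2 b)
     (hs @ [(y, sample_Z (fker P s) d1, k, clock_after k (rH P (sample_Z (fker P s) d1)) d3 a)]) cx c0 \<delta>
   else snd (RR n) k y s (clock_after y (rV P s) d2 b) hs cx c0 \<delta>)" for d0 d1 d2 d3 \<delta>
 define A where "A = (nint unifM (%d1. nint unifM (%d2. nint unifM (%d3. VV n k y (s - sample_Z (fker P s) d1) (clock_after y (rV P (s - sample_Z (fker P s) d1)) d2 b)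
     (hs @ [(y, sample_Z (fker P s) d1, k, clock_after k (rH P (sample_Z (fker P s) d1)) d3 a)]) cx c0))))"
 have "(%(d0, d1, d2, d3, \<delta>). F d0 d1 d2 d3 \<delta>) \<in> borel_measurable (borel >< borel >< borel >< borel >< seqM)"
  unfolding F_def by measurable
 from seq_split4[OF this]
 have "hev n (y, s, x0, k) hs cx c0 = (nint unifM (%d0. nint unifM (%d1. nint unifM (%d2. nint unifM (%d3. nint seqM (%\<delta>. F d0 d1 d2 d3 \<delta>))))))"
  unfolding hev_def sH_def prod.case Let_def F_def .
 also have "... = (nint unifM (%d0. phH x0 k y s * (if d0 * rH P s < lamH P s then A else vst n k y s hs cx c0)))"
 proof (rule nn_integral_cong)
  fix d0
  show "(nint unifM (%d1. nint unifM (%d2. nint unifM (%d3. nint seqM (%\<delta>. F d0 d1 d2 d3 \<delta>))))) = phH x0 k y s * (if d0 * rH P s < lamH P s then A else vst n k y s hs cx c0)"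
  proof (cases "d0 * rH P s < lamH P s")
   case True then show ?thesis by (simp add: F_def A_def VV_def nn_integral_cmult)
  next
   case False then show ?thesis by (simp add: F_def VV_def vst_def nn_integral_cmult)
  qed
 qed
 also have "... = phH x0 k y s * (nint unifM (%d0. (if d0 * rH P s < lamH P s then A else vst n k y s hs cx c0)))"
  by (rule nn_integral_cmult) measurable
 finally have "ennreal (rH P s) * hev n (y, s, x0, k) hs cx c0 = phH x0 k y s * (ennreal (lamH P s) * A + ennreal (turnH P s) * vst n k y s hs cx c0)"
  unfolding rate_split[OF assms lamH0 turnH0 rH_def, symmetric] by (simp only: mult.left_commute)
 \<comment> \<open>The kernel can be normalised as soon as the splitting rate is non-zero; if the
   rate is zero, the whole term vanishes.\<close>
 moreover have "0 < hfun P s" if "lamH P s ~= 0"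
  using that hfun_nonneg[of s] by (auto simp: lamH_def less_le)
 then have "ennreal (lamH P s) * A = ennreal (lamH P s) * HV n s k y hs cx c0"
  by (cases "lamH P s = 0") (simp_all add: A_def split_event)
 ultimately show ?thesis by simp
qed

lemma fev_eq:
 assumes "0 < rV P s"
 shows "ennreal (rV P s) * fev n x y s k hs cx c0 =
  phV x y k s * (ennreal (lamV P s) * HV n s x k hs cx c0 + ennreal (turnV P s) * app x k s (VS n) hs cx c0)"
proof -
 note [measurable (raw)] = measRV_raw[OF RR_meas(2)] measRS_raw[OF RR_meas(1)]
 define F where "F d0 d1 d2 d3 \<delta> = phV x y k s * (if d0 * rV P s < lamV P s then
    snd (RR n) x k (s - sample_Z (fker P s) d1) (clock_after k (rV P (s - sample_Z (fker P s) d1)) d2 b)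
     (hs @ [(k, sample_Z (fker P s) d1, x, clock_after x (rH P (sample_Z (fker P s) d1)) d3 a)]) cx c0 \<delta>
   else fst (RR n) (hs @ [(k, s, x, clock_after x (rH P s) d3 a)]) cx c0 \<delta>)" for d0 d1 d2 d3 \<delta>
 define A where "A = (nint unifM (%d1. nint unifM (%d2. nint unifM (%d3. VV n x k (s - sample_Z (fker P s) d1) (clock_after k (rV P (s - sample_Z (fker P s) d1)) d2 b)
     (hs @ [(k, sample_Z (fker P s) d1, x, clock_after x (rH P (sample_Z (fker P s) d1)) d3 a)]) cx c0))))"
 have "(%(d0, d1, d2, d3, \<delta>). F d0 d1 d2 d3 \<delta>) \<in> borel_measurable (borel >< borel >< borel >< borel >< seqM)"
  unfolding F_def by measurable
 from seq_split4[OF this]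
 have "fev n x y s k hs cx c0 = (nint unifM (%d0. nint unifM (%d1. nint unifM (%d2. nint unifM (%d3. nint seqM (%\<delta>. F d0 d1 d2 d3 \<delta>))))))"
  unfolding fev_def rv_free_def Let_def F_def .
 also have "... = (nint unifM (%d0. phV x y k s * (if d0 * rV P s < lamV P s then A else app x k s (VS n) hs cx c0)))"
 proof (rule nn_integral_cong)
  fix d0
  show "(nint unifM (%d1. nint unifM (%d2. nint unifM (%d3. nint seqM (%\<delta>. F d0 d1 d2 d3 \<delta>))))) = phV x y k s * (if d0 * rV P s < lamV P s then A else app x k s (VS n) hs cx c0)"
  proof (cases "d0 * rV P s < lamV P s")
   case True then show ?thesis by (simp add: F_def A_def VV_def nn_integral_cmult)
  next
   case False then show ?thesis by (simp add: F_def VS_def app_def nn_integral_cmult)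
  qed
 qed
 also have "... = phV x y k s * (nint unifM (%d0. (if d0 * rV P s < lamV P s then A else app x k s (VS n) hs cx c0)))"
  by (rule nn_integral_cmult) measurable
 finally have "ennreal (rV P s) * fev n x y s k hs cx c0 = phV x y k s * (ennreal (lamV P s) * A + ennreal (turnV P s) * app x k s (VS n) hs cx c0)"
  unfolding rate_split[OF assms lamV0 turnV0 rV_def, symmetric] by (simp only: mult.left_commute)
 moreover have "0 < hfun P s" if "lamV P s ~= 0"
  using that hfun_nonneg[of s] by (auto simp: lamV_def less_le)
 then have "ennreal (lamV P s) * A = ennreal (lamV P s) * HV n s x k hs cx c0"
  by (cases "lamV P s = 0") (simp_all add: A_def split_event)
 ultimately show ?thesis by simp
qed

text \<open>Absorbs the test \<open>u = 0\<close>, so that the four outcomes of a collision become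
  one partition of the unit interval.\<close>

definition p0' :: "int => real" where "p0' u = (if u = 0 then pk_p0 P else 0)"

lemma cev_eq:
 assumes "0 < hfun P (s + sW)"
 shows "cev n x y s (yh, sW, x0, kh) hs cx c0 = phV x y yh s * phH x0 x yh sW *
  (ennreal (pk_pV P (s + sW)) * vst n x yh (s + sW) hs cx c0 + ennreal (pk_pH P (s + sW)) * app x yh (s + sW) (VS n) hs cx c0
   + ennreal (p0' (s + sW)) * VS n hs cx c0
   + ennreal (1 - pk_pV P (s + sW) - pk_pH P (s + sW) - p0' (s + sW)) * HV n (s + sW) x yh hs cx c0)"
proof -
 note [measurable (raw)] = measRV_raw[OF RR_meas(2)] measRS_raw[OF RR_meas(1)]
 define u where "u = s + sW"
 define F where "F d0 d1 d2 d3 \<delta> = phV x y yh s * phH x0 x yh sW *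
   (if d0 < pk_pV P u then snd (RR n) x yh u (clock_after yh (rV P u) d1 b) hs cx c0 \<delta>
   else if d0 < pk_pV P u + pk_pH P u then fst (RR n) (hs @ [(yh, u, x, clock_after x (rH P u) d1 a)]) cx c0 \<delta>
   else if u = 0 & d0 < pk_pV P u + pk_pH P u + pk_p0 P then fst (RR n) hs cx c0 \<delta>
   else snd (RR n) x yh (u - sample_Z (fker P u) d1) (clock_after yh (rV P (u - sample_Z (fker P u) d1)) d2 b)
     (hs @ [(yh, sample_Z (fker P u) d1, x, clock_after x (rH P (sample_Z (fker P u) d1)) d3 a)]) cx c0 \<delta>)" for d0 d1 d2 d3 \<delta>
 have "(%(d0, d1, d2, d3, \<delta>). F d0 d1 d2 d3 \<delta>) \<in> borel_measurable (borel >< borel >< borel >< borel >< seqM)"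
  unfolding F_def by measurable
 from seq_split4[OF this]
 have "cev n x y s (yh, sW, x0, kh) hs cx c0 = (nint unifM (%d0. nint unifM (%d1. nint unifM (%d2. nint unifM (%d3. nint seqM (%\<delta>. F d0 d1 d2 d3 \<delta>))))))"
  unfolding cev_def rv_coll_def prod.case Let_def F_def u_def[symmetric] .
 also have "... = phV x y yh s * phH x0 x yh sW * (nint unifM (%d0. (if d0 < pk_pV P u then vst n x yh u hs cx c0
   else if d0 < pk_pV P u + pk_pH P u then app x yh u (VS n) hs cx c0
   else if d0 < pk_pV P u + pk_pH P u + p0' u then VS n hs cx c0
   else (nint unifM (%d1. nint unifM (%d2. nint unifM (%d3. VV n x yh (u - sample_Z (fker P u) d1) (clock_after yh (rV P (u - sample_Z (fker P u) d1)) d2 b)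
     (hs @ [(yh, sample_Z (fker P u) d1, x, clock_after x (rH P (sample_Z (fker P u) d1)) d3 a)]) cx c0)))))))"
 proof (subst nn_integral_cmult[symmetric], measurable, rule nn_integral_cong)
  fix d0
  consider (1) "d0 < pk_pV P u" | (2) "\<not> d0 < pk_pV P u" "d0 < pk_pV P u + pk_pH P u"
   | (3) "\<not> d0 < pk_pV P u" "\<not> d0 < pk_pV P u + pk_pH P u" "u = 0 & d0 < pk_pV P u + pk_pH P u + pk_p0 P"
   | (4) "\<not> d0 < pk_pV P u" "\<not> d0 < pk_pV P u + pk_pH P u" "\<not> (u = 0 & d0 < pk_pV P u + pk_pH P u + pk_p0 P)"
   by blast
  then show "(nint unifM (%d1. nint unifM (%d2. nint unifM (%d3. nint seqM (%\<delta>. F d0 d1 d2 d3 \<delta>))))) = phV x y yh s * phH x0 x yh sW *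
   (if d0 < pk_pV P u then vst n x yh u hs cx c0
   else if d0 < pk_pV P u + pk_pH P u then app x yh u (VS n) hs cx c0
   else if d0 < pk_pV P u + pk_pH P u + p0' u then VS n hs cx c0
   else (nint unifM (%d1. nint unifM (%d2. nint unifM (%d3. VV n x yh (u - sample_Z (fker P u) d1) (clock_after yh (rV P (u - sample_Z (fker P u) d1)) d2 b)
     (hs @ [(yh, sample_Z (fker P u) d1, x, clock_after x (rH P (sample_Z (fker P u) d1)) d3 a)]) cx c0)))))"
  proof cases
   case 1 then show ?thesis by (simp add: F_def VV_def vst_def nn_integral_cmult)
  next
   case 2 then show ?thesis by (simp add: F_def VS_def app_def nn_integral_cmult)
  next
   case 3
   then have "p0' u = pk_p0 P" by (simp add: p0'_def)
   then have p: "d0 < pk_pV P u + pk_pH P u + p0' u" using 3(3)[THEN conjunct2] by (simp only:)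
   show ?thesis unfolding F_def if_not_P[OF 3(1)] if_not_P[OF 3(2)] if_P[OF 3(3)] if_P[OF p]
    by (simp add: VS_def nn_integral_cmult)
  next
   case 4
   then have "\<not> d0 < pk_pV P u + pk_pH P u + p0' u" by (auto simp: p0'_def)
   with 4 have F: "F d0 d1 d2 d3 \<delta> = phV x y yh s * phH x0 x yh sW * snd (RR n) x yh (u - sample_Z (fker P u) d1) (clock_after yh (rV P (u - sample_Z (fker P u) d1)) d2 b)
     (hs @ [(yh, sample_Z (fker P u) d1, x, clock_after x (rH P (sample_Z (fker P u) d1)) d3 a)]) cx c0 \<delta>" for d1 d2 d3 \<delta>
    unfolding F_def by (simp only: if_False simp_thms)
   show ?thesis using 4(1,2) \<open>\<not> d0 < pk_pV P u + pk_pH P u + p0' u\<close>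
    by (simp add: F VV_def nn_integral_cmult)
  qed
 qed
 finally show ?thesis unfolding u_def[symmetric] split_event[OF assms[folded u_def]]
  by (subst (asm) unif_split4) (use pV0[of u] pH0[of u] p0 psum[of u] psum0 in \<open>auto simp: p0'_def\<close>)
qed

lemma VS_Suc: "VS (Suc n) hs cx c0 =
   fsum (%e e'. fst e < fst e') (%e e'. fst e \<le> fst e') (%e cx'.
    if fst e \<le> a & (\<forall>e'\<in>set c0. fst e \<le> fst e') & (\<forall>e'\<in>set hs. fst e \<le> clk e') then vst n (fst e) 0 (snd e) hs cx' c0 else 0) cx
  + fsum (%e e'. fst e < fst e') (%e e'. fst e \<le> fst e') (%e c0'.
    if fst e \<le> a & (\<forall>e'\<in>set cx. fst e < fst e') & (\<forall>e'\<in>set hs. fst e \<le> clk e')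
    then app (fst e) (fst (snd e)) (snd (snd e)) (vst n (fst e) (fst (snd e)) (- snd (snd e))) hs cx c0' else 0) c0
  + fsum (%e e'. clk e < clk e') (%e e'. clk e \<le> clk e') (%e hs'.
    if clk e \<le> a & (\<forall>e'\<in>set cx. clk e < fst e') & (\<forall>e'\<in>set c0. clk e < fst e') then hev n e hs' cx c0 else 0) hs"
proof -
 note [measurable (raw)] = measRV_raw[OF RR_meas(2)]
 have mX [measurable]: "(%\<delta>. sX (snd (RR n)) e hs cx c0 \<delta>) \<in> borel_measurable seqM" for e hs cx c0
  unfolding sX_def by measurable
 have m0 [measurable]: "(%\<delta>. s0 (snd (RR n)) e hs cx c0 \<delta>) \<in> borel_measurable seqM" for e hs cx c0
  unfolding s0_def split_beta' by measurable
 have mH [measurable]: "(%\<delta>. sH (snd (RR n)) e hs cx c0 \<delta>) \<in> borel_measurable seqM" for e hs cx c0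
  unfolding sH_def split_beta' Let_def by measurable
 have if_int: "(nint seqM (%\<delta>. (if C then G \<delta> else 0))) = (if C then (nint seqM (%\<delta>. G \<delta>)) else 0)" for C G by simp
 have s0': "(nint seqM (%\<delta>. s0 (snd (RR n)) e hs cx c0 \<delta>)) = app (fst e) (fst (snd e)) (snd (snd e)) (vst n (fst e) (fst (snd e)) (- snd (snd e))) hs cx c0" for e hs cx c0
  using s0_int[of n "fst e" "fst (snd e)" "snd (snd e)"] by simp
 have m: "(%\<delta>. fsum Q R (%e r. if C e r then G e r \<delta> else 0) xs) \<in> borel_measurable seqM"
  if "\<And>e r. G e r \<in> borel_measurable seqM" for Q R C G and xs :: "'z list"
  unfolding fsum_def using that by (intro borel_measurable_sum) auto
 define FX where "FX \<delta> = fsum (%e e'. fst e < fst e') (%e e'. fst e \<le> fst e') (%e cx'.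
    if fst e \<le> a & (\<forall>e'\<in>set c0. fst e \<le> fst e') & (\<forall>e'\<in>set hs. fst e \<le> clk e') then sX (snd (RR n)) e hs cx' c0 \<delta> else 0) cx" for \<delta>
 define F0 where "F0 \<delta> = fsum (%e e'. fst e < fst e') (%e e'. fst e \<le> fst e') (%e c0'.
    if fst e \<le> a & (\<forall>e'\<in>set cx. fst e < fst e') & (\<forall>e'\<in>set hs. fst e \<le> clk e') then s0 (snd (RR n)) e hs cx c0' \<delta> else 0) c0" for \<delta>
 define FH where "FH \<delta> = fsum (%e e'. clk e < clk e') (%e e'. clk e \<le> clk e') (%e hs'.
    if clk e \<le> a & (\<forall>e'\<in>set cx. clk e < fst e') & (\<forall>e'\<in>set c0. clk e < fst e') then sH (snd (RR n)) e hs' cx c0 \<delta> else 0) hs" for \<delta>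
 have [measurable]: "FX \<in> borel_measurable seqM" "F0 \<in> borel_measurable seqM" "FH \<in> borel_measurable seqM"
  unfolding FX_def[abs_def] F0_def[abs_def] FH_def[abs_def] by (rule m, rule mX, rule m, rule m0, rule m, rule mH)
 have "VS (Suc n) hs cx c0 = (nint seqM (%\<delta>. FX \<delta>)) + (nint seqM (%\<delta>. F0 \<delta>)) + (nint seqM (%\<delta>. FH \<delta>))"
  unfolding VS_def RR.simps fst_conv rs_step_def FX_def[symmetric] F0_def[symmetric] FH_def[symmetric]
  by (simp add: nn_integral_add)
 moreover have "(nint seqM (%\<delta>. FX \<delta>)) = fsum (%e e'. fst e < fst e') (%e e'. fst e \<le> fst e') (%e cx'.
    if fst e \<le> a & (\<forall>e'\<in>set c0. fst e \<le> fst e') & (\<forall>e'\<in>set hs. fst e \<le> clk e') then vst n (fst e) 0 (snd e) hs cx' c0 else 0) cx"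
  unfolding FX_def sX_int[symmetric] if_int[symmetric] by (rule nn_integral_fsum) measurable
 moreover have "(nint seqM (%\<delta>. F0 \<delta>)) = fsum (%e e'. fst e < fst e') (%e e'. fst e \<le> fst e') (%e c0'.
    if fst e \<le> a & (\<forall>e'\<in>set cx. fst e < fst e') & (\<forall>e'\<in>set hs. fst e \<le> clk e')
    then app (fst e) (fst (snd e)) (snd (snd e)) (vst n (fst e) (fst (snd e)) (- snd (snd e))) hs cx c0' else 0) c0"
  unfolding F0_def s0'[symmetric] if_int[symmetric] by (rule nn_integral_fsum) measurable
 moreover have "(nint seqM (%\<delta>. FH \<delta>)) = fsum (%e e'. clk e < clk e') (%e e'. clk e \<le> clk e') (%e hs'.
    if clk e \<le> a & (\<forall>e'\<in>set cx. clk e < fst e') & (\<forall>e'\<in>set c0. clk e < fst e') then hev n e hs' cx c0 else 0) hs"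
  unfolding FH_def hev_def if_int[symmetric] by (rule nn_integral_fsum) measurable
 ultimately show ?thesis by (simp only:)
qed

end

text \<open>The selected entry is the first of all hidden events, so all of them lie to the right of
  \<open>x\<close> as soon as it does; the global restriction in \<open>Full\<close> becomes one on
  the selected entry.\<close>

lemma fsum_if_min:
 fixes f :: "'a => real"
 assumes "\<And>e. e \<in> set xs ==> C e ==> \<forall>e'\<in>set xs. f e \<le> f e' ==> (G \<longleftrightarrow> x < f e)"
 shows "(if G then fsum (%e e'. f e < f e') (%e e'. f e \<le> f e') (%e r. if C e then F e r else 0) xs else 0)
  = fsum (%e e'. f e < f e') (%e e'. f e \<le> f e') (%e r. if x < f e & C e then F e r else 0) xs"
proof -
 let ?c = "%i. \<forall>j<length xs. (j < i --> f (xs ! i) < f (xs ! j)) & (i < j --> f (xs ! i) \<le> f (xs ! j))"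
 have "(if G then (if ?c i then if C (xs ! i) then F (xs ! i) (rem i xs) else 0 else 0) else 0)
  = (if ?c i then if x < f (xs ! i) & C (xs ! i) then F (xs ! i) (rem i xs) else 0 else 0)" if i: "i < length xs" for i
 proof (cases "?c i & C (xs ! i)")
  case True
  have "f (xs ! i) \<le> f (xs ! j)" if "j < length xs" for j
   using True that by (cases j i rule: linorder_cases) (auto dest: spec[of _ j])
  then have "\<forall>e'\<in>set xs. f (xs ! i) \<le> f e'" by (auto simp: all_set_conv_all_nth)
  then have "G \<longleftrightarrow> x < f (xs ! i)" using assms[of "xs ! i"] i True by simp
  then show ?thesis using True by simp
 next
  case False
  have "\<not> (c & C') ==> (if G then (if c then if C' then A else 0 else 0) else 0) = (if c then if H & C' then A else 0 else 0)"
   for c C' H :: bool and A :: ennreal by auto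
  from this[OF False] show ?thesis .
 qed
 then have "(\<Sum>i<length xs. if G then (if ?c i then if C (xs ! i) then F (xs ! i) (rem i xs) else 0 else 0) else 0)
  = (\<Sum>i<length xs. if ?c i then if x < f (xs ! i) & C (xs ! i) then F (xs ! i) (rem i xs) else 0 else 0)"
  by (intro sum.cong refl) simp
 then show ?thesis unfolding fsum_def by (cases G) simp_all
qed

lemma nn_count_single:
 assumes "\<And>x. x ~= c ==> f x = 0"
 shows "(nint (count_space UNIV) (%x. f x)) = f c"
proof -
 have "(nint (count_space UNIV) (%x. f x)) = (\<Sum>x\<in>{c}. f x)"
  by (rule nn_integral_count_space'[of "{c}"]) (use assms in auto)
 then show ?thesis by simp
qed

section \<open>The weights of the chain and their detailed balance\<close>

context pks_dist
begin

abbreviation "am m x y \<equiv> al (snd m) x y (fst m)"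
abbreviation "bm m x y \<equiv> be (snd m) x y (fst m)"

text \<open>The turning rate of either direction divided by the reference mass of the line that it
  produces. The geometric mean in the denominator is what makes the two directions agree.\<close>

definition tq :: "int => real" where "tq s = pk_q P s / sqrt (nV s * nH s)"
definition cc :: "int => real" where "cc u = 1 - pk_pV P u - pk_pH P u - p0' u"

text \<open>Each weight is a rate or probability of the simulation divided by the reference masses
  of the outgoing lines, with \<open>be\<close> for every incoming and \<open>al\<close> for every
  outgoing line. For instance \<open>lamH\<close> times \<open>fker / hfun\<close> leaves
  \<open>pk_pH / nH\<close> after division by \<open>nH * nV\<close>, which is also the probability
  \<open>pk_pH\<close> of the reverse meeting divided by \<open>nH\<close>.\<close>

definition W :: "(int \<times> nat) wts" where
 "W = \<lparr> wL = (%y m. am m 0 y), wR = (%y m. bm m a y), wB = (%x m. am m x 0), wT = (%x m. bm m x b),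
  wC = (%x y h v. ennreal (if fst h + fst v = 0 then pk_p0 P else 0) * am h x y * am v x y),
  wA = (%x y h v. ennreal (if fst h + fst v = 0 then pk_p0 P else 0) * bm h x y * bm v x y),
  wHT = (%x y m v. ennreal (if fst m = fst v then tq (fst m) else 0) * bm m x y * am v x y),
  wVT = (%x y v m. ennreal (if fst m = fst v then tq (fst m) else 0) * bm v x y * am m x y),
  wHS = (%x y m h v. ennreal (if fst m = fst h + fst v then pk_pH P (fst m) / nH (fst m) else 0) * bm m x y * am h x y * am v x y),
  wHJ = (%x y h v m. ennreal (if fst m = fst h + fst v then pk_pH P (fst m) / nH (fst m) else 0) * bm h x y * bm v x y * am m x y),
  wVS = (%x y m h v. ennreal (if fst m = fst h + fst v then pk_pV P (fst m) / nV (fst m) else 0) * bm m x y * am h x y * am v x y),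
  wVJ = (%x y h v m. ennreal (if fst m = fst h + fst v then pk_pV P (fst m) / nV (fst m) else 0) * bm h x y * bm v x y * am m x y),
  wX = (%x y h v h' v'. ennreal (if fst h + fst v = fst h' + fst v' then cc (fst h + fst v) / hfun P (fst h + fst v) else 0)
    * bm h x y * bm v x y * am h' x y * am v' x y) \<rparr>"

definition RL :: "(real \<times> int \<times> nat) list => real" where "RL \<eta> = sum_list (map (%z. rH P (fst (snd z))) \<eta>)"
definition RT :: "(real \<times> int \<times> real) list => real" where "RT L = sum_list (map (%l. rH P (fst (snd l))) L)"
text \<open>Survival of all horizontal clocks between two columns. The rate of the event that ends
  the flight belongs to the vertex weight, so the kernel depends on \<open>x' - x\<close> alone and
  is invariant under reflection.\<close>

definition kS :: "(real \<times> int \<times> nat) list => real => real => ennreal" where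
 "kS \<eta> x x' = (if x < x' then ennreal (exp (- (x' - x) * RL \<eta>)) else 0)"
text \<open>A vertical line is also stopped by the first horizontal line above it, so a flight from
  \<open>y\<close> to \<open>y'\<close> needs a gap without lines. This condition, too, is invariant
  under reflection.\<close>

definition kV :: "int \<times> nat => (real \<times> int \<times> nat) list => real => real => ennreal" where
 "kV m \<eta> y y' = (if y < y' & (\<forall>z\<in>set \<eta>. \<not> (y < fst z & fst z < y')) then ennreal (exp (- (y' - y) * rV P (fst m))) else 0)"

lemma am_meas [measurable (raw)]:
 assumes [measurable]: "m \<in> M \<rightarrow>\<^sub>M markM" "x \<in> borel_measurable M" "y \<in> borel_measurable M"
 shows "(%w. al (snd (m w)) (x w) (y w) (fst (m w))) \<in> borel_measurable M"
  "(%w. be (snd (m w)) (x w) (y w) (fst (m w))) \<in> borel_measurable M"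
proof -
 note [measurable] = measurable_mark_fst[OF assms(1)] measurable_mark_snd[OF assms(1)]
 show "(%w. al (snd (m w)) (x w) (y w) (fst (m w))) \<in> borel_measurable M"
  "(%w. be (snd (m w)) (x w) (y w) (fst (m w))) \<in> borel_measurable M" by measurable
qed

lemma mark_meas2:
 fixes c :: "int \<times> nat => int \<times> nat => ennreal"
 assumes "m \<in> M \<rightarrow>\<^sub>M markM" "m' \<in> M \<rightarrow>\<^sub>M markM"
 shows "(%w. c (m w) (m' w)) \<in> borel_measurable M"
proof (rule measurable_compose_countable[OF _ assms(1), where f="%i w. c i (m' w)"])
 show "(%w. c i (m' w)) \<in> borel_measurable M" for i by (rule measurable_compose[OF assms(2)]) simp
qed

lemma mark_meas3:
 fixes c :: "int \<times> nat => int \<times> nat => int \<times> nat => ennreal"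
 assumes "m \<in> M \<rightarrow>\<^sub>M markM" "m' \<in> M \<rightarrow>\<^sub>M markM" "m'' \<in> M \<rightarrow>\<^sub>M markM"
 shows "(%w. c (m w) (m' w) (m'' w)) \<in> borel_measurable M"
proof (rule measurable_compose_countable[OF _ assms(1), where f="%i w. c i (m' w) (m'' w)"])
 show "(%w. c i (m' w) (m'' w)) \<in> borel_measurable M" for i by (rule mark_meas2[OF assms(2,3)])
qed

lemma mark_meas4:
 fixes c :: "int \<times> nat => int \<times> nat => int \<times> nat => int \<times> nat => ennreal"
 assumes "m \<in> M \<rightarrow>\<^sub>M markM" "m' \<in> M \<rightarrow>\<^sub>M markM" "m'' \<in> M \<rightarrow>\<^sub>M markM" "m3 \<in> M \<rightarrow>\<^sub>M markM"
 shows "(%w. c (m w) (m' w) (m'' w) (m3 w)) \<in> borel_measurable M"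
proof (rule measurable_compose_countable[OF _ assms(1), where f="%i w. c i (m' w) (m'' w) (m3 w)"])
 show "(%w. c i (m' w) (m'' w) (m3 w)) \<in> borel_measurable M" for i by (rule mark_meas3[OF assms(2-4)])
qed

lemma W_meas: "lc.wts_meas W"
proof -
 have A: "(%w. ennreal (if fst (h w) + fst (v w) = 0 then c else 0)) \<in> borel_measurable M"
  if "h \<in> M \<rightarrow>\<^sub>M markM" "v \<in> M \<rightarrow>\<^sub>M markM" for h v :: "'z => int \<times> nat" and c M
  by (rule mark_meas2[where c="%h v. ennreal (if fst h + fst v = 0 then c else 0)", OF that])
 have B: "(%w. ennreal (if fst (h w) = fst (v w) then c (fst (h w)) else 0)) \<in> borel_measurable M"
  if "h \<in> M \<rightarrow>\<^sub>M markM" "v \<in> M \<rightarrow>\<^sub>M markM" for h v :: "'z => int \<times> nat" and c M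
  by (rule mark_meas2[where c="%h v. ennreal (if fst h = fst v then c (fst h) else 0)", OF that])
 have C: "(%w. ennreal (if fst (m w) = fst (h w) + fst (v w) then c (fst (m w)) / d (fst (m w)) else 0)) \<in> borel_measurable M"
  if "m \<in> M \<rightarrow>\<^sub>M markM" "h \<in> M \<rightarrow>\<^sub>M markM" "v \<in> M \<rightarrow>\<^sub>M markM" for m h v :: "'z => int \<times> nat" and c d M
  by (rule mark_meas3[where c="%m h v. ennreal (if fst m = fst h + fst v then c (fst m) / d (fst m) else 0)", OF that])
 have D: "(%w. ennreal (if fst (h w) + fst (v w) = fst (h' w) + fst (v' w) then cc (fst (h w) + fst (v w)) / hfun P (fst (h w) + fst (v w)) else 0)) \<in> borel_measurable M"
  if "h \<in> M \<rightarrow>\<^sub>M markM" "v \<in> M \<rightarrow>\<^sub>M markM" "h' \<in> M \<rightarrow>\<^sub>M markM" "v' \<in> M \<rightarrow>\<^sub>M markM" for h v h' v' :: "'z => int \<times> nat" and M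
  by (rule mark_meas4[where c="%h v h' v'. ennreal (if fst h + fst v = fst h' + fst v' then cc (fst h + fst v) / hfun P (fst h + fst v) else 0)", OF that])
 show ?thesis unfolding lc.wts_meas_def W_def wts.simps split_beta'
  by (intro conjI borel_measurable_times_ennreal) ((rule A B C D am_meas)?; measurable)+
qed

lemma RL_meas [measurable (raw)]: "f \<in> M \<rightarrow>\<^sub>M listM (borel >< markM) ==> (%w. RL (f w)) \<in> borel_measurable M"
proof -
 assume [measurable]: "f \<in> M \<rightarrow>\<^sub>M listM (borel >< markM)"
 have [measurable]: "(%z. rH P (fst (snd z))) \<in> borel_measurable (borel >< markM)"
  by (rule measurable_compose[OF measurable_snd]) simp
 show ?thesis unfolding RL_def by measurable
qed

lemma rV_mark_meas: "m \<in> M \<rightarrow>\<^sub>M markM ==> (%w. rV P (fst (m w))) \<in> borel_measurable M"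
 by (rule measurable_compose[where g="%m. rV P (fst m)" and N=markM]) simp_all

lemma RL_sym: "sym_fun RL"
proof (rule sym_funI)
 fix xs ys :: "(real \<times> int \<times> nat) list" assume e: "mset xs = mset ys"
 have "RL zs = sum_mset (image_mset (%z. rH P (fst (snd z))) (mset zs))" for zs
  unfolding RL_def by (metis mset_map sum_mset_sum_list)
 then show "RL xs = RL ys" by (simp only: e)
qed

lemma k_meas: "lc.kern_meas kS kV"
proof -
 have S: "sym_fun (%\<eta>. kS \<eta> x x')" for x x'
 proof (rule sym_funI)
  fix xs ys :: "(real \<times> int \<times> nat) list" assume e: "mset xs = mset ys"
  show "kS xs x x' = kS ys x x'" unfolding kS_def sym_funD[OF RL_sym e] ..
 qed
 have V: "sym_fun (%\<eta>. kV m \<eta> x x')" for m x x'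
 proof (rule sym_funI)
  fix xs ys :: "(real \<times> int \<times> nat) list" assume e: "mset xs = mset ys"
  show "kV m xs x x' = kV m ys x x'" unfolding kV_def mset_eq_setD[OF e] ..
 qed
 note [measurable (raw)] = rV_mark_meas
 have 1: "(%(\<eta>, x, x'). kS \<eta> x x') \<in> borel_measurable (listM (borel >< markM) >< borel >< borel)"
  unfolding kS_def by measurable
 have 2: "(%(m, \<eta>, x, x'). kV m \<eta> x x') \<in> borel_measurable (markM >< listM (borel >< markM) >< borel >< borel)"
  unfolding kV_def by measurable
 show ?thesis unfolding lc.kern_meas_def by (intro conjI allI S V 1 2)
qed

definition "gS = lc.chS W kS kV a 0 b"
definition "gV = lc.chV W kS kV a 0 b"

lemma g_meas: "lc.measS (gS n)" "lc.measV (gV n)"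
 unfolding gS_def gV_def by (intro lc.ch_measurable W_meas k_meas)+

lemma g_sym: "sym_fun (gS n x)" "sym_fun (gV n x y m)"
 unfolding gS_def gV_def by (intro lc.ch_sym k_meas)+

lemmas gS_raw [measurable (raw)] = lc.measS_raw[OF g_meas(1)]
lemmas gV_raw [measurable (raw)] = lc.measV_raw[OF g_meas(2)]

lemma g_Suc:
 "gS (Suc n) = lc.pS kS (%x. lc.vS W 0 x (gV n x))"
 "gV (Suc n) = (%x. lc.pV kV b (lc.vT W x (gS n x)) (lc.v1 W x (gS n x) (gV n x)) (lc.v2 W x (gS n x) (gV n x)))"
 by (simp_all add: gS_def gV_def split_beta')

abbreviation "SL \<equiv> lint KL"

lemma nn_mkH: "(nint mkH (%m. f m)) = (nint intM (%s. nint natM (%j. ennreal (nH s) * f (s, j))))"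
 and nn_mkV: "(nint mkV (%m. f m)) = (nint intM (%s. nint natM (%j. ennreal (nV s) * f (s, j))))"
 unfolding mkH_def mkV_def by (simp_all add: nn_integral_density nn_integral_fst_count_space[symmetric])

text \<open>The constraint that the intensities add up to \<open>u\<close> leaves one of them free,
  and the two reference masses multiply to the unnormalised splitting kernel.\<close>

lemma mk_pair: "(nint mkH (%h. nint mkV (%v. (if u = fst h + fst v then A h v else 0))))
  = (nint intM (%t. ennreal (fker P u t) * (nint natM (%j. nint natM (%l. A (t, j) (u - t, l))))))"
proof -
 have 1: "(nint mkV (%v. (if u = fst h + fst v then A h v else 0))) = ennreal (nV (u - fst h)) * (nint natM (%l. A h (u - fst h, l)))" for h
  unfolding nn_mkV by (subst nn_count_single[of "u - fst h"]) (auto simp: nn_integral_cmult)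
 show ?thesis unfolding 1 nn_mkH
  by (simp add: nn_integral_cmult fker_def ennreal_mult nV0 nH0 mult_ac)
qed

lemma mk_singleV: "(nint mkV (%v. (if u = fst v then A v else 0))) = ennreal (nV u) * (nint natM (%l. A (u, l)))"
 and mk_singleH: "(nint mkH (%v. (if u = fst v then A v else 0))) = ennreal (nH u) * (nint natM (%l. A (u, l)))"
 unfolding nn_mkV nn_mkH by (subst nn_count_single[of u], auto simp: nn_integral_cmult)+

lemma mk_borel: "f \<in> borel_measurable mkV" "f \<in> borel_measurable mkH"
 by (simp_all add: measurable_def mkV_def mkH_def)

lemma SL_int:
 assumes "sigma_finite_measure M" and [measurable]: "w \<in> borel_measurable M"
  and G: "(%(m, \<eta>). G m \<eta>) \<in> borel_measurable (M >< listM (borel >< markM))"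
 shows "SL L (%\<eta>. nint M (%m. w m * G m \<eta>)) = (nint M (%m. w m * SL L (G m)))"
proof -
 note [measurable (raw)] = meas2[OF G]
 show ?thesis by (subst kL.lint_nn_integral[OF assms(1)], measurable, intro nn_integral_cong kL.lint_cmult, measurable)
qed

lemma SL_picks:
 assumes F: "(%(z, r). F z r) \<in> borel_measurable ((borel >< markM) >< listM (borel >< markM))"
 shows "SL L (picks F) = (\<Sum>i<length L. nint natM (%j. al j (snd (snd (L ! i))) (fst (L ! i)) (fst (snd (L ! i))) *
   SL (rem i L) (F (fst (L ! i), fst (snd (L ! i)), j))))"
proof -
 note [measurable (raw)] = meas2[OF F]
 have "SL L (picks F) = (\<Sum>i<length L. nint (KL (L ! i)) (%e. SL (rem i L) (F e)))"
  by (subst kL.lint_fsum[where B="%_ _. True"], measurable)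
 moreover have "(nint (KL (L ! i)) (%e. SL (rem i L) (F e))) = (nint natM (%j. al j (snd (snd (L ! i))) (fst (L ! i)) (fst (snd (L ! i))) *
   SL (rem i L) (F (fst (L ! i), fst (snd (L ! i)), j))))" for i
  using nn_KL[of "%e. SL (rem i L) (F e)" "fst (L ! i)" "fst (snd (L ! i))" "snd (snd (L ! i))"] by simp
 ultimately show ?thesis by simp
qed

definition relK :: "real \<times> int \<times> real => real \<times> int \<times> nat => bool" where
 "relK l z \<longleftrightarrow> fst z = fst l & fst (snd z) = fst (snd l)"

lemma SL_cong: "(\<And>\<eta>. list_all2 relK L \<eta> ==> F \<eta> = G \<eta>) ==> SL L F = SL L G"
proof (rule lint_cong_AE[where \<rho>=relK])
 fix l
 have "AE z in KL l. fst z = fst l & fst (snd z) = fst (snd l)"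
  unfolding KL_def
 proof (subst AE_distr_iff)
  show "{x \<in> space (borel >< markM). fst x = fst l & fst (snd x) = fst (snd l)} \<in> sets (borel >< markM)"
  proof -
   have [measurable]: "Measurable.pred (borel >< markM) (%x. fst (snd x) = fst (snd l))"
    by (rule measurable_compose[OF measurable_snd]) simp
   have "Measurable.pred (borel >< markM) (%x. fst x = fst l & fst (snd x) = fst (snd l))" by measurable
   then show ?thesis by (rule predE)
  qed
 qed auto
 then show "AE z in KL l. relK l z" by (simp add: relK_def)
qed

text \<open>General position: distinct heights make the next collision unique, and positivity of
  \<open>nH\<close> keeps out intensities that no line of the simulation has.\<close>

definition gen :: "real => (real \<times> int \<times> real) list => bool" where
 "gen x L \<longleftrightarrow> distinct (map fst L) & (\<forall>l\<in>set L. 0 < fst l & fst l < b & 0 < nH (fst (snd l)) & snd (snd l) \<le> x)"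

text \<open>The probability that none of the clocks of \<open>L\<close>, all started at 0, has rung
  before \<open>x\<close>.\<close>

definition EE :: "real => (real \<times> int \<times> real) list => ennreal" where
 "EE x L = ennreal (exp (- RT L * x))"

lemma set_rem: "i < length L ==> set L = insert (L ! i) (set (rem i L))"
 by (metis mset_rem set_mset_add_mset_insert set_mset_mset)

lemma gen_rem:
 assumes "gen x L" "i < length L" shows "gen x (rem i L)" "fst (L ! i) \<notin> fst ` set (rem i L)"
proof -
 have m: "mset (map fst L) = add_mset (fst (L ! i)) (mset (map fst (rem i L)))"
  using mset_rem[OF assms(2)] by (metis mset_map image_mset_add_mset)
 then have d: "distinct (fst (L ! i) # map fst (rem i L))"
  using assms(1) unfolding gen_def by (metis mset.simps(2) mset_eq_imp_distinct_iff)
 then show "fst (L ! i) \<notin> fst ` set (rem i L)" by simp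
 show "gen x (rem i L)" using assms(1) d set_rem[OF assms(2)] by (auto simp: gen_def)
qed

lemma EE_rem: "i < length L ==> EE x L = ennreal (exp (- rH P (fst (snd (L ! i))) * x)) * EE x (rem i L)"
proof -
 assume i: "i < length L"
 have "RT L = sum_mset (image_mset (%l. rH P (fst (snd l))) (mset L))" unfolding RT_def by (metis mset_map sum_mset_sum_list)
 also have "... = rH P (fst (snd (L ! i))) + RT (rem i L)"
  unfolding mset_rem[OF i, symmetric] RT_def by (simp flip: sum_mset_sum_list)
 finally have e: "- RT L * x = - rH P (fst (snd (L ! i))) * x + - RT (rem i L) * x" by (simp add: algebra_simps)
 show ?thesis unfolding EE_def e exp_add by (simp only: ennreal_mult exp_ge_zero)
qed

text \<open>The price \<open>exp (rH P s * x)\<close> of entering a new line with a clock started at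
  0 cancels against the survival factor of that line.\<close>

lemma EE_app: "ennreal (exp (rH P s * x)) * EE x (L @ [(y, s, x0)]) = EE x L"
proof -
 have "rH P s * x + - RT (L @ [(y, s, x0)]) * x = - RT L * x" by (simp add: RT_def algebra_simps)
 then show ?thesis unfolding EE_def by (metis ennreal_mult exp_add exp_ge_zero)
qed

lemma gen_app: "gen x L ==> 0 < y ==> y < b ==> y \<notin> fst ` set L ==> 0 < nH h ==> gen x (L @ [(y, h, x)])"
 by (auto simp: gen_def)

text \<open>The simulation appends a new line at the end, the chain puts it in front; symmetry of
  \<open>F\<close> identifies the two.\<close>

lemma SL_app:
 assumes F: "F \<in> borel_measurable (listM (borel >< markM))" and "sym_fun F"
 shows "SL (L @ [(y, h, x)]) F = (nint natM (%j. al j x y h * SL L (%\<eta>. F ((y, h, j) # \<eta>))))"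
proof -
 note [measurable] = F
 have "SL (L @ [(y, h, x)]) F = SL L (%\<eta>. nint natM (%j. al j x y h * F (\<eta> @ [(y, h, j)])))"
  unfolding kL.lint_snoc by (subst nn_KL, measurable)
 also have "... = SL L (%\<eta>. nint natM (%j. al j x y h * F ((y, h, j) # \<eta>)))"
 proof -
  have "F (\<eta> @ [z]) = F (z # \<eta>)" for \<eta> z by (rule sym_funD[OF assms(2)]) simp
  then show ?thesis by simp
 qed
 also have "... = (nint natM (%j. al j x y h * SL L (%\<eta>. F ((y, h, j) # \<eta>))))"
  by (rule SL_int[OF sigma_finite_measure_count_space]) measurable
 finally show ?thesis .
qed

text \<open>Continuations after a vertex with outgoing intensity \<open>u\<close>, on the side of
  the chain: a vertical line, a horizontal line (\<open>oH\<close>), or both with vertex weight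
  \<open>c\<close> (\<open>oHV\<close>).\<close>

definition "oV n x y u L = (nint natM (%l. al l x y u * SL L (gV n x y (u, l))))"
definition "oH n x y u L = (nint natM (%l. al l x y u * SL L (%\<eta>. gS n x ((y, u, l) # \<eta>))))"
definition "oHV n c x y u L = (nint mkH (%h. nint mkV (%v. ennreal (if u = fst h + fst v then c else 0) * am h x y * am v x y * SL L (%\<eta>. gV n x y v ((y, h) # \<eta>)))))"

lemma oHV_eq: "oHV n c x y u L = (nint intM (%t. ennreal (fker P u t) * (nint natM (%j. nint natM (%l. ennreal c * al j x y t * al l x y (u - t) * SL L (%\<eta>. gV n x y (u - t, l) ((y, t, j) # \<eta>)))))))"
proof -
 have e: "ennreal (if u = fst h + fst v then c else 0) * A = (if u = fst h + fst v then ennreal c * A else 0)" for h v :: "int \<times> nat" and A by simp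
 show ?thesis unfolding oHV_def mult.assoc unfolding e
  unfolding mk_pair[of u "%h v. ennreal c * (am h x y * (am v x y * SL L (%\<eta>. gV n x y v ((y, h) # \<eta>))))"] by simp
qed

lemma oHV_scale:
 assumes "0 \<le> c" "0 \<le> d" shows "oHV n (c * d) x y u L = ennreal c * oHV n d x y u L"
 unfolding oHV_eq ennreal_mult[OF assms]
 by (simp add: nn_integral_cmult[symmetric] mult_ac)

lemma oHV_zero: "hfun P u = 0 ==> oHV n c x y u L = 0"
 unfolding oHV_eq using fker_le_hfun[of u] by (simp add: ennreal_neg)

text \<open>The central identity with \<open>n\<close> steps left, used as induction hypothesis:
  \<open>IS\<close> between columns and \<open>IV\<close> inside one. In \<open>IV\<close> the lines
  above \<open>y\<close> have started strictly to the left of \<open>x\<close>, so that the piece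
  which ends at a collision has positive length; lines at or below \<open>y\<close> may have been
  born in this very column.\<close>

context
 fixes n :: nat
 assumes IS: "\<And>x L. 0 \<le> x ==> x < a ==> gen x L ==> Full x L (VS n) = EE x L * SL L (gS n x)"
  and IV: "\<And>x y s L. 0 \<le> x ==> x < a ==> gen x L ==> 0 \<le> y ==> y < b ==> 0 < nV s ==>
   \<forall>l\<in>set L. y < fst l --> snd (snd l) < x ==> Full x L (vst n x y s) = EE x L * oV n x y s L"
begin

lemma out_H:
 assumes "0 \<le> x" "x < a" "gen x L" "0 < y" "y < b" "y \<notin> fst ` set L" "0 < nH h"
 shows "Full x L (app x y h (VS n)) = EE x L * oH n x y h L"
proof -
 have "measF (VS n)" unfolding measF_def by measurable
 then have "Full x L (app x y h (VS n)) = ennreal (exp (rH P h * x)) * (EE x (L @ [(y, h, x)]) * SL (L @ [(y, h, x)]) (gS n x))"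
  using assms by (simp add: Full_app IS gen_app)
 also have "... = EE x L * SL (L @ [(y, h, x)]) (gS n x)" by (simp add: mult.assoc[symmetric] EE_app)
 also have "SL (L @ [(y, h, x)]) (gS n x) = oH n x y h L"
  unfolding oH_def by (rule SL_app) (measurable, rule g_sym)
 finally show ?thesis .
qed

text \<open>The horizontal line is entered first and the vertical line then starts with the enlarged
  list. The new line starts at \<open>x\<close> itself but lies at height \<open>y\<close>, not
  above it, so the hypothesis of \<open>IV\<close> on the lines above \<open>y\<close>
  persists.\<close>

lemma out_HV1:
 assumes "0 \<le> x" "x < a" "gen x L" "0 < y" "y < b" "y \<notin> fst ` set L" "\<forall>l\<in>set L. y < fst l --> snd (snd l) < x" "0 < nH h" "0 < nV v"
 shows "Full x L (app x y h (vst n x y v)) =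
  EE x L * (nint natM (%j. nint natM (%l. al j x y h * al l x y v * SL L (%\<eta>. gV n x y (v, l) ((y, h, j) # \<eta>)))))"
proof -
 have "measF (vst n x y v)" unfolding measF_def by measurable
 then have "Full x L (app x y h (vst n x y v)) = ennreal (exp (rH P h * x)) * (EE x (L @ [(y, h, x)]) * oV n x y v (L @ [(y, h, x)]))"
  using assms by (simp add: Full_app IV gen_app)
 also have "... = EE x L * oV n x y v (L @ [(y, h, x)])" by (simp add: mult.assoc[symmetric] EE_app)
 also have "oV n x y v (L @ [(y, h, x)]) = (nint natM (%l. al l x y v * (nint natM (%j. al j x y h * SL L (%\<eta>. gV n x y (v, l) ((y, h, j) # \<eta>))))))"
  unfolding oV_def by (intro nn_integral_cong arg_cong2[of _ _ _ _ "(*)"] refl SL_app) (measurable, rule g_sym)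
 also have "... = (nint natM (%l. nint natM (%j. al j x y h * al l x y v * SL L (%\<eta>. gV n x y (v, l) ((y, h, j) # \<eta>)))))"
  by (simp add: nn_integral_cmult[symmetric] mult_ac)
 also have "... = (nint natM (%j. nint natM (%l. al j x y h * al l x y v * SL L (%\<eta>. gV n x y (v, l) ((y, h, j) # \<eta>)))))"
  by (rule nn_swap2[OF sigma_finite_measure_count_space sigma_finite_measure_count_space]) (simp add: pair_measure_countable)
 finally show ?thesis .
qed

lemma out_HV:
 assumes "0 \<le> x" "x < a" "gen x L" "0 < y" "y < b" "y \<notin> fst ` set L" "\<forall>l\<in>set L. y < fst l --> snd (snd l) < x"
 shows "Full x L (HV n u x y) = EE x L * oHV n (1 / hfun P u) x y u L"
proof -
 have "Full x L (HV n u x y) = (nint intM (%T. Full x L (%hs cx c0. ennreal (fker P u T / hfun P u) * app x y T (vst n x y (u - T)) hs cx c0)))"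
  unfolding HV_def by (rule Full_nn_integral[OF sigma_finite_measure_count_space]) measurable
 also have "... = (nint intM (%T. EE x L * (ennreal (fker P u T) * (nint natM (%j. nint natM (%l. ennreal (1 / hfun P u) * al j x y T * al l x y (u - T) * SL L (%\<eta>. gV n x y (u - T, l) ((y, T, j) # \<eta>))))))))"
 proof (rule nn_integral_cong)
  fix T
  have "measF (app x y T (vst n x y (u - T)))" unfolding measF_def by measurable
  then have 1: "Full x L (%hs cx c0. ennreal (fker P u T / hfun P u) * app x y T (vst n x y (u - T)) hs cx c0)
   = ennreal (fker P u T / hfun P u) * Full x L (app x y T (vst n x y (u - T)))" by (rule Full_cmult)
  show "Full x L (%hs cx c0. ennreal (fker P u T / hfun P u) * app x y T (vst n x y (u - T)) hs cx c0)
   = EE x L * (ennreal (fker P u T) * (nint natM (%j. nint natM (%l. ennreal (1 / hfun P u) * al j x y T * al l x y (u - T) * SL L (%\<eta>. gV n x y (u - T, l) ((y, T, j) # \<eta>))))))"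
  \<comment> \<open>Intensities of mass zero lie outside the scope of \<open>out_HV1\<close>, but
    they carry kernel weight zero.\<close>
  proof (cases "fker P u T = 0")
   case True then show ?thesis unfolding 1 by simp
  next
   case False
   then have p: "0 < nH T" "0 < nV (u - T)" using nH0[of T] nV0[of "u - T"] by (auto simp: fker_def less_le)
   have f: "ennreal (fker P u T / hfun P u) = ennreal (fker P u T) * ennreal (1 / hfun P u)"
    using hfun_nonneg[of u] fker_nonneg[of u T] by (subst ennreal_mult[symmetric]) auto
   have "(nint natM (%j. nint natM (%l. ennreal (1 / hfun P u) * al j x y T * al l x y (u - T) * SL L (%\<eta>. gV n x y (u - T, l) ((y, T, j) # \<eta>)))))
    = ennreal (1 / hfun P u) * (nint natM (%j. nint natM (%l. al j x y T * al l x y (u - T) * SL L (%\<eta>. gV n x y (u - T, l) ((y, T, j) # \<eta>)))))"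
    by (simp add: nn_integral_cmult[symmetric] mult.assoc)
   then show ?thesis unfolding 1 unfolding out_HV1[OF assms p] f by (simp only: mult_ac)
  qed
 qed
 also have "... = EE x L * oHV n (1 / hfun P u) x y u L"
  unfolding oHV_eq by (rule nn_integral_cmult) simp
 finally show ?thesis .
qed

end

text \<open>\<open>q * sqrt (nH / nV)\<close> is \<open>nH\<close> times
  \<open>q / sqrt (nV * nH)\<close>, and symmetrically for \<open>nV\<close>: the two turning rates
  come from one weight. Where one of the masses vanishes, \<open>q\<close> vanishes too.\<close>

lemma tq_turn: "ennreal (tq s) * ennreal (nH s) = ennreal (turnV P s)" "ennreal (tq s) * ennreal (nV s) = ennreal (turnH P s)"
proof -
 have "tq s * nH s = turnV P s & tq s * nV s = turnH P s"
 proof (cases "nV s = 0 \<or> nH s = 0")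
  case True then show ?thesis using nVz[of s] nHz[of s] by (auto simp: tq_def turnV_def turnH_def)
 next
  case False
  then have p: "0 < nV s" "0 < nH s" using nV0[of s] nH0[of s] by (auto simp: less_le)
  then have "nH s / sqrt (nV s * nH s) = sqrt (nH s / nV s)" "nV s / sqrt (nV s * nH s) = sqrt (nV s / nH s)"
   by (simp_all add: real_sqrt_mult real_sqrt_divide field_simps)
  then show ?thesis by (simp add: tq_def turnV_def turnH_def times_divide_eq_right[symmetric] del: times_divide_eq_right)
 qed
 moreover have "0 \<le> tq s" using q0[of s] nV0[of s] nH0[of s] by (simp add: tq_def)
 ultimately show "ennreal (tq s) * ennreal (nH s) = ennreal (turnV P s)" "ennreal (tq s) * ennreal (nV s) = ennreal (turnH P s)"
  using nH0[of s] nV0[of s] by (simp_all add: ennreal_mult[symmetric])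
qed

lemma p_nu: "ennreal (pk_pV P u / nV u) * ennreal (nV u) = ennreal (pk_pV P u)" "ennreal (pk_pH P u / nH u) * ennreal (nH u) = ennreal (pk_pH P u)"
proof -
 have "pk_pV P u / nV u * nV u = pk_pV P u" "pk_pH P u / nH u * nH u = pk_pH P u" using nVz[of u] nHz[of u] by auto
 then show "ennreal (pk_pV P u / nV u) * ennreal (nV u) = ennreal (pk_pV P u)" "ennreal (pk_pH P u / nH u) * ennreal (nH u) = ennreal (pk_pH P u)"
  using nV0[of u] nH0[of u] pV0[of u] pH0[of u] by (simp_all add: ennreal_mult[symmetric])
qed

text \<open>\<open>hfun\<close> cancels between the splitting rate and the normalisation of the
  kernel; what is left is the weight of the meeting that reverses the split. If \<open>hfun\<close>
  is zero, so are both sides.\<close>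

lemma lam_oHV: "ennreal (lamV P s) * oHV n (1 / hfun P s) x y s L = oHV n (pk_pV P s / nV s) x y s L"
 "ennreal (lamH P s) * oHV n (1 / hfun P s) x y s L = oHV n (pk_pH P s / nH s) x y s L"
proof -
 consider "hfun P s = 0" | "0 < hfun P s" using hfun_nonneg[of s] by linarith
 then have "ennreal (lamV P s) * oHV n (1 / hfun P s) x y s L = oHV n (pk_pV P s / nV s) x y s L &
  ennreal (lamH P s) * oHV n (1 / hfun P s) x y s L = oHV n (pk_pH P s / nH s) x y s L"
 proof cases
  case 2
  then have "lamV P s * (1 / hfun P s) = pk_pV P s / nV s" "lamH P s * (1 / hfun P s) = pk_pH P s / nH s"
   by (simp_all add: lamV_def lamH_def)
  then show ?thesis using oHV_scale[OF lamV0[of s], of "1 / hfun P s"] oHV_scale[OF lamH0[of s], of "1 / hfun P s"] 2 by simp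
 qed (simp add: oHV_zero)
 then show "ennreal (lamV P s) * oHV n (1 / hfun P s) x y s L = oHV n (pk_pV P s / nV s) x y s L"
  "ennreal (lamH P s) * oHV n (1 / hfun P s) x y s L = oHV n (pk_pH P s / nH s) x y s L" by blast+
qed

lemma SL_HV: "SL L (%\<eta>. nint mkH (%h. nint mkV (%v. ennreal (if u = fst h + fst v then c else 0) * d * am h x y * am v x y * gV n x y v ((y, h) # \<eta>))))
  = d * oHV n c x y u L"
proof -
 have [measurable]: "(%(h, v). F h v) \<in> borel_measurable (markM >< markM)" for F :: "int \<times> nat => int \<times> nat => ennreal"
  by (simp add: pair_measure_countable)
 note [measurable (raw)] = meas2[OF this]
 have "SL L (%\<eta>. nint mkH (%h. nint mkV (%v. ennreal (if u = fst h + fst v then c else 0) * d * am h x y * am v x y * gV n x y v ((y, h) # \<eta>))))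
  = (nint mkH (%h. SL L (%\<eta>. nint mkV (%v. (ennreal (if u = fst h + fst v then c else 0) * d * am h x y * am v x y) * gV n x y v ((y, h) # \<eta>)))))"
  by (rule kL.lint_nn_integral[OF sfin(3)]) measurable
 also have "... = (nint mkH (%h. nint mkV (%v. (ennreal (if u = fst h + fst v then c else 0) * d * am h x y * am v x y) * SL L (%\<eta>. gV n x y v ((y, h) # \<eta>)))))"
  by (intro nn_integral_cong SL_int sfin) measurable
 also have "... = d * oHV n c x y u L"
  unfolding oHV_def by (simp add: nn_integral_cmult[symmetric] mult_ac)
 finally show ?thesis .
qed

lemma SL_V: "SL L (%\<eta>. nint mkV (%v. ennreal (if u = fst v then c else 0) * d * am v x y * gV n x y v \<eta>))
  = d * (ennreal c * ennreal (nV u) * oV n x y u L)"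
proof -
 have "SL L (%\<eta>. nint mkV (%v. (ennreal (if u = fst v then c else 0) * d * am v x y) * gV n x y v \<eta>))
  = (nint mkV (%v. (ennreal (if u = fst v then c else 0) * d * am v x y) * SL L (gV n x y v)))"
  by (intro SL_int sfin) (rule mk_borel, measurable)
 also have "... = (nint mkV (%v. (if u = fst v then ennreal c * d * am v x y * SL L (gV n x y v) else 0)))"
  by (intro nn_integral_cong) auto
 also have "... = d * (ennreal c * ennreal (nV u) * oV n x y u L)"
  unfolding mk_singleV oV_def by (simp add: nn_integral_cmult[symmetric] mult_ac)
 finally show ?thesis .
qed

lemma SL_H: "SL L (%\<eta>. nint mkH (%h. ennreal (if fst h = u then c else 0) * d * am h x y * gS n x ((y, h) # \<eta>)))
  = d * (ennreal c * ennreal (nH u) * oH n x y u L)"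
proof -
 have "SL L (%\<eta>. nint mkH (%h. (ennreal (if fst h = u then c else 0) * d * am h x y) * gS n x ((y, h) # \<eta>)))
  = (nint mkH (%h. (ennreal (if fst h = u then c else 0) * d * am h x y) * SL L (%\<eta>. gS n x ((y, h) # \<eta>))))"
  by (intro SL_int sfin) (rule mk_borel, measurable)
 also have "... = (nint mkH (%h. (if u = fst h then ennreal c * d * am h x y * SL L (%\<eta>. gS n x ((y, h) # \<eta>)) else 0)))"
  by (intro nn_integral_cong) auto
 also have "... = d * (ennreal c * ennreal (nH u) * oH n x y u L)"
  unfolding mk_singleH oH_def by (simp add: nn_integral_cmult[symmetric] mult_ac)
 finally show ?thesis .
qed

end

section \<open>The race to the next column\<close>

lemma le_less_ball: "\<forall>e\<in>A. f e ~= (t::real) ==> (\<forall>e\<in>A. t \<le> f e) \<longleftrightarrow> (\<forall>e\<in>A. t < f e)"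
 by (metis order_le_less)

lemma fsum_single:
 assumes i: "i < length xs" and 1: "\<And>j. j < length xs ==> j ~= i ==> Q (xs ! i) (xs ! j) & R (xs ! i) (xs ! j)"
  and 2: "\<And>j r. j < length xs ==> j ~= i ==> F (xs ! j) r = 0 \<or> \<not> Q (xs ! j) (xs ! i) & \<not> R (xs ! j) (xs ! i)"
 shows "fsum Q R F xs = F (xs ! i) (rem i xs)"
proof -
 have "fsum Q R F xs = (\<Sum>j<length xs. if j = i then F (xs ! i) (rem i xs) else 0)"
  unfolding fsum_def
 proof (rule sum.cong[OF refl])
  fix j assume "j \<in> {..<length xs}"
  then have j: "j < length xs" by simp
  show "(if \<forall>k<length xs. (k < j --> Q (xs ! j) (xs ! k)) & (j < k --> R (xs ! j) (xs ! k)) then F (xs ! j) (rem j xs) else 0)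
   = (if j = i then F (xs ! i) (rem i xs) else 0)"
  proof (cases "j = i")
   case True
   then have "\<forall>k<length xs. (k < j --> Q (xs ! j) (xs ! k)) & (j < k --> R (xs ! j) (xs ! k))" using 1 by auto
   then show ?thesis using True by simp
  next
   case False
   then consider "F (xs ! j) (rem j xs) = 0" | "\<not> (\<forall>k<length xs. (k < j --> Q (xs ! j) (xs ! k)) & (j < k --> R (xs ! j) (xs ! k)))"
    using 2[OF j False, of "rem j xs"] i by (metis linorder_neqE_nat)
   then show ?thesis
   proof cases
    case 1 then show ?thesis using False by simp
   next
    case 2 then show ?thesis using False by (simp only: if_False)
   qed
  qed
 qed
 then show ?thesis using i by simp
qed

context pks_dist
begin

lemma hev_raw [measurable (raw)]:
 assumes [measurable]: "e \<in> M \<rightarrow>\<^sub>M hsE" "hs \<in> M \<rightarrow>\<^sub>M listM hsE" "cx \<in> M \<rightarrow>\<^sub>M listM cxE" "c0 \<in> M \<rightarrow>\<^sub>M listM c0E"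
 shows "(%w. hev n (e w) (hs w) (cx w) (c0 w)) \<in> borel_measurable M"
proof -
 note [measurable (raw)] = measRV_raw[OF RR_meas(2)]
 show ?thesis unfolding hev_def sH_def Let_def split_beta' by measurable
qed

lemma fev_raw [measurable (raw)]:
 assumes [measurable]: "x \<in> borel_measurable M" "y \<in> borel_measurable M" "s \<in> M \<rightarrow>\<^sub>M intM" "k \<in> borel_measurable M"
  "hs \<in> M \<rightarrow>\<^sub>M listM hsE" "cx \<in> M \<rightarrow>\<^sub>M listM cxE" "c0 \<in> M \<rightarrow>\<^sub>M listM c0E"
 shows "(%w. fev n (x w) (y w) (s w) (k w) (hs w) (cx w) (c0 w)) \<in> borel_measurable M"
proof -
 note [measurable (raw)] = measRV_raw[OF rv_free_meas[OF RR_meas]]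
 show ?thesis unfolding fev_def by measurable
qed

lemma cev_raw [measurable (raw)]:
 assumes [measurable]: "x \<in> borel_measurable M" "y \<in> borel_measurable M" "s \<in> M \<rightarrow>\<^sub>M intM" "e \<in> M \<rightarrow>\<^sub>M hsE"
  "hs \<in> M \<rightarrow>\<^sub>M listM hsE" "cx \<in> M \<rightarrow>\<^sub>M listM cxE" "c0 \<in> M \<rightarrow>\<^sub>M listM c0E"
 shows "(%w. cev n (x w) (y w) (s w) (e w) (hs w) (cx w) (c0 w)) \<in> borel_measurable M"
proof -
 note [measurable (raw)] = meas8[OF rv_coll_meas[OF RR_meas]]
 show ?thesis unfolding cev_def by measurable
qed

text \<open>If the next event is a birth on the lower side, all other hidden events lie to the right
  of it. Ties are null, so the mixture of weak and strict comparisons becomes the restriction in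
  \<open>Full x'\<close>.\<close>

lemma race_X:
 "Full x L (%hs cx c0. fsum (%e e'. fst e < fst e') (%e e'. fst e \<le> fst e') (%e cx'.
    if fst e \<le> a & (\<forall>e'\<in>set c0. fst e \<le> fst e') & (\<forall>e'\<in>set hs. fst e \<le> clk e') then vst n (fst e) 0 (snd e) hs cx' c0 else 0) cx)
  = (nint LA (%x'. (if x < x' then nint nuVM (%s. Full x' L (vst n x' 0 s)) else 0)))"
 (is "Full x L ?F = _")
proof -
 let ?H = "%e hs cx c0. if x < fst e & (fst e \<le> a & (\<forall>e'\<in>set c0. fst e \<le> fst e') & (\<forall>e'\<in>set hs. fst e \<le> clk e')) then vst n (fst e) 0 (snd e) hs cx c0 else 0"
 have "Full x L ?F = Tri L (%hs cx c0. fsum (%e e'. fst e < fst e') (%e e'. fst e \<le> fst e') (%e cx'. ?H e hs cx' c0) cx)"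
  unfolding Full_def
 proof (intro arg_cong[of _ _ "Tri L"] ext, rule fsum_if_min)
  fix hs :: "(real \<times> int \<times> real \<times> real) list" and cx :: "(real \<times> int) list" and c0 :: "(real \<times> real \<times> int) list" and e :: "real \<times> int"
  assume "e \<in> set cx" "fst e \<le> a & (\<forall>e'\<in>set c0. fst e \<le> fst e') & (\<forall>e'\<in>set hs. fst e \<le> clk e')" "\<forall>e'\<in>set cx. fst e \<le> fst e'"
  then show "all_gt x hs cx c0 = (x < fst e)" unfolding all_gt_def by (meson less_le_trans)
 qed
 also have "... = (nint muX (%e. Tri L (%hs cx c0. if \<forall>e'\<in>set cx. fst e < fst e' then ?H e hs cx c0 else 0)))"
  by (rule Tri_X) measurable
 also have "... = (nint muX (%e. (if x < fst e then Full (fst e) L (vst n (fst e) 0 (snd e)) else 0)))"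
 proof (rule nn_integral_cong_AE)
  have "AE e in muX. 0 < fst e & fst e < a" by (rule AE_fst[OF sfin(5) AE_LA])
  then show "AE e in muX. Tri L (%hs cx c0. if \<forall>e'\<in>set cx. fst e < fst e' then ?H e hs cx c0 else 0)
    = (if x < fst e then Full (fst e) L (vst n (fst e) 0 (snd e)) else 0)"
  proof eventually_elim
   case (elim e)
   show ?case
   proof (cases "x < fst e")
    case True
    have "Tri L (%hs cx c0. if \<forall>e'\<in>set cx. fst e < fst e' then ?H e hs cx c0 else 0) = Full (fst e) L (vst n (fst e) 0 (snd e))"
     unfolding Full_def
    proof (rule Tri_cong_AE[of "fst e"])
     show ea: "fst e \<le> a" using elim by simp
     fix hs :: "(real \<times> int \<times> real \<times> real) list" and cx :: "(real \<times> int) list" and c0 :: "(real \<times> real \<times> int) list" assume h: "\<forall>e'\<in>set hs. clk e' ~= fst e" and c: "\<forall>e'\<in>set c0. fst e' ~= fst e & fst e' < a"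
     then have c: "\<forall>e'\<in>set c0. fst e' ~= fst e" by blast
     show "(if \<forall>e'\<in>set cx. fst e < fst e' then ?H e hs cx c0 else 0) = (if all_gt (fst e) hs cx c0 then vst n (fst e) 0 (snd e) hs cx c0 else 0)"
      unfolding all_gt_def le_less_ball[OF h] le_less_ball[OF c] using True ea by simp
    qed
    then show ?thesis using True by simp
   qed (simp cong: if_cong)
  qed
 qed
 also have "... = (nint LA (%x'. nint nuVM (%s. (if x < fst (x', s) then Full (fst (x', s)) L (vst n (fst (x', s)) 0 (snd (x', s))) else 0))))"
  by (rule nn_muX) measurable
 also have "... = (nint LA (%x'. (if x < x' then nint nuVM (%s. Full x' L (vst n x' 0 s)) else 0)))"
  by (intro nn_integral_cong) simp
 finally show ?thesis .
qed

lemma race_0: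
 "Full x L (%hs cx c0. fsum (%e e'. fst e < fst e') (%e e'. fst e \<le> fst e') (%e c0'.
    if fst e \<le> a & (\<forall>e'\<in>set cx. fst e < fst e') & (\<forall>e'\<in>set hs. fst e \<le> clk e')
    then app (fst e) (fst (snd e)) (snd (snd e)) (vst n (fst e) (fst (snd e)) (- snd (snd e))) hs cx c0' else 0) c0)
  = (nint LA (%x'. (if x < x' then nint LB (%y. nint nu0M (%s. Full x' L (app x' y s (vst n x' y (- s))))) else 0)))"
 (is "Full x L ?F = _")
proof -
 let ?V = "%e. app (fst e) (fst (snd e)) (snd (snd e)) (vst n (fst e) (fst (snd e)) (- snd (snd e)))"
 let ?H = "%e hs cx c0. if x < fst e & (fst e \<le> a & (\<forall>e'\<in>set cx. fst e < fst e') & (\<forall>e'\<in>set hs. fst e \<le> clk e')) then ?V e hs cx c0 else 0"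
 have "Full x L ?F = Tri L (%hs cx c0. fsum (%e e'. fst e < fst e') (%e e'. fst e \<le> fst e') (%e c0'. ?H e hs cx c0') c0)"
  unfolding Full_def
 proof (intro arg_cong[of _ _ "Tri L"] ext, rule fsum_if_min)
  fix hs :: "(real \<times> int \<times> real \<times> real) list" and cx :: "(real \<times> int) list" and c0 :: "(real \<times> real \<times> int) list" and e :: "real \<times> real \<times> int"
  assume "e \<in> set c0" "fst e \<le> a & (\<forall>e'\<in>set cx. fst e < fst e') & (\<forall>e'\<in>set hs. fst e \<le> clk e')" "\<forall>e'\<in>set c0. fst e \<le> fst e'"
  then show "all_gt x hs cx c0 = (x < fst e)" unfolding all_gt_def by (meson less_le_trans less_trans)
 qed
 also have "... = (nint mu0 (%e. Tri L (%hs cx c0. if \<forall>e'\<in>set c0. fst e < fst e' then ?H e hs cx c0 else 0)))"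
  by (rule Tri_0) measurable
 also have "... = (nint mu0 (%e. (if x < fst e then Full (fst e) L (?V e) else 0)))"
 proof (rule nn_integral_cong_AE)
  have "AE e in mu0. 0 < fst e & fst e < a" by (rule AE_fst[OF psB0.sigma_finite_measure_axioms AE_LA])
  then show "AE e in mu0. Tri L (%hs cx c0. if \<forall>e'\<in>set c0. fst e < fst e' then ?H e hs cx c0 else 0)
    = (if x < fst e then Full (fst e) L (?V e) else 0)"
  proof eventually_elim
   case (elim e)
   show ?case
   proof (cases "x < fst e")
    case True
    have "Tri L (%hs cx c0. if \<forall>e'\<in>set c0. fst e < fst e' then ?H e hs cx c0 else 0) = Full (fst e) L (?V e)"
     unfolding Full_def
    proof (rule Tri_cong_AE[of "fst e"])
     show ea: "fst e \<le> a" using elim by simp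
     fix hs :: "(real \<times> int \<times> real \<times> real) list" and cx :: "(real \<times> int) list" and c0 :: "(real \<times> real \<times> int) list" assume h: "\<forall>e'\<in>set hs. clk e' ~= fst e"
     show "(if \<forall>e'\<in>set c0. fst e < fst e' then ?H e hs cx c0 else 0) = (if all_gt (fst e) hs cx c0 then ?V e hs cx c0 else 0)"
      unfolding all_gt_def le_less_ball[OF h] using True ea by simp
    qed
    then show ?thesis using True by simp
   qed (simp cong: if_cong)
  qed
 qed
 also have "... = (nint LA (%x'. nint LB (%y. nint nu0M (%s. (if x < fst (x', y, s) then Full (fst (x', y, s)) L (?V (x', y, s)) else 0)))))"
  by (rule nn_mu0) measurable
 also have "... = (nint LA (%x'. (if x < x' then nint LB (%y. nint nu0M (%s. Full x' L (app x' y s (vst n x' y (- s))))) else 0)))"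
  by (intro nn_integral_cong) simp
 finally show ?thesis .
qed

lemma clock_LA:
 assumes "0 \<le> r" and [measurable]: "F \<in> borel_measurable borel"
 shows "(nint unifM (%u. (if clock_after 0 r u a \<le> a then F (clock_after 0 r u a) else 0))) = (nint LA (%t. ennreal (r * exp (- r * t)) * F t))"
proof -
 have "(nint unifM (%u. (if clock_after 0 r u a \<le> a then F (clock_after 0 r u a) else 0)))
  = (nint lborel (%t. ennreal (r * exp (- r * (t - 0))) * (if 0 < t & t \<le> a then F t else 0)))"
  using assms a_pos by (intro clock_le) auto
 also have "... = (nint lborel (%t. indicator {0<..<a} t * (ennreal (r * exp (- r * t)) * F t)))"
  by (intro nn_integral_cong_AE, rule eventually_mono[OF AE_lborel_singleton[of a]]) (auto simp: indicator_def)
 finally show ?thesis by (simp add: nn_LA)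
qed

lemma clock_LB:
 assumes "0 \<le> r" "0 \<le> y" "c \<le> b" and [measurable]: "F \<in> borel_measurable borel"
 shows "(nint unifM (%u. (if clock_after y r u b \<le> c then F (clock_after y r u b) else 0))) =
  (nint LB (%t. (if y < t & t < c then ennreal (r * exp (- r * (t - y))) * F t else 0)))"
proof -
 have "(nint unifM (%u. (if clock_after y r u b \<le> c then F (clock_after y r u b) else 0)))
  = (nint unifM (%u. (if clock_after y r u b \<le> b then (%t. if t \<le> c then F t else 0) (clock_after y r u b) else 0)))"
  using assms(3) by (intro nn_integral_cong) auto
 also have "... = (nint lborel (%t. ennreal (r * exp (- r * (t - y))) * (if y < t & t \<le> b then (%t. if t \<le> c then F t else 0) t else 0)))"
  using assms b_pos by (intro clock_le) auto
 also have "... = (nint lborel (%t. indicator {0<..<b} t * (if y < t & t < c then ennreal (r * exp (- r * (t - y))) * F t else 0)))"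
  by (intro nn_integral_cong_AE, rule eventually_mono[OF AE_lborel_singleton[of c]]) (use assms in \<open>auto simp: indicator_def\<close>)
 finally show ?thesis by (simp add: nn_LB)
qed

text \<open>The density at \<open>x\<close> of the clock of line \<open>i\<close>, started at 0,
  times the outcome of its event while everything else is silent up to \<open>x\<close>.\<close>

definition "hrate n x L i = ennreal (rH P (fst (snd (L ! i))) * exp (- rH P (fst (snd (L ! i))) * x)) *
  Full x (rem i L) (hev n (fst (L ! i), fst (snd (L ! i)), snd (snd (L ! i)), x))"

lemma hrate_meas [measurable]: "(%x. hrate n x L i) \<in> borel_measurable borel"
 unfolding hrate_def by measurable

lemma race_H:
 "Full x L (%hs cx c0. fsum (%e e'. clk e < clk e') (%e e'. clk e \<le> clk e') (%e hs'.
    if clk e \<le> a & (\<forall>e'\<in>set cx. clk e < fst e') & (\<forall>e'\<in>set c0. clk e < fst e') then hev n e hs' cx c0 else 0) hs)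
  = (nint LA (%x'. (if x < x' then (\<Sum>i<length L. hrate n x' L i) else 0)))"
 (is "Full x L ?F = _")
proof -
 let ?H = "%e hs cx c0. if x < clk e & (clk e \<le> a & (\<forall>e'\<in>set cx. clk e < fst e') & (\<forall>e'\<in>set c0. clk e < fst e')) then hev n e hs cx c0 else 0"
 have "Full x L ?F = Tri L (%hs cx c0. fsum (%e e'. clk e < clk e') (%e e'. clk e \<le> clk e') (%e hs'. ?H e hs' cx c0) hs)"
  unfolding Full_def
 proof (intro arg_cong[of _ _ "Tri L"] ext, rule fsum_if_min)
  fix hs :: "(real \<times> int \<times> real \<times> real) list" and cx :: "(real \<times> int) list" and c0 :: "(real \<times> real \<times> int) list" and e :: "real \<times> int \<times> real \<times> real"
  assume "e \<in> set hs" "clk e \<le> a & (\<forall>e'\<in>set cx. clk e < fst e') & (\<forall>e'\<in>set c0. clk e < fst e')" "\<forall>e'\<in>set hs. clk e \<le> clk e'"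
  then show "all_gt x hs cx c0 = (x < clk e)" unfolding all_gt_def by (meson less_le_trans less_trans)
 qed
 also have "... = (\<Sum>i<length L. nint (KH (L ! i)) (%e. Tri (rem i L) (%hs cx c0. if \<forall>e'\<in>set hs. clk e < clk e' then ?H e hs cx c0 else 0)))"
 proof (rule Tri_H)
  show "(%(e, hs, cx, c0). ?H e hs cx c0) \<in> borel_measurable (hsE >< listM hsE >< listM cxE >< listM c0E)"
   by measurable
 next
  fix e :: "real \<times> int \<times> real \<times> real" and hs :: "(real \<times> int \<times> real \<times> real) list" and cx :: "(real \<times> int) list" and c0 :: "(real \<times> real \<times> int) list"
  assume "a < clk e"
  then show "?H e hs cx c0 = 0" by (intro if_not_P notI) linarith
 qed
 also have "... = (\<Sum>i<length L. nint LA (%x'. (if x < x' then hrate n x' L i else 0)))"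
 proof (rule sum.cong[OF refl])
  fix i
  obtain y s x0 where l: "L ! i = (y, s, x0)" by (metis prod_cases3)
  have 1: "Tri (rem i L) (%hs cx c0. if \<forall>e'\<in>set hs. clk e < clk e' then ?H e hs cx c0 else 0)
   = (if clk e \<le> a then if x < clk e then Full (clk e) (rem i L) (hev n e) else 0 else 0)" for e
  proof (cases "x < clk e & clk e \<le> a")
   case True
   show ?thesis unfolding Full_def all_gt_def using True
    by (simp, intro arg_cong[of _ _ "Tri (rem i L)"] ext) simp
  next
   case False
   then have e: "?H e hs cx c0 = 0" for hs cx c0 by (intro if_not_P) blast
   show ?thesis unfolding e using False by simp
  qed
  have "(nint (KH (y, s, x0)) (%e. (if clk e \<le> a then if x < clk e then Full (clk e) (rem i L) (hev n e) else 0 else 0)))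
   = (nint unifM (%u. (if clock_after 0 (rH P s) u a \<le> a then (%t. if x < t then Full t (rem i L) (hev n (y, s, x0, t)) else 0) (clock_after 0 (rH P s) u a) else 0)))"
  proof (rule trans[OF nn_KH])
   show "(%e. if clk e \<le> a then if x < clk e then Full (clk e) (rem i L) (hev n e) else 0 else 0) \<in> borel_measurable hsE"
    by measurable
  qed (simp only: snd_conv)
  also have "... = (nint LA (%t. ennreal (rH P s * exp (- rH P s * t)) * (%t. if x < t then Full t (rem i L) (hev n (y, s, x0, t)) else 0) t))"
   by (rule clock_LA[OF rH0]) measurable
  also have "... = (nint LA (%x'. (if x < x' then hrate n x' L i else 0)))"
   by (intro nn_integral_cong) (simp add: hrate_def l)
  finally show "(nint (KH (L ! i)) (%e. Tri (rem i L) (%hs cx c0. if \<forall>e'\<in>set hs. clk e < clk e' then ?H e hs cx c0 else 0)))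
   = (nint LA (%x'. (if x < x' then hrate n x' L i else 0)))"
   unfolding 1 l .
 qed
 also have "... = (nint LA (%x'. (\<Sum>i<length L. if x < x' then hrate n x' L i else 0)))"
  by (rule nn_integral_sum[symmetric]) measurable
 also have "... = (nint LA (%x'. (if x < x' then (\<Sum>i<length L. hrate n x' L i) else 0)))"
  by (intro nn_integral_cong) simp
 finally show ?thesis .
qed

lemma Full_VS_Suc:
 "Full x L (VS (Suc n)) = (nint LA (%x'. (if x < x' then (nint nuVM (%s. Full x' L (vst n x' 0 s)))
   + (nint LB (%y. nint nu0M (%s. Full x' L (app x' y s (vst n x' y (- s)))))) + (\<Sum>i<length L. hrate n x' L i) else 0)))"
proof -
 define FX where "FX hs cx c0 = fsum (%e e'. fst e < fst e') (%e e'. fst e \<le> fst e') (%e cx'.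
    if fst e \<le> a & (\<forall>e'\<in>set c0. fst e \<le> fst e') & (\<forall>e'\<in>set hs. fst e \<le> clk e') then vst n (fst e) 0 (snd e) hs cx' c0 else 0) cx" for hs cx c0
 define F0 where "F0 hs cx c0 = fsum (%e e'. fst e < fst e') (%e e'. fst e \<le> fst e') (%e c0'.
    if fst e \<le> a & (\<forall>e'\<in>set cx. fst e < fst e') & (\<forall>e'\<in>set hs. fst e \<le> clk e')
    then app (fst e) (fst (snd e)) (snd (snd e)) (vst n (fst e) (fst (snd e)) (- snd (snd e))) hs cx c0' else 0) c0" for hs cx c0
 define FH where "FH hs cx c0 = fsum (%e e'. clk e < clk e') (%e e'. clk e \<le> clk e') (%e hs'.
    if clk e \<le> a & (\<forall>e'\<in>set cx. clk e < fst e') & (\<forall>e'\<in>set c0. clk e < fst e') then hev n e hs' cx c0 else 0) hs" for hs cx c0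
 have m: "measF FX" "measF F0" "measF FH" "measF (%hs cx c0. FX hs cx c0 + F0 hs cx c0)"
 proof -
  show "measF FX" unfolding measF_def FX_def by measurable
  moreover show "measF F0" unfolding measF_def F0_def by measurable
  ultimately show "measF (%hs cx c0. FX hs cx c0 + F0 hs cx c0)"
   unfolding measF_def split_beta' by (rule borel_measurable_add)
  show "measF FH" unfolding measF_def FH_def by measurable
 qed
 have "VS (Suc n) = (%hs cx c0. FX hs cx c0 + F0 hs cx c0 + FH hs cx c0)"
  unfolding FX_def F0_def FH_def by (intro ext VS_Suc)
 then have "Full x L (VS (Suc n)) = Full x L FX + Full x L F0 + Full x L FH"
  by (simp only: Full_add[OF m(4,3)] Full_add[OF m(1,2)])
 also have "... = (nint LA (%x'. (if x < x' then nint nuVM (%s. Full x' L (vst n x' 0 s)) else 0)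
   + (if x < x' then nint LB (%y. nint nu0M (%s. Full x' L (app x' y s (vst n x' y (- s))))) else 0) + (if x < x' then (\<Sum>i<length L. hrate n x' L i) else 0)))"
  unfolding FX_def F0_def FH_def race_X race_0 race_H
  by ((subst nn_integral_add, measurable)+)
 also have "... = (nint LA (%x'. (if x < x' then (nint nuVM (%s. Full x' L (vst n x' 0 s)))
   + (nint LB (%y. nint nu0M (%s. Full x' L (app x' y s (vst n x' y (- s)))))) + (\<Sum>i<length L. hrate n x' L i) else 0)))"
  by (intro nn_integral_cong) simp
 finally show ?thesis .
qed

lemma RL_RT: "list_all2 relK L \<eta> ==> RL \<eta> = RT L"
 by (induction rule: list_all2_induct) (auto simp: RL_def RT_def relK_def)

lemma relK_fst: "list_all2 relK L \<eta> ==> map fst \<eta> = map fst L"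
 by (induction rule: list_all2_induct) (auto simp: relK_def)

lemma EE_prop: "EE x L * ennreal (exp (- (x' - x) * RT L)) = EE x' L"
proof -
 have "- RT L * x + - (x' - x) * RT L = - RT L * x'" by (simp add: algebra_simps)
 then show ?thesis unfolding EE_def by (metis ennreal_mult exp_add exp_ge_zero)
qed

text \<open>The end of a line: the sum over its label joins the weight \<open>al\<close> of its
  start and the weight \<open>be\<close> of its end into the factor of the whole segment.\<close>

lemma phi_int: "(nint natM (%l. al l x0 y0 s * (be l x1 y1 s * A))) = phi x0 y0 x1 y1 s * A"
 unfolding phi_dec by (simp add: nn_integral_multc mult.assoc[symmetric])

lemma wC_eq: "wC W x y h v = ennreal (if 0 = fst h + fst v then pk_p0 P else 0) * 1 * am h x y * am v x y"
 by (auto simp: W_def)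

context
 fixes n :: nat
 assumes IS: "\<And>x L. 0 \<le> x ==> x < a ==> gen x L ==> Full x L (VS n) = EE x L * SL L (gS n x)"
  and IV: "\<And>x y s L. 0 \<le> x ==> x < a ==> gen x L ==> 0 \<le> y ==> y < b ==> 0 < nV s ==>
   \<forall>l\<in>set L. y < fst l --> snd (snd l) < x ==> Full x L (vst n x y s) = EE x L * oV n x y s L"
begin

lemma step_B:
 assumes "0 \<le> x" "x < a" "gen x L" "\<forall>l\<in>set L. snd (snd l) < x"
 shows "(nint nuVM (%s. Full x L (vst n x 0 s))) = EE x L * SL L (%\<eta>. nint mkV (%m. wB W x m * gV n x 0 m \<eta>))"
proof -
 have "SL L (%\<eta>. nint mkV (%m. wB W x m * gV n x 0 m \<eta>)) = (nint mkV (%m. wB W x m * SL L (gV n x 0 m)))"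
  by (intro SL_int sfin) (rule mk_borel, measurable)
 also have "... = (nint intM (%s. ennreal (nV s) * oV n x 0 s L))"
  unfolding nn_mkV oV_def by (simp add: W_def nn_integral_cmult)
 finally have 1: "EE x L * SL L (%\<eta>. nint mkV (%m. wB W x m * gV n x 0 m \<eta>)) = (nint intM (%s. ennreal (nV s) * (EE x L * oV n x 0 s L)))"
  by (simp add: nn_integral_cmult[symmetric] mult_ac)
 have "(nint nuVM (%s. Full x L (vst n x 0 s))) = (nint intM (%s. ennreal (nV s) * Full x L (vst n x 0 s)))"
  unfolding nuVM_def by (simp add: nn_integral_density)
 also have "... = (nint intM (%s. ennreal (nV s) * (EE x L * oV n x 0 s L)))"
 proof (rule nn_integral_cong)
  fix s show "ennreal (nV s) * Full x L (vst n x 0 s) = ennreal (nV s) * (EE x L * oV n x 0 s L)"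
   using IV[of x L 0 s] assms b_pos nV0[of s] by (cases "nV s = 0") auto
 qed
 finally show ?thesis unfolding 1 .
qed

text \<open>The density of \<open>nu0M\<close> is \<open>pk_p0\<close> times the unnormalised kernel
  \<open>fker P 0\<close>, so that the creation of a pair is treated like a split of intensity
  0.\<close>

lemma step_C:
 assumes "0 \<le> x" "x < a" "gen x L" "\<forall>l\<in>set L. snd (snd l) < x"
 shows "(nint LB (%y. nint nu0M (%s. Full x L (app x y s (vst n x y (- s)))))) =
  EE x L * SL L (%\<eta>. nint LB (%y. nint mkH (%h. nint mkV (%v. wC W x y h v * gV n x y v ((y, h) # \<eta>)))))"
proof -
 note [measurable (raw)] = lc.wts_raw[OF W_meas]
 have m: "(%y. SL L (%\<eta>. nint mkH (%h. nint mkV (%v. wC W x y h v * gV n x y v ((y, h) # \<eta>))))) \<in> borel_measurable LB"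
  by measurable
 have "SL L (%\<eta>. nint LB (%y. nint mkH (%h. nint mkV (%v. wC W x y h v * gV n x y v ((y, h) # \<eta>)))))
  = (nint LB (%y. SL L (%\<eta>. nint mkH (%h. nint mkV (%v. wC W x y h v * gV n x y v ((y, h) # \<eta>))))))"
  by (rule kL.lint_nn_integral[OF sfin(2)]) measurable
 then have "EE x L * SL L (%\<eta>. nint LB (%y. nint mkH (%h. nint mkV (%v. wC W x y h v * gV n x y v ((y, h) # \<eta>)))))
  = (nint LB (%y. EE x L * SL L (%\<eta>. nint mkH (%h. nint mkV (%v. wC W x y h v * gV n x y v ((y, h) # \<eta>))))))"
  using nn_integral_cmult[OF m] by simp
 also have "... = (nint LB (%y. EE x L * oHV n (pk_p0 P) x y 0 L))"
  unfolding wC_eq SL_HV by simp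
 also have "... = (nint LB (%y. nint nu0M (%s. Full x L (app x y s (vst n x y (- s))))))"
 proof (rule nn_integral_cong_AE)
  have "AE y in LB. (0 < y & y < b) & y \<notin> fst ` set L"
   using AE_LB AE_LB_notin[of "fst ` set L"] by simp
  then show "AE y in LB. EE x L * oHV n (pk_p0 P) x y 0 L = (nint nu0M (%s. Full x L (app x y s (vst n x y (- s)))))"
  proof eventually_elim
   case (elim y)
   have "(nint nu0M (%s. Full x L (app x y s (vst n x y (- s))))) = (nint intM (%s. ennreal (pk_p0 P * nV (- s) * nH s) * Full x L (app x y s (vst n x y (- s)))))"
    unfolding nu0M_def by (simp add: nn_integral_density)
   also have "... = (nint intM (%t. EE x L * (ennreal (fker P 0 t) * (nint natM (%j. nint natM (%l. ennreal (pk_p0 P) * al j x y t * al l x y (0 - t) * SL L (%\<eta>. gV n x y (0 - t, l) ((y, t, j) # \<eta>))))))))"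
   proof (rule nn_integral_cong)
    fix t
    have k: "ennreal (pk_p0 P * nV (- t) * nH t) = ennreal (pk_p0 P) * ennreal (fker P 0 t)"
     using nV0 nH0 p0 by (simp add: fker_def ennreal_mult mult_ac)
    have c: "(nint natM (%j. nint natM (%l. ennreal (pk_p0 P) * al j x y t * al l x y (0 - t) * SL L (%\<eta>. gV n x y (0 - t, l) ((y, t, j) # \<eta>)))))
     = ennreal (pk_p0 P) * (nint natM (%j. nint natM (%l. al j x y t * al l x y (- t) * SL L (%\<eta>. gV n x y (- t, l) ((y, t, j) # \<eta>)))))"
     by (simp add: nn_integral_cmult[symmetric] mult.assoc)
    show "ennreal (pk_p0 P * nV (- t) * nH t) * Full x L (app x y t (vst n x y (- t))) =
     EE x L * (ennreal (fker P 0 t) * (nint natM (%j. nint natM (%l. ennreal (pk_p0 P) * al j x y t * al l x y (0 - t) * SL L (%\<eta>. gV n x y (0 - t, l) ((y, t, j) # \<eta>))))))"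
    proof (cases "fker P 0 t = 0")
     case True then show ?thesis unfolding k True by simp
    next
     case False
     then have p: "0 < nH t" "0 < nV (- t)" using nH0[of t] nV0[of "- t"] by (auto simp: fker_def less_le)
     have "Full x L (app x y t (vst n x y (- t))) = EE x L * (nint natM (%j. nint natM (%l. al j x y t * al l x y (- t) * SL L (%\<eta>. gV n x y (- t, l) ((y, t, j) # \<eta>)))))"
      by (rule out_HV1[OF IS IV]) (use assms elim p in auto)
     then show ?thesis unfolding k c by (simp only: mult_ac)
    qed
   qed
   also have "... = EE x L * oHV n (pk_p0 P) x y 0 L"
    unfolding oHV_eq by (rule nn_integral_cmult) simp
   finally show ?case ..
  qed
 qed
 finally show ?thesis ..
qed

text \<open>The exponential density of the clock is rate times survival. The survival is the share
  of line \<open>i\<close> in \<open>EE x L\<close>, the rate is distributed over the split and turn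
  weights, and the sum over the label of the line closes its segment.\<close>

lemma step_H:
 assumes "0 \<le> x" "x < a" "gen x L" "\<forall>l\<in>set L. snd (snd l) < x" "i < length L"
 shows "hrate n x L i = EE x L * (nint natM (%j. al j (snd (snd (L ! i))) (fst (L ! i)) (fst (snd (L ! i))) * SL (rem i L)
   (%r. (nint mkH (%h. nint mkV (%v. wHS W x (fst (L ! i)) (fst (snd (L ! i)), j) h v * gV n x (fst (L ! i)) v ((fst (L ! i), h) # r))))
     + (nint mkV (%v. wHT W x (fst (L ! i)) (fst (snd (L ! i)), j) v * gV n x (fst (L ! i)) v r)))))"
proof -
 note [measurable (raw)] = lc.wts_raw[OF W_meas]
 obtain y s x0 where l: "L ! i = (y, s, x0)" by (metis prod_cases3)
 then have ls: "(y, s, x0) \<in> set L" using assms(5) by (metis nth_mem)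
 then have y: "0 < y" "y < b" "0 < nH s" "x0 < x" using assms(3,4) by (auto simp: gen_def)
 let ?R = "rem i L"
 have R: "gen x ?R" "y \<notin> fst ` set ?R" "\<forall>l\<in>set ?R. snd (snd l) < x"
  using gen_rem[OF assms(3,5)] assms(4) set_rem[OF assms(5)] by (auto simp: l)
 define A where "A = oHV n (pk_pH P s / nH s) x y s ?R + ennreal (turnH P s) * oV n x y s ?R"
 have 1: "ennreal (rH P s) * Full x ?R (hev n (y, s, x0, x)) = phi x0 y x y s * (EE x ?R * A)"
 proof (cases "rH P s = 0")
  case True
  then have z: "lamH P s = 0" "turnH P s = 0" using lamH0[of s] turnH0[of s] by (auto simp: rH_def)
  then show ?thesis using lam_oHV(2)[of s n x y ?R] True by (simp add: A_def)
 next
  case False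
  then have r: "0 < rH P s" using rH0[of s] by simp
  have m: "measF (hev n (y, s, x0, x))" "measF (HV n s x y)" "measF (vst n x y s)"
   "measF (%hs cx c0. ennreal (lamH P s) * HV n s x y hs cx c0)" "measF (%hs cx c0. ennreal (turnH P s) * vst n x y s hs cx c0)"
   "measF (%hs cx c0. ennreal (lamH P s) * HV n s x y hs cx c0 + ennreal (turnH P s) * vst n x y s hs cx c0)"
   unfolding measF_def by measurable
  have "ennreal (rH P s) * Full x ?R (hev n (y, s, x0, x)) = Full x ?R (%hs cx c0. ennreal (rH P s) * hev n (y, s, x0, x) hs cx c0)"
   by (rule Full_cmult[OF m(1), symmetric])
  also have "... = phH x0 x y s * (ennreal (lamH P s) * Full x ?R (HV n s x y) + ennreal (turnH P s) * Full x ?R (vst n x y s))"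
   unfolding hev_eq[OF r] Full_cmult[OF m(6)] Full_add[OF m(4,5)] Full_cmult[OF m(2)] Full_cmult[OF m(3)] ..
  also have "phH x0 x y s = phi x0 y x y s" using y by (simp add: phH_def)
  also have "Full x ?R (HV n s x y) = EE x ?R * oHV n (1 / hfun P s) x y s ?R"
   by (rule out_HV[OF IS IV]) (use assms R y in auto)
  also have "ennreal (turnH P s) * Full x ?R (vst n x y s) = ennreal (turnH P s) * (EE x ?R * oV n x y s ?R)"
  proof (cases "nV s = 0")
   case True then show ?thesis using nVz[of s] by (simp add: turnH_def)
  next
   case False
   then have "0 < nV s" using nV0[of s] by simp
   then have "Full x ?R (vst n x y s) = EE x ?R * oV n x y s ?R" using IV[of x ?R y s] assms R y by auto
   then show ?thesis by simp
  qed
  also have "ennreal (lamH P s) * (EE x ?R * oHV n (1 / hfun P s) x y s ?R) = EE x ?R * oHV n (pk_pH P s / nH s) x y s ?R"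
   using lam_oHV(2)[of s n x y ?R] by (metis mult.left_commute)
  finally show ?thesis by (simp add: A_def distrib_left mult_ac)
 qed
 have 2: "SL ?R (%r. (nint mkH (%h. nint mkV (%v. wHS W x y (s, j) h v * gV n x y v ((y, h) # r))))
     + (nint mkV (%v. wHT W x y (s, j) v * gV n x y v r))) = be j x y s * A" for j
 proof -
  have "SL ?R (%r. (nint mkH (%h. nint mkV (%v. wHS W x y (s, j) h v * gV n x y v ((y, h) # r))))
     + (nint mkV (%v. wHT W x y (s, j) v * gV n x y v r)))
   = SL ?R (%r. nint mkH (%h. nint mkV (%v. wHS W x y (s, j) h v * gV n x y v ((y, h) # r))))
    + SL ?R (%r. nint mkV (%v. wHT W x y (s, j) v * gV n x y v r))"
   by (rule kL.lint_add) measurable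
  also have "SL ?R (%r. nint mkH (%h. nint mkV (%v. wHS W x y (s, j) h v * gV n x y v ((y, h) # r)))) = be j x y s * oHV n (pk_pH P s / nH s) x y s ?R"
   by (subst SL_HV[symmetric]) (simp add: W_def cong: if_cong)
  also have "SL ?R (%r. nint mkV (%v. wHT W x y (s, j) v * gV n x y v r)) = be j x y s * (ennreal (tq s) * ennreal (nV s) * oV n x y s ?R)"
   by (subst SL_V[symmetric]) (simp add: W_def cong: if_cong)
  finally show ?thesis unfolding tq_turn A_def distrib_left .
 qed
 have "hrate n x L i = ennreal (exp (- rH P s * x)) * (ennreal (rH P s) * Full x ?R (hev n (y, s, x0, x)))"
  by (simp add: hrate_def l ennreal_mult rH0 mult_ac)
 also have "... = EE x L * (phi x0 y x y s * A)"
  unfolding 1 EE_rem[OF assms(5)] l by (simp add: mult_ac)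
 also have "phi x0 y x y s * A = (nint natM (%j. al j x0 y s * (be j x y s * A)))" by (rule phi_int[symmetric])
 finally show ?thesis unfolding l fst_conv snd_conv 2 .
qed

lemma S_vertex:
 assumes "0 \<le> x" "x < a" "gen x L" "\<forall>l\<in>set L. snd (snd l) < x"
 shows "(nint nuVM (%s. Full x L (vst n x 0 s))) + (nint LB (%y. nint nu0M (%s. Full x L (app x y s (vst n x y (- s)))))) + (\<Sum>i<length L. hrate n x L i)
  = EE x L * SL L (lc.vS W 0 x (gV n x))"
proof -
 note [measurable (raw)] = lc.wts_raw[OF W_meas]
 let ?G = "%z r. (nint mkH (%h. nint mkV (%v. wHS W x (fst z) (snd z) h v * gV n x (fst z) v ((fst z, h) # r))))
     + (nint mkV (%v. wHT W x (fst z) (snd z) v * gV n x (fst z) v r))"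
 have "SL L (lc.vS W 0 x (gV n x)) = SL L (%\<eta>. nint mkV (%m. wB W x m * gV n x 0 m \<eta>))
   + SL L (%\<eta>. nint LB (%y. nint mkH (%h. nint mkV (%v. wC W x y h v * gV n x y v ((y, h) # \<eta>))))) + SL L (picks ?G)"
  unfolding lc.vS_def by (subst kL.lint_add, measurable, subst kL.lint_add, measurable)
 also have "SL L (picks ?G) = (\<Sum>i<length L. nint natM (%j. al j (snd (snd (L ! i))) (fst (L ! i)) (fst (snd (L ! i))) *
   SL (rem i L) (?G (fst (L ! i), fst (snd (L ! i)), j))))"
  by (rule SL_picks) measurable
 finally show ?thesis unfolding step_B[OF assms] step_C[OF assms] using step_H[OF assms]
  by (simp add: distrib_left sum_distrib_left)
qed

text \<open>\<open>EE x L\<close> times the survival from \<open>x\<close> to \<open>x'\<close>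
  equals \<open>EE x' L\<close>, the factor with which \<open>S_vertex\<close> describes the column
  at \<open>x'\<close>.\<close>

lemma IS_step:
 assumes "0 \<le> x" "x < a" "gen x L"
 shows "Full x L (VS (Suc n)) = EE x L * SL L (gS (Suc n) x)"
proof -
 note [measurable (raw)] = lc.measS_raw[OF lc.vS_measurable[OF W_meas g_meas(2)]]
 define k where "k x' = (if x < x' then ennreal (exp (- (x' - x) * RT L)) else 0)" for x'
 have [measurable]: "k \<in> borel_measurable borel" unfolding k_def by measurable
 have "SL L (gS (Suc n) x) = SL L (%\<eta>. nint LA (%x'. k x' * lc.vS W 0 x' (gV n x') \<eta>))"
  by (rule SL_cong) (simp add: g_Suc lc.pS_def kS_def k_def RL_RT cong: if_cong)
 also have "... = (nint LA (%x'. k x' * SL L (lc.vS W 0 x' (gV n x'))))"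
  by (rule SL_int[OF sfin(1)]) measurable
 finally have "EE x L * SL L (gS (Suc n) x) = (nint LA (%x'. EE x L * (k x' * SL L (lc.vS W 0 x' (gV n x')))))"
  by (simp add: nn_integral_cmult)
 also have "... = Full x L (VS (Suc n))"
  unfolding Full_VS_Suc
 proof (rule nn_integral_cong_AE, rule eventually_mono[OF AE_LA])
  fix x' assume x': "0 < x' & x' < a"
  show "EE x L * (k x' * SL L (lc.vS W 0 x' (gV n x'))) = (if x < x' then (nint nuVM (%s. Full x' L (vst n x' 0 s)))
   + (nint LB (%y. nint nu0M (%s. Full x' L (app x' y s (vst n x' y (- s)))))) + (\<Sum>i<length L. hrate n x' L i) else 0)"
  proof (cases "x < x'")
   case True
   have "gen x' L" "\<forall>l\<in>set L. snd (snd l) < x'" using assms(3) True by (force simp: gen_def)+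
   then have "(nint nuVM (%s. Full x' L (vst n x' 0 s)))
    + (nint LB (%y. nint nu0M (%s. Full x' L (app x' y s (vst n x' y (- s)))))) + (\<Sum>i<length L. hrate n x' L i)
    = EE x' L * SL L (lc.vS W 0 x' (gV n x'))" using x' by (intro S_vertex) auto
   then show ?thesis unfolding k_def if_P[OF True] mult.assoc[symmetric] EE_prop ..
  qed (simp add: k_def)
 qed
 finally show ?thesis ..
qed

end

end

section \<open>The flight of a vertical line inside a column\<close>

context pks_dist
begin

lemma int_sh4: "(nint seqM (%\<delta>. fst (RR n) hs cx c0 (sh4 \<delta>))) = VS n hs cx c0"
proof -
 note [measurable (raw)] = measRS_raw[OF RR_meas(1)]
 define F where "F d0 d1 d2 d3 \<delta> = fst (RR n) hs cx c0 \<delta>" for d0 d1 d2 d3 :: real and \<delta>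
 have "(%(d0, d1, d2, d3, \<delta>). F d0 d1 d2 d3 \<delta>) \<in> borel_measurable (borel >< borel >< borel >< borel >< seqM)"
  unfolding F_def by measurable
 from seq_split4[OF this] show ?thesis unfolding F_def VS_def by simp
qed

lemma VV_none:
 assumes "\<forall>e\<in>set hs. \<not> y < fst e"
 shows "VV (Suc n) x y s k hs cx c0 = (if k \<le> b then fev n x y s k hs cx c0 else phV x y b s * VS n hs cx c0)"
proof -
 note [measurable (raw)] = measRS_raw[OF RR_meas(1)]
 have 1: "\<forall>e\<in>set hs. y < fst e --> b < fst e" "\<forall>e\<in>set hs. y < fst e --> k \<le> fst e" using assms by blast+
 show ?thesis
 proof (cases "b < k")
  case True
  then have "VV (Suc n) x y s k hs cx c0 = (nint seqM (%\<delta>. phV x y b s * fst (RR n) hs cx c0 (sh4 \<delta>)))"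
   unfolding VV_def RR.simps snd_conv rv_step_def using 1 by simp
  also have "... = phV x y b s * VS n hs cx c0"
   by (subst nn_integral_cmult, measurable) (simp add: int_sh4)
  finally show ?thesis using True by simp
 next
  case False
  then show ?thesis unfolding VV_def RR.simps snd_conv rv_step_def fev_def using 1 by simp
 qed
qed

text \<open>Entry \<open>i\<close> is the lowest line above \<open>y\<close>, and hypothesis
  \<open>m\<close> excludes a second line at its height, so that the selecting sum has a single
  term.\<close>

lemma VV_some:
 assumes i: "i < length hs" "y < fst (hs ! i)" "fst (hs ! i) < b"
  and m: "\<And>j. j < length hs ==> j ~= i ==> y < fst (hs ! j) ==> fst (hs ! i) < fst (hs ! j)"
 shows "VV (Suc n) x y s k hs cx c0 = (if k \<le> fst (hs ! i) then fev n x y s k hs cx c0 else cev n x y s (hs ! i) (rem i hs) cx c0)"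
proof -
 have e: "hs ! i \<in> set hs" using i by simp
 then have 1: "\<not> (b < k & (\<forall>e\<in>set hs. y < fst e --> b < fst e))" using i by force
 have 2: "(\<forall>e\<in>set hs. y < fst e --> k \<le> fst e) \<longleftrightarrow> k \<le> fst (hs ! i)"
 proof
  show "\<forall>e\<in>set hs. y < fst e --> k \<le> fst e ==> k \<le> fst (hs ! i)" using e i(2) by blast
  assume k: "k \<le> fst (hs ! i)"
  have "k \<le> fst (hs ! j)" if "j < length hs" "y < fst (hs ! j)" for j
   using m[OF that(1) _ that(2)] k by (cases "j = i") auto
  then show "\<forall>e\<in>set hs. y < fst e --> k \<le> fst e" by (metis in_set_conv_nth)
 qed
 have 3: "fsum (%e e'. y < fst e' --> fst e < fst e') (%e e'. y < fst e' --> fst e \<le> fst e')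
    (%e hs'. if y < fst e then G e hs' else 0) hs = G (hs ! i) (rem i hs)" for G
 proof (subst fsum_single[OF i(1)])
  fix j assume j: "j < length hs" "j ~= i"
  show "(y < fst (hs ! j) --> fst (hs ! i) < fst (hs ! j)) & (y < fst (hs ! j) --> fst (hs ! i) \<le> fst (hs ! j))"
   using m[OF j] by auto
  fix r
  show "(if y < fst (hs ! j) then G (hs ! j) r else 0) = 0 \<or>
   \<not> (y < fst (hs ! i) --> fst (hs ! j) < fst (hs ! i)) & \<not> (y < fst (hs ! i) --> fst (hs ! j) \<le> fst (hs ! i))"
   using m[OF j] i(2) by (cases "y < fst (hs ! j)") auto
 qed (simp add: i)
 show ?thesis unfolding VV_def RR.simps snd_conv rv_step_def if_not_P[OF 1] 2 3 fev_def cev_def by simp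
qed

text \<open>The vertical line runs freely up to height \<open>T\<close>, the next horizontal line or the top of the box.\<close>

lemma vst_split:
 assumes y: "0 \<le> y" "y < T" "T \<le> b"
  and V: "\<And>k. VV (Suc n) x y s k hs cx c0 = (if k \<le> T then fev n x y s k hs cx c0 else E)"
 shows "vst (Suc n) x y s hs cx c0 = (nint LB (%k. (if y < k & k < T then ennreal (exp (- (k - y) * rV P s)) * phi x y x k s else 0) *
   (ennreal (lamV P s) * HV n s x k hs cx c0 + ennreal (turnV P s) * app x k s (VS n) hs cx c0)))
  + ennreal (exp (- (T - y) * rV P s)) * E"
proof -
 let ?c = "%u. clock_after y (rV P s) u b"
 have "vst (Suc n) x y s hs cx c0 = (nint unifM (%u. (if ?c u \<le> T then fev n x y s (?c u) hs cx c0 else 0) + (if T < ?c u then E else 0)))"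
  unfolding vst_def V by (intro nn_integral_cong) auto
 also have "... = (nint unifM (%u. (if ?c u \<le> T then fev n x y s (?c u) hs cx c0 else 0))) + (nint unifM (%u. (if T < ?c u then E else 0)))"
  by (rule nn_integral_add) measurable
 also have "(nint unifM (%u. (if T < ?c u then E else 0))) = ennreal (exp (- rV P s * (T - y))) * E"
  by (rule clock_gt[OF rV0]) (use y in auto)
 also have "- rV P s * (T - y) = - (T - y) * rV P s" by (simp add: algebra_simps)
 also have "(nint unifM (%u. (if ?c u \<le> T then fev n x y s (?c u) hs cx c0 else 0)))
  = (nint LB (%k. (if y < k & k < T then ennreal (rV P s * exp (- rV P s * (k - y))) * fev n x y s k hs cx c0 else 0)))"
  using clock_LB[OF rV0 y(1,3), of "%k. fev n x y s k hs cx c0"] by simp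
 also have "... = (nint LB (%k. (if y < k & k < T then ennreal (exp (- (k - y) * rV P s)) * phi x y x k s else 0) *
   (ennreal (lamV P s) * HV n s x k hs cx c0 + ennreal (turnV P s) * app x k s (VS n) hs cx c0)))"
 proof (rule nn_integral_cong)
  fix k
  show "(if y < k & k < T then ennreal (rV P s * exp (- rV P s * (k - y))) * fev n x y s k hs cx c0 else 0)
   = (if y < k & k < T then ennreal (exp (- (k - y) * rV P s)) * phi x y x k s else 0) *
   (ennreal (lamV P s) * HV n s x k hs cx c0 + ennreal (turnV P s) * app x k s (VS n) hs cx c0)"
  proof (cases "y < k & k < T")
   case True
   have e: "- rV P s * (k - y) = - (k - y) * rV P s" by (simp add: algebra_simps)
   have "ennreal (rV P s * exp (- rV P s * (k - y))) * fev n x y s k hs cx c0 = ennreal (exp (- (k - y) * rV P s)) * (ennreal (rV P s) * fev n x y s k hs cx c0)"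
    unfolding e by (simp add: ennreal_mult rV0 mult_ac)
   also have "ennreal (rV P s) * fev n x y s k hs cx c0 = phi x y x k s * (ennreal (lamV P s) * HV n s x k hs cx c0 + ennreal (turnV P s) * app x k s (VS n) hs cx c0)"
   proof (cases "rV P s = 0")
    case z: True
    then have "lamV P s = 0" "turnV P s = 0" using lamV0[of s] turnV0[of s] by (auto simp: rV_def)
    then show ?thesis using z by simp
   next
    case False
    then have r: "0 < rV P s" using rV0[of s] by simp
    show ?thesis unfolding fev_eq[OF r] using True by (simp add: phV_def)
   qed
   finally show ?thesis unfolding if_P[OF True] mult.assoc .
  next
   case False
   then show ?thesis by (simp only: if_False mult_zero_left)
  qed
 qed
 finally show ?thesis .
qed

text \<open>\<open>kV\<close> depends on the lines through their heights alone. These are fixed by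
  \<open>L\<close>, so the kernel can be taken out of the integral over labels.\<close>

definition kc :: "(real \<times> int \<times> real) list => real => int => real => ennreal" where
 "kc L y s k = (if y < k & (\<forall>l\<in>set L. \<not> (y < fst l & fst l < k)) then ennreal (exp (- (k - y) * rV P s)) else 0)"

lemma kV_rel: "list_all2 relK L \<eta> ==> kV m \<eta> y k = kc L y (fst m) k"
proof -
 assume "list_all2 relK L \<eta>"
 then have "fst ` set \<eta> = fst ` set L" using relK_fst by (metis set_map)
 moreover have "(\<forall>z\<in>S. \<not> (y < fst z & fst z < k)) \<longleftrightarrow> (\<forall>h\<in>fst ` S. \<not> (y < h & h < k))" for S :: "(real \<times> 'q) set" by blast
 ultimately have "(\<forall>z\<in>set \<eta>. \<not> (y < fst z & fst z < k)) \<longleftrightarrow> (\<forall>l\<in>set L. \<not> (y < fst l & fst l < k))" by metis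
 then show ?thesis unfolding kV_def kc_def by simp
qed

lemma kc_meas [measurable]: "(%k. kc L y s k) \<in> borel_measurable borel"
proof -
 have "Measurable.pred borel (%k. \<forall>l\<in>set L. \<not> (y < fst l & fst l < k))" by measurable
 then show ?thesis unfolding kc_def by measurable
qed

lemma SL_gV_Suc:
 "SL L (gV (Suc n) x y (s, l)) = kc L y s b * (be l x b s * SL L (gS n x))
  + (nint LB (%k. kc L y s k * SL L (lc.v1 W x (gS n x) (gV n x) k (s, l))))
  + (\<Sum>i<length L. nint natM (%j. al j (snd (snd (L ! i))) (fst (L ! i)) (fst (snd (L ! i))) *
    (kc L y s (fst (L ! i)) * SL (rem i L) (lc.v2 W x (gS n x) (gV n x) (fst (L ! i), fst (snd (L ! i)), j) (s, l)))))"
proof -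
 note [measurable (raw)] = lc.measV_raw[OF lc.v1_measurable[OF W_meas g_meas]] meas4[OF lc.v2_measurable[OF W_meas g_meas]]
 have kz [measurable]: "(%z. kc L y s (fst z)) \<in> borel_measurable (borel >< markM)"
  by (rule measurable_compose[OF measurable_fst kc_meas])
 have "SL L (gV (Suc n) x y (s, l)) = SL L (%\<eta>. kc L y s b * (be l x b s * gS n x \<eta>)
   + (nint LB (%k. kc L y s k * lc.v1 W x (gS n x) (gV n x) k (s, l) \<eta>))
   + picks (%z r. kc L y s (fst z) * lc.v2 W x (gS n x) (gV n x) z (s, l) r) \<eta>)"
  by (rule SL_cong) (simp add: g_Suc lc.pV_def kV_rel lc.vT_def W_def)
 also have "... = SL L (%\<eta>. kc L y s b * (be l x b s * gS n x \<eta>))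
   + SL L (%\<eta>. nint LB (%k. kc L y s k * lc.v1 W x (gS n x) (gV n x) k (s, l) \<eta>))
   + SL L (picks (%z r. kc L y s (fst z) * lc.v2 W x (gS n x) (gV n x) z (s, l) r))"
  by ((subst kL.lint_add, measurable)+)
 also have "SL L (%\<eta>. kc L y s b * (be l x b s * gS n x \<eta>)) = kc L y s b * (be l x b s * SL L (gS n x))"
  by ((subst kL.lint_cmult, measurable)+)
 also have "SL L (%\<eta>. nint LB (%k. kc L y s k * lc.v1 W x (gS n x) (gV n x) k (s, l) \<eta>)) = (nint LB (%k. kc L y s k * SL L (lc.v1 W x (gS n x) (gV n x) k (s, l))))"
  by (rule SL_int[OF sfin(2)]) measurable
 also have "SL L (picks (%z r. kc L y s (fst z) * lc.v2 W x (gS n x) (gV n x) z (s, l) r))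
  = (\<Sum>i<length L. nint natM (%j. al j (snd (snd (L ! i))) (fst (L ! i)) (fst (snd (L ! i))) *
    SL (rem i L) (%r. kc L y s (fst (fst (L ! i), fst (snd (L ! i)), j)) * lc.v2 W x (gS n x) (gV n x) (fst (L ! i), fst (snd (L ! i)), j) (s, l) r)))"
  by (rule SL_picks) measurable
 also have "... = (\<Sum>i<length L. nint natM (%j. al j (snd (snd (L ! i))) (fst (L ! i)) (fst (snd (L ! i))) *
    (kc L y s (fst (L ! i)) * SL (rem i L) (lc.v2 W x (gS n x) (gV n x) (fst (L ! i), fst (snd (L ! i)), j) (s, l)))))"
  unfolding fst_conv by (intro sum.cong nn_integral_cong arg_cong2[of _ _ _ _ "(*)"] refl kL.lint_cmult) measurable
 finally show ?thesis .
qed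

lemma SL_v1: "SL L (lc.v1 W x (gS n x) (gV n x) k (s, l)) =
  be l x k s * (oHV n (pk_pV P s / nV s) x k s L + ennreal (turnV P s) * oH n x k s L)"
proof -
 note [measurable (raw)] = lc.wts_raw[OF W_meas]
 have "SL L (lc.v1 W x (gS n x) (gV n x) k (s, l)) =
   SL L (%\<eta>. nint mkH (%h. nint mkV (%v. wVS W x k (s, l) h v * gV n x k v ((k, h) # \<eta>))))
   + SL L (%\<eta>. nint mkH (%h. wVT W x k (s, l) h * gS n x ((k, h) # \<eta>)))"
  unfolding lc.v1_def by (rule kL.lint_add) measurable
 also have "SL L (%\<eta>. nint mkH (%h. nint mkV (%v. wVS W x k (s, l) h v * gV n x k v ((k, h) # \<eta>)))) = be l x k s * oHV n (pk_pV P s / nV s) x k s L"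
  by (subst SL_HV[symmetric]) (simp add: W_def cong: if_cong)
 also have "SL L (%\<eta>. nint mkH (%h. wVT W x k (s, l) h * gS n x ((k, h) # \<eta>))) = be l x k s * (ennreal (tq s) * ennreal (nH s) * oH n x k s L)"
  by (subst SL_H[symmetric]) (simp add: W_def cong: if_cong)
 finally show ?thesis unfolding tq_turn distrib_left .
qed

lemma cc0: "0 \<le> cc u"
 using psum[of u] psum0 by (cases "u = 0") (auto simp: cc_def p0'_def)

definition "oX n x y u L = ennreal (pk_pV P u) * oV n x y u L + ennreal (pk_pH P u) * oH n x y u L
  + ennreal (p0' u) * SL L (gS n x) + oHV n (cc u / hfun P u) x y u L"

text \<open>The denominators \<open>nV\<close> and \<open>nH\<close> of the weights are cancelled by
  the reference mass of the outgoing line, which gives back the outcome probabilities of the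
  simulation.\<close>

lemma SL_v2: "SL L (lc.v2 W x (gS n x) (gV n x) (y, s', j) (s, l)) =
  be j x y s' * (be l x y s * oX n x y (s' + s) L)"
proof -
 note [measurable (raw)] = lc.wts_raw[OF W_meas]
 let ?d = "be j x y s' * be l x y s" and ?u = "s' + s"
 have "SL L (lc.v2 W x (gS n x) (gV n x) (y, s', j) (s, l)) =
   SL L (%r. nint mkV (%v. wVJ W x y (s', j) (s, l) v * gV n x y v r))
   + SL L (%r. nint mkH (%h. wHJ W x y (s', j) (s, l) h * gS n x ((y, h) # r)))
   + SL L (%r. wA W x y (s', j) (s, l) * gS n x r)
   + SL L (%r. nint mkH (%h. nint mkV (%v. wX W x y (s', j) (s, l) h v * gV n x y v ((y, h) # r))))"
  unfolding lc.v2_def fst_conv snd_conv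
  by ((subst kL.lint_add, measurable)+)
 also have "SL L (%r. nint mkV (%v. wVJ W x y (s', j) (s, l) v * gV n x y v r)) = ?d * (ennreal (pk_pV P ?u / nV ?u) * ennreal (nV ?u) * oV n x y ?u L)"
  by (subst SL_V[symmetric], intro arg_cong[of _ _ "SL L"] ext nn_integral_cong) (auto simp: W_def mult.assoc)
 also have "SL L (%r. nint mkH (%h. wHJ W x y (s', j) (s, l) h * gS n x ((y, h) # r))) = ?d * (ennreal (pk_pH P ?u / nH ?u) * ennreal (nH ?u) * oH n x y ?u L)"
  by (subst SL_H[symmetric], intro arg_cong[of _ _ "SL L"] ext nn_integral_cong) (auto simp: W_def mult.assoc)
 also have "SL L (%r. wA W x y (s', j) (s, l) * gS n x r) = ?d * (ennreal (p0' ?u) * SL L (gS n x))"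
  by (subst kL.lint_cmult, measurable) (auto simp: W_def p0'_def mult_ac)
 also have "SL L (%r. nint mkH (%h. nint mkV (%v. wX W x y (s', j) (s, l) h v * gV n x y v ((y, h) # r)))) = ?d * oHV n (cc ?u / hfun P ?u) x y ?u L"
  by (subst SL_HV[symmetric], intro arg_cong[of _ _ "SL L"] ext nn_integral_cong) (auto simp: W_def mult.assoc)
 finally show ?thesis unfolding p_nu oX_def by (simp only: distrib_left mult.assoc)
qed

lemma oH_meas [measurable]: "(%k. oH n x k s L) \<in> borel_measurable borel"
proof -
 interpret N: sigma_finite_measure natM by (rule sigma_finite_measure_count_space)
 show ?thesis unfolding oH_def by measurable
qed

lemma oHV_meas [measurable]: "(%k. oHV n c x k s L) \<in> borel_measurable borel"
proof -
 interpret N: sigma_finite_measure natM by (rule sigma_finite_measure_count_space)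
 interpret I: sigma_finite_measure intM by (rule sigma_finite_measure_count_space)
 show ?thesis unfolding oHV_eq by measurable
qed

text \<open>The labels of the vertical line and of the line that it hits are summed here, and each
  sum restores the factor \<open>phi\<close> of a finished segment. The result has the shape of the
  simulated flight: exit at the top, free event, collision.\<close>

lemma oV_Suc:
 "oV (Suc n) x y s L = kc L y s b * (phi x y x b s * SL L (gS n x))
  + (nint LB (%k. kc L y s k * (phi x y x k s * (oHV n (pk_pV P s / nV s) x k s L + ennreal (turnV P s) * oH n x k s L))))
  + (\<Sum>i<length L. kc L y s (fst (L ! i)) * (phi x y x (fst (L ! i)) s * phi (snd (snd (L ! i))) (fst (L ! i)) x (fst (L ! i)) (fst (snd (L ! i))) *
    oX n x (fst (L ! i)) (fst (snd (L ! i)) + s) (rem i L)))"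
proof -
 let ?A = "%k. oHV n (pk_pV P s / nV s) x k s L + ennreal (turnV P s) * oH n x k s L"
 let ?p = "%i. phi (snd (snd (L ! i))) (fst (L ! i)) x (fst (L ! i)) (fst (snd (L ! i)))"
 let ?X = "%i. oX n x (fst (L ! i)) (fst (snd (L ! i)) + s) (rem i L)"
 have g: "SL L (gV (Suc n) x y (s, l)) = kc L y s b * (be l x b s * SL L (gS n x))
  + (nint LB (%k. kc L y s k * (be l x k s * ?A k)))
  + (\<Sum>i<length L. kc L y s (fst (L ! i)) * (be l x (fst (L ! i)) s * (?p i * ?X i)))" for l
 proof -
  have "(nint natM (%j. al j (snd (snd (L ! i))) (fst (L ! i)) (fst (snd (L ! i))) *
    (kc L y s (fst (L ! i)) * SL (rem i L) (lc.v2 W x (gS n x) (gV n x) (fst (L ! i), fst (snd (L ! i)), j) (s, l)))))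
   = kc L y s (fst (L ! i)) * (be l x (fst (L ! i)) s * (?p i * ?X i))" for i
  proof -
   have "(nint natM (%j. al j (snd (snd (L ! i))) (fst (L ! i)) (fst (snd (L ! i))) *
    (kc L y s (fst (L ! i)) * SL (rem i L) (lc.v2 W x (gS n x) (gV n x) (fst (L ! i), fst (snd (L ! i)), j) (s, l)))))
    = (nint natM (%j. al j (snd (snd (L ! i))) (fst (L ! i)) (fst (snd (L ! i))) *
    (be j x (fst (L ! i)) (fst (snd (L ! i))) * (kc L y s (fst (L ! i)) * (be l x (fst (L ! i)) s * ?X i)))))"
    unfolding SL_v2 by (simp only: mult_ac)
   then show ?thesis unfolding phi_int by (simp only: mult_ac)
  qed
  then show ?thesis unfolding SL_gV_Suc SL_v1 by simp
 qed
 interpret N: sigma_finite_measure natM by (rule sigma_finite_measure_count_space)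
 interpret NB: pair_sigma_finite natM LB ..
 have "oV (Suc n) x y s L = (nint natM (%l. al l x y s * (be l x b s * (kc L y s b * SL L (gS n x)))
   + ((nint LB (%k. al l x y s * (be l x k s * (kc L y s k * ?A k))))
   + (\<Sum>i<length L. al l x y s * (be l x (fst (L ! i)) s * (kc L y s (fst (L ! i)) * (?p i * ?X i)))))))"
  unfolding oV_def g
  by (intro nn_integral_cong) (simp add: distrib_left sum_distrib_left nn_integral_cmult[symmetric] mult.left_commute[of "kc _ _ _ _"] add.assoc)
 also have "... = (nint natM (%l. al l x y s * (be l x b s * (kc L y s b * SL L (gS n x)))))
   + ((nint natM (%l. nint LB (%k. al l x y s * (be l x k s * (kc L y s k * ?A k)))))
   + (\<Sum>i<length L. nint natM (%l. al l x y s * (be l x (fst (L ! i)) s * (kc L y s (fst (L ! i)) * (?p i * ?X i))))))"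
  by (simp add: nn_integral_add nn_integral_sum)
 also have "(nint natM (%l. nint LB (%k. al l x y s * (be l x k s * (kc L y s k * ?A k)))))
  = (nint LB (%k. nint natM (%l. al l x y s * (be l x k s * (kc L y s k * ?A k)))))"
  by (rule nn_swap2[OF sigma_finite_measure_count_space sfin(2)]) measurable
 finally show ?thesis unfolding phi_int by (simp only: mult_ac add.assoc)
qed

context
 fixes n :: nat
 assumes IS: "\<And>x L. 0 \<le> x ==> x < a ==> gen x L ==> Full x L (VS n) = EE x L * SL L (gS n x)"
  and IV: "\<And>x y s L. 0 \<le> x ==> x < a ==> gen x L ==> 0 \<le> y ==> y < b ==> 0 < nV s ==>
   \<forall>l\<in>set L. y < fst l --> snd (snd l) < x ==> Full x L (vst n x y s) = EE x L * oV n x y s L"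
begin

text \<open>\<open>T\<close> is the first obstacle above \<open>y\<close>, the next line or the top
  of the box. The last hypothesis says that up to this height, and only up to it, there is a gap
  without lines, which identifies the free part of the flight with the kernel
  \<open>kc\<close>.\<close>

lemma Full_vst_split:
 assumes x: "0 \<le> x" "x < a" "gen x L" "\<forall>l\<in>set L. y < fst l --> snd (snd l) < x" and y: "0 \<le> y" "y < T" "T \<le> b"
  and E: "measF E"
  and V: "\<And>k hs cx c0. list_all2 relL L hs ==> VV (Suc n) x y s k hs cx c0 = (if k \<le> T then fev n x y s k hs cx c0 else E hs cx c0)"
  and T: "\<And>k. k \<notin> fst ` set L ==> 0 < k ==> k < b ==> (y < k & k < T) \<longleftrightarrow> (y < k & (\<forall>l\<in>set L. \<not> (y < fst l & fst l < k)))"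
 shows "Full x L (vst (Suc n) x y s) =
  EE x L * (nint LB (%k. kc L y s k * (phi x y x k s * (oHV n (pk_pV P s / nV s) x k s L + ennreal (turnV P s) * oH n x k s L))))
  + ennreal (exp (- (T - y) * rV P s)) * Full x L E"
proof -
 note [measurable (raw)] = measF_raw[OF E] meas5[OF phi_meas]
 let ?w = "%k. (if y < k & k < T then ennreal (exp (- (k - y) * rV P s)) * phi x y x k s else 0)"
 let ?A = "%k. oHV n (pk_pV P s / nV s) x k s L + ennreal (turnV P s) * oH n x k s L"
 let ?F = "%k hs cx c0. ?w k * (ennreal (lamV P s) * HV n s x k hs cx c0 + ennreal (turnV P s) * app x k s (VS n) hs cx c0)"
 have mA: "(%k. ?A k) \<in> borel_measurable borel" by measurable
 have mI: "measF (%hs cx c0. nint LB (%k. ?F k hs cx c0))" unfolding measF_def by measurable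
 have mE: "measF (%hs cx c0. ennreal (exp (- (T - y) * rV P s)) * E hs cx c0)" unfolding measF_def by measurable
 have "Full x L (vst (Suc n) x y s) = Full x L (%hs cx c0. (nint LB (%k. ?F k hs cx c0)) + ennreal (exp (- (T - y) * rV P s)) * E hs cx c0)"
  by (rule Full_cong, rule vst_split[OF y V])
 also have "... = Full x L (%hs cx c0. nint LB (%k. ?F k hs cx c0)) + ennreal (exp (- (T - y) * rV P s)) * Full x L E"
  unfolding Full_add[OF mI mE] Full_cmult[OF E] ..
 also have "Full x L (%hs cx c0. nint LB (%k. ?F k hs cx c0)) = (nint LB (%k. Full x L (?F k)))"
  by (rule Full_nn_integral[OF sfin(2)]) measurable
 also have "... = (nint LB (%k. EE x L * (kc L y s k * (phi x y x k s * ?A k))))"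
 proof (rule nn_integral_cong_AE)
  have "AE y in LB. (0 < y & y < b) & y \<notin> fst ` set L"
   using AE_LB AE_LB_notin[of "fst ` set L"] by simp
  then show "AE k in LB. Full x L (?F k) = EE x L * (kc L y s k * (phi x y x k s * ?A k))"
  proof eventually_elim
   case (elim k)
   have m: "measF (HV n s x k)" "measF (app x k s (VS n))"
    "measF (%hs cx c0. ennreal (lamV P s) * HV n s x k hs cx c0)" "measF (%hs cx c0. ennreal (turnV P s) * app x k s (VS n) hs cx c0)"
    "measF (%hs cx c0. ennreal (lamV P s) * HV n s x k hs cx c0 + ennreal (turnV P s) * app x k s (VS n) hs cx c0)"
    unfolding measF_def by measurable
   show ?case
   proof (cases "y < k & k < T")
    case True
    then have kc: "kc L y s k = ennreal (exp (- (k - y) * rV P s))" using T[of k] elim by (simp add: kc_def)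
    have 1: "Full x L (HV n s x k) = EE x L * oHV n (1 / hfun P s) x k s L"
     by (rule out_HV[OF IS IV]) (use x elim True y in auto)
    have 2: "ennreal (turnV P s) * Full x L (app x k s (VS n)) = ennreal (turnV P s) * (EE x L * oH n x k s L)"
    \<comment> \<open>\<open>out_H\<close> asks for a positive mass \<open>nH s\<close>; where it
      vanishes, \<open>q\<close> and with it the turning rate vanish.\<close>
    proof (cases "nH s = 0")
     case True then show ?thesis using nHz[of s] by (simp add: turnV_def)
    next
     case False
     then have "0 < nH s" using nH0[of s] by simp
     then have "Full x L (app x k s (VS n)) = EE x L * oH n x k s L"
      by (intro out_H[OF IS IV]) (use x elim in auto)
     then show ?thesis by simp
    qed
    have "Full x L (?F k) = ?w k * (ennreal (lamV P s) * Full x L (HV n s x k) + ennreal (turnV P s) * Full x L (app x k s (VS n)))"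
     unfolding Full_cmult[OF m(5)] Full_add[OF m(3,4)] Full_cmult[OF m(1)] Full_cmult[OF m(2)] ..
    also have "... = ?w k * (EE x L * ?A k)"
     unfolding 1 2 lam_oHV(1)[symmetric] by (simp only: distrib_left mult_ac)
    finally show ?thesis unfolding kc if_P[OF True] by (simp only: mult_ac)
   next
    case False
    then have kc: "kc L y s k = 0" using T[of k] elim by (auto simp: kc_def)
    have e: "?F k = (%_ _ _. 0)" unfolding if_not_P[OF False] by simp
    have "Full x L (?F k) = 0" unfolding e Full_def by simp
    then show ?thesis unfolding kc by simp
   qed
  qed
 qed
 also have "... = EE x L * (nint LB (%k. kc L y s k * (phi x y x k s * ?A k)))"
  by (rule nn_integral_cmult) (use mA in measurable)
 finally show ?thesis .
qed

text \<open>The line that is hit leaves the list by \<open>Full_rem\<close>, and the factor which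
  this costs is exactly its share in \<open>EE x L\<close>. The four outcomes then continue with the
  remaining lines, to which the induction hypotheses apply.\<close>

lemma Full_cev:
 assumes x: "0 \<le> x" "x < a" "gen x L" "\<forall>l\<in>set L. y < fst l --> snd (snd l) < x" and y: "0 \<le> y" "0 < nV s"
  and i: "i < length L" "L ! i = (Y, s', x0)" "y < Y"
 shows "Full x L (%hs cx c0. cev n x y s (hs ! i) (rem i hs) cx c0) = EE x L * (phi x y x Y s * phi x0 Y x Y s' * oX n x Y (s' + s) (rem i L))"
proof -
 have "(Y, s', x0) \<in> set L" using i by (metis nth_mem)
 then have Y: "0 < Y" "Y < b" "0 < nH s'" "x0 < x" using x(3,4) i(3) by (auto simp: gen_def)
 let ?R = "rem i L" and ?u = "s' + s"
 have R: "gen x ?R" "Y \<notin> fst ` set ?R" "\<forall>l\<in>set ?R. Y < fst l --> snd (snd l) < x"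
  using gen_rem[OF x(3) i(1)] x(4) i(3) set_rem[OF i(1)] by (auto simp: i(2))
 have us: "s + s' = s' + s" by simp
 have h: "0 < hfun P (s + s')" unfolding us by (rule hfun_pos) (use Y y in auto)
 let ?G = "%hs cx c0. ennreal (pk_pV P ?u) * vst n x Y ?u hs cx c0 + ennreal (pk_pH P ?u) * app x Y ?u (VS n) hs cx c0
   + ennreal (p0' ?u) * VS n hs cx c0 + ennreal (cc ?u) * HV n ?u x Y hs cx c0"
 have m: "measF (vst n x Y ?u)" "measF (app x Y ?u (VS n))" "measF (VS n)" "measF (HV n ?u x Y)" "measF ?G"
  "measF (%hs cx c0. phi x y x Y s * phi x0 Y x Y s' * ?G hs cx c0)"
  "measF (%hs cx c0. ennreal (pk_pV P ?u) * vst n x Y ?u hs cx c0)" "measF (%hs cx c0. ennreal (pk_pH P ?u) * app x Y ?u (VS n) hs cx c0)"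
  "measF (%hs cx c0. ennreal (p0' ?u) * VS n hs cx c0)" "measF (%hs cx c0. ennreal (cc ?u) * HV n ?u x Y hs cx c0)"
  "measF (%hs cx c0. ennreal (pk_pV P ?u) * vst n x Y ?u hs cx c0 + ennreal (pk_pH P ?u) * app x Y ?u (VS n) hs cx c0)"
  "measF (%hs cx c0. ennreal (pk_pV P ?u) * vst n x Y ?u hs cx c0 + ennreal (pk_pH P ?u) * app x Y ?u (VS n) hs cx c0
   + ennreal (p0' ?u) * VS n hs cx c0)"
  unfolding measF_def by measurable
 have "Full x L (%hs cx c0. cev n x y s (hs ! i) (rem i hs) cx c0) = Full x L (%hs cx c0. (%hs cx c0. phi x y x Y s * phi x0 Y x Y s' * ?G hs cx c0) (rem i hs) cx c0)"
 proof (rule Full_cong)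
  fix hs cx c0 assume "list_all2 relL L hs"
  then have "relL (L ! i) (hs ! i)" using i(1) by (rule list_all2_nthD)
  then obtain kh where hi: "hs ! i = (Y, s', x0, kh)" by (cases "hs ! i") (auto simp: relL_def i(2))
  show "cev n x y s (hs ! i) (rem i hs) cx c0 = (%hs cx c0. phi x y x Y s * phi x0 Y x Y s' * ?G hs cx c0) (rem i hs) cx c0"
   unfolding hi cev_eq[OF h] us cc_def using i(3) Y by (simp add: phV_def phH_def)
 qed
 also have "... = ennreal (exp (- rH P s' * x)) * Full x ?R (%hs cx c0. phi x y x Y s * phi x0 Y x Y s' * ?G hs cx c0)"
  by (rule Full_rem[OF _ _ i(1) m(6) i(2)]) (use x in auto)
 also have "Full x ?R (%hs cx c0. phi x y x Y s * phi x0 Y x Y s' * ?G hs cx c0) = phi x y x Y s * phi x0 Y x Y s' *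
   (ennreal (pk_pV P ?u) * Full x ?R (vst n x Y ?u) + ennreal (pk_pH P ?u) * Full x ?R (app x Y ?u (VS n))
   + ennreal (p0' ?u) * Full x ?R (VS n) + ennreal (cc ?u) * Full x ?R (HV n ?u x Y))"
  unfolding Full_cmult[OF m(5)] Full_add[OF m(12,10)] Full_add[OF m(11,9)] Full_add[OF m(7,8)] Full_cmult[OF m(1)] Full_cmult[OF m(2)]
   Full_cmult[OF m(3)] Full_cmult[OF m(4)] ..
 also have "ennreal (pk_pV P ?u) * Full x ?R (vst n x Y ?u) = ennreal (pk_pV P ?u) * (EE x ?R * oV n x Y ?u ?R)"
 proof (cases "nV ?u = 0")
  case True then show ?thesis using nVz[of ?u] by simp
 next
  case False
  then have "0 < nV ?u" using nV0[of ?u] by simp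
  then have "Full x ?R (vst n x Y ?u) = EE x ?R * oV n x Y ?u ?R" using IV[of x ?R Y ?u] x R Y by auto
  then show ?thesis by simp
 qed
 also have "ennreal (pk_pH P ?u) * Full x ?R (app x Y ?u (VS n)) = ennreal (pk_pH P ?u) * (EE x ?R * oH n x Y ?u ?R)"
 proof (cases "nH ?u = 0")
  case True then show ?thesis using nHz[of ?u] by simp
 next
  case False
  then have "0 < nH ?u" using nH0[of ?u] by simp
  then have "Full x ?R (app x Y ?u (VS n)) = EE x ?R * oH n x Y ?u ?R" by (intro out_H[OF IS IV]) (use x R Y in auto)
  then show ?thesis by simp
 qed
 also have "Full x ?R (VS n) = EE x ?R * SL ?R (gS n x)" using IS x R by auto
 also have "Full x ?R (HV n ?u x Y) = EE x ?R * oHV n (1 / hfun P ?u) x Y ?u ?R"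
  by (rule out_HV[OF IS IV]) (use x R Y in auto)
 also have "ennreal (cc ?u) * (EE x ?R * oHV n (1 / hfun P ?u) x Y ?u ?R) = EE x ?R * oHV n (cc ?u / hfun P ?u) x Y ?u ?R"
  using oHV_scale[of "cc ?u" "1 / hfun P ?u" n x Y ?u ?R] cc0[of ?u] hfun_nonneg[of ?u] by (simp add: mult.left_commute)
 also have "ennreal (pk_pV P ?u) * (EE x ?R * oV n x Y ?u ?R) + ennreal (pk_pH P ?u) * (EE x ?R * oH n x Y ?u ?R)
   + ennreal (p0' ?u) * (EE x ?R * SL ?R (gS n x)) + EE x ?R * oHV n (cc ?u / hfun P ?u) x Y ?u ?R = EE x ?R * oX n x Y ?u ?R"
  unfolding oX_def by (simp only: distrib_left mult.left_commute[of "EE x ?R"])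
 finally show ?thesis unfolding EE_rem[OF i(1)] i(2) fst_conv snd_conv by (simp only: mult_ac)
qed

text \<open>Either no line lies above \<open>y\<close> and the flight ends at the top, or the lowest
  such line stops it. In both cases \<open>kc\<close> annihilates all terms of \<open>oV_Suc\<close>
  except the free part and one other.\<close>

lemma IV_step:
 assumes x: "0 \<le> x" "x < a" "gen x L" "\<forall>l\<in>set L. y < fst l --> snd (snd l) < x" and y: "0 \<le> y" "y < b" "0 < nV s"
 shows "Full x L (vst (Suc n) x y s) = EE x L * oV (Suc n) x y s L"
proof (cases "\<forall>l\<in>set L. \<not> y < fst l")
 case True
 have hn: "\<forall>e\<in>set hs. \<not> y < fst e" if "list_all2 relL L hs" for hs
  using that True by (auto simp: list_all2_conv_all_nth all_set_conv_all_nth relL_def)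
 have m: "measF (VS n)" "measF (%hs cx c0. phV x y b s * VS n hs cx c0)" unfolding measF_def by measurable
 have "Full x L (vst (Suc n) x y s) =
  EE x L * (nint LB (%k. kc L y s k * (phi x y x k s * (oHV n (pk_pV P s / nV s) x k s L + ennreal (turnV P s) * oH n x k s L))))
  + ennreal (exp (- (b - y) * rV P s)) * Full x L (%hs cx c0. phV x y b s * VS n hs cx c0)"
  by (rule Full_vst_split[OF x y(1,2) order_refl m(2)], rule VV_none, rule hn) (use True in auto)
 moreover have "kc L y s b = ennreal (exp (- (b - y) * rV P s))" using True y by (auto simp: kc_def)
 moreover have "kc L y s (fst (L ! i)) = 0" if "i < length L" for i using True that by (auto simp: kc_def)
 moreover have "Full x L (%hs cx c0. phV x y b s * VS n hs cx c0) = phi x y x b s * (EE x L * SL L (gS n x))"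
  unfolding Full_cmult[OF m(1)] using IS[OF x(1-3)] y by (simp add: phV_def)
 ultimately show ?thesis unfolding oV_Suc by (simp add: distrib_left mult_ac add_ac)
next
 case False
 let ?A = "{i. i < length L & y < fst (L ! i)}"
 obtain l0 where "l0 \<in> set L" "y < fst l0" using False by blast
 then have ne: "?A ~= {}" by (metis (mono_tags, lifting) empty_iff in_set_conv_nth mem_Collect_eq)
 have fin: "finite ((%i. fst (L ! i)) ` ?A)" by simp
 have "Min ((%i. fst (L ! i)) ` ?A) \<in> (%i. fst (L ! i)) ` ?A" by (rule Min_in[OF fin]) (use ne in blast)
 then obtain i where i: "i < length L" "y < fst (L ! i)" and iM: "fst (L ! i) = Min ((%i. fst (L ! i)) ` ?A)"
  by (metis (mono_tags, lifting) image_iff mem_Collect_eq)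
 have mn: "fst (L ! i) \<le> fst (L ! j)" if "j < length L" "y < fst (L ! j)" for j
  unfolding iM by (rule Min_le[OF fin]) (use that in blast)
 obtain Y s' x0 where l: "L ! i = (Y, s', x0)" by (metis prod_cases3)
 have yY: "y < Y" using i l by simp
 have ls: "(Y, s', x0) \<in> set L" using i l by (metis nth_mem)
 then have Y: "0 < Y" "Y < b" using x(3) by (auto simp: gen_def)
 have mn': "Y < fst (L ! j)" if "j < length L" "j ~= i" "y < fst (L ! j)" for j
 proof -
  have "fst (L ! j) ~= fst (L ! i)" using x(3) that i(1) nth_eq_iff_index_eq[of "map fst L" j i] by (auto simp: gen_def)
  then show ?thesis using mn[OF that(1,3)] l by simp
 qed
 have V: "VV (Suc n) x y s k hs cx c0 = (if k \<le> Y then fev n x y s k hs cx c0 else cev n x y s (hs ! i) (rem i hs) cx c0)"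
  if "list_all2 relL L hs" for k hs cx c0
 proof -
  have f: "length hs = length L" "\<And>j. j < length L ==> fst (hs ! j) = fst (L ! j)"
   using that by (auto simp: list_all2_conv_all_nth relL_def)
  have "fst (hs ! i) = Y" using f(2)[OF i(1)] l by simp
  moreover have "VV (Suc n) x y s k hs cx c0 = (if k \<le> fst (hs ! i) then fev n x y s k hs cx c0 else cev n x y s (hs ! i) (rem i hs) cx c0)"
   by (rule VV_some) (use f i Y yY mn' l in auto)
  ultimately show ?thesis by simp
 qed
 have T: "(y < k & k < Y) \<longleftrightarrow> (y < k & (\<forall>l\<in>set L. \<not> (y < fst l & fst l < k)))" if "k \<notin> fst ` set L" for k
 proof -
  have "k ~= Y" using that ls by force
  moreover have "\<not> (y < fst l' & fst l' < k)" if "k < Y" "l' \<in> set L" for l'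
  proof -
   obtain j where "j < length L" "l' = L ! j" using \<open>l' \<in> set L\<close> by (metis in_set_conv_nth)
   then show ?thesis using mn[of j] that l by auto
  qed
  ultimately show ?thesis using ls yY by force
 qed
 have m: "measF (%hs cx c0. cev n x y s (hs ! i) (rem i hs) cx c0)" unfolding measF_def by measurable
 have ex: "\<exists>l\<in>set L. y < fst l & fst l < k" if "Y < k" for k
  by (rule bexI[OF _ ls]) (use yY that in simp)
 have "Full x L (vst (Suc n) x y s) =
  EE x L * (nint LB (%k. kc L y s k * (phi x y x k s * (oHV n (pk_pV P s / nV s) x k s L + ennreal (turnV P s) * oH n x k s L))))
  + ennreal (exp (- (Y - y) * rV P s)) * Full x L (%hs cx c0. cev n x y s (hs ! i) (rem i hs) cx c0)"
  by (rule Full_vst_split[OF x y(1) yY less_imp_le[OF Y(2)] m V T])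
 moreover have "kc L y s b = 0" unfolding kc_def by (rule if_not_P) (use ex[OF Y(2)] in blast)
 moreover have "(\<Sum>j<length L. kc L y s (fst (L ! j)) * (phi x y x (fst (L ! j)) s * phi (snd (snd (L ! j))) (fst (L ! j)) x (fst (L ! j)) (fst (snd (L ! j))) *
    oX n x (fst (L ! j)) (fst (snd (L ! j)) + s) (rem j L))) =
   ennreal (exp (- (Y - y) * rV P s)) * (phi x y x Y s * phi x0 Y x Y s' * oX n x Y (s' + s) (rem i L))" (is "sum ?f _ = _")
 proof -
  have "kc L y s (fst (L ! j)) = 0" if "j < length L" "j ~= i" for j
  proof (cases "y < fst (L ! j)")
   case True
   show ?thesis unfolding kc_def by (rule if_not_P) (use ex[OF mn'[OF that True]] in blast)
  qed (simp add: kc_def)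
  then have "sum ?f {..<length L} = sum ?f {i}" using i(1) by (intro sum.mono_neutral_right) auto
  moreover have "kc L y s Y = ennreal (exp (- (Y - y) * rV P s))"
  proof -
   have "\<not> (y < fst l' & fst l' < Y)" if l': "l' \<in> set L" for l'
   proof -
    obtain j where "j < length L" "l' = L ! j" using l' by (metis in_set_conv_nth)
    then show ?thesis using mn[of j] l by auto
   qed
   then show ?thesis using yY by (auto simp: kc_def)
  qed
  ultimately show ?thesis by (simp add: l)
 qed
 moreover have "Full x L (%hs cx c0. cev n x y s (hs ! i) (rem i hs) cx c0) = EE x L * (phi x y x Y s * phi x0 Y x Y s' * oX n x Y (s' + s) (rem i L))"
  by (rule Full_cev[OF x y(1,3) i(1) l yY])
 ultimately show ?thesis unfolding oV_Suc by (simp add: distrib_left mult_ac add_ac)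
qed

end

lemma mint_empty: "mint \<mu> (%es. if es = [] then A else 0) = A"
proof -
 have "lint (%_. \<mu>) (replicate N ()) (%es. if es = [] then A else 0) = (if N = 0 then A else 0)" for N
  by (cases N) auto
 then have "mint \<mu> (%es. if es = [] then A else 0) = (\<Sum>N. if N = 0 then A else 0)"
  unfolding mint_def by (intro suminf_cong) auto
 also have "... = A" by (subst suminf_finite[of "{0}"]) auto
 finally show ?thesis .
qed

text \<open>The last step: no point of the two processes is left and every clock is silent up to
  \<open>a\<close>. All lines then end on the right side, where their labels are summed.\<close>

lemma IS_0:
 assumes "0 \<le> x" "x < a" "gen x L"
 shows "Full x L (VS 0) = EE x L * SL L (gS 0 x)"
proof -
 define C where "C = prod_list (map (%l. phi (snd (snd l)) (fst l) a (fst l) (fst (snd l))) L)"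
 have l: "lint KH L' (%hs. if \<forall>e\<in>set hs. a < clk e then c else 0) = EE a L' * c" for L' c
 proof (induction L' arbitrary: c)
  case Nil then show ?case by (simp add: EE_def RT_def)
 next
  case (Cons l L')
  have "lint KH (l # L') (%hs. if \<forall>e\<in>set hs. a < clk e then c else 0)
   = (nint (KH (fst l, fst (snd l), snd (snd l))) (%e. EE a L' * (if a < clk e then c else 0)))"
  proof -
   have "lint KH L' (%es. if \<forall>e'\<in>set (e # es). a < clk e' then c else 0) = EE a L' * (if a < clk e then c else 0)" for e
   proof (cases "a < clk e")
    case True then show ?thesis using Cons[of c] by simp
   qed simp
   then show ?thesis by simp
  qed
  also have "... = EE a L' * (nint unifM (%u. (if a < clock_after 0 (rH P (fst (snd l))) u a then c else 0)))"
   by (subst nn_KH, measurable) (simp add: nn_integral_cmult)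
  also have "(nint unifM (%u. (if a < clock_after 0 (rH P (fst (snd l))) u a then c else 0))) = ennreal (exp (- rH P (fst (snd l)) * (a - 0))) * c"
   by (rule clock_gt[OF rH0]) (use a_pos in auto)
  also have "EE a L' * (ennreal (exp (- rH P (fst (snd l)) * (a - 0))) * c) = EE a (l # L') * c"
  proof -
   have e: "- RT (l # L') * a = - RT L' * a + - rH P (fst (snd l)) * (a - 0)" by (simp add: RT_def algebra_simps)
   show ?thesis unfolding EE_def e exp_add by (simp only: ennreal_mult exp_ge_zero mult.assoc)
  qed
  finally show ?case .
 qed
 have "Full x L (VS 0) = Tri L (%hs cx c0. if cx = [] then if c0 = [] then if \<forall>e\<in>set hs. a < clk e then C else 0 else 0 else 0)"
  unfolding Full_def
 proof (rule Tri_cong_AE[OF order_refl])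
  fix hs :: "(real \<times> int \<times> real \<times> real) list" and cx :: "(real \<times> int) list" and c0 :: "(real \<times> real \<times> int) list"
  assume r: "list_all2 relL L hs" and cx: "\<forall>e\<in>set cx. fst e ~= a & fst e < a" and c0: "\<forall>e\<in>set c0. fst e ~= a & fst e < a"
  have V: "VS 0 hs cx c0 = rs_fin hs cx c0 (%_. 0)" unfolding VS_def RR.simps fst_conv rs_fin_def by (simp add: prob_space.emeasure_space_1[OF prob_seqM])
  \<comment> \<open>Almost surely all points lie to the left of \<open>a\<close>, so a list with all
    its points beyond \<open>a\<close> is empty.\<close>
  have 1: "(\<forall>e\<in>set cx. a < fst e) \<longleftrightarrow> cx = []" "(\<forall>e\<in>set c0. a < fst e) \<longleftrightarrow> c0 = []" using cx c0 by (cases cx; cases c0; force)+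
  have "prod_list (map (%e. phH (fst (snd (snd e))) a (fst e) (fst (snd e))) hs) = C"
  proof -
   have "map (%e. phH (fst (snd (snd e))) a (fst e) (fst (snd e))) hs = map (%l. phi (snd (snd l)) (fst l) a (fst l) (fst (snd l))) L"
    using r assms by (intro nth_equalityI) (auto simp: list_all2_conv_all_nth relL_def phH_def gen_def all_set_conv_all_nth)
   then show ?thesis by (simp add: C_def)
  qed
  moreover have "all_gt x hs cx c0 \<longleftrightarrow> (\<forall>e\<in>set hs. x < clk e)" if "cx = []" "c0 = []" using that by (simp add: all_gt_def)
  moreover have "(\<forall>e\<in>set hs. x < clk e)" if "\<forall>e\<in>set hs. a < clk e" using that assms(2) by (meson less_trans)
  ultimately show "(if all_gt x hs cx c0 then VS 0 hs cx c0 else 0) = (if cx = [] then if c0 = [] then if \<forall>e\<in>set hs. a < clk e then C else 0 else 0 else 0)"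
   unfolding V rs_fin_def 1 by auto
 qed
 also have "... = EE a L * C"
 proof -
  have 1: "lint KH L (%hs. if p then G hs else 0) = (if p then lint KH L G else 0)" for p G by simp
  have 2: "mint mu0 (%c0. if p then G c0 else 0) = (if p then mint mu0 G else 0)" for p G by (simp add: mint_def)
  show ?thesis unfolding Tri_def 1 2 l mint_empty ..
 qed
 also have "... = EE x L * SL L (gS 0 x)"
 proof -
  have m: "(%z. wR W (fst z) (snd z)) \<in> borel_measurable (borel >< markM)"
   using lc.wts_measD(2)[OF W_meas] by (simp add: split_beta')
  have C: "SL L' (%\<eta>. prod_list (map (%z. wR W (fst z) (snd z)) \<eta>)) = prod_list (map (%l. phi (snd (snd l)) (fst l) a (fst l) (fst (snd l))) L')" for L'
  proof (induction L')
   case (Cons l L')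
   note [measurable] = m
   have "SL (l # L') (%\<eta>. prod_list (map (%z. wR W (fst z) (snd z)) \<eta>))
    = (nint (KL (fst l, fst (snd l), snd (snd l))) (%e. wR W (fst e) (snd e) * prod_list (map (%l. phi (snd (snd l)) (fst l) a (fst l) (fst (snd l))) L')))"
    by (simp add: kL.lint_cmult Cons)
   also have "... = phi (snd (snd l)) (fst l) a (fst l) (fst (snd l)) * prod_list (map (%l. phi (snd (snd l)) (fst l) a (fst l) (fst (snd l))) L')"
    by (subst nn_KL, measurable) (simp add: W_def phi_int)
   finally show ?case by simp
  qed simp
  have "SL L (gS 0 x) = SL L (%\<eta>. ennreal (exp (- (a - x) * RT L)) * prod_list (map (%z. wR W (fst z) (snd z)) \<eta>))"
   by (rule SL_cong) (use assms in \<open>simp add: gS_def kS_def RL_RT\<close>)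
  also have "... = ennreal (exp (- (a - x) * RT L)) * C"
   unfolding C_def C[symmetric] by (rule kL.lint_cmult) (use m in measurable)
  finally show ?thesis using EE_prop[of x L a] by (simp add: mult.assoc[symmetric])
 qed
 finally show ?thesis .
qed

lemma IV_0: "Full x L (vst 0 x y s) = EE x L * oV 0 x y s L"
proof -
 have "vst 0 x y s = (%_ _ _. 0)" by (intro ext) (simp add: vst_def VV_def)
 moreover have "gV 0 x y m = (%_. 0)" for m by (simp add: gV_def)
 ultimately show ?thesis by (simp add: Full_def oV_def)
qed

text \<open>The central identity: averaged over all that is hidden, the simulation is the abstract
  chain, up to the survival of the clocks started at 0. Both modes go through one induction, because
  a step may lead from either to the other.\<close>

theorem Full_VS: "0 \<le> x ==> x < a ==> gen x L ==> Full x L (VS n) = EE x L * SL L (gS n x)"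
proof -
 have "(\<forall>x L. 0 \<le> x --> x < a --> gen x L --> Full x L (VS n) = EE x L * SL L (gS n x)) &
  (\<forall>x y s L. 0 \<le> x --> x < a --> gen x L --> 0 \<le> y --> y < b --> 0 < nV s -->
   (\<forall>l\<in>set L. y < fst l --> snd (snd l) < x) --> Full x L (vst n x y s) = EE x L * oV n x y s L)"
 proof (induction n)
  case 0 then show ?case using IS_0 IV_0 by blast
 next
  case (Suc n)
  show ?case using IS_step[of n] IV_step[of n] Suc by (intro conjI allI impI) blast+
 qed
 then show "0 \<le> x ==> x < a ==> gen x L ==> Full x L (VS n) = EE x L * SL L (gS n x)" by blast
qed

end

section \<open>The law of the initial configuration\<close>

lemma lint_snoc': "lint K (L @ [l]) F = lint K L (%es. nint (K l) (%e. F (es @ [e])))"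
 by (induction L arbitrary: F) auto

lemma AE_snd:
 assumes "sigma_finite_measure N" "AE x in N. P x"
 shows "AE z in M >< N. P (snd z)"
proof -
 interpret N: sigma_finite_measure N by fact
 obtain A where A: "A \<in> null_sets N" "{x \<in> space N. \<not> P x} \<subseteq> A"
  using assms(2) by (auto elim!: AE_E simp: null_sets_def)
 have "emeasure (M >< N) (space M \<times> A) = 0"
  using A by (subst N.emeasure_pair_measure_Times) auto
 then show ?thesis
  using A by (intro AE_I[of _ _ "space M \<times> A"]) (auto simp: space_pair_measure)
qed

lemma (in list_kernel) lint_mint_swap:
 assumes m: "mint_space E2 \<mu>" and F: "(%(es, ys). F es ys) \<in> borel_measurable (listM E >< listM E2)"
 shows "lint K L (%es. mint \<mu> (F es)) = mint \<mu> (%ys. lint K L (%es. F es ys))"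
 using F
proof (induction L arbitrary: F)
 case Nil show ?case by simp
next
 case (Cons l L)
 interpret m: mint_space E2 \<mu> by (rule m)
 note [measurable (raw)] = meas2[OF Cons.prems]
 have "lint K (l # L) (%es. mint \<mu> (F es)) = (nint (K l) (%e. mint \<mu> (%ys. lint K L (%es. F (e # es) ys))))"
  unfolding lint.simps by (intro nn_integral_cong Cons.IH) measurable
 also have "... = mint \<mu> (%ys. nint (K l) (%e. lint K L (%es. F (e # es) ys)))"
  by (rule m.mint_nn_integral[OF sfin, symmetric]) measurable
 finally show ?case by simp
qed

text \<open>If the measure of one entry is a mixture of the \<open>K (f p)\<close> over
  \<open>\<mu>\<close>, lists of such entries are mixtures as well. This separates height and
  intensity of an initial line from its clock, or from its label.\<close>

lemma (in list_kernel) lint_average: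
 assumes \<mu>: "sigma_finite_measure \<mu>"
  and k: "\<And>G. G \<in> borel_measurable E ==> (nint \<kappa> (%e. G e)) = (nint \<mu> (%p. nint (K (f p)) (%e. G e)))"
  and m: "\<And>G. (%(es, e). G es e) \<in> borel_measurable (listM E >< E) ==> (%(p, es). nint (K (f p)) (%e. G es e)) \<in> borel_measurable (\<mu> >< listM E)"
  and F: "F \<in> borel_measurable (listM E)"
 shows "lint (%_. \<kappa>) (replicate N ()) F = lint (%_. \<mu>) (replicate N ()) (%ps. lint K (map f ps) F)"
 using F
proof (induction N arbitrary: F)
 case 0 show ?case by simp
next
 case (Suc N)
 interpret \<mu>: sigma_finite_measure \<mu> by (rule \<mu>)
 note [measurable] = Suc.prems
 have r: "replicate (Suc N) () = replicate N () @ [()]" by (simp add: replicate_append_same)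
 have mm: "(%(p, es). nint (K (f p)) (%e. F (es @ [e]))) \<in> borel_measurable (\<mu> >< listM E)"
  by (rule m) measurable
 have mi: "(%es. nint \<mu> (%p. nint (K (f p)) (%e. F (es @ [e])))) \<in> borel_measurable (listM E)"
  using measurable_compose[OF measurable_pair_swap' mm] by (intro \<mu>.borel_measurable_nn_integral) (simp add: split_beta')
 have "lint (%_. \<kappa>) (replicate (Suc N) ()) F = lint (%_. \<kappa>) (replicate N ()) (%es. nint \<mu> (%p. nint (K (f p)) (%e. F (es @ [e]))))"
  unfolding r lint_snoc' by (subst k, measurable)
 also have "... = lint (%_. \<mu>) (replicate N ()) (%ps. lint K (map f ps) (%es. nint \<mu> (%p. nint (K (f p)) (%e. F (es @ [e])))))"
  by (rule Suc.IH[OF mi])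
 also have "... = lint (%_. \<mu>) (replicate N ()) (%ps. nint \<mu> (%p. lint K (map f ps @ [f p]) F))"
 proof -
  have "lint K (map f ps @ [f p]) F = lint K (map f ps) (%es. nint (K (f p)) (%e. F (es @ [e])))" for ps p by (rule lint_snoc')
  then show ?thesis by (simp only: lint_nn_integral[OF \<mu> mm])
 qed
 also have "... = lint (%_. \<mu>) (replicate (Suc N) ()) (%ps. lint K (map f ps) F)"
  unfolding r by (simp add: lint_snoc')
 finally show ?case .
qed

lemma (in mint_space) lint_density:
 assumes w: "w \<in> borel_measurable E" and F: "F \<in> borel_measurable (listM E)"
 shows "lint (%_. density \<mu> w) (replicate N ()) F = lint (%_. \<mu>) (replicate N ()) (%es. prod_list (map w es) * F es)"
 using F
proof (induction N arbitrary: F)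
 case (Suc N)
 note [measurable] = Suc.prems w
 have "lint (%_. density \<mu> w) (replicate (Suc N) ()) F = (nint (density \<mu> w) (%e. lint (%_. \<mu>) (replicate N ()) (%es. prod_list (map w es) * F (e # es))))"
  unfolding replicate.simps lint.simps by (intro nn_integral_cong Suc.IH) measurable
 also have "... = (nint \<mu> (%e. w e * lint (%_. \<mu>) (replicate N ()) (%es. prod_list (map w es) * F (e # es))))"
  by (rule nn_integral_density) measurable
 also have "... = (nint \<mu> (%e. lint (%_. \<mu>) (replicate N ()) (%es. w e * (prod_list (map w es) * F (e # es)))))"
  by (intro nn_integral_cong kern.lint_cmult[symmetric]) measurable
 finally show ?case by (simp add: mult.assoc)
qed simp

text \<open>\<open>A\<close> collects the keys already used; the next entry avoids this finite set
  almost surely, so that coinciding keys are null.\<close>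

lemma lint_cong_distinct:
 assumes "finite A" "\<And>A. finite A ==> AE e in \<mu>. fst e \<notin> A & \<rho> e"
  and "\<And>es. distinct (map fst es) ==> fst ` set es \<inter> A = {} ==> list_all \<rho> es ==> F es = G es"
 shows "lint (%_. \<mu>) (replicate N ()) F = lint (%_. \<mu>) (replicate N ()) G"
 using assms(1,3)
proof (induction N arbitrary: A F G)
 case (Suc N)
 have "AE e in \<mu>. lint (%_. \<mu>) (replicate N ()) (%es. F (e # es)) = lint (%_. \<mu>) (replicate N ()) (%es. G (e # es))"
  using assms(2)[OF Suc.prems(1)]
 proof eventually_elim
  case (elim e)
  show ?case
   by (rule Suc.IH[of "insert (fst e) A"]) (use Suc.prems elim in \<open>auto\<close>)
 qed
 then show ?case by (simp add: nn_integral_cong_AE)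
qed simp

definition shc :: "nat => (nat => real) => nat => real" where "shc c \<delta> = (%k. \<delta> (k + c))"

lemma measurable_shc [measurable (raw)]:
 assumes "d \<in> M \<rightarrow>\<^sub>M seqM" shows "(%w. shc c (d w)) \<in> M \<rightarrow>\<^sub>M seqM"
 unfolding shc_def by (rule measurable_PiM_single') (auto intro: measurable_seq_component'[OF assms])

lemma shc_shc: "shc c (shc c' \<delta>) = shc (c + c') \<delta>"
 by (auto simp: shc_def add.assoc)

lemma seq_split_shc1:
 assumes F: "(%(u, \<delta>). F u \<delta>) \<in> borel_measurable (borel >< seqM)"
 shows "(nint seqM (%\<delta>. F (sq \<delta> 0) (shc 1 \<delta>))) = (nint unifM (%u. nint seqM (%\<delta>. F u \<delta>)))"
proof -
 note [measurable (raw)] = meas2[OF F]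
 have "sq (case_nat u \<delta>) 0 = u" "shc 1 (case_nat u \<delta>) = \<delta>" for u \<delta> by (auto simp: sq_def shc_def)
 then show ?thesis by (subst seq_split1, measurable)
qed

lemma seq_split_shc2:
 assumes F: "(%(u, v, \<delta>). F u v \<delta>) \<in> borel_measurable (borel >< borel >< seqM)"
 shows "(nint seqM (%\<delta>. F (sq \<delta> 0) (sq \<delta> 1) (shc 2 \<delta>))) = (nint unifM (%u. nint unifM (%v. nint seqM (%\<delta>. F u v \<delta>))))"
proof -
 note [measurable (raw)] = meas3[OF F]
 have e: "sq \<delta> 1 = sq (shc 1 \<delta>) 0" "shc 2 \<delta> = shc 1 (shc 1 \<delta>)" for \<delta> by (auto simp: sq_def shc_def)
 have "(nint seqM (%\<delta>. F (sq \<delta> 0) (sq \<delta> 1) (shc 2 \<delta>))) = (nint unifM (%u. nint seqM (%\<delta>. F u (sq \<delta> 0) (shc 1 \<delta>))))"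
  unfolding e by (rule seq_split_shc1[of "%u \<delta>. F u (sq \<delta> 0) (shc 1 \<delta>)"]) measurable
 also have "... = (nint unifM (%u. nint unifM (%v. nint seqM (%\<delta>. F u v \<delta>))))"
  by (intro nn_integral_cong seq_split_shc1) measurable
 finally show ?thesis .
qed

lemma seq_split_shc3:
 assumes F: "(%(u, v, w, \<delta>). F u v w \<delta>) \<in> borel_measurable (borel >< borel >< borel >< seqM)"
 shows "(nint seqM (%\<delta>. F (sq \<delta> 0) (sq \<delta> 1) (sq \<delta> 2) (shc 3 \<delta>))) = (nint unifM (%u. nint unifM (%v. nint unifM (%w. nint seqM (%\<delta>. F u v w \<delta>)))))"
proof -
 note [measurable (raw)] = meas4[OF F]
 have e: "sq \<delta> 1 = sq (shc 1 \<delta>) 0" "sq \<delta> 2 = sq (shc 1 \<delta>) 1" "shc 3 \<delta> = shc 2 (shc 1 \<delta>)" for \<delta>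
  by (auto simp: sq_def shc_def numeral_eq_Suc)
 have "(nint seqM (%\<delta>. F (sq \<delta> 0) (sq \<delta> 1) (sq \<delta> 2) (shc 3 \<delta>))) = (nint unifM (%u. nint seqM (%\<delta>. F u (sq \<delta> 0) (sq \<delta> 1) (shc 2 \<delta>))))"
 proof -
  have "F (sq \<delta> 0) (sq \<delta> 1) (sq \<delta> 2) (shc 3 \<delta>) = (%u \<delta>. F u (sq \<delta> 0) (sq \<delta> 1) (shc 2 \<delta>)) (sq \<delta> 0) (shc 1 \<delta>)" for \<delta>
   by (simp only: e)
  then show ?thesis
   by (simp only:) (rule seq_split_shc1[of "%u \<delta>. F u (sq \<delta> 0) (sq \<delta> 1) (shc 2 \<delta>)"], measurable)
 qed
 also have "... = (nint unifM (%u. nint unifM (%v. nint unifM (%w. nint seqM (%\<delta>. F u v w \<delta>)))))"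
  by (intro nn_integral_cong seq_split_shc2) measurable
 finally show ?thesis .
qed

lemma (in list_space) measurable_list_map:
 assumes "\<And>i. g i \<in> M \<rightarrow>\<^sub>M E"
 shows "(%w. map (%i. g i w) is) \<in> M \<rightarrow>\<^sub>M listM E"
proof (induction "is")
 case (Cons i "is")
 from measurable_Cons[OF assms Cons] show ?case by simp
next
 case Nil
 show ?case unfolding list.map by (rule measurable_Nil)
qed

text \<open>Entries read from consecutive blocks of \<open>c\<close> uniforms, the pattern in which
  the initialisation consumes its streams.\<close>

definition stream_list :: "((nat => real) => 'a) => nat => (nat => real) => nat => 'a list" where
 "stream_list h c \<delta> N = map (%i. h (shc (c * i) \<delta>)) [0..<N]"

lemma stream_list_simps: "stream_list h c \<delta> 0 = []" "stream_list h c \<delta> (Suc N) = h \<delta> # stream_list h c (shc c \<delta>) N"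
proof -
 have "[0..<Suc N] = 0 # map Suc [0..<N]" by (simp add: upt_conv_Cons map_Suc_upt del: upt_Suc)
 then show "stream_list h c \<delta> (Suc N) = h \<delta> # stream_list h c (shc c \<delta>) N"
  unfolding stream_list_def by (simp del: upt_Suc add: shc_shc comp_def add.commute) (simp add: shc_def)
qed (simp add: stream_list_def)

lemma (in mint_space) stream_list_law:
 assumes h: "h \<in> seqM \<rightarrow>\<^sub>M E"
  and item: "\<And>G. (%(e, \<delta>). G e \<delta>) \<in> borel_measurable (E >< seqM) ==> (nint seqM (%\<delta>. G (h \<delta>) (shc c \<delta>))) = c0 * (nint \<mu> (%e. nint seqM (%\<delta>. G e \<delta>)))"
  and F: "F \<in> borel_measurable (listM E)"
 shows "(nint seqM (%\<delta>. F (stream_list h c \<delta> N))) = c0 ^ N * lint (%_. \<mu>) (replicate N ()) F"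
 using F
proof (induction N arbitrary: F)
 case 0 show ?case by (simp add: stream_list_simps prob_space.emeasure_space_1[OF prob_seqM])
next
 case (Suc N)
 note [measurable] = Suc.prems
 have m [measurable]: "(%\<delta>. stream_list h c \<delta> N) \<in> seqM \<rightarrow>\<^sub>M listM E"
  unfolding stream_list_def by (intro measurable_list_map measurable_compose[OF _ h]) measurable
 have "(nint seqM (%\<delta>. F (stream_list h c \<delta> (Suc N)))) = c0 * (nint \<mu> (%e. nint seqM (%\<delta>. F (e # stream_list h c \<delta> N))))"
  unfolding stream_list_simps by (rule item[of "%e \<delta>. F (e # stream_list h c \<delta> N)"]) measurable
 also have "... = c0 * (nint \<mu> (%e. c0 ^ N * lint (%_. \<mu>) (replicate N ()) (%es. F (e # es))))"
  by (intro arg_cong[of _ _ "(*) c0"] nn_integral_cong Suc.IH) measurable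
 also have "... = c0 * (c0 ^ N * lint (%_. \<mu>) (replicate (Suc N) ()) F)"
  by (subst nn_integral_cmult, measurable)
 finally show ?case by (simp add: mult.assoc)
qed

lemma measurable_poisson_sample [measurable]: "poisson_sample l \<in> borel \<rightarrow>\<^sub>M count_space UNIV"
 unfolding poisson_sample_def[abs_def] by measurable

text \<open>The factor \<open>l ^ n\<close> of the Poisson weight cancels against the normalisation
  \<open>1 / l\<close> of each of the \<open>n\<close> points, and the remaining
  \<open>1 / fact n\<close> is that of \<open>mint\<close>.\<close>

lemma (in mint_space) poisson_list_law:
 assumes h: "h \<in> seqM \<rightarrow>\<^sub>M E" and l: "0 < l"
  and item: "\<And>G. (%(e, \<delta>). G e \<delta>) \<in> borel_measurable (E >< seqM) ==>
   (nint seqM (%\<delta>. G (h \<delta>) (shc c \<delta>))) = ennreal (1 / l) * (nint \<mu> (%e. nint seqM (%\<delta>. G e \<delta>)))"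
  and F: "F \<in> borel_measurable (listM E)"
 shows "(nint seqM (%\<delta>. F (stream_list h c (shc 1 \<delta>) (poisson_sample l (sq \<delta> 0))))) = ennreal (exp (- l)) * mint \<mu> F"
proof -
 note [measurable] = F
 have m: "(%\<delta>. stream_list h c \<delta> N) \<in> seqM \<rightarrow>\<^sub>M listM E" for N
  unfolding stream_list_def by (intro measurable_list_map measurable_compose[OF _ h]) measurable
 have "(%(u, \<delta>). F (stream_list h c \<delta> (poisson_sample l u))) \<in> borel_measurable (borel >< seqM)"
  unfolding split_beta'
  by (rule measurable_compose_countable[where f="%N w. F (stream_list h c (snd w) N)"])
   (rule measurable_compose[OF measurable_compose[OF measurable_snd m] F], measurable)
 from seq_split_shc1[OF this]
 have "(nint seqM (%\<delta>. F (stream_list h c (shc 1 \<delta>) (poisson_sample l (sq \<delta> 0)))))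
  = (nint unifM (%u. ennreal (1 / l) ^ poisson_sample l u * lint (%_. \<mu>) (replicate (poisson_sample l u) ()) F))"
  by (simp only: stream_list_law[OF h item F])
 also have "... = (\<Sum>n. ennreal (exp (- l) * l ^ n / fact n) * (ennreal (1 / l) ^ n * lint (%_. \<mu>) (replicate n ()) F))"
  by (rule nn_integral_poisson) (use l in simp)
 also have "... = (\<Sum>n. ennreal (exp (- l)) * (ennreal (1 / fact n) * lint (%_. \<mu>) (replicate n ()) F))"
 proof (rule suminf_cong)
  fix n
  have "exp (- l) * l ^ n / fact n * (1 / l) ^ n = exp (- l) * (1 / fact n)"
   using l by (simp add: field_simps power_mult_distrib[symmetric])
  then have "ennreal (exp (- l) * l ^ n / fact n) * ennreal (1 / l) ^ n = ennreal (exp (- l)) * ennreal (1 / fact n)"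
   using l by (simp add: ennreal_power ennreal_mult[symmetric])
  then show "ennreal (exp (- l) * l ^ n / fact n) * (ennreal (1 / l) ^ n * lint (%_. \<mu>) (replicate n ()) F)
   = ennreal (exp (- l)) * (ennreal (1 / fact n) * lint (%_. \<mu>) (replicate n ()) F)"
   by (simp only: mult.assoc[symmetric])
 qed
 finally show ?thesis by (simp add: mint_def)
qed

lemma unif_scale:
 assumes "0 < c" and [measurable]: "f \<in> borel_measurable borel"
 shows "(nint unifM (%u. f (c * u))) = ennreal (1 / c) * (nint lborel (%x. indicator {0<..<c} x * f x))"
proof -
 have "(nint lborel (%x. indicator {0<..<c} x * f x)) = ennreal c * (nint lborel (%u. indicator {0<..<c} (0 + c * u) * f (0 + c * u)))"
  by (subst nn_integral_real_affine[of _ c 0]) (use assms in auto)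
 also have "(nint lborel (%u. indicator {0<..<c} (0 + c * u) * f (0 + c * u))) = (nint lborel (%u. f (c * u) * indicator {0..1} u))"
 proof (rule nn_integral_cong_AE)
  have "AE u in lborel. u ~= (0::real) & u ~= 1"
   using AE_lborel_singleton[of "0::real"] AE_lborel_singleton[of "1::real"] by eventually_elim auto
  then show "AE u in lborel. indicator {0<..<c} (0 + c * u) * f (0 + c * u) = f (c * u) * indicator {0..1} u"
  proof eventually_elim
   case (elim u)
   have "0 < c * u & c * u < c \<longleftrightarrow> 0 \<le> u & u \<le> 1" using elim assms(1) by (auto simp: zero_less_mult_iff mult_less_cancel_left1)
   then show ?case by (simp add: indicator_def)
  qed
 qed
 also have "... = (nint unifM (%u. f (c * u)))" by (rule nn_unif[symmetric]) measurable
 finally have "ennreal (1 / c) * (nint lborel (%x. indicator {0<..<c} x * f x)) = ennreal (1 / c) * ennreal c * (nint unifM (%u. f (c * u)))"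
  by (simp add: mult.assoc)
 also have "ennreal (1 / c) * ennreal c = 1" using assms(1) by (simp add: ennreal_mult[symmetric])
 finally show ?thesis by simp
qed

lemma restrict_univ: "restrict f UNIV = f"
 by (simp add: restrict_def)

text \<open>The streams read disjoint coordinates of one i.i.d. sequence, because
  \<open>prod_encode\<close> is injective; so they are independent, and each is an i.i.d. sequence
  again. The order of the integrals is that in which \<open>initial_law\<close> evaluates
  them.\<close>

lemma streams_law:
 assumes F: "(%(d0, d1, d2, d3). F d0 d1 d2 d3) \<in> borel_measurable (seqM >< seqM >< seqM >< seqM)"
 shows "(nint seqM (%\<omega>. F (ustr \<omega> 0) (ustr \<omega> 1) (ustr \<omega> 2) (ustr \<omega> 3))) =
  (nint seqM (%d1. nint seqM (%d0. nint seqM (%d2. nint seqM (%d3. F d0 d1 d2 d3)))))"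
proof -
 let ?K = "%j. range (%k. prod_encode (j, k))"
 let ?I = "{0, 1, 2, 3} :: nat set"
 have u: "(%\<omega>. ustr \<omega> j) \<in> seqM \<rightarrow>\<^sub>M seqM" for j
  unfolding ustr_def by (rule measurable_PiM_single') (auto intro: measurable_component_singleton)
 have ps: "product_prob_space (%_::nat. unifM)"
  by (intro product_prob_space.intro product_sigma_finite.intro product_prob_space_axioms.intro prob_space_imp_sigma_finite prob_unifM)
 have 1: "prob_space.indep_vars seqM (%_. unifM) (%i \<omega>. \<omega> i) UNIV"
 proof (subst prob_space.indep_vars_iff_distr_eq_PiM'[OF prob_seqM])
  have "distr seqM seqM (%\<omega>. \<omega>) = seqM" by (rule distr_id2) simp
  moreover have "distr seqM unifM (%\<omega>. \<omega> i) = unifM" for i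
   by (rule distr_PiM_component) (auto intro: prob_unifM)
  ultimately show "distr seqM (Pi\<^sub>M UNIV (%i. unifM)) (%x. \<lambda>i\<in>UNIV. x i) = Pi\<^sub>M UNIV (%i. distr seqM unifM (%\<omega>. \<omega> i))"
   by (simp add: restrict_univ)
 qed (auto intro: measurable_component_singleton)
 have 2: "prob_space.indep_vars seqM (%j. PiM (?K j) (%_. unifM)) (%j \<omega>. restrict (%i. \<omega> i) (?K j)) ?I"
  by (rule prob_space.indep_vars_restrict[OF prob_seqM 1]) (auto simp: disjoint_family_on_def)
 have 3: "prob_space.indep_vars seqM (%j. seqM) (%j \<omega>. (%k. restrict (%i. \<omega> i) (?K j) (prod_encode (j, k)))) ?I"
 proof (rule prob_space.indep_vars_compose2[OF prob_seqM 2, of "%j \<omega> k. \<omega> (prod_encode (j, k))"])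
  fix j
  show "(%\<omega> k. \<omega> (prod_encode (j, k))) \<in> PiM (?K j) (%_. unifM) \<rightarrow>\<^sub>M seqM"
   by (rule measurable_PiM_single') (auto intro!: measurable_component_singleton)
 qed
 have e: "(%k. restrict (%i. \<omega> i) (?K j) (prod_encode (j, k))) = ustr \<omega> j" for \<omega> j by (auto simp: ustr_def)
 have d: "distr seqM seqM (%\<omega>. ustr \<omega> j) = seqM" for j
 proof -
  have "distr seqM (PiM UNIV (%i. unifM)) (%\<omega>. \<lambda>n\<in>UNIV. \<omega> (prod_encode (j, n))) = PiM UNIV (%i. unifM)"
   by (rule distr_PiM_reindex) (auto intro: prob_unifM inj_onI)
  then show ?thesis by (simp add: ustr_def[abs_def] restrict_univ)
 qed
 have 4: "distr seqM (PiM ?I (%_. seqM)) (%\<omega>. \<lambda>j\<in>?I. ustr \<omega> j) = PiM ?I (%_. seqM)"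
  using prob_space.indep_vars_iff_distr_eq_PiM'[OF prob_seqM, of ?I "%j \<omega>. ustr \<omega> j" "%_. seqM"] u 3[unfolded e] d by simp
 interpret ps: product_sigma_finite "%_::nat. seqM"
  by (rule product_sigma_finite.intro) (rule prob_space_imp_sigma_finite[OF prob_seqM])
 note [measurable (raw)] = meas4[OF F]
 have c: "(%f. f j) \<in> PiM J (%_. seqM) \<rightarrow>\<^sub>M seqM" if "j \<in> J" for j :: nat and J
  using that by (rule measurable_component_singleton)
 have m: "(%f. F (f 0) (f 1) (f 2) (f 3)) \<in> borel_measurable (PiM ?I (%_. seqM))"
  by (rule meas4[OF F]; rule c; simp)
 have "(nint seqM (%\<omega>. F (ustr \<omega> 0) (ustr \<omega> 1) (ustr \<omega> 2) (ustr \<omega> 3))) = (nint (distr seqM (PiM ?I (%_. seqM)) (%\<omega>. \<lambda>j\<in>?I. ustr \<omega> j)) (%f. F (f 0) (f 1) (f 2) (f 3)))"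
 proof (subst nn_integral_distr)
  show "(%\<omega>. \<lambda>j\<in>?I. ustr \<omega> j) \<in> seqM \<rightarrow>\<^sub>M PiM ?I (%_. seqM)" by (intro measurable_restrict u)
  show "(%f. F (f 0) (f 1) (f 2) (f 3)) \<in> borel_measurable (distr seqM (PiM ?I (%_. seqM)) (%\<omega>. \<lambda>j\<in>?I. ustr \<omega> j))"
   using m by (simp only: measurable_distr_eq1)
 qed simp
 also have "... = (nint (PiM (insert (3::nat) {2, 0, 1}) (%_. seqM)) (%f. F (f 0) (f 1) (f 2) (f 3)))"
  unfolding 4 by (simp add: insert_commute)
 also have "... = (nint (PiM (insert (2::nat) {0, 1}) (%_. seqM)) (%f. nint seqM (%d3. F (f 0) (f 1) (f 2) d3)))"
  by (subst ps.product_nn_integral_insert) (use m in \<open>auto simp: insert_commute\<close>)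
 also have "... = (nint (PiM (insert (0::nat) {1}) (%_. seqM)) (%f. nint seqM (%d2. nint seqM (%d3. F (f 0) (f 1) d2 d3))))"
 proof -
  note [measurable] = c[of 0 "insert (2::nat) {0, 1}"] c[of 1 "insert (2::nat) {0, 1}"] c[of 2 "insert (2::nat) {0, 1}"]
  have "(%f. nint seqM (%d3. F (f 0) (f 1) (f 2) d3)) \<in> borel_measurable (PiM (insert (2::nat) {0, 1}) (%_. seqM))" by measurable
  then show ?thesis by (subst ps.product_nn_integral_insert) auto
 qed
 also have "... = (nint (PiM (insert (1::nat) {}) (%_. seqM)) (%f. nint seqM (%d0. nint seqM (%d2. nint seqM (%d3. F d0 (f 1) d2 d3)))))"
 proof -
  note [measurable] = c[of 0 "insert (0::nat) {1}"] c[of 1 "insert (0::nat) {1}"]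
  have "(%f. nint seqM (%d2. nint seqM (%d3. F (f 0) (f 1) d2 d3))) \<in> borel_measurable (PiM (insert (0::nat) {1}) (%_. seqM))" by measurable
  then show ?thesis by (subst ps.product_nn_integral_insert) auto
 qed
 also have "... = (nint seqM (%d1. nint seqM (%d0. nint seqM (%d2. nint seqM (%d3. F d0 d1 d2 d3)))))"
 proof -
  note [measurable] = c[of 1 "insert (1::nat) {}"]
  have "(%f. nint seqM (%d0. nint seqM (%d2. nint seqM (%d3. F d0 (f 1) d2 d3)))) \<in> borel_measurable (PiM (insert (1::nat) {}) (%_. seqM))" by measurable
  then show ?thesis by (subst ps.product_nn_integral_insert) (auto simp: prob_space.emeasure_space_1 prob_space_PiM prob_seqM prob_unifM)
 qed
 finally show ?thesis .
qed

lemma (in list_space) measurable_stream_list: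
 assumes h: "h \<in> seqM \<rightarrow>\<^sub>M E"
 shows "(%\<delta>. stream_list h c (shc 1 \<delta>) (poisson_sample l (sq \<delta> 0))) \<in> seqM \<rightarrow>\<^sub>M listM E"
proof (rule measurable_compose_countable[where f="%N \<delta>. stream_list h c (shc 1 \<delta>) N"])
 show "(%\<delta>. stream_list h c (shc 1 \<delta>) N) \<in> seqM \<rightarrow>\<^sub>M listM E" for N
  unfolding stream_list_def by (intro measurable_list_map measurable_compose[OF _ h]) measurable
qed measurable

context pks_dist
begin

text \<open>One initial item made from its block of uniforms: a birth on the lower side here, a
  creation in the interior for \<open>h0\<close>, a line on the left side with its clock for
  \<open>hH\<close>.\<close>

definition "hX \<delta> = (a * sq \<delta> 0, sample_Z nV (sq \<delta> 1))"
definition "h0 \<delta> = (a * sq \<delta> 0, b * sq \<delta> 1, sample_Z (fker P 0) (sq \<delta> 2))"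
definition "hH \<delta> = (b * sq \<delta> 0, sample_Z nH (sq \<delta> 1), 0 :: real, clock_after 0 (rH P (sample_Z nH (sq \<delta> 1))) (sq \<delta> 2) a)"
text \<open>Position 0 of the stream draws the number of items, so the items themselves start after
  the shift \<open>shc 1\<close>.\<close>

definition "LX d = stream_list hX 2 (shc 1 d) (poisson_sample (a * tot nV) (sq d 0))"
definition "L0 d = stream_list h0 3 (shc 1 d) (poisson_sample (a * b * pk_p0 P * hfun P 0) (sq d 0))"
definition "LH d = stream_list hH 3 (shc 1 d) (poisson_sample (b * tot nH) (sq d 0))"

lemma h_meas [measurable]: "hX \<in> seqM \<rightarrow>\<^sub>M cxE" "h0 \<in> seqM \<rightarrow>\<^sub>M c0E" "hH \<in> seqM \<rightarrow>\<^sub>M hsE"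
 unfolding hX_def[abs_def] h0_def[abs_def] hH_def[abs_def] by measurable

lemma LX_meas [measurable]: "LX \<in> seqM \<rightarrow>\<^sub>M listM cxE"
 unfolding LX_def[abs_def] by (rule cxL.measurable_stream_list) measurable
lemma L0_meas [measurable]: "L0 \<in> seqM \<rightarrow>\<^sub>M listM c0E"
 unfolding L0_def[abs_def] by (rule c0L.measurable_stream_list) measurable
lemma LH_meas [measurable]: "LH \<in> seqM \<rightarrow>\<^sub>M listM hsE"
 unfolding LH_def[abs_def] by (rule hsL.measurable_stream_list) measurable

lemma init_eq:
 "cfg_mode (pks_init P \<omega>) = Sweep" "cfg_out (pks_init P \<omega>) = {}" "cfg_idx (pks_init P \<omega>) = 0"
 "cfg_cx (pks_init P \<omega>) = LX (ustr \<omega> 0)" "cfg_hs (pks_init P \<omega>) = LH (ustr \<omega> 1)" "cfg_c0 (pks_init P \<omega>) = L0 (ustr \<omega> 2)"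
 "dl \<omega> 0 = ustr \<omega> 3"
 by (simp_all add: pks_init_def Let_def LX_def LH_def L0_def stream_list_def hX_def hH_def h0_def sq_def shc_def dl_def)
  (simp_all add: numeral_eq_Suc)

lemma item_X:
 assumes t: "0 < tot nV" and G: "(%(e, \<delta>). G e \<delta>) \<in> borel_measurable (cxE >< seqM)"
 shows "(nint seqM (%\<delta>. G (hX \<delta>) (shc 2 \<delta>))) = ennreal (1 / (a * tot nV)) * (nint muX (%e. nint seqM (%\<delta>. G e \<delta>)))"
proof -
 note [measurable (raw)] = meas2[OF G]
 define g where "g e = (nint seqM (%\<delta>. G e \<delta>))" for e
 have g [measurable]: "g \<in> borel_measurable cxE" unfolding g_def by measurable
 define K where "K x = (nint nuVM (%s. g (x, s)))" for x
 have K [measurable]: "K \<in> borel_measurable borel" unfolding K_def by measurable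
 have "(%(u, v, \<delta>). G (a * u, sample_Z nV v) \<delta>) \<in> borel_measurable (borel >< borel >< seqM)" by measurable
 from seq_split_shc2[OF this]
 have "(nint seqM (%\<delta>. G (hX \<delta>) (shc 2 \<delta>))) = (nint unifM (%u. nint unifM (%v. g (a * u, sample_Z nV v))))"
  by (simp add: hX_def g_def)
 also have "... = (nint unifM (%u. ennreal (1 / tot nV) * K (a * u)))"
 proof (rule nn_integral_cong)
  fix u
  have "(nint unifM (%v. g (a * u, sample_Z nV v))) = (nint intM (%s. ennreal (nV s / tot nV) * g (a * u, s)))"
   by (rule nn_integral_sample_Z[OF nV0 nVs t])
  also have "... = (nint intM (%s. ennreal (1 / tot nV) * (ennreal (nV s) * g (a * u, s))))"
   using t nV0 by (intro nn_integral_cong) (simp add: mult.assoc[symmetric] ennreal_mult[symmetric])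
  also have "... = ennreal (1 / tot nV) * K (a * u)"
   unfolding K_def nuVM_def by (simp add: nn_integral_cmult nn_integral_density)
  finally show "(nint unifM (%v. g (a * u, sample_Z nV v))) = ennreal (1 / tot nV) * K (a * u)" .
 qed
 also have "... = ennreal (1 / tot nV) * (nint unifM (%u. K (a * u)))" by (rule nn_integral_cmult) measurable
 also have "... = ennreal (1 / tot nV) * (ennreal (1 / a) * (nint LA (%x. K x)))"
  unfolding unif_scale[OF a_pos K] nn_LA[OF K] ..
 also have "... = ennreal (1 / (a * tot nV)) * (nint LA (%x. K x))"
 proof -
  have "ennreal (1 / tot nV) * ennreal (1 / a) = ennreal (1 / (a * tot nV))"
   using t a_pos by (simp add: ennreal_mult[symmetric] mult_ac)
  then show ?thesis by (simp only: mult.assoc[symmetric])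
 qed
 also have "(nint LA (%x. K x)) = (nint muX (%e. g e))" unfolding K_def by (rule nn_muX[symmetric]) measurable
 finally show ?thesis unfolding g_def .
qed

lemma item_0:
 assumes t: "0 < hfun P 0" "0 < pk_p0 P" and G: "(%(e, \<delta>). G e \<delta>) \<in> borel_measurable (c0E >< seqM)"
 shows "(nint seqM (%\<delta>. G (h0 \<delta>) (shc 3 \<delta>))) = ennreal (1 / (a * b * pk_p0 P * hfun P 0)) * (nint mu0 (%e. nint seqM (%\<delta>. G e \<delta>)))"
proof -
 note [measurable (raw)] = meas2[OF G]
 define g where "g e = (nint seqM (%\<delta>. G e \<delta>))" for e
 have g [measurable]: "g \<in> borel_measurable c0E" unfolding g_def by measurable
 define K where "K x y = (nint nu0M (%s. g (x, y, s)))" for x y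
 have K: "(%(x, y). K x y) \<in> borel_measurable (borel >< borel)" unfolding K_def by measurable
 note [measurable (raw)] = meas2[OF K]
 define K1 where "K1 x = (nint LB (%y. K x y))" for x
 have K1 [measurable]: "K1 \<in> borel_measurable borel" unfolding K1_def by measurable
 let ?c = "ennreal (1 / (pk_p0 P * hfun P 0))"
 have "(%(u, v, w, \<delta>). G (a * u, b * v, sample_Z (fker P 0) w) \<delta>) \<in> borel_measurable (borel >< borel >< borel >< seqM)" by measurable
 from seq_split_shc3[OF this]
 have "(nint seqM (%\<delta>. G (h0 \<delta>) (shc 3 \<delta>))) = (nint unifM (%u. nint unifM (%v. nint unifM (%w. g (a * u, b * v, sample_Z (fker P 0) w)))))"
  by (simp add: h0_def g_def)
 also have "... = (nint unifM (%u. nint unifM (%v. ?c * K (a * u) (b * v))))"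
 proof (intro nn_integral_cong)
  fix u v
  have "(nint unifM (%w. g (a * u, b * v, sample_Z (fker P 0) w))) = (nint intM (%s. ennreal (fker P 0 s / hfun P 0) * g (a * u, b * v, s)))"
   using nn_integral_sample_Z[OF fker_nonneg fker_summable, of 0 "%s. g (a * u, b * v, s)"] t by (simp add: tot_fker)
  also have "... = (nint intM (%s. ?c * (ennreal (pk_p0 P * nV (- s) * nH s) * g (a * u, b * v, s))))"
  proof (rule nn_integral_cong)
   fix s
   have "fker P 0 s / hfun P 0 = 1 / (pk_p0 P * hfun P 0) * (pk_p0 P * nV (- s) * nH s)" using t by (simp add: fker_def)
   then have "ennreal (fker P 0 s / hfun P 0) = ?c * ennreal (pk_p0 P * nV (- s) * nH s)"
    using t nV0 nH0 by (simp only:) (rule ennreal_mult, auto)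
   then show "ennreal (fker P 0 s / hfun P 0) * g (a * u, b * v, s) = ?c * (ennreal (pk_p0 P * nV (- s) * nH s) * g (a * u, b * v, s))"
    by (simp only: mult.assoc)
  qed
  also have "... = ?c * K (a * u) (b * v)"
   unfolding K_def nu0M_def by (simp add: nn_integral_cmult nn_integral_density)
  finally show "(nint unifM (%w. g (a * u, b * v, sample_Z (fker P 0) w))) = ?c * K (a * u) (b * v)" .
 qed
 also have "... = (nint unifM (%u. ?c * (ennreal (1 / b) * K1 (a * u))))"
 proof (rule nn_integral_cong)
  fix u
  have m: "(%y. K (a * u) y) \<in> borel_measurable borel" by measurable
  have "(nint unifM (%v. ?c * K (a * u) (b * v))) = ?c * (nint unifM (%v. K (a * u) (b * v)))" by (rule nn_integral_cmult) measurable
  then show "(nint unifM (%v. ?c * K (a * u) (b * v))) = ?c * (ennreal (1 / b) * K1 (a * u))"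
   unfolding unif_scale[OF b_pos m] K1_def nn_LB[OF m] .
 qed
 also have "... = ?c * ennreal (1 / b) * (nint unifM (%u. K1 (a * u)))"
  unfolding mult.assoc[symmetric] by (rule nn_integral_cmult) measurable
 also have "... = ?c * ennreal (1 / b) * (ennreal (1 / a) * (nint LA (%x. K1 x)))"
  unfolding unif_scale[OF a_pos K1] nn_LA[OF K1] ..
 also have "... = ennreal (1 / (a * b * pk_p0 P * hfun P 0)) * (nint LA (%x. K1 x))"
 proof -
  have "?c * ennreal (1 / b) * ennreal (1 / a) = ennreal (1 / (a * b * pk_p0 P * hfun P 0))"
   using t a_pos b_pos by (simp add: ennreal_mult[symmetric] mult_ac)
  then show ?thesis by (simp only: mult.assoc[symmetric])
 qed
 also have "(nint LA (%x. K1 x)) = (nint mu0 (%e. g e))" unfolding K1_def K_def by (rule nn_mu0[symmetric]) measurable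
 finally show ?thesis unfolding g_def .
qed

definition nuHM :: "int measure" where "nuHM = density intM (%s. ennreal (nH s))"
definition muH :: "(real \<times> int) measure" where "muH = LB >< nuHM"
definition kapH :: "(real \<times> int \<times> real \<times> real) measure" where
 "kapH = distr (muH >< unifM) hsE (%w. (fst (fst w), snd (fst w), 0, clock_after 0 (rH P (snd (fst w))) (snd w) a))"
definition st :: "real \<times> int => real \<times> int \<times> real" where "st p = (fst p, snd p, 0)"

lemma sets_nuHM [simp, measurable_cong]: "sets nuHM = sets intM" by (simp add: nuHM_def)
lemma sets_muH [simp, measurable_cong]: "sets muH = sets cxE" unfolding muH_def by (intro sets_pair_measure_cong) simp_all
lemma sets_kapH [simp, measurable_cong]: "sets kapH = sets hsE" by (simp add: kapH_def)

lemma sfin_nuHM: "sigma_finite_measure nuHM"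
 by (rule sigma_finite_countable; simp add: nuHM_def emeasure_density ennreal_mult_eq_top_iff)

lemma sfin_muH: "sigma_finite_measure muH"
proof -
 interpret N: sigma_finite_measure nuHM by (rule sfin_nuHM)
 interpret pair_sigma_finite LB nuHM ..
 show ?thesis unfolding muH_def by (rule sigma_finite_measure_axioms)
qed

lemma nn_muH: "f \<in> borel_measurable cxE ==> (nint muH (%p. f p)) = (nint LB (%y. nint nuHM (%s. f (y, s))))"
 unfolding muH_def by (rule sigma_finite_measure.nn_integral_fst[OF sfin_nuHM, symmetric]) measurable

lemma nn_kapH:
 assumes f [measurable]: "f \<in> borel_measurable hsE"
 shows "(nint kapH (%e. f e)) = (nint muH (%p. nint (KH (st p)) (%e. f e)))"
proof -
 have T: "(%w. (fst (fst w), snd (fst w), 0, clock_after 0 (rH P (snd (fst w))) (snd w) a)) \<in> muH >< unifM \<rightarrow>\<^sub>M hsE"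
  by measurable
 have "(nint kapH (%e. f e)) = (nint (muH >< unifM) (%w. f (fst (fst w), snd (fst w), 0, clock_after 0 (rH P (snd (fst w))) (snd w) a)))"
  unfolding kapH_def by (rule nn_integral_distr) measurable
 also have "... = (nint muH (%p. nint unifM (%u. f (fst p, snd p, 0, clock_after 0 (rH P (snd p)) u a))))"
  using sigma_finite_measure.nn_integral_fst[OF prob_space_imp_sigma_finite[OF prob_unifM] measurable_compose[OF T f]] by simp
 finally show ?thesis by (simp add: st_def nn_KH)
qed

lemma item_H:
 assumes t: "0 < tot nH" and G: "(%(e, \<delta>). G e \<delta>) \<in> borel_measurable (hsE >< seqM)"
 shows "(nint seqM (%\<delta>. G (hH \<delta>) (shc 3 \<delta>))) = ennreal (1 / (b * tot nH)) * (nint kapH (%e. nint seqM (%\<delta>. G e \<delta>)))"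
proof -
 note [measurable (raw)] = meas2[OF G]
 interpret N: sigma_finite_measure nuHM by (rule sfin_nuHM)
 define g where "g e = (nint seqM (%\<delta>. G e \<delta>))" for e
 have g [measurable]: "g \<in> borel_measurable hsE" unfolding g_def by measurable
 define K1 where "K1 p = (nint unifM (%u. g (fst p, snd p, 0, clock_after 0 (rH P (snd p)) u a)))" for p
 have K1 [measurable]: "K1 \<in> borel_measurable cxE" unfolding K1_def by measurable
 define K where "K y = (nint nuHM (%s. K1 (y, s)))" for y
 have K [measurable]: "K \<in> borel_measurable borel" unfolding K_def by measurable
 have "(%(u, v, w, \<delta>). G (b * u, sample_Z nH v, 0, clock_after 0 (rH P (sample_Z nH v)) w a) \<delta>) \<in> borel_measurable (borel >< borel >< borel >< seqM)" by measurable
 from seq_split_shc3[OF this]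
 have "(nint seqM (%\<delta>. G (hH \<delta>) (shc 3 \<delta>))) = (nint unifM (%u. nint unifM (%v. K1 (b * u, sample_Z nH v))))"
  by (simp add: hH_def g_def K1_def)
 also have "... = (nint unifM (%u. ennreal (1 / tot nH) * K (b * u)))"
 proof (rule nn_integral_cong)
  fix u
  have "(nint unifM (%v. K1 (b * u, sample_Z nH v))) = (nint intM (%s. ennreal (nH s / tot nH) * K1 (b * u, s)))"
   by (rule nn_integral_sample_Z[OF nH0 nHs t])
  also have "... = (nint intM (%s. ennreal (1 / tot nH) * (ennreal (nH s) * K1 (b * u, s))))"
   using t nH0 by (intro nn_integral_cong) (simp add: mult.assoc[symmetric] ennreal_mult[symmetric])
  also have "... = ennreal (1 / tot nH) * K (b * u)"
   unfolding K_def nuHM_def by (simp add: nn_integral_cmult nn_integral_density)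
  finally show "(nint unifM (%v. K1 (b * u, sample_Z nH v))) = ennreal (1 / tot nH) * K (b * u)" .
 qed
 also have "... = ennreal (1 / tot nH) * (nint unifM (%u. K (b * u)))" by (rule nn_integral_cmult) measurable
 also have "... = ennreal (1 / tot nH) * (ennreal (1 / b) * (nint LB (%x. K x)))"
  unfolding unif_scale[OF b_pos K] nn_LB[OF K] ..
 also have "... = ennreal (1 / (b * tot nH)) * (nint LB (%x. K x))"
 proof -
  have "ennreal (1 / tot nH) * ennreal (1 / b) = ennreal (1 / (b * tot nH))"
   using t b_pos by (simp add: ennreal_mult[symmetric] mult_ac)
  then show ?thesis by (simp only: mult.assoc[symmetric])
 qed
 also have "(nint LB (%x. K x)) = (nint muH (%p. K1 p))" unfolding K_def by (rule nn_muH[symmetric]) measurable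
 also have "... = (nint kapH (%e. g e))"
  unfolding nn_kapH[OF g] by (intro nn_integral_cong) (simp add: K1_def st_def nn_KH)
 finally show ?thesis unfolding g_def .
qed

lemma sfin_kapH:
 assumes t: "0 < tot nH" shows "sigma_finite_measure kapH"
proof -
 \<comment> \<open>The mass of \<open>nH\<close> in \<open>ennreal\<close> is seen to be finite by
   applying the sampling formula to the constant 1.\<close>
 have "(nint intM (%s. ennreal (nH s))) ~= \<top>"
 proof
  assume top: "(nint intM (%s. ennreal (nH s))) = \<top>"
  have "1 = (nint unifM (%v. 1))" by (simp add: prob_space.emeasure_space_1[OF prob_unifM])
  also have "... = (nint intM (%s. ennreal (nH s / tot nH) * 1))" by (rule nn_integral_sample_Z[OF nH0 nHs t])
  also have "... = (nint intM (%s. ennreal (1 / tot nH) * ennreal (nH s)))"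
   using t nH0 by (intro nn_integral_cong) (simp add: ennreal_mult[symmetric])
  also have "... = ennreal (1 / tot nH) * \<top>" by (simp add: nn_integral_cmult top)
  also have "... = \<top>" using t by (simp add: ennreal_mult_eq_top_iff)
  finally show False by simp
 qed
 then have "emeasure nuHM (space nuHM) ~= \<top>" by (simp add: nuHM_def emeasure_density)
 moreover have "emeasure LB (space LB) ~= \<top>" using b_pos by (simp add: LB_def emeasure_density)
 moreover have "emeasure kapH (space kapH) = emeasure LB (space LB) * emeasure nuHM (space nuHM)"
 proof -
  have "emeasure kapH (space kapH) = (nint kapH (%e. 1))" by simp
  also have "... = (nint muH (%p. 1))"
  proof (subst nn_kapH)
   have "(nint (KH l) (%e. 1)) = 1" for l
   proof -
    have "prob_space (KH l)" unfolding KH_def by (intro prob_space.prob_space_distr prob_unifM) measurable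
    from prob_space.emeasure_space_1[OF this] show ?thesis by (simp only: nn_integral_const mult_1_left)
   qed
   then show "(nint muH (%p. nint (KH (st p)) (%e. 1))) = (nint muH (%p. 1))" by (simp only:)
  qed measurable
  also have "... = (nint LB (%y. nint nuHM (%s. 1)))" by (rule nn_muH) measurable
  finally show ?thesis by (simp add: mult.commute)
 qed
 ultimately have "finite_measure kapH" by (intro finite_measureI) (simp add: ennreal_mult_eq_top_iff)
 then show ?thesis by (rule finite_measure.axioms(1))
qed

text \<open>Clocks and points have positive abscissae almost surely, so at abscissa 0 the
  restriction in \<open>Full\<close> is void.\<close>

lemma Tri_Full_0: "Tri L F = Full 0 L F"
 unfolding Full_def Tri_def
proof (rule mX.mint_cong_AE[where \<rho>="%e. 0 < fst e"])
 have LA: "AE x in LA. 0 < x" using AE_LA by eventually_elim auto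
 show "AE e in muX. 0 < fst e" by (rule AE_fst[OF sfin(5) LA])
 fix cx assume cx: "list_all (%e. 0 < fst e) (cx :: (real \<times> int) list)"
 show "mint mu0 (%c0. lint KH L (%hs. F hs cx c0)) = mint mu0 (%c0. lint KH L (%hs. if all_gt 0 hs cx c0 then F hs cx c0 else 0))"
 proof (rule m0.mint_cong_AE[where \<rho>="%e. 0 < fst e"])
  show "AE e in mu0. 0 < fst e" by (rule AE_fst[OF psB0.sigma_finite_measure_axioms LA])
  fix c0 assume c0: "list_all (%e. 0 < fst e) (c0 :: (real \<times> real \<times> int) list)"
  show "lint KH L (%hs. F hs cx c0) = lint KH L (%hs. if all_gt 0 hs cx c0 then F hs cx c0 else 0)"
  proof (rule lint_cong_AE[where \<rho>="%l e. 0 < clk e"])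
   fix l :: "real \<times> int \<times> real"
   let ?r = "rH P (fst (snd l))"
   have "AE u in unifM. 0 < clock_after 0 ?r u a"
    using AE_unifM clock_AE_neq[where x=0 and t=0 and c=a, OF rH0[of "fst (snd l)"] less_imp_le[OF a_pos]]
   proof eventually_elim
    case (elim u)
    have "0 \<le> clock_after 0 ?r u a"
     using elim a_pos rH0[of "fst (snd l)"] by (auto simp: clock_after_def divide_nonpos_pos)
    then show ?case using elim by simp
   qed
   moreover have 1: "(%u. (fst l, fst (snd l), snd (snd l), clock_after 0 ?r u a)) \<in> unifM \<rightarrow>\<^sub>M hsE"
    by measurable
   moreover have "Measurable.pred hsE (%e. 0 < clk e)" by measurable
   then have 2: "{e \<in> space hsE. 0 < clk e} \<in> sets hsE" by (rule predE)
   ultimately show "AE e in KH l. 0 < clk e" unfolding KH_def AE_distr_iff[OF 1 2] by simp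
  next
   fix hs assume "list_all2 (%l e. 0 < clk e) L hs"
   then have "all_gt 0 hs cx c0"
    using cx c0 unfolding all_gt_def by (auto simp: list_all_iff list_all2_conv_all_nth all_set_conv_all_nth)
   then show "F hs cx c0 = (if all_gt 0 hs cx c0 then F hs cx c0 else 0)" by simp
  qed
 qed
qed

text \<open>The counterpart of \<open>kapH\<close> on the side of the chain: a line on the left side
  with a label, weighted by its start, in place of a line with a clock.\<close>

definition kapL :: "(real \<times> int \<times> nat) measure" where "kapL = density lc.lineM (%z. wL W (fst z) (snd z))"

lemma wL_meas [measurable]: "(%z. wL W (fst z) (snd z)) \<in> borel_measurable (borel >< markM)"
 using lc.wts_measD(1)[OF W_meas] by (simp add: split_beta')

lemma nn_kapL:
 assumes f: "f \<in> borel_measurable (borel >< markM)"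
 shows "(nint kapL (%e. f e)) = (nint muH (%p. nint (KL (st p)) (%e. f e)))"
proof -
 interpret N: sigma_finite_measure natM by (rule sigma_finite_measure_count_space)
 note m1 = borel_measurable_times_ennreal[OF wL_meas f]
 have fm: "(%w. f (y w, s w, j w)) \<in> borel_measurable M" if "y \<in> borel_measurable M" "s \<in> M \<rightarrow>\<^sub>M intM" "j \<in> M \<rightarrow>\<^sub>M natM" for y s j and M :: "'z measure"
  by (rule measurable_compose[OF _ f]) (use that in \<open>intro measurable_Pair measurable_mark_Pair\<close>)
 have m2: "(%p. nint natM (%j. al j 0 (fst p) (snd p) * f (fst p, snd p, j))) \<in> borel_measurable cxE"
 proof (rule N.borel_measurable_nn_integral)
  show "(%(p, j). al j 0 (fst p) (snd p) * f (fst p, snd p, j)) \<in> borel_measurable (cxE >< natM)"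
   unfolding split_beta' by (intro borel_measurable_times_ennreal fm) measurable
 qed
 have "(nint kapL (%e. f e)) = (nint lc.lineM (%z. wL W (fst z) (snd z) * f z))"
  unfolding kapL_def using wL_meas f by (intro nn_integral_density) (simp_all cong: measurable_cong_sets)
 also have "... = (nint LB (%y. nint mkH (%m. wL W y m * f (y, m))))"
  using lc.nn_integral_lineM[OF m1] by simp
 also have "... = (nint LB (%y. nint nuHM (%s. nint natM (%j. al j 0 y s * f (y, s, j)))))"
  unfolding nn_mkH nuHM_def by (simp add: W_def nn_integral_density nn_integral_cmult)
 also have "... = (nint muH (%p. nint natM (%j. al j 0 (fst p) (snd p) * f (fst p, snd p, j))))"
  using nn_muH[OF m2] by simp
 finally show ?thesis by (simp add: st_def nn_KL f)
qed

text \<open>The three initial lists are Poisson, so their constants \<open>exp (- mass)\<close> come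
  out. The rest is \<open>Full 0\<close> averaged over heights and intensities of the starting
  lines; \<open>Full_VS\<close> replaces the clocks of these lines by labels, which yields the
  chain.\<close>

lemma initial_law:
 assumes t: "0 < tot nV" "0 < tot nH"
 shows "(nint seqM (%\<omega>. fst (RR n) (LH (ustr \<omega> 1)) (LX (ustr \<omega> 0)) (L0 (ustr \<omega> 2)) (ustr \<omega> 3))) =
  ennreal (exp (- (b * tot nH))) * (ennreal (exp (- (a * tot nV))) * (ennreal (exp (- (a * b * pk_p0 P * hfun P 0))) *
   mint lc.lineM (%\<eta>. lc.lprod (wL W) \<eta> * gS n 0 \<eta>)))"
proof -
 note [measurable (raw)] = measRS_raw[OF RR_meas(1)]
 let ?cH = "ennreal (exp (- (b * tot nH)))" and ?cX = "ennreal (exp (- (a * tot nV)))" and ?c0 = "ennreal (exp (- (a * b * pk_p0 P * hfun P 0)))"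
 have kap: "mint_space hsE kapH"
  by (intro mint_space.intro mint_space_axioms.intro hsL.list_space_axioms sets_kapH sfin_kapH t)
 interpret mH: mint_space hsE kapH by (rule kap)
 have i0: "(nint seqM (%d. F (L0 d))) = ?c0 * mint mu0 F" if F: "F \<in> borel_measurable (listM c0E)" for F
 \<comment> \<open>With intensity zero the simulated list is empty almost surely, and
   \<open>mu0\<close> is the null measure, so \<open>mint mu0\<close> sees the empty list
   alone.\<close>
 proof (cases "pk_p0 P * hfun P 0 = 0")
  case False
  then have p: "0 < hfun P 0" "0 < pk_p0 P" using p0 hfun_nonneg[of 0] by (auto simp: less_le)
  show ?thesis unfolding L0_def by (rule m0.poisson_list_law[OF h_meas(2) _ item_0[OF p] F]) (use p a_pos b_pos in simp)
 next
  case True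
  have z: "a * b * pk_p0 P * hfun P 0 = 0" using True by simp
  have "(nint seqM (%d. F (L0 d))) = (nint unifM (%u. nint seqM (%\<delta>. F (stream_list h0 3 \<delta> (poisson_sample 0 u)))))"
  proof -
   have "(%(u, \<delta>). F (stream_list h0 3 \<delta> (poisson_sample 0 u))) \<in> borel_measurable (borel >< seqM)"
   proof -
    have "(%\<delta>. stream_list h0 3 \<delta> N) \<in> seqM \<rightarrow>\<^sub>M listM c0E" for N
     unfolding stream_list_def by (intro c0L.measurable_list_map measurable_compose[OF _ h_meas(2)]) measurable
    from measurable_compose[OF measurable_compose[OF measurable_snd this] F]
    show ?thesis unfolding split_beta' by (rule measurable_compose_countable[where f="%N w. F (stream_list h0 3 (snd w) N)"]) measurable
   qed
   from seq_split_shc1[OF this] show ?thesis unfolding L0_def z .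
  qed
  also have "... = (\<Sum>n. ennreal (exp (- 0) * 0 ^ n / fact n) * (nint seqM (%\<delta>. F (stream_list h0 3 \<delta> n))))"
   by (rule nn_integral_poisson) simp
  also have "... = F []" by (subst suminf_finite[of "{0}"]) (auto simp: stream_list_simps prob_space.emeasure_space_1[OF prob_seqM])
  also have "F [] = mint mu0 (%es. if es = [] then F [] else 0)" by (rule mint_empty[symmetric])
  also have "... = mint mu0 F"
  proof (rule m0.mint_cong_AE[where \<rho>="%_. False"])
   show "(if es = [] then F [] else 0) = F es" if "list_all (%_. False) es" for es using that by (cases es) auto
   have "ennreal (pk_p0 P * nV (- s) * nH s) = 0" for s
   proof (cases "pk_p0 P = 0")
    case False
    then have "hfun P 0 = 0" using True by simp
    then have "nV (- s) * nH s = 0" using fker_le_hfun[of 0 s] fker_nonneg[of 0 s] by (simp add: fker_def)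
    then show ?thesis by auto
   qed simp
   then have "AE s in nu0M. False" unfolding nu0M_def by (subst AE_density) (auto simp: AE_count_space)
   then have "AE e in LB >< nu0M. False" using AE_snd[OF sfin(6), of "%_. False" LB] by simp
   then show "AE e in mu0. False" using AE_snd[OF psB0.sigma_finite_measure_axioms, of "%_. False" LA] by simp
  qed
  finally show ?thesis unfolding z by simp
 qed
 have iX: "(nint seqM (%d. F (LX d))) = ?cX * mint muX F" if F: "F \<in> borel_measurable (listM cxE)" for F
  unfolding LX_def by (rule mX.poisson_list_law[OF h_meas(1) _ item_X[OF t(1)] F]) (use t a_pos in simp)
 have iH: "(nint seqM (%d. F (LH d))) = ?cH * mint kapH F" if F: "F \<in> borel_measurable (listM hsE)" for F
  unfolding LH_def by (rule mH.poisson_list_law[OF h_meas(3) _ item_H[OF t(2)] F]) (use t b_pos in simp)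
 define Fh where "Fh hs = mint muX (%cx. mint mu0 (%c0. VS n hs cx c0))" for hs
 have Fhm [measurable]: "Fh \<in> borel_measurable (listM hsE)" unfolding Fh_def by measurable
 have "(%(d0, d1, d2, d3). fst (RR n) (LH d1) (LX d0) (L0 d2) d3) \<in> borel_measurable (seqM >< seqM >< seqM >< seqM)"
  by measurable
 from streams_law[OF this]
 have "(nint seqM (%\<omega>. fst (RR n) (LH (ustr \<omega> 1)) (LX (ustr \<omega> 0)) (L0 (ustr \<omega> 2)) (ustr \<omega> 3)))
  = (nint seqM (%d1. nint seqM (%d0. nint seqM (%d2. VS n (LH d1) (LX d0) (L0 d2)))))"
  unfolding VS_def .
 also have "... = (nint seqM (%d1. nint seqM (%d0. ?c0 * mint mu0 (%c0. VS n (LH d1) (LX d0) c0))))"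
  by (intro nn_integral_cong i0) measurable
 also have "... = (nint seqM (%d1. ?c0 * (?cX * Fh (LH d1))))"
 proof (rule nn_integral_cong)
  fix d1
  have "(nint seqM (%d0. ?c0 * mint mu0 (%c0. VS n (LH d1) (LX d0) c0))) = ?c0 * (nint seqM (%d0. mint mu0 (%c0. VS n (LH d1) (LX d0) c0)))"
   by (rule nn_integral_cmult) measurable
  also have "(nint seqM (%d0. mint mu0 (%c0. VS n (LH d1) (LX d0) c0))) = ?cX * Fh (LH d1)"
   unfolding Fh_def by (rule iX[of "%cx. mint mu0 (%c0. VS n (LH d1) cx c0)"]) measurable
  finally show "(nint seqM (%d0. ?c0 * mint mu0 (%c0. VS n (LH d1) (LX d0) c0))) = ?c0 * (?cX * Fh (LH d1))" .
 qed
 also have "... = ?c0 * ?cX * (nint seqM (%d1. Fh (LH d1)))"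
  unfolding mult.assoc[symmetric] by (rule nn_integral_cmult) measurable
 also have "... = ?cH * (?cX * (?c0 * mint kapH Fh))"
  unfolding iH[OF Fhm] by (simp only: mult_ac)
 also have "mint kapH Fh = mint lc.lineM (%\<eta>. lc.lprod (wL W) \<eta> * gS n 0 \<eta>)"
  unfolding mint_def
 proof (intro suminf_cong arg_cong2[of _ _ _ _ "(*)"] refl)
  fix N
  have g0: "gS n 0 \<in> borel_measurable (listM (borel >< markM))" by measurable
  have "lint (%_. kapH) (replicate N ()) Fh = lint (%_. muH) (replicate N ()) (%ps. lint KH (map st ps) Fh)"
  proof (rule kH.lint_average[OF sfin_muH nn_kapH _ Fhm])
   fix G :: "(real \<times> int \<times> real \<times> real) list => real \<times> int \<times> real \<times> real => ennreal"
   assume G: "(%(es, e). G es e) \<in> borel_measurable (listM hsE >< hsE)"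
   note [measurable (raw)] = meas2[OF G]
   have "(nint (KH (st p)) (%e. G es e)) = (nint unifM (%u. G es (fst p, snd p, 0, clock_after 0 (rH P (snd p)) u a)))" for p es
    unfolding st_def by (rule nn_KH) measurable
   then show "(%(p, es). nint (KH (st p)) (%e. G es e)) \<in> borel_measurable (muH >< listM hsE)"
    by simp measurable
  qed
  also have "... = lint (%_. muH) (replicate N ()) (%ps. Tri (map st ps) (VS n))"
  proof -
   have "lint KH L Fh = Tri L (VS n)" for L
   proof -
    have "lint KH L Fh = mint muX (%cx. lint KH L (%hs. mint mu0 (%c0. VS n hs cx c0)))"
     unfolding Fh_def by (rule kH.lint_mint_swap[OF mX.mint_space_axioms]) measurable
    also have "... = mint muX (%cx. mint mu0 (%c0. lint KH L (%hs. VS n hs cx c0)))"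
     by (intro arg_cong[of _ _ "mint muX"] ext, rule kH.lint_mint_swap[OF m0.mint_space_axioms]) measurable
    finally show ?thesis unfolding Tri_def .
   qed
   then show ?thesis by simp
  qed
  \<comment> \<open>Almost every starting configuration is in general position, as
    \<open>Full_VS\<close> asks.\<close>
  also have "... = lint (%_. muH) (replicate N ()) (%ps. SL (map st ps) (gS n 0))"
  proof (rule lint_cong_distinct[where A="{}" and \<rho>="%e. 0 < fst e & fst e < b & 0 < nH (snd e)"])
   fix A :: "real set" assume A: "finite A"
   have "AE e in muH. fst e \<notin> A & 0 < fst e & fst e < b"
    unfolding muH_def by (rule AE_fst[OF sfin_nuHM]) (use AE_LB_notin[OF A] AE_LB in eventually_elim, auto)
   moreover have "AE e in muH. 0 < nH (snd e)"
   proof -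
    have "AE s in nuHM. 0 < nH s" unfolding nuHM_def by (subst AE_density) (auto simp: AE_count_space)
    from AE_snd[OF sfin_nuHM this, of LB] show ?thesis by (simp only: muH_def)
   qed
   ultimately show "AE e in muH. fst e \<notin> A & 0 < fst e & fst e < b & 0 < nH (snd e)" by eventually_elim auto
  next
   fix ps :: "(real \<times> int) list"
   assume d: "distinct (map fst ps)" and r: "list_all (%e. 0 < fst e & fst e < b & 0 < nH (snd e)) ps"
   have "gen 0 (map st ps)" using d r by (auto simp: gen_def st_def list_all_iff comp_def)
   then show "Tri (map st ps) (VS n) = SL (map st ps) (gS n 0)"
    unfolding Tri_Full_0 using Full_VS[of 0 "map st ps" n] a_pos by (simp add: EE_def)
  qed simp
  also have "... = lint (%_. kapL) (replicate N ()) (gS n 0)"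
  proof (rule kL.lint_average[OF sfin_muH nn_kapL _ g0, symmetric])
   fix G :: "(real \<times> int \<times> nat) list => real \<times> int \<times> nat => ennreal"
   assume G: "(%(es, e). G es e) \<in> borel_measurable (listM (borel >< markM) >< (borel >< markM))"
   note [measurable (raw)] = meas2[OF G]
   interpret N: sigma_finite_measure natM by (rule sigma_finite_measure_count_space)
   have "(nint (KL (st p)) (%e. G es e)) = (nint natM (%j. al j 0 (fst p) (snd p) * G es (fst p, snd p, j)))" for p es
    unfolding st_def by (rule nn_KL) measurable
   then show "(%(p, es). nint (KL (st p)) (%e. G es e)) \<in> borel_measurable (muH >< listM (borel >< markM))"
    by simp measurable
  qed
  also have "... = lint (%_. lc.lineM) (replicate N ()) (%\<eta>. lc.lprod (wL W) \<eta> * gS n 0 \<eta>)"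
   unfolding kapL_def by (rule lc.lint_density[OF _ g0]) measurable
  finally show "lint (%_. kapH) (replicate N ()) Fh = lint (%_. lc.lineM) (replicate N ()) (%\<eta>. lc.lprod (wL W) \<eta> * gS n 0 \<eta>)" .
 qed
 finally show ?thesis .
qed

end

section \<open>Segment configurations and the conclusion\<close>

text \<open>This is the interface to \<open>pks_dist\<close>: countably many labels, jointly
  measurable finite factors, one for each end of a segment, both allowed to depend on the
  intensity.\<close>

definition dec :: "seg set => (nat => real => real => int => ennreal) => (nat => real => real => int => ennreal) => bool" where
 "dec B al be \<longleftrightarrow>
   (%(l, x, y, s). al l x y s) \<in> borel_measurable (count_space UNIV >< borel >< borel >< count_space UNIV) &
   (%(l, x, y, s). be l x y s) \<in> borel_measurable (count_space UNIV >< borel >< borel >< count_space UNIV) &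
   (\<forall>l x y s. al l x y s ~= \<top>) & (\<forall>l x y s. be l x y s ~= \<top>) &
   (\<forall>x0 y0 x1 y1 s. indicator (- B) ((x0, y0), (x1, y1), s) = (nint (count_space UNIV) (%l. al l x0 y0 s * be l x1 y1 s)))"

definition avoid :: "seg set => seg set set" where
 "avoid B = {F. finite F & F \<inter> B = {}}"

lemma borel_seg_sets: "X \<in> sets ((borel >< borel) >< ((borel >< borel) >< count_space UNIV)) ==> X \<in> sets (borel :: seg measure)"
proof -
 assume X: "X \<in> sets ((borel >< borel) >< ((borel >< borel) >< count_space UNIV) :: seg measure)"
 have 1: "(%e. snd (snd e)) \<in> (borel :: seg measure) \<rightarrow>\<^sub>M count_space UNIV"
 proof (subst measurable_count_space_eq2_countable, intro conjI ballI)
  fix k :: int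
  have "continuous_on UNIV (%e :: seg. snd (snd e))" by (intro continuous_intros)
  then have "open ((%e :: seg. snd (snd e)) -` {k})" by (intro open_vimage Topological_Spaces.open_discrete)
  then show "(%e. snd (snd e)) -` {k} \<inter> space (borel :: seg measure) \<in> sets borel" by simp
 qed auto
 have 2: "(%e. fst e) \<in> (borel :: seg measure) \<rightarrow>\<^sub>M borel >< borel" "(%e. fst (snd e)) \<in> (borel :: seg measure) \<rightarrow>\<^sub>M borel >< borel"
  unfolding borel_prod by (intro borel_measurable_continuous_onI continuous_intros)+
 have "(%e. (fst e, fst (snd e), snd (snd e))) \<in> (borel :: seg measure) \<rightarrow>\<^sub>M (borel >< borel) >< ((borel >< borel) >< count_space UNIV)"
  using 1 2 by (intro measurable_Pair)
 from measurable_sets[OF this X] show ?thesis by (simp add: vimage_def)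
qed

lemma dec_meas:
 assumes "dec B al be" shows "B \<in> sets borel"
proof -
 let ?M = "(borel >< borel) >< ((borel >< borel) >< count_space UNIV) :: seg measure"
 have al: "(%(l, x, y, s). al l x y s) \<in> borel_measurable (count_space UNIV >< borel >< borel >< count_space UNIV)"
  and be: "(%(l, x, y, s). be l x y s) \<in> borel_measurable (count_space UNIV >< borel >< borel >< count_space UNIV)"
  using assms by (auto simp: dec_def)
 have 1: "(%e. al (fst w) (fst (fst e)) (snd (fst e)) (snd (snd e))) \<in> borel_measurable ?M" for w :: "nat \<times> nat"
  using measurable_compose[OF _ al, of "%e. (fst w, fst (fst e), snd (fst e), snd (snd e))" ?M] by simp
 have 2: "(%e. be (fst w) (fst (fst (snd e))) (snd (fst (snd e))) (snd (snd e))) \<in> borel_measurable ?M" for w :: "nat \<times> nat"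
  using measurable_compose[OF _ be, of "%e. (fst w, fst (fst (snd e)), snd (fst (snd e)), snd (snd e))" ?M] by simp
 have "(%e. \<Sum>l. al l (fst (fst e)) (snd (fst e)) (snd (snd e)) * be l (fst (fst (snd e))) (snd (fst (snd e))) (snd (snd e))) \<in> borel_measurable ?M"
 proof (intro borel_measurable_suminf_order borel_measurable_times_ennreal)
  fix l
  show "(%e. al l (fst (fst e)) (snd (fst e)) (snd (snd e))) \<in> borel_measurable ?M"
   "(%e. be l (fst (fst (snd e))) (snd (fst (snd e))) (snd (snd e))) \<in> borel_measurable ?M"
   using 1[of "(l, 0)"] 2[of "(l, 0)"] by simp_all
 qed
 also have "(%e. \<Sum>l. al l (fst (fst e)) (snd (fst e)) (snd (snd e)) * be l (fst (fst (snd e))) (snd (fst (snd e))) (snd (snd e))) = (indicator (- B) :: seg => ennreal)"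
 proof
  fix e :: seg
  obtain x0 y0 x1 y1 s where e: "e = ((x0, y0), (x1, y1), s)" by (metis prod.collapse)
  show "(\<Sum>l. al l (fst (fst e)) (snd (fst e)) (snd (snd e)) * be l (fst (fst (snd e))) (snd (fst (snd e))) (snd (snd e))) = indicator (- B) e"
   using assms by (simp add: e dec_def nn_integral_count_space_nat)
 qed
 finally have m: "(indicator (- B) :: seg => ennreal) \<in> borel_measurable ?M" .
 have "- B = (indicator (- B) :: seg => ennreal) -` {1} \<inter> space ?M" by (auto simp: indicator_def space_pair_measure)
 also have "... \<in> sets ?M" by (rule measurable_sets[OF m]) simp
 finally have "- B \<in> sets (borel :: seg measure)" by (rule borel_seg_sets)
 then have "- (- B) \<in> sets (borel :: seg measure)" by (rule borel_comp)
 then show ?thesis by simp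
qed

text \<open>The indicator of the complement of a union is a product of indicators; the labels of its
  product form are pairs, encoded by \<open>prod_decode\<close>. This gives the avoidance events
  their stability under intersection.\<close>

lemma dec_Un:
 assumes "dec B al be" "dec C al' be'"
 shows "dec (B \<union> C) (%l x y s. al (fst (prod_decode l)) x y s * al' (snd (prod_decode l)) x y s)
   (%l x y s. be (fst (prod_decode l)) x y s * be' (snd (prod_decode l)) x y s)"
proof -
 let ?M = "count_space UNIV >< borel >< borel >< count_space UNIV :: (nat \<times> real \<times> real \<times> int) measure"
 have m: "(%(l, x, y, s). f (g l) x y s) \<in> borel_measurable ?M"
  if "(%(l, x, y, s). f l x y s) \<in> borel_measurable ?M" for f :: "nat => real => real => int => ennreal" and g :: "nat => nat"
 proof -
  have "(%w. g (fst w)) \<in> ?M \<rightarrow>\<^sub>M count_space UNIV" by (rule measurable_compose[OF measurable_fst]) simp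
  then have "(%w. (g (fst w), snd w)) \<in> ?M \<rightarrow>\<^sub>M ?M" by measurable
  from measurable_compose[OF this that] show ?thesis by (simp add: split_beta')
 qed
 have m2: "(%(l, x, y, s). f (g l) x y s * f' (g' l) x y s) \<in> borel_measurable ?M"
  if "(%(l, x, y, s). f l x y s) \<in> borel_measurable ?M" "(%(l, x, y, s). f' l x y s) \<in> borel_measurable ?M"
  for f f' :: "nat => real => real => int => ennreal" and g g' :: "nat => nat"
  using borel_measurable_times_ennreal[OF m[OF that(1), of g] m[OF that(2), of g']] by (simp add: split_beta')
 have i: "indicator (- (B \<union> C)) e = (indicator (- B) e * indicator (- C) e :: ennreal)" for e :: seg
  by (simp add: indicator_def)
 have s: "(nint (count_space UNIV) (%l. f (fst (prod_decode l)) * f' (snd (prod_decode l)))) = (nint (count_space UNIV) (%l. f l)) * (nint (count_space UNIV) (%l. f' l))"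
  for f f' :: "nat => ennreal"
 proof -
  have "(nint (count_space UNIV) (%l. f (fst (prod_decode l)) * f' (snd (prod_decode l)))) = (nint (count_space UNIV) (%p. f (fst p) * f' (snd p)))"
   by (rule nn_integral_bij_count_space) (rule bij_prod_decode)
  also have "... = (nint (count_space UNIV) (%l. nint (count_space UNIV) (%l'. f l * f' l')))"
   by (subst nn_integral_fst_count_space[symmetric]) simp
  finally show ?thesis by (simp add: nn_integral_cmult nn_integral_multc)
 qed
 have e: "indicator (- (B \<union> C)) ((x0, y0), (x1, y1), s) = (nint (count_space UNIV) (%l. al (fst (prod_decode l)) x0 y0 s * al' (snd (prod_decode l)) x0 y0 s *
   (be (fst (prod_decode l)) x1 y1 s * be' (snd (prod_decode l)) x1 y1 s)))" for x0 y0 x1 y1 s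
 proof -
  have "indicator (- (B \<union> C)) ((x0, y0), (x1, y1), s) = (nint (count_space UNIV) (%l. al l x0 y0 s * be l x1 y1 s)) * (nint (count_space UNIV) (%l. al' l x0 y0 s * be' l x1 y1 s))"
   using assms unfolding i dec_def by metis
  also have "... = (nint (count_space UNIV) (%l. (al (fst (prod_decode l)) x0 y0 s * be (fst (prod_decode l)) x1 y1 s) * (al' (snd (prod_decode l)) x0 y0 s * be' (snd (prod_decode l)) x1 y1 s)))"
   by (rule s[of "%l. al l x0 y0 s * be l x1 y1 s" "%l. al' l x0 y0 s * be' l x1 y1 s", symmetric])
  finally show ?thesis by (simp only: mult_ac)
 qed
 have f: "x * y ~= \<top>" if "x ~= \<top>" "y ~= \<top>" for x y :: ennreal using that by (simp add: ennreal_mult_eq_top_iff)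
 show ?thesis unfolding dec_def
 proof (intro conjI allI m2 e f)
 qed (use assms in \<open>simp_all add: dec_def\<close>)
qed

text \<open>Three labels suffice. The complement of \<open>A \<times> C \<times> S\<close> splits
  disjointly: first end outside \<open>A\<close>; first end in \<open>A\<close>, second outside
  \<open>C\<close>; both ends inside and the intensity outside \<open>S\<close>.\<close>

lemma dec_rect:
 assumes "A \<in> sets borel" "C \<in> sets borel"
 shows "\<exists>al be. dec (A \<times> C \<times> S) al be"
proof -
 define al :: "nat => real => real => int => ennreal" where
  "al l x y s = (if l = 0 then indicator (- A) (x, y) else if l = 1 then indicator A (x, y) else if l = 2 then indicator A (x, y) else 0)" for l x y s
 define be :: "nat => real => real => int => ennreal" where
  "be l x y s = (if l = 0 then 1 else if l = 1 then indicator (- C) (x, y) else if l = 2 then indicator C (x, y) * indicator (- S) s else 0)" for l x y s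
 let ?M = "count_space UNIV >< borel >< borel >< count_space UNIV :: (nat \<times> real \<times> real \<times> int) measure"
 have p: "(%w. (fst (snd w), fst (snd (snd w)))) \<in> ?M \<rightarrow>\<^sub>M borel" unfolding borel_prod[symmetric] by measurable
 have i: "(%w. indicator D (fst (snd w), fst (snd (snd w))) :: ennreal) \<in> borel_measurable ?M" if "D \<in> sets borel" for D :: "(real \<times> real) set"
  by (rule measurable_compose[OF p]) (use that in simp)
 have S: "(%w. indicator (- S) (snd (snd (snd w))) :: ennreal) \<in> borel_measurable ?M"
  by (rule measurable_compose[where N="count_space UNIV"]) simp_all
 have l: "Measurable.pred ?M (%w. fst w = k)" for k by (rule measurable_compose[OF measurable_fst]) simp
 note [measurable] = i[OF assms(1)] i[OF assms(2)] i[OF borel_comp[OF assms(1)]] i[OF borel_comp[OF assms(2)]] S l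
 have "dec (A \<times> C \<times> S) al be"
  unfolding dec_def
 proof (intro conjI allI)
  show "(%(l, x, y, s). al l x y s) \<in> borel_measurable ?M" "(%(l, x, y, s). be l x y s) \<in> borel_measurable ?M"
   unfolding al_def be_def split_beta' by measurable
  show "al l x y s ~= \<top>" "be l x y s ~= \<top>" for l x y s by (auto simp: al_def be_def indicator_def)
  fix x0 y0 x1 y1 s
  have "(nint (count_space UNIV) (%l. al l x0 y0 s * be l x1 y1 s)) = (\<Sum>l\<in>{0, 1, 2}. al l x0 y0 s * be l x1 y1 s)"
   by (rule nn_integral_count_space') (auto simp: al_def)
  also have "... = indicator (- (A \<times> C \<times> S)) ((x0, y0), (x1, y1), s)"
   by (auto simp: al_def be_def indicator_def)
  finally show "indicator (- (A \<times> C \<times> S)) ((x0, y0), (x1, y1), s) = (nint (count_space UNIV) (%l. al l x0 y0 s * be l x1 y1 s))" ..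
 qed
 then show ?thesis by blast
qed

definition decs :: "seg set set" where "decs = {B. \<exists>al be. dec B al be}"

definition avoidM :: "seg set measure" where "avoidM = sigma (Collect finite) (avoid ` decs)"

lemma space_avoidM: "space avoidM = Collect finite" and sets_avoidM: "sets avoidM = sigma_sets (Collect finite) (avoid ` decs)"
 unfolding avoidM_def by (subst space_measure_of sets_measure_of; auto simp: avoid_def)+

lemma separate_points:
 assumes "finite (G :: 'a::t2_space set)"
 shows "\<exists>N. (\<forall>p. open (N p) & p \<in> N p) & (\<forall>p\<in>G. \<forall>q\<in>G. p ~= q --> N p \<inter> N q = {})"
proof -
 have "\<forall>p q. \<exists>A C. p ~= q --> open A & open C & p \<in> (A :: 'a set) & q \<in> C & A \<inter> C = {}"
  using hausdorff by metis
 then obtain A C where AC: "\<And>p q. p ~= q ==> open (A p q) & open (C p q) & p \<in> (A p q :: 'a set) & q \<in> C p q & A p q \<inter> C p q = {}"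
  by metis
 show ?thesis
 proof (intro exI[of _ "%p. \<Inter>q\<in>G - {p}. A p q \<inter> C q p"] conjI allI ballI impI)
  show "open (\<Inter>q\<in>G - {p}. A p q \<inter> C q p)" for p using assms AC by (intro open_INT ballI open_Int) auto
  show "p \<in> (\<Inter>q\<in>G - {p}. A p q \<inter> C q p)" for p
  proof (rule INT_I)
   fix q assume "q \<in> G - {p}"
   then show "p \<in> A p q \<inter> C q p" using AC[of p q] AC[of q p] by blast
  qed
  fix p q assume "p \<in> G" "q \<in> G" "p ~= q"
  then show "(\<Inter>q\<in>G - {p}. A p q \<inter> C q p) \<inter> (\<Inter>r\<in>G - {q}. A q r \<inter> C r q) = {}"
   using AC[of p q] by blast
 qed
qed

text \<open>Counting is reduced to hitting: points of a finite set can be separated by disjoint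
  basis sets, and a countable basis has only countably many finite families.\<close>

lemma card_ge_iff_separated:
 fixes F B :: "'a::t2_space set"
 assumes bas: "topological_basis CC" and F: "finite F"
 shows "k \<le> card (F \<inter> B) \<longleftrightarrow> (\<exists>E. E \<subseteq> CC & finite E & disjoint E & card E = k & (\<forall>C\<in>E. F \<inter> (B \<inter> C) ~= {}))"
proof
 assume "k \<le> card (F \<inter> B)"
 then obtain G where G: "G \<subseteq> F \<inter> B" "card G = k" "finite G" by (rule obtain_subset_with_card_n)
 from separate_points[OF G(3)] obtain N where N0: "\<forall>p. open (N p) & p \<in> N p" and N3: "\<forall>p\<in>G. \<forall>q\<in>G. p ~= q --> N p \<inter> N q = {}"
  by (elim exE conjE)
 have N: "open (N p)" "p \<in> N p" for p using N0 by simp_all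
 have "\<exists>C\<in>CC. p \<in> C & C \<subseteq> N p" for p
 proof (rule topological_basisE[OF bas N(1)[of p] N(2)[of p]])
  show "\<exists>C\<in>CC. p \<in> C & C \<subseteq> N p" if "C \<in> CC" "p \<in> C" "C \<subseteq> N p" for C using that by (intro bexI[of _ C] conjI)
 qed
 then obtain c where c: "\<And>p. c p \<in> CC" "\<And>p. p \<in> c p" "\<And>p. c p \<subseteq> N p" by metis
 have dj: "c p \<inter> c q = {}" if "p \<in> G" "q \<in> G" "p ~= q" for p q using c(3)[of p] c(3)[of q] N3 that by (metis disjoint_iff subset_iff)
 have inj: "inj_on c G"
  using dj c(2) by (intro inj_onI) (metis disjoint_iff)
 show "\<exists>E. E \<subseteq> CC & finite E & disjoint E & card E = k & (\<forall>C\<in>E. F \<inter> (B \<inter> C) ~= {})"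
 proof (intro exI[of _ "c ` G"] conjI)
  show "disjoint (c ` G)" unfolding disjoint_def using dj by blast
  show "\<forall>C\<in>c ` G. F \<inter> (B \<inter> C) ~= {}" using c(2) G(1) by blast
 qed (use c G in \<open>auto simp: card_image[OF inj]\<close>)
next
 assume "\<exists>E. E \<subseteq> CC & finite E & disjoint E & card E = k & (\<forall>C\<in>E. F \<inter> (B \<inter> C) ~= {})"
 then obtain E where E: "finite E" "disjoint E" "card E = k" "\<forall>C\<in>E. F \<inter> (B \<inter> C) ~= {}" by blast
 then have "\<forall>C\<in>E. \<exists>x. x \<in> F \<inter> (B \<inter> C)" by blast
 from bchoice[OF this] obtain p where p: "\<forall>C\<in>E. p C \<in> F \<inter> (B \<inter> C)" ..
 have "inj_on p E"
  using p E(2) by (intro inj_onI) (metis IntD2 disjointD disjoint_iff)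
 then have "card E = card (p ` E)" by (simp add: card_image)
 also have "... \<le> card (F \<inter> B)" using p F by (intro card_mono) auto
 finally show "k \<le> card (F \<inter> B)" using E(3) by simp
qed

lemma decs_rect: "A \<in> sets borel ==> C \<in> sets borel ==> A \<times> C \<times> S \<in> decs"
 using dec_rect by (auto simp: decs_def)

lemma avoid_sets: "B \<in> decs ==> avoid B \<in> sets avoidM"
 unfolding sets_avoidM by blast

definition seg_basis :: "(real \<times> real) set set => seg set set" where
 "seg_basis U = (%(A, R). A \<times> R) ` (U \<times> ((%(C, S). C \<times> S) ` (U \<times> range (%s::int. {s}))))"

lemma seg_basis: "topological_basis U ==> topological_basis (seg_basis U)" "countable U ==> countable (seg_basis U)"
 "R \<in> seg_basis U ==> \<exists>A\<in>U. \<exists>C\<in>U. \<exists>S. R = A \<times> C \<times> S"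
proof -
 have "topological_basis (range (%s::int. {s}))"
  by (rule topological_basisI) (auto intro: Topological_Spaces.open_discrete)
 then show "topological_basis U ==> topological_basis (seg_basis U)"
  unfolding seg_basis_def by (intro topological_basis_prod)
qed (auto simp: seg_basis_def)

text \<open>The intersection of the rectangle with a basis rectangle is a rectangle again, so the
  hitting events in \<open>card_ge_iff_separated\<close> are complements of avoidance events of sets
  in \<open>decs\<close>.\<close>

lemma count_rect_meas:
 fixes A C :: "(real \<times> real) set"
 assumes "open A" "open C"
 shows "(%F. card (F \<inter> (A \<times> C \<times> S))) \<in> avoidM \<rightarrow>\<^sub>M count_space UNIV"
proof -
 let ?B = "A \<times> C \<times> S"
 obtain U :: "(real \<times> real) set set" where U: "countable U" "topological_basis U" using ex_countable_basis by blast
 let ?E = "%k. {E. E \<subseteq> seg_basis U & finite E & disjoint E & card E = k}"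
 have cE: "countable (?E k)" for k
  by (rule countable_subset[OF _ countable_Collect_finite_subset[OF seg_basis(2)[OF U(1)]]]) auto
 have hit: "{F \<in> space avoidM. F \<inter> (?B \<inter> R) ~= {}} \<in> sets avoidM" if RU: "R \<in> seg_basis U" for R
 proof -
  obtain A' C' S' where R: "R = A' \<times> C' \<times> S'" "A' \<in> U" "C' \<in> U" using seg_basis(3)[OF RU] by blast
  then have "open A'" "open C'" using U(2) by (auto simp: topological_basis_open)
  then have "(A \<inter> A') \<times> (C \<inter> C') \<times> (S \<inter> S') \<in> decs" using assms by (intro decs_rect) auto
  also have "(A \<inter> A') \<times> (C \<inter> C') \<times> (S \<inter> S') = ?B \<inter> R" unfolding R by blast
  finally have "space avoidM - avoid (?B \<inter> R) \<in> sets avoidM" by (intro sets.Diff avoid_sets sets.top)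
  also have "space avoidM - avoid (?B \<inter> R) = {F \<in> space avoidM. F \<inter> (?B \<inter> R) ~= {}}" by (auto simp: space_avoidM avoid_def)
  finally show ?thesis .
 qed
 have ge: "{F \<in> space avoidM. k \<le> card (F \<inter> ?B)} \<in> sets avoidM" for k
 proof -
  have "{F \<in> space avoidM. k \<le> card (F \<inter> ?B)} = (\<Union>E\<in>?E k. {F \<in> space avoidM. \<forall>R\<in>E. F \<inter> (?B \<inter> R) ~= {}})"
  proof (rule set_eqI)
   fix F
   show "F \<in> {F \<in> space avoidM. k \<le> card (F \<inter> ?B)} \<longleftrightarrow> F \<in> (\<Union>E\<in>?E k. {F \<in> space avoidM. \<forall>R\<in>E. F \<inter> (?B \<inter> R) ~= {}})"
   proof (cases "finite F")
    case True
    note iff = card_ge_iff_separated[OF seg_basis(1)[OF U(2)] True, of k ?B]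
    show ?thesis unfolding UN_iff mem_Collect_eq iff space_avoidM Bex_def using True by (simp only: conj_assoc simp_thms)
   qed (simp add: space_avoidM)
  qed
  also have "... \<in> sets avoidM"
  proof (rule sets.countable_UN''[OF cE])
   fix E assume "E \<in> ?E k"
   then show "{F \<in> space avoidM. \<forall>R\<in>E. F \<inter> (?B \<inter> R) ~= {}} \<in> sets avoidM"
    by (intro sets.sets_Collect_finite_All hit) auto
  qed
  finally show ?thesis .
 qed
 have "(%F. card (F \<inter> ?B)) -` {k} \<inter> space avoidM \<in> sets avoidM" for k
 proof -
  have "(%F. card (F \<inter> ?B)) -` {k} \<inter> space avoidM = {F \<in> space avoidM. k \<le> card (F \<inter> ?B)} - {F \<in> space avoidM. Suc k \<le> card (F \<inter> ?B)}"
   by auto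
  then show ?thesis using ge by simp
 qed
 then show ?thesis by (subst measurable_count_space_eq2_countable) auto
qed

lemma emeasure_count_fin: "finite F ==> emeasure (count_space F) (F \<inter> B) = of_nat (card (F \<inter> B))"
 by (subst emeasure_count_space) auto

text \<open>Dynkin's argument from open rectangles to Borel sets. The count is written as
  \<open>emeasure (count_space F)\<close> to have countable additivity in \<open>B\<close> with
  values in \<open>ennreal\<close>.\<close>

lemma count_meas:
 assumes "B \<in> sets (borel :: seg measure)"
 shows "(%F. emeasure (count_space F) (F \<inter> B)) \<in> borel_measurable avoidM"
proof -
 let ?G = "{A \<times> C \<times> S | A C S. open (A :: (real \<times> real) set) & open (C :: (real \<times> real) set)} :: seg set set"
 obtain U :: "(real \<times> real) set set" where U: "countable U" "topological_basis U" using ex_countable_basis by blast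
 have rect: "(%F. emeasure (count_space F) (F \<inter> (A \<times> C \<times> S))) \<in> borel_measurable avoidM" if "open A" "open C"
  for A C :: "(real \<times> real) set" and S
 proof -
  have "(%F. of_nat (card (F \<inter> (A \<times> C \<times> S))) :: ennreal) \<in> borel_measurable avoidM"
   by (rule measurable_compose[OF count_rect_meas[OF that]]) simp
  then show ?thesis
   by (rule measurable_cong[THEN iffD1, rotated]) (simp add: space_avoidM emeasure_count_fin)
 qed
 have "(borel :: seg measure) = sigma UNIV (seg_basis U)" by (rule borel_eq_countable_basis) (use seg_basis U in blast)+
 then have "sets (borel :: seg measure) = sigma_sets UNIV (seg_basis U)"
  by (rule ssubst[where P="%M. sets M = _"]) (rule sets_measure_of, simp)
 with assms have "B \<in> sigma_sets UNIV (seg_basis U)" by (rule subst[rotated])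
 moreover have "seg_basis U \<subseteq> ?G"
 proof
  fix R assume "R \<in> seg_basis U"
  from seg_basis(3)[OF this] obtain A C S where "A \<in> U" "C \<in> U" "R = A \<times> C \<times> S" by blast
  then show "R \<in> ?G" using topological_basis_open[OF U(2)] by blast
 qed
 ultimately have mem: "B \<in> sigma_sets UNIV ?G" by (meson in_mono sigma_sets_mono')
 have "Int_stable ?G"
 proof (rule Int_stableI)
  fix X Y assume "X \<in> ?G" "Y \<in> ?G"
  then obtain A C S A' C' S' where "X = A \<times> C \<times> S" "Y = A' \<times> C' \<times> S'" "open A" "open C" "open A'" "open C'" by blast
  then show "X \<inter> Y \<in> ?G" by (intro CollectI exI[of _ "A \<inter> A'"] exI[of _ "C \<inter> C'"] exI[of _ "S \<inter> S'"]) auto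
 qed
 moreover have "?G \<subseteq> Pow UNIV" by simp
 ultimately show ?thesis
  using mem
 proof (induction rule: sigma_sets_induct_disjoint)
  case (basic A) then show ?case using rect by blast
 next
  case empty then show ?case by simp
 next
  \<comment> \<open>Counts of a finite \<open>F\<close> are finite, so the count in the complement
    is obtained by subtraction from the total count.\<close>
  case (compl A)
  have "(%F. emeasure (count_space F) (F \<inter> UNIV)) \<in> borel_measurable avoidM"
   using rect[of UNIV UNIV UNIV] by simp
  then have "(%F. emeasure (count_space F) (F \<inter> UNIV) - emeasure (count_space F) (F \<inter> A)) \<in> borel_measurable avoidM"
   using compl(2) by measurable
  then show ?case
  proof (rule measurable_cong[THEN iffD1, rotated])
   fix F assume "F \<in> space avoidM"
   then have "finite F" by (simp add: space_avoidM)
   then have "emeasure (count_space F) (F - F \<inter> A) = emeasure (count_space F) F - emeasure (count_space F) (F \<inter> A)"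
    by (intro emeasure_Diff) (auto simp: emeasure_count_fin)
   then show "emeasure (count_space F) (F \<inter> UNIV) - emeasure (count_space F) (F \<inter> A) = emeasure (count_space F) (F \<inter> (UNIV - A))"
    by (simp add: Diff_Int_distrib Diff_eq Int_commute[of F] Int_Un_distrib2)
  qed
 next
  case (union A)
  have "emeasure (count_space F) (F \<inter> (\<Union>i. A i)) = (\<Sum>i. emeasure (count_space F) (F \<inter> A i))" for F
  proof -
   have "disjoint_family (%i. F \<inter> A i)" using union(1) by (auto simp: disjoint_family_on_def)
   from suminf_emeasure[OF _ this, of "count_space F"] show ?thesis by (simp add: image_subset_iff)
  qed
  then show ?case using borel_measurable_suminf_order[OF union(3)] by simp
 qed
qed

text \<open>An avoidance event is a count equal to zero; conversely, all counts are measurable for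
  the avoidance events by \<open>count_meas\<close>.\<close>

lemma sets_seg_space: "sets pks_seg_space = sets avoidM" and space_seg_space: "space pks_seg_space = Collect finite"
proof -
 have sp: "{{F. finite F & card (F \<inter> B) = k} |B k. B \<in> sets (borel :: seg measure)} \<subseteq> Pow (Collect finite)" by auto
 show s: "space pks_seg_space = Collect finite"
  unfolding pks_seg_space_def using sp by (rule space_measure_of)
 have st: "sets pks_seg_space = sigma_sets (Collect finite) {{F. finite F & card (F \<inter> B) = k} |B k. B \<in> sets (borel :: seg measure)}"
  unfolding pks_seg_space_def using sp by (rule sets_measure_of)
 show "sets pks_seg_space = sets avoidM"
 proof
  show "sets pks_seg_space \<subseteq> sets avoidM"
   unfolding st
  proof (subst space_avoidM[symmetric], rule sets.sigma_sets_subset, rule subsetI)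
   fix X assume "X \<in> {{F. finite F & card (F \<inter> B) = k} |B k. B \<in> sets (borel :: seg measure)}"
   then obtain B k where X: "X = {F. finite F & card (F \<inter> B) = k}" and B: "B \<in> sets (borel :: seg measure)" by blast
   have "{F \<in> space avoidM. emeasure (count_space F) (F \<inter> B) = of_nat k} \<in> sets avoidM"
    using count_meas[OF B] by measurable
   also have "{F \<in> space avoidM. emeasure (count_space F) (F \<inter> B) = of_nat k} = X"
    by (auto simp: X space_avoidM emeasure_count_fin)
   finally show "X \<in> sets avoidM" .
  qed
  show "sets avoidM \<subseteq> sets pks_seg_space"
   unfolding sets_avoidM
  proof (subst s[symmetric], rule sets.sigma_sets_subset, rule subsetI)
   fix X assume "X \<in> avoid ` decs"
   then obtain B where B: "X = avoid B" "B \<in> sets (borel :: seg measure)" using dec_meas by (auto simp: decs_def)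
   have "X = {F. finite F & card (F \<inter> B) = 0}" unfolding B(1) avoid_def by auto
   then show "X \<in> sets pks_seg_space" unfolding st using B(2) by blast
  qed
 qed
qed

lemma avoid_in_seg_space: "B \<in> decs ==> avoid B \<in> sets pks_seg_space"
 by (simp add: sets_seg_space avoid_sets)

lemma measurable_seg_spaceI:
 assumes "\<And>w. w \<in> space M ==> finite (f w)" "\<And>B. B \<in> decs ==> {w \<in> space M. f w \<inter> B = {}} \<in> sets M"
 shows "f \<in> M \<rightarrow>\<^sub>M pks_seg_space"
proof -
 have "f \<in> M \<rightarrow>\<^sub>M avoidM" unfolding avoidM_def
 proof (rule measurable_measure_of)
  fix X assume "X \<in> avoid ` decs"
  then obtain B where B: "X = avoid B" "B \<in> decs" by blast
  have "f -` X \<inter> space M = {w \<in> space M. f w \<inter> B = {}}" using assms(1) by (auto simp: B avoid_def)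
  then show "f -` X \<inter> space M \<in> sets M" using assms(2)[OF B(2)] by simp
 qed (use assms(1) in \<open>auto simp: avoid_def\<close>)
 then show ?thesis using measurable_cong_sets[OF refl sets_seg_space] by blast
qed

lemma seg_space_eqI:
 assumes "prob_space M" "prob_space N" "sets M = sets pks_seg_space" "sets N = sets pks_seg_space"
  and eq: "\<And>B. B \<in> decs ==> emeasure M (avoid B) = emeasure N (avoid B)"
 shows "M = N"
proof (rule measure_eqI_generator_eq[where E="avoid ` decs" and \<Omega>="Collect finite" and A="%_. Collect finite"])
 show "Int_stable (avoid ` decs)"
 proof (rule Int_stableI)
  fix X Y assume "X \<in> avoid ` decs" "Y \<in> avoid ` decs"
  then obtain B C where B: "X = avoid B" "B \<in> decs" and C: "Y = avoid C" "C \<in> decs" by (elim imageE)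
  have "avoid B \<inter> avoid C = avoid (B \<union> C)" by (auto simp: avoid_def)
  moreover have "B \<union> C \<in> decs" using B(2) C(2) dec_Un unfolding decs_def by blast
  ultimately show "X \<inter> Y \<in> avoid ` decs" unfolding B(1) C(1) by (simp only: imageI)
 qed
 show "avoid ` decs \<subseteq> Pow (Collect finite)" by (auto simp: avoid_def)
 show "sets M = sigma_sets (Collect finite) (avoid ` decs)" "sets N = sigma_sets (Collect finite) (avoid ` decs)"
  using assms(3,4) by (simp_all add: sets_seg_space sets_avoidM)
 have "{} \<in> decs" using decs_rect[of "{}" "{}" "{}"] by simp
 moreover have "avoid {} = Collect finite" by (auto simp: avoid_def)
 ultimately show "range (%_. Collect finite) \<subseteq> avoid ` decs" by auto
 have "space M = Collect finite" using sets_eq_imp_space_eq[OF assms(3)] by (simp add: space_seg_space)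
 then show "emeasure M (Collect finite) ~= \<infinity>" using prob_space.emeasure_space_1[OF assms(1)] by simp
qed (use eq in auto)

section \<open>Rotation of the avoidance probabilities and the law\<close>

lemma (in pks_dist) fR_init:
 assumes "pks_alg_ind phi B"
 shows "fR P B (Suc n) \<omega> (pks_init P \<omega>) = fst (RR n) (LH (ustr \<omega> 1)) (LX (ustr \<omega> 0)) (L0 (ustr \<omega> 2)) (ustr \<omega> 3)"
 unfolding pks_alg_ind.fR_RR(1)[OF assms init_eq(1)] init_eq by simp

lemma measurable_ustr [measurable]: "(%\<omega>. ustr \<omega> j) \<in> seqM \<rightarrow>\<^sub>M seqM"
 unfolding ustr_def by (rule measurable_PiM_single') (auto intro: measurable_component_singleton)

lemma (in pks_dist) fR_init_meas:
 assumes "pks_alg_ind phi B"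
 shows "(%\<omega>. fR P B n \<omega> (pks_init P \<omega>)) \<in> borel_measurable seqM"
proof (cases n)
 case 0
 then show ?thesis by (simp add: init_eq)
next
 case (Suc m)
 note [measurable (raw)] = measRS_raw[OF RR_meas(1)]
 show ?thesis unfolding Suc fR_init[OF assms] by measurable
qed

text \<open>Rotation exchanges the two ends of a segment, hence \<open>al\<close> and
  \<open>be\<close>, while the rate part of \<open>W\<close> takes the same value on a vertex and on
  its reversal. This is where the special form of the rates enters.\<close>

lemma (in pks_dist) rotated_weights:
 assumes "pks_dist P phi' (%l x y s. be l (a - x) (b - y) s) (%l x y s. al l (a - x) (b - y) s)"
 shows "pks_dist.W P (%l x y s. be l (a - x) (b - y) s) (%l x y s. al l (a - x) (b - y) s) = lc.rot (adj W)"
proof -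
 interpret d2: pks_dist P phi' "%l x y s. be l (a - x) (b - y) s" "%l x y s. al l (a - x) (b - y) s" by (rule assms)
 show ?thesis
  by (intro wts.equality ext) (auto simp: d2.W_def W_def lc.rot_def adj_def mult_ac)
qed

text \<open>Both sides are the same normalising constant times a chain integral.
  \<open>chain_rotation\<close> equates the integrals, because \<open>kS\<close> and
  \<open>kV\<close> are invariant under reflection and the rotated weights belong to the exchanged
  and reflected product form.\<close>

lemma (in pks_dist) rotated_law:
 assumes d: "pks_dist P phi' (%l x y s. be l (a - x) (b - y) s) (%l x y s. al l (a - x) (b - y) s)"
  and ai: "pks_alg_ind phi B" and ai': "pks_alg_ind phi' B'" and t: "0 < tot nV" "0 < tot nH"
 shows "(nint seqM (%\<omega>. fR P B n \<omega> (pks_init P \<omega>))) = (nint seqM (%\<omega>. fR P B' n \<omega> (pks_init P \<omega>)))"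
proof (cases n)
 case 0
 then show ?thesis by (simp add: init_eq)
next
 case (Suc m)
 interpret d2: pks_dist P phi' "%l x y s. be l (a - x) (b - y) s" "%l x y s. al l (a - x) (b - y) s" by (rule d)
 have "RL (map lc.flip \<eta>) = RL \<eta>" for \<eta> by (simp add: RL_def comp_def)
 then have kS: "kS (map lc.flip \<eta>) (a - x') (a - x) = kS \<eta> x x'" for \<eta> x x' by (simp add: kS_def)
 have kV: "kV m (map lc.flip \<eta>) (b - y') (b - y) = kV m \<eta> y y'" for m \<eta> y y' by (auto simp: kV_def)
 have "mint lc.lineM (%\<eta>. lc.lprod (wL W) \<eta> * gS m 0 \<eta>) = mint lc.lineM (%\<eta>. lc.lprod (wL d2.W) \<eta> * d2.gS m 0 \<eta>)"
  unfolding gS_def d2.gS_def rotated_weights[OF d] by (rule lc.chain_rotation[of W kS kV m, OF W_meas k_meas kS kV])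
 then show ?thesis
  unfolding Suc fR_init[OF ai] d2.fR_init[OF ai'] initial_law[OF t] d2.initial_law[OF t] by simp
qed

lemma fR_run: "fR P B n \<omega> c = (if cfg_mode ((pks_step P \<omega> ^^ n) c) = Done & (\<forall>m<n. cfg_mode ((pks_step P \<omega> ^^ m) c) ~= Done)
  then av B (cfg_out ((pks_step P \<omega> ^^ n) c)) else 0)"
proof (induction n arbitrary: c)
 case (Suc n)
 have "(\<forall>m<Suc n. cfg_mode ((pks_step P \<omega> ^^ m) c) ~= Done) \<longleftrightarrow>
  cfg_mode c ~= Done & (\<forall>m<n. cfg_mode ((pks_step P \<omega> ^^ m) (pks_step P \<omega> c)) ~= Done)"
  unfolding All_less_Suc2 by (simp add: funpow_swap1)
 note e = this
 have r: "(pks_step P \<omega> ^^ Suc n) c = (pks_step P \<omega> ^^ n) (pks_step P \<omega> c)" by (simp add: funpow_swap1)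
 show ?case unfolding fR.simps Suc e r by (cases "cfg_mode c = Done") simp_all
qed simp

text \<open>Runs that end are sorted by their number of steps. A run that never ends yields the
  empty set, which avoids every \<open>B\<close>; and since every run that ends avoids
  \<open>{}\<close>, the sum for \<open>{}\<close> is the indicator of ending.\<close>

lemma box_avoid_iff:
 "indicator {\<omega>. pks_box P \<omega> \<inter> B = {}} \<omega> =
  (\<Sum>n. fR P B n \<omega> (pks_init P \<omega>)) + (1 - (\<Sum>n. fR P {} n \<omega> (pks_init P \<omega>)))"
proof (cases "\<exists>n. cfg_mode (pks_run P \<omega> n) = Done")
 case True
 define N where "N = (LEAST n. cfg_mode (pks_run P \<omega> n) = Done)"
 have N: "cfg_mode (pks_run P \<omega> N) = Done" unfolding N_def by (rule LeastI_ex[OF True])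
 have N': "cfg_mode (pks_run P \<omega> m) ~= Done" if "m < N" for m using not_less_Least that unfolding N_def by blast
 have "fR P C n \<omega> (pks_init P \<omega>) = (if n = N then av C (cfg_out (pks_run P \<omega> N)) else 0)" for C n
  unfolding fR_run pks_run_def[symmetric] using N N' by (metis linorder_neqE_nat)
 then have s: "(\<Sum>n. fR P C n \<omega> (pks_init P \<omega>)) = av C (cfg_out (pks_run P \<omega> N))" for C
  by (subst suminf_finite[of "{N}"]) auto
 have "pks_box P \<omega> = cfg_out (pks_run P \<omega> N)" using True by (simp add: pks_box_def N_def)
 then show ?thesis unfolding s by (simp add: av_def indicator_def)
next
 case False
 then have "fR P C n \<omega> (pks_init P \<omega>) = 0" for C n unfolding fR_run pks_run_def[symmetric] by simp
 moreover have "pks_box P \<omega> = {}" using False by (simp add: pks_box_def)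
 ultimately show ?thesis by simp
qed

lemma finite_emit: "finite (emitH x0 x1 y s)" "finite (emitV x y0 y1 s)"
 by (simp_all add: emitH_def emitV_def)

lemma finite_out_cases:
 "finite (cfg_out x) ==> finite (cfg_out y) ==> finite (cfg_out (if p then x else y))"
 "finite (cfg_out x) ==> (\<And>e. finite (cfg_out (f e))) ==> finite (cfg_out (case_option x f z))"
 "(\<And>u v. finite (cfg_out (g u v))) ==> finite (cfg_out (case_prod g w))"
 "finite (cfg_out x) ==> (\<And>x y s k. finite (cfg_out (h x y s k))) ==> finite (cfg_out y) ==> finite (cfg_out (case_md x h y m))"
 by (simp, cases z, simp_all, cases w, simp, cases m, simp_all)

lemma finite_out_step:
 assumes "finite (cfg_out c)" shows "finite (cfg_out (pks_step P \<omega> c))"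
 unfolding pks_step_def Let_def
 by (intro finite_out_cases) (simp_all add: finite_emit split_beta assms)

lemma finite_box: "finite (pks_box P \<omega>)"
proof -
 have "finite (cfg_out (pks_run P \<omega> n))" for n
 proof (induction n)
  case 0 show ?case by (simp add: pks_run_def pks_init_def Let_def)
 next
  case (Suc n) then show ?case by (simp add: pks_run_def finite_out_step)
 qed
 then show ?thesis by (simp add: pks_box_def)
qed

definition phiB :: "seg set => real => real => real => real => int => ennreal" where
 "phiB B x0 y0 x1 y1 s = indicator (- B) ((x0, y0), (x1, y1), s)"

lemma phiB_meas:
 assumes "dec B al be"
 shows "(%(x0, y0, x1, y1, s). phiB B x0 y0 x1 y1 s) \<in> borel_measurable (borel >< borel >< borel >< borel >< intM)"
proof -
 have al: "(%(l, x, y, s). al l x y s) \<in> borel_measurable (natM >< borel >< borel >< intM)"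
  and be: "(%(l, x, y, s). be l x y s) \<in> borel_measurable (natM >< borel >< borel >< intM)"
  and p: "phiB B x0 y0 x1 y1 s = (nint natM (%l. al l x0 y0 s * be l x1 y1 s))" for x0 y0 x1 y1 s
  using assms by (simp_all add: dec_def phiB_def)
 interpret N: sigma_finite_measure natM by (rule sigma_finite_measure_count_space)
 note [measurable (raw)] = meas4[OF al] meas4[OF be]
 show ?thesis unfolding p by measurable
qed

definition rotS :: "real => real => seg => seg" where
 "rotS a b = (%((xm, ym), (xp, yp), s). ((a - xp, b - yp), (a - xm, b - ym), s))"

lemma dec_rotS:
 assumes "dec B al be"
 shows "dec (rotS a b -` B) (%l x y s. be l (a - x) (b - y) s) (%l x y s. al l (a - x) (b - y) s)"
proof -
 have al: "(%(l, x, y, s). al l x y s) \<in> borel_measurable (natM >< borel >< borel >< intM)"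
  and be: "(%(l, x, y, s). be l x y s) \<in> borel_measurable (natM >< borel >< borel >< intM)"
  and p: "indicator (- B) ((x0, y0), (x1, y1), s) = (nint natM (%l. al l x0 y0 s * be l x1 y1 s))" for x0 y0 x1 y1 s
  using assms by (simp_all add: dec_def)
 note [measurable (raw)] = meas4[OF al] meas4[OF be]
 have i: "(indicator (- (rotS a b -` B)) ((x0, y0), (x1, y1), s) :: ennreal) = indicator (- B) ((a - x1, b - y1), (a - x0, b - y0), s)" for x0 y0 x1 y1 s
  by (simp add: rotS_def indicator_def)
 show ?thesis unfolding dec_def i p
 proof (intro conjI allI)
  show "(%(l, x, y, s). be l (a - x) (b - y) s) \<in> borel_measurable (natM >< borel >< borel >< intM)"
   "(%(l, x, y, s). al l (a - x) (b - y) s) \<in> borel_measurable (natM >< borel >< borel >< intM)"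
   by measurable
 qed (use assms in \<open>simp_all add: dec_def mult.commute\<close>)
qed

lemma decs_rotS: assumes "B \<in> decs" shows "rotS a b -` B \<in> decs"
proof -
 obtain al be where "dec B al be" using assms unfolding decs_def by blast
 from dec_rotS[OF this] show ?thesis unfolding decs_def by blast
qed

lemma rot180_avoid: "rot180 a b F \<inter> B = {} \<longleftrightarrow> F \<inter> rotS a b -` B = {}"
 unfolding rot180_def rotS_def[symmetric] by blast

lemma rot180_meas: "rot180 a b \<in> pks_seg_space \<rightarrow>\<^sub>M pks_seg_space"
proof (rule measurable_seg_spaceI)
 show "finite (rot180 a b F)" if "F \<in> space pks_seg_space" for F using that by (simp add: space_seg_space rot180_def)
 fix B :: "seg set" assume "B \<in> decs"
 then have "rotS a b -` B \<in> decs" by (rule decs_rotS)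
 then have "avoid (rotS a b -` B) \<in> sets pks_seg_space" by (rule avoid_in_seg_space)
 also have "avoid (rotS a b -` B) = {F \<in> space pks_seg_space. rot180 a b F \<inter> B = {}}"
  unfolding rot180_avoid by (auto simp: avoid_def space_seg_space)
 finally show "{F \<in> space pks_seg_space. rot180 a b F \<inter> B = {}} \<in> sets pks_seg_space" .
qed

lemma tot_pos: "\<forall>i. 0 \<le> w i ==> w summable_on UNIV ==> w i ~= 0 ==> 0 < tot w"
proof -
 assume a: "\<forall>i. 0 \<le> w i" "w summable_on UNIV" "w i ~= 0"
 then have "w i \<le> tot w" using infsum_mono_neutral[OF summable_on_finite[of "{i}" w] a(2)] by (simp add: tot_def)
 then show "0 < tot w" using a(1,3) by (metis less_le less_le_trans)
qed

lemma pks_reversible: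
 assumes d: "\<And>B al be. dec B al be ==> pks_dist P (phiB B) al be" and t: "0 < tot (pk_nuV P)" "0 < tot (pk_nuH P)"
 shows "pks_box P \<in> pks_source \<rightarrow>\<^sub>M pks_seg_space & distr (pks_law P) pks_seg_space (rot180 (pk_a P) (pk_b P)) = pks_law P"
proof -
 let ?a = "pk_a P" and ?b = "pk_b P"
 have src: "pks_source = seqM" by (simp add: pks_source_def)
 have ai: "pks_alg_ind (phiB B) B" if "dec B al be" for B al be
  by (intro pks_alg_ind.intro pks_alg_ind_axioms.intro pks_dist.axioms(1)[OF d[OF that]] phiB_def)
 have fm: "(%\<omega>. fR P B n \<omega> (pks_init P \<omega>)) \<in> borel_measurable seqM" if B: "B \<in> decs" for B n
 proof -
  obtain al be where "dec B al be" using B unfolding decs_def by blast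
  from pks_dist.fR_init_meas[OF d[OF this] ai[OF this]] show ?thesis .
 qed
 have e: "{} \<in> decs" using decs_rect[of "{}" "{}" "{}"] by simp
 note [measurable] = fm fm[OF e]
 have im: "(%\<omega>. indicator {\<omega>. pks_box P \<omega> \<inter> B = {}} \<omega> :: ennreal) \<in> borel_measurable seqM" if "B \<in> decs" for B
  unfolding box_avoid_iff using that by measurable
 have sm: "{\<omega> \<in> space seqM. pks_box P \<omega> \<inter> B = {}} \<in> sets seqM" if "B \<in> decs" for B
 proof -
  have "(indicator {\<omega>. pks_box P \<omega> \<inter> B = {}} :: _ => ennreal) -` {1} \<inter> space seqM \<in> sets seqM"
   by (rule measurable_sets[OF im[OF that]]) simp
  also have "(indicator {\<omega>. pks_box P \<omega> \<inter> B = {}} :: _ => ennreal) -` {1} \<inter> space seqM = {\<omega> \<in> space seqM. pks_box P \<omega> \<inter> B = {}}"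
   by (auto simp: indicator_def split: if_splits)
  finally show ?thesis .
 qed
 have box: "pks_box P \<in> pks_source \<rightarrow>\<^sub>M pks_seg_space"
  unfolding src by (rule measurable_seg_spaceI) (use sm finite_box in auto)
 \<comment> \<open>The second term, the mass of the runs that never end, is common to all
   \<open>B\<close>; comparing two sets concerns the terms of the first sum alone.\<close>
 have em: "emeasure seqM {\<omega> \<in> space seqM. pks_box P \<omega> \<inter> B = {}} = (\<Sum>n. nint seqM (%\<omega>. fR P B n \<omega> (pks_init P \<omega>)))
   + (nint seqM (%\<omega>. 1 - (\<Sum>n. fR P {} n \<omega> (pks_init P \<omega>))))" if B: "B \<in> decs" for B
 proof -
  have "emeasure seqM {\<omega> \<in> space seqM. pks_box P \<omega> \<inter> B = {}} = (nint seqM (%\<omega>. indicator {\<omega> \<in> space seqM. pks_box P \<omega> \<inter> B = {}} \<omega>))"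
   using sm[OF B] by simp
  also have "... = (nint seqM (%\<omega>. (\<Sum>n. fR P B n \<omega> (pks_init P \<omega>)) + (1 - (\<Sum>n. fR P {} n \<omega> (pks_init P \<omega>)))))"
   unfolding box_avoid_iff[symmetric] by (intro nn_integral_cong) (simp add: indicator_def)
  also have "... = (nint seqM (%\<omega>. (\<Sum>n. fR P B n \<omega> (pks_init P \<omega>)))) + (nint seqM (%\<omega>. 1 - (\<Sum>n. fR P {} n \<omega> (pks_init P \<omega>))))"
   by (rule nn_integral_add) (use B in measurable)
  also have "(nint seqM (%\<omega>. (\<Sum>n. fR P B n \<omega> (pks_init P \<omega>)))) = (\<Sum>n. nint seqM (%\<omega>. fR P B n \<omega> (pks_init P \<omega>)))"
   by (rule nn_integral_suminf) (rule fm[OF B])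
  finally show ?thesis .
 qed
 \<comment> \<open>The equality already holds for each number of steps separately, so the two series
   agree term by term.\<close>
 have inv: "emeasure seqM {\<omega> \<in> space seqM. pks_box P \<omega> \<inter> (rotS ?a ?b -` B) = {}} = emeasure seqM {\<omega> \<in> space seqM. pks_box P \<omega> \<inter> B = {}}"
  if BD: "B \<in> decs" for B
 proof -
  obtain al be where B: "dec B al be" using BD unfolding decs_def by blast
  note B' = dec_rotS[OF B, of ?a ?b]
  show ?thesis
   unfolding em[OF BD] em[OF decs_rotS[OF BD]] pks_dist.rotated_law[OF d[OF B] d[OF B'] ai[OF B] ai[OF B'] t] ..
 qed
 have P: "prob_space (pks_law P)" unfolding pks_law_def src by (rule prob_space.prob_space_distr[OF prob_seqM box[unfolded src]])
 have sp: "sets (pks_law P) = sets pks_seg_space" by (simp add: pks_law_def)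
 have rm: "rot180 ?a ?b \<in> pks_law P \<rightarrow>\<^sub>M pks_seg_space" using rot180_meas by (simp add: measurable_cong_sets[OF sp refl])
 have "distr (pks_law P) pks_seg_space (rot180 ?a ?b) = pks_law P"
 proof (rule seg_space_eqI[OF prob_space.prob_space_distr[OF P rm] P _ sp])
  fix B :: "seg set" assume B: "B \<in> decs"
  have rB: "rotS ?a ?b -` B \<in> decs" by (rule decs_rotS[OF B])
  have law: "emeasure (pks_law P) (avoid C) = emeasure seqM {\<omega> \<in> space seqM. pks_box P \<omega> \<inter> C = {}}" if "C \<in> decs" for C
  proof -
   have "pks_box P -` avoid C \<inter> space seqM = {\<omega> \<in> space seqM. pks_box P \<omega> \<inter> C = {}}"
    using finite_box by (auto simp: avoid_def)
   then show ?thesis unfolding pks_law_def src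
    by (subst emeasure_distr[OF box[unfolded src] avoid_in_seg_space[OF that]]) simp
  qed
  have "rot180 ?a ?b -` avoid B \<inter> space (pks_law P) = avoid (rotS ?a ?b -` B)"
   unfolding avoid_def pks_law_def space_distr space_seg_space
   by (auto simp: rot180_avoid) (simp add: rot180_def)
  then have "emeasure (distr (pks_law P) pks_seg_space (rot180 ?a ?b)) (avoid B) = emeasure (pks_law P) (avoid (rotS ?a ?b -` B))"
   by (subst emeasure_distr[OF rm avoid_in_seg_space[OF B]]) simp
  then show "emeasure (distr (pks_law P) pks_seg_space (rot180 ?a ?b)) (avoid B) = emeasure (pks_law P) (avoid B)"
   unfolding law[OF B] law[OF rB] inv[OF B] .
 qed simp
 with box show ?thesis by blast
qed


theorem theorem2:
  fixes nuV nuH pV pH q :: "int \<Rightarrow> real" and p0 a b :: real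
  defines "P \<equiv> \<lparr> pk_nuV = nuV, pk_nuH = nuH, pk_pV = pV, pk_pH = pH,
                  pk_p0 = p0, pk_q = q, pk_a = a, pk_b = b \<rparr>"
  assumes nuV_nonneg: "\<forall>i. 0 \<le> nuV i" and nuH_nonneg: "\<forall>i. 0 \<le> nuH i"
    and nuV_fin: "nuV summable_on UNIV" and nuH_fin: "nuH summable_on UNIV"
    and nuV_nz: "\<exists>i. nuV i \<noteq> 0" and nuH_nz: "\<exists>i. nuH i \<noteq> 0"
    and p0_range: "0 \<le> p0 \<and> p0 \<le> 1"
    and q_nonneg: "\<forall>i. 0 \<le> q i"
    and pV_range: "\<forall>i. 0 \<le> pV i \<and> pV i \<le> 1"
    and pH_range: "\<forall>i. 0 \<le> pH i \<and> pH i \<le> 1"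
    and nuV_zero: "\<forall>i. nuV i = 0 \<longrightarrow> pV i = 0 \<and> q i = 0"
    and nuH_zero: "\<forall>i. nuH i = 0 \<longrightarrow> pH i = 0 \<and> q i = 0"
    and sum_le: "\<forall>i. i \<noteq> 0 \<longrightarrow> pV i + pH i \<le> 1"
    and sum0_le: "pV 0 + pH 0 + p0 \<le> 1"
    and a_pos: "0 < a" and b_pos: "0 < b"
  shows "pks_box P \<in> pks_source \<rightarrow>\<^sub>M pks_seg_space \<and>
         distr (pks_law P) pks_seg_space (rot180 a b) = pks_law P"
proof -
  have "pks_box P \<in> pks_source \<rightarrow>\<^sub>M pks_seg_space \<and> distr (pks_law P) pks_seg_space (rot180 (pk_a P) (pk_b P)) = pks_law P"
  proof (rule pks_reversible)
    fix B al be assume B: "dec B al be"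
    then have fin: "al l x y s \<noteq> \<top>" "be l x y s \<noteq> \<top>" for l x y s by (auto simp: dec_def)
    have ab: "(\<lambda>(l, x, y, s). al l x y s) \<in> borel_measurable (natM \<Otimes>\<^sub>M borel \<Otimes>\<^sub>M borel \<Otimes>\<^sub>M intM)"
      "(\<lambda>(l, x, y, s). be l x y s) \<in> borel_measurable (natM \<Otimes>\<^sub>M borel \<Otimes>\<^sub>M borel \<Otimes>\<^sub>M intM)"
      "phiB B x0 y0 x1 y1 s = (\<integral>\<^sup>+l. al l x0 y0 s * be l x1 y1 s \<partial>natM)" for x0 y0 x1 y1 s
      using B by (simp_all add: dec_def phiB_def)
    have f: "pk_nuV P = nuV" "pk_nuH P = nuH" "pk_pV P = pV" "pk_pH P = pH" "pk_p0 P = p0" "pk_q P = q" "pk_a P = a" "pk_b P = b"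
      by (simp_all add: P_def)
    show "pks_dist P (phiB B) al be"
    proof (intro pks_dist.intro pks_alg.intro pks_dist_axioms.intro phiB_meas[OF B] ab fin, unfold f)
      show "0 \<le> nuV i" "0 \<le> nuH i" "0 \<le> q i" "0 \<le> pV i" "0 \<le> pH i" for i
        using nuV_nonneg nuH_nonneg q_nonneg pV_range pH_range by auto
      show "nuV i = 0 \<Longrightarrow> pV i = 0 \<and> q i = 0" "nuH i = 0 \<Longrightarrow> pH i = 0 \<and> q i = 0" "i \<noteq> 0 \<Longrightarrow> pV i + pH i \<le> 1" for i
        using nuV_zero nuH_zero sum_le by auto
    qed (use nuV_fin nuH_fin p0_range sum0_le a_pos b_pos in auto)
  next
    show "0 < tot (pk_nuV P)" "0 < tot (pk_nuH P)"
      using tot_pos[OF nuV_nonneg nuV_fin] tot_pos[OF nuH_nonneg nuH_fin] nuV_nz nuH_nz by (auto simp: P_def)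
  qed
  then show ?thesis by (simp add: P_def)
qed

end
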